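(* Let $N\ge2$, let $\Omega\subset\mathbb{R}^N$ be a ball with unit outward normal $\nu$ on $\partial\Omega$, let $\beta>0$, and let $p$ be subcritical. Consider the problem $$-\Delta u=u^p\ \text{in }\Omega,\qquad u>0\ \text{in }\Omega,\qquad \frac{\partial u}{\partial\nu}+\beta u=0\ \text{on }\partial\Omega.\qquad (P)$$ Suppose that either $N=2$, or $N\ge3$ and $\beta\ge N-2$. Then each positive radial solution $u$ of $(P)$ is nondegenerate, in the sense that the linearized problem $$-\Delta h-pu^{p-1}h=0\ \text{in }\Omega,\qquad \frac{\partial h}{\partial\nu}+\beta h=0\ \text{on }\partial\Omega$$ has only the trivial solution $h\equiv0$ in $H^1_{rad}(\Omega)$. Moreover, the positive radial solution of $(P)$ is unique, i.e. $(P)$ has exactly one positive radial solution.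
   Context: The exponent $p$ is called subcritical if $1<p<\infty$ when $N=2$, and $1<p<\frac{N+2}{N-2}$ when $N\ge3$. "Radial" means radially symmetric about the center of the ball, and $H^1_{rad}(\Omega):=\{u\in H^1(\Omega): u\ \text{is radial}\}$. A (positive) solution of $(P)$ is a function $u\in H^1(\Omega)$, $u>0$ in $\Omega$, with $\int_\Omega\nabla u\cdot\nabla v\,dx+\beta\int_{\partial\Omega}uv\,dS=\int_\Omega u^pv\,dx$ for all $v\in H^1(\Omega)$; by elliptic regularity it is a classical solution. Solutions $h$ of the linearized problem are understood in the analogous weak sense. *)

theory Defs
  imports "HOL-Analysis.Analysis"
begin

text \<open>
  The ambient space \<open>\<real>\<^sup>N\<close> is a type \<open>'a :: euclidean_space\<close> with \<open>N = DIM('a)\<close>.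
  Elements of \<open>H\<^sup>1(\<Omega>)\<close> are represented by functions on \<open>'a\<close>; only their values on \<open>\<Omega>\<close>
  up to null sets matter, so pointwise properties of such elements are stated almost everywhere.
\<close>

definition subcritical :: "nat \<Rightarrow> real \<Rightarrow> bool" where
  "subcritical N p \<longleftrightarrow> 1 < p \<and> (N \<ge> 3 \<longrightarrow> p < (real N + 2) / (real N - 2))"


subsection \<open>Smooth functions and the Sobolev space\<close>

primrec Ck :: "nat \<Rightarrow> ('a::euclidean_space \<Rightarrow> real) \<Rightarrow> bool" where
  "Ck 0 f \<longleftrightarrow> continuous_on UNIV f"
| "Ck (Suc k) f \<longleftrightarrow> (\<forall>x. f differentiable (at x)) \<and>
     (\<forall>b\<in>Basis. Ck k (\<lambda>x. frechet_derivative f (at x) b))"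

definition smooth :: "('a::euclidean_space \<Rightarrow> real) \<Rightarrow> bool" where
  "smooth f \<longleftrightarrow> (\<forall>k. Ck k f)"

definition test_function :: "'a set \<Rightarrow> ('a::euclidean_space \<Rightarrow> real) \<Rightarrow> bool" where
  "test_function \<Omega> \<phi> \<longleftrightarrow> smooth \<phi> \<and>
     compact (closure {x. \<phi> x \<noteq> 0}) \<and> closure {x. \<phi> x \<noteq> 0} \<subseteq> \<Omega>"

definition L2 :: "'a measure \<Rightarrow> ('a \<Rightarrow> 'b::euclidean_space) \<Rightarrow> bool" where
  "L2 M f \<longleftrightarrow> f \<in> borel_measurable M \<and> integrable M (\<lambda>x. (norm (f x))\<^sup>2)"

definition has_weak_gradient ::
    "'a set \<Rightarrow> ('a::euclidean_space \<Rightarrow> real) \<Rightarrow> ('a \<Rightarrow> 'a) \<Rightarrow> bool" where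
  "has_weak_gradient \<Omega> u G \<longleftrightarrow>
     (\<forall>\<phi>. test_function \<Omega> \<phi> \<longrightarrow> (\<forall>b\<in>Basis.
        (\<integral>x. u x * frechet_derivative \<phi> (at x) b \<partial>lebesgue_on \<Omega>)
          = - (\<integral>x. (G x \<bullet> b) * \<phi> x \<partial>lebesgue_on \<Omega>)))"

definition H1 :: "'a set \<Rightarrow> ('a::euclidean_space \<Rightarrow> real) set" where
  "H1 \<Omega> = {u. L2 (lebesgue_on \<Omega>) u \<and> (\<exists>G. L2 (lebesgue_on \<Omega>) G \<and> has_weak_gradient \<Omega> u G)}"

text \<open>For \<open>u \<in> H1 \<Omega>\<close> with \<open>\<Omega>\<close> open, the weak gradient is determined up to null sets.\<close>

definition weak_gradient :: "'a set \<Rightarrow> ('a::euclidean_space \<Rightarrow> real) \<Rightarrow> 'a \<Rightarrow> 'a" where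
  "weak_gradient \<Omega> u = (SOME G. L2 (lebesgue_on \<Omega>) G \<and> has_weak_gradient \<Omega> u G)"

definition H1_norm :: "'a set \<Rightarrow> ('a::euclidean_space \<Rightarrow> real) \<Rightarrow> real" where
  "H1_norm \<Omega> u = sqrt ((\<integral>x. (u x)\<^sup>2 \<partial>lebesgue_on \<Omega>)
                      + (\<integral>x. (norm (weak_gradient \<Omega> u x))\<^sup>2 \<partial>lebesgue_on \<Omega>))"

definition radial_on_ball :: "'a \<Rightarrow> real \<Rightarrow> ('a::euclidean_space \<Rightarrow> real) \<Rightarrow> bool" where
  "radial_on_ball c R u \<longleftrightarrow> (\<exists>g. AE x in lebesgue_on (ball c R). u x = g (dist c x))"

definition H1_rad :: "'a \<Rightarrow> real \<Rightarrow> ('a::euclidean_space \<Rightarrow> real) set" where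
  "H1_rad c R = {u \<in> H1 (ball c R). radial_on_ball c R u}"


subsection \<open>Surface measure and trace on the sphere\<close>

text \<open>
  Surface measure on \<open>sphere c R\<close>, obtained from Lebesgue measure by polar coordinates:
  the area of \<open>A\<close> is \<open>N / R\<close> times the volume of the cone \<open>{c + t (x - c) | x \<in> A, 0 < t < 1}\<close>.
  It is a Borel measure on the whole space, concentrated on the sphere.  The projection sends
  \<open>c\<close> to \<open>c\<close> (division by zero), which affects only a null set.
\<close>

definition surface_measure :: "'a::euclidean_space \<Rightarrow> real \<Rightarrow> 'a measure" where
  "surface_measure c R = scale_measure (ennreal (real DIM('a) / R))
     (distr (lebesgue_on (ball c R)) borel (\<lambda>x. c + (R / norm (x - c)) *\<^sub>R (x - c)))"

text \<open>
  The trace operator \<open>H\<^sup>1(ball c R) \<rightarrow> L\<^sup>2(sphere c R)\<close> is the continuous extension of restriction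
  of functions smooth up to the boundary.
\<close>

definition has_trace ::
    "'a \<Rightarrow> real \<Rightarrow> ('a::euclidean_space \<Rightarrow> real) \<Rightarrow> ('a \<Rightarrow> real) \<Rightarrow> bool" where
  "has_trace c R u g \<longleftrightarrow> L2 (surface_measure c R) g \<and>
     (\<exists>\<phi>. (\<forall>k::nat. smooth (\<phi> k)) \<and>
        (\<lambda>k. H1_norm (ball c R) (\<lambda>x. \<phi> k x - u x)) \<longlonglongrightarrow> 0 \<and>
        (\<lambda>k. \<integral>x. (\<phi> k x - g x)\<^sup>2 \<partial>surface_measure c R) \<longlonglongrightarrow> 0)"

definition trace_on_sphere ::
    "'a \<Rightarrow> real \<Rightarrow> ('a::euclidean_space \<Rightarrow> real) \<Rightarrow> 'a \<Rightarrow> real" where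
  "trace_on_sphere c R u = (SOME g. has_trace c R u g)"


subsection \<open>Weak solutions\<close>

text \<open>
  Weak solutions of \<open>-\<Delta>u = f\<close> in the ball with \<open>\<partial>u/\<partial>\<nu> + \<beta>u = 0\<close> on its boundary.
  The integrability clause makes the right-hand side a genuine integral (a non-integrable function
  would have integral 0); for the two \<open>f\<close> below it is automatic by the Sobolev embedding,
  the exponent being subcritical.
\<close>

definition weak_Robin_solution ::
    "'a \<Rightarrow> real \<Rightarrow> real \<Rightarrow> ('a \<Rightarrow> real) \<Rightarrow> ('a::euclidean_space \<Rightarrow> real) \<Rightarrow> bool" where
  "weak_Robin_solution c R \<beta> f u \<longleftrightarrow> u \<in> H1 (ball c R) \<and>
     (\<forall>v \<in> H1 (ball c R).
        integrable (lebesgue_on (ball c R)) (\<lambda>x. f x * v x) \<and>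
        (\<integral>x. weak_gradient (ball c R) u x \<bullet> weak_gradient (ball c R) v x \<partial>lebesgue_on (ball c R))
          + \<beta> * (\<integral>x. trace_on_sphere c R u x * trace_on_sphere c R v x \<partial>surface_measure c R)
        = (\<integral>x. f x * v x \<partial>lebesgue_on (ball c R)))"

definition positive_solution ::
    "'a \<Rightarrow> real \<Rightarrow> real \<Rightarrow> real \<Rightarrow> ('a::euclidean_space \<Rightarrow> real) \<Rightarrow> bool" where
  "positive_solution c R \<beta> p u \<longleftrightarrow>
     (AE x in lebesgue_on (ball c R). u x > 0) \<and>
     weak_Robin_solution c R \<beta> (\<lambda>x. u x powr p) u"

definition linearized_solution ::
    "'a \<Rightarrow> real \<Rightarrow> real \<Rightarrow> real \<Rightarrow> ('a::euclidean_space \<Rightarrow> real) \<Rightarrow> ('a \<Rightarrow> real) \<Rightarrow> bool" where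
  "linearized_solution c R \<beta> p u h \<longleftrightarrow>
     weak_Robin_solution c R \<beta> (\<lambda>x. p * u x powr (p - 1) * h x) h"

definition radially_nondegenerate ::
    "'a \<Rightarrow> real \<Rightarrow> real \<Rightarrow> real \<Rightarrow> ('a::euclidean_space \<Rightarrow> real) \<Rightarrow> bool" where
  "radially_nondegenerate c R \<beta> p u \<longleftrightarrow>
     (\<forall>h \<in> H1_rad c R. linearized_solution c R \<beta> p u h \<longrightarrow>
        (AE x in lebesgue_on (ball c R). h x = 0))"

end

theory Submission
  imports Defs "HOL-Computational_Algebra.Polynomial" "HOL-Real_Asymp.Real_Asymp"
begin

text \<open>
  Testing the weak equation with powers of \<open>|x - c|\<^sup>2\<close> determines a radial weak solution by its moments
  and turns it into a solution of the radial equation \<open>\<phi>' = - m / r\<^sup>N\<^sup>-\<^sup>1\<close>, \<open>m' = r\<^sup>N\<^sup>-\<^sup>1 \<phi>\<^sup>p\<close>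
  with \<open>N = d + 2\<close>, possibly singular at the centre. Finite energy bounds \<open>m\<close> near the centre, and
  subcriticality bootstraps this to boundedness of \<open>\<phi>\<close>, so that \<open>\<phi>\<close> is a rescaled Lane--Emden function.
  For such \<open>\<phi>\<close> the Pohozaev function is positive, which makes the logarithmic slope \<open>- r \<phi>' / \<phi>\<close>
  strictly increasing. The Robin condition prescribes its value at \<open>r = R\<close>: this gives existence and
  uniqueness, while its strict monotonicity under the scaling of the equation gives nondegeneracy.
\<close>

subsection \<open>Functions of class C^k and mollification\<close>

text \<open>One obstacle is that \<open>weak_gradient\<close> and \<open>trace_on_sphere\<close> are
  arbitrary choices and that elements of H1 are only classes of functions. The weak equation can be
  exploited only once weak gradients are known to be unique, smooth functions to be dense up to the
  sphere, and traces to exist and to be restrictions for C^1 functions. The other obstacle is that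
  the radial equation off the centre does not exclude blow-up: for N / (N - 2) < p < (N + 2) / (N -
  2) a multiple of r^(-2 / (p - 1)) solves it, and its energy is infinite. Finite energy is
  therefore extracted from the weak formulation as a decay rate of the flux \<open>m\<close>. For L
  = - r \<phi>' / \<phi> the equation reads r L' = L^2 - (N - 2) L + r^2 \<phi>^(p - 1), and the
  right-hand side is a positive multiple of the Pohozaev function plus a positive term. Up to a
  negative factor the same expression at r = R is the boundary coefficient in the Wronskian of a
  degenerate direction with the generator of the scaling; this is why one monotonicity serves
  uniqueness and nondegeneracy.\<close>

lemma Ck_SucI:
  assumes "\<And>x. (f has_derivative f' x) (at x)"
    and "\<And>b. b \<in> Basis \<Longrightarrow> Ck k (\<lambda>x. f' x b)"
  shows "Ck (Suc k) f"
proof -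
  have "frechet_derivative f (at x) = f' x" for x
    using frechet_derivative_at[OF assms(1)] by simp
  then show ?thesis using assms by (auto simp: differentiable_def)
qed

lemma Ck_SucD:
  assumes "Ck (Suc k) f"
  shows "(f has_derivative frechet_derivative f (at x)) (at x)"
    and "b \<in> Basis \<Longrightarrow> Ck k (\<lambda>x. frechet_derivative f (at x) b)"
  using assms by (auto simp flip: frechet_derivative_works)

lemma Ck_Suc_imp_Ck: "Ck (Suc k) f \<Longrightarrow> Ck k f"
proof (induction k arbitrary: f)
  case 0
  then have "f differentiable (at x)" for x by simp
  then show ?case
    by (auto intro!: differentiable_imp_continuous_within continuous_at_imp_continuous_on)
next
  case (Suc k)
  from Suc.prems have 1: "f differentiable (at x)" for x by simp
  from Suc.prems have "Ck (Suc k) (\<lambda>x. frechet_derivative f (at x) b)" if "b \<in> Basis" for b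
    using that by simp
  then show ?case using Suc.IH 1 by simp
qed

lemma Ck_continuous: "Ck k f \<Longrightarrow> continuous_on UNIV f"
proof (induction k)
  case (Suc k) then show ?case using Ck_Suc_imp_Ck by blast
qed simp

lemma Ck_const [simp]: "Ck k (\<lambda>x. a)"
  by (induction k arbitrary: a) (auto intro!: Ck_SucI[where f'="\<lambda>_ _. 0"])

lemma Ck_inner: "Ck k (\<lambda>x. x \<bullet> v)"
proof (cases k)
  case (Suc n)
  show ?thesis unfolding Suc
    by (rule Ck_SucI[where f'="\<lambda>_ y. y \<bullet> v"]) (auto intro!: derivative_eq_intros)
qed (auto intro!: continuous_intros)

lemma Ck_add: "Ck k f \<Longrightarrow> Ck k g \<Longrightarrow> Ck k (\<lambda>x. f x + g x)"
proof (induction k arbitrary: f g)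
  case (Suc k)
  show ?case
    by (rule Ck_SucI) (auto intro!: has_derivative_add Ck_SucD[OF Suc.prems(1)]
        Ck_SucD[OF Suc.prems(2)] Suc.IH)
qed (auto intro!: continuous_intros)

lemma Ck_mult: "Ck k f \<Longrightarrow> Ck k g \<Longrightarrow> Ck k (\<lambda>x. f x * g x)"
proof (induction k arbitrary: f g)
  case (Suc k)
  show ?case
    by (rule Ck_SucI, rule has_derivative_mult)
      (auto intro!: Ck_SucD[OF Suc.prems(1)] Ck_add
        Ck_SucD[OF Suc.prems(2)] Suc.IH Suc.prems[THEN Ck_Suc_imp_Ck])
qed (auto intro!: continuous_intros)

lemma Ck_affine:
  fixes f :: "'a::euclidean_space \<Rightarrow> real"
  shows "Ck k f \<Longrightarrow> Ck k (\<lambda>x. f (a *\<^sub>R x + v))"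
proof (induction k arbitrary: f)
  case 0
  then have "continuous_on UNIV f" by simp
  then have "continuous_on UNIV (\<lambda>x. f (a *\<^sub>R x + v))"
    by (rule continuous_on_compose2) (auto intro!: continuous_intros)
  then show ?case by simp
next
  case (Suc k)
  show ?case
  proof (rule Ck_SucI)
    fix x
    have "((\<lambda>x. f (a *\<^sub>R x + v)) has_derivative
      (\<lambda>h. frechet_derivative f (at (a *\<^sub>R x + v)) (a *\<^sub>R h))) (at x)"
      by (rule has_derivative_compose[OF _ Ck_SucD(1)[OF Suc.prems]])
        (auto intro!: derivative_eq_intros)
    moreover have "linear (frechet_derivative f (at (a *\<^sub>R x + v)))"
      using Ck_SucD(1)[OF Suc.prems] has_derivative_linear by blast
    ultimately show "((\<lambda>x. f (a *\<^sub>R x + v)) has_derivative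
      (\<lambda>h. a * frechet_derivative f (at (a *\<^sub>R x + v)) h)) (at x)"
      by (simp add: linear_cmul)
  next
    fix b :: 'a assume "b \<in> Basis"
    then show "Ck k (\<lambda>x. a * frechet_derivative f (at (a *\<^sub>R x + v)) b)"
      by (intro Ck_mult Ck_const Suc.IH Ck_SucD(2)[OF Suc.prems])
  qed
qed

lemma smooth_Ck: "smooth f \<Longrightarrow> Ck k f" by (simp add: smooth_def)
lemma smooth_const [simp]: "smooth (\<lambda>x. a)" by (simp add: smooth_def)
lemma smooth_inner: "smooth (\<lambda>x. x \<bullet> v)" by (simp add: smooth_def Ck_inner)
lemma smooth_add: "smooth f \<Longrightarrow> smooth g \<Longrightarrow> smooth (\<lambda>x. f x + g x)"
  by (simp add: smooth_def Ck_add)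
lemma smooth_mult: "smooth f \<Longrightarrow> smooth g \<Longrightarrow> smooth (\<lambda>x. f x * g x)"
  by (simp add: smooth_def Ck_mult)
lemma smooth_diff: "smooth f \<Longrightarrow> smooth g \<Longrightarrow> smooth (\<lambda>x. f x - g x)"
  using smooth_add[OF _ smooth_mult[OF smooth_const[of "-1"]], of f g] by simp
lemma smooth_sum: "(\<And>i. i \<in> I \<Longrightarrow> smooth (f i)) \<Longrightarrow> smooth (\<lambda>x. \<Sum>i\<in>I. f i x)"
  by (induction I rule: infinite_finite_induct) (auto intro: smooth_add)
lemma smooth_power: "smooth f \<Longrightarrow> smooth (\<lambda>x. f x ^ n)"
  by (induction n) (auto intro: smooth_mult)
lemma smooth_affine: "smooth f \<Longrightarrow> smooth (\<lambda>x. f (a *\<^sub>R x + v))"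
  by (simp add: smooth_def Ck_affine)

lemma smooth_norm_square: "smooth (\<lambda>x. (norm (x - c))\<^sup>2)"
proof -
  have "(norm (x - c))\<^sup>2 = (\<Sum>b\<in>Basis. (x \<bullet> b - c \<bullet> b)\<^sup>2)" for x
    by (simp add: euclidean_dist_l2[of x c, unfolded dist_norm L2_set_def] dist_real_def
        sum_nonneg)
  then show ?thesis
    by (auto intro!: smooth_sum smooth_power smooth_diff smooth_inner)
qed

lemma smooth_continuous: "smooth f \<Longrightarrow> continuous_on UNIV f"
  using Ck_continuous smooth_Ck by blast

lemma smooth_has_derivative:
  "smooth f \<Longrightarrow> (f has_derivative frechet_derivative f (at x)) (at x)"
  using Ck_SucD(1) smooth_Ck by blast

lemma smooth_partial:
  "smooth f \<Longrightarrow> b \<in> Basis \<Longrightarrow> smooth (\<lambda>x. frechet_derivative f (at x) b)"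
  unfolding smooth_def using Ck_SucD(2) by blast

text \<open>The outer function is given as a sequence \<open>d\<close> of successive derivatives:
  the chain rule then turns index \<open>j\<close> into \<open>Suc j\<close>, and the induction on
  the order of differentiability runs over all \<open>j\<close> at once.\<close>

lemma smooth_compose_real:
  assumes q: "smooth q" and d: "\<And>j x. (d j has_real_derivative d (Suc j) x) (at x)"
  shows "smooth (\<lambda>x. d j (q x))"
proof -
  have "Ck k (\<lambda>x. d j (q x))" for k
  proof (induction k arbitrary: j)
    case 0
    have "isCont (d j) x" for x using d DERIV_isCont by blast
    then show ?case using smooth_continuous[OF q]
      by (simp del: Ck.simps add: Ck.simps(1) continuous_on_compose2[of UNIV "d j"] continuous_at_imp_continuous_on)
  next
    case (Suc k)
    show ?case
    proof (rule Ck_SucI)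
      fix x
      show "((\<lambda>x. d j (q x)) has_derivative
          (\<lambda>h. d (Suc j) (q x) * frechet_derivative q (at x) h)) (at x)"
        using has_derivative_compose[OF smooth_has_derivative[OF q, of x]
          d[THEN has_field_derivative_imp_has_derivative, of j "q x"]]
        by simp
    qed (intro Ck_mult Suc.IH Ck_SucD(2)[OF smooth_Ck[OF q]])
  qed
  then show ?thesis by (simp add: smooth_def)
qed


section \<open>A smooth bump function\<close>

definition flat_poly :: "real poly \<Rightarrow> real \<Rightarrow> real" where
  "flat_poly P x = (if x > 0 then poly P (inverse x) * exp (- inverse x) else 0)"

lemma poly_times_exp_tendsto_0: "((\<lambda>t::real. poly P t * exp (- t)) \<longlongrightarrow> 0) at_top"
proof -
  have "((\<lambda>t::real. \<Sum>i\<le>degree P. coeff P i * (t ^ i / exp t)) \<longlongrightarrow> (\<Sum>i\<le>degree P. coeff P i * 0)) at_top"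
    by (intro tendsto_sum tendsto_mult tendsto_const tendsto_power_div_exp_0)
  then show ?thesis by (simp add: poly_altdef exp_minus divide_inverse sum_distrib_right mult.assoc)
qed

text \<open>With t = 1 / x one has d/dx = - t^2 d/dt, so P(t) e^(-t) has derivative t^2 (P - P')(t)
  e^(-t), where \<open>[:0,0,1:]\<close> stands for t^2. The family is thus closed under
  differentiation, which makes it usable as the sequence in \<open>smooth_compose_real\<close>. At 0
  the difference quotient is t P(t) e^(-t), and the exponential beats the polynomial.\<close>

lemma has_derivative_flat_poly:
  "(flat_poly P has_real_derivative flat_poly ([:0,0,1:] * (P - pderiv P)) x) (at x)"
proof -
  consider "x > 0" | "x < 0" | "x = 0" by linarith
  then show ?thesis
  proof cases
    case 1
    have "((\<lambda>x. poly P (inverse x) * exp (- inverse x)) has_real_derivative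
       flat_poly ([:0,0,1:] * (P - pderiv P)) x) (at x)"
      using 1 by (auto intro!: derivative_eq_intros DERIV_chain2[OF poly_DERIV] simp: flat_poly_def)
        (simp add: field_simps power2_eq_square)
    then show ?thesis
      by (rule has_field_derivative_transform_within_open[of _ _ _ "{0<..}"])
        (use 1 in \<open>auto simp: flat_poly_def\<close>)
  next
    case 2
    have "((\<lambda>x. 0) has_real_derivative flat_poly ([:0,0,1:] * (P - pderiv P)) x) (at x)"
      using 2 by (auto simp: flat_poly_def)
    then show ?thesis
      by (rule has_field_derivative_transform_within_open[of _ _ _ "{..<0}"])
        (use 2 in \<open>auto simp: flat_poly_def\<close>)
  next
    case 3
    have "((\<lambda>y. poly (pCons 0 P) (inverse y) * exp (- inverse y)) \<longlongrightarrow> 0) (at_right 0)"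
      by (rule filterlim_compose[OF poly_times_exp_tendsto_0 filterlim_inverse_at_top_right])
    then have "((\<lambda>y. (flat_poly P y - flat_poly P 0) / (y - 0)) \<longlongrightarrow> 0) (at_right 0)"
      by (rule Lim_transform_eventually)
        (auto simp: flat_poly_def field_simps eventually_at_right_less intro!: eventually_at_rightI[of 0 1])
    moreover have "((\<lambda>y. (flat_poly P y - flat_poly P 0) / (y - 0)) \<longlongrightarrow> 0) (at_left 0)"
      by (rule Lim_transform_eventually[OF tendsto_const])
        (auto simp: flat_poly_def intro!: eventually_at_leftI[of "-1"])
    ultimately have "((\<lambda>y. (flat_poly P y - flat_poly P 0) / (y - 0)) \<longlongrightarrow> 0) (at 0)"
      by (rule filterlim_split_at[rotated])
    then show ?thesis using 3 by (simp add: has_field_derivative_iff flat_poly_def)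
  qed
qed

definition bump :: "'a::euclidean_space \<Rightarrow> real" where
  "bump x = flat_poly 1 (1 - (norm x)\<^sup>2)"

lemma smooth_bump_compose:
  assumes "smooth q" shows "smooth (\<lambda>x. flat_poly 1 (q x))"
  using smooth_compose_real[OF assms, of "\<lambda>j. flat_poly (((\<lambda>P. [:0,0,1:] * (P - pderiv P)) ^^ j) 1)" 0]
    has_derivative_flat_poly by simp

lemma smooth_bump: "smooth bump"
  unfolding bump_def[abs_def] using smooth_norm_square[of 0]
  by (intro smooth_bump_compose smooth_diff smooth_const) simp

lemma bump_nonneg: "0 \<le> bump x" and bump_le_1: "bump x \<le> 1"
  by (auto simp: bump_def flat_poly_def)

lemma bump_pos_iff: "0 < bump x \<longleftrightarrow> norm x < 1"
  by (auto simp: bump_def flat_poly_def abs_square_less_1)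

lemma bump_eq_0_iff: "bump x = 0 \<longleftrightarrow> norm x \<ge> 1"
  using bump_pos_iff[of x] bump_nonneg[of x] by linarith

section \<open>Compactly supported functions and differentiation under the integral\<close>

lemma compact_support_uniformly_continuous:
  fixes f :: "'a::euclidean_space \<Rightarrow> real"
  assumes "continuous_on UNIV f" and "\<And>x. norm x > r \<Longrightarrow> f x = 0"
  shows "uniformly_continuous_on UNIV f"
proof -
  \<comment> \<open>Two points at distance below 1 either both lie in this ball or both lie outside
    radius r, where f vanishes.\<close>
  have "uniformly_continuous_on (cball 0 (r + 2)) f"
    using assms(1) by (intro compact_uniformly_continuous) (auto intro: continuous_on_subset)
  then have *: "\<exists>d>0. \<forall>x\<in>cball 0 (r+2). \<forall>y\<in>cball 0 (r+2). dist y x < d \<longrightarrow> dist (f y) (f x) < e"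
    if "e > 0" for e using that unfolding uniformly_continuous_on_def by blast
  show ?thesis unfolding uniformly_continuous_on_def
  proof (intro allI impI)
    fix e :: real assume e: "e > 0"
    from *[OF e] obtain d where d: "d > 0"
      "\<And>x y. x \<in> cball 0 (r+2) \<Longrightarrow> y \<in> cball 0 (r+2) \<Longrightarrow> dist y x < d \<Longrightarrow> dist (f y) (f x) < e"
      by blast
    have "dist (f y) (f x) < e" if "dist y x < min d 1" for x y
    proof (cases "norm x \<le> r + 1")
      case True
      have "norm y \<le> norm x + norm (y - x)" by (metis norm_triangle_sub)
      then show ?thesis using True that by (intro d(2)) (auto simp: dist_norm)
    next
      case False
      have "norm x \<le> norm y + norm (x - y)" by (metis norm_triangle_sub)
      then have "f x = 0" "f y = 0"
        using False that by (auto intro!: assms(2) simp: dist_norm norm_minus_commute)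
      then show ?thesis using e by simp
    qed
    then show "\<exists>d>0. \<forall>x\<in>UNIV. \<forall>x'\<in>UNIV. dist x' x < d \<longrightarrow> dist (f x') (f x) < e"
      using d(1) by (intro exI[of _ "min d 1"]) auto
  qed
qed

lemma compact_support_bounded:
  fixes f :: "'a::euclidean_space \<Rightarrow> real"
  assumes "continuous_on UNIV f" and "\<And>x. norm x > r \<Longrightarrow> f x = 0"
  obtains C where "C > 0" "\<And>x. \<bar>f x\<bar> \<le> C"
proof -
  have "compact (f ` cball 0 r)"
    by (intro compact_continuous_image continuous_on_subset[OF assms(1)]) auto
  then obtain C where C: "C > 0" "\<forall>y\<in>f ` cball 0 r. norm y \<le> C"
    using compact_imp_bounded bounded_pos by blast
  have "\<bar>f x\<bar> \<le> C" for x
    using C assms(2)[of x] by (cases "norm x \<le> r") auto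
  then show ?thesis using that C by blast
qed

lemma frechet_derivative_outside_support:
  assumes "(f has_derivative f') (at x)" and "\<And>x. norm x > r \<Longrightarrow> f x = 0" "norm x > r"
  shows "f' h = 0"
proof -
  have "open {y. norm y > r}" by (intro open_Collect_less continuous_intros)
  then have "((\<lambda>_. 0) has_derivative f') (at x)"
    by (rule has_derivative_transform_within_open[OF assms(1)]) (use assms in auto)
  from has_derivative_unique[OF this has_derivative_const] show ?thesis by simp
qed

lemma onorm_le_sum_Basis:
  fixes L :: "'a::euclidean_space \<Rightarrow> real"
  assumes "linear L"
  shows "onorm L \<le> (\<Sum>b\<in>Basis. \<bar>L b\<bar>)"
proof (rule onorm_bound)
  fix x :: 'a
  have "L x = L (\<Sum>b\<in>Basis. (x \<bullet> b) *\<^sub>R b)" by (simp add: euclidean_representation)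
  also have "\<dots> = (\<Sum>b\<in>Basis. (x \<bullet> b) * L b)"
    using assms by (simp add: linear_sum linear_cmul)
  also have "norm \<dots> \<le> (\<Sum>b\<in>Basis. norm x * \<bar>L b\<bar>)"
    by (rule order_trans[OF norm_sum]) (auto intro!: sum_mono mult_right_mono simp: abs_mult Basis_le_norm)
  finally show "norm (L x) \<le> (\<Sum>b\<in>Basis. \<bar>L b\<bar>) * norm x"
    by (simp add: sum_distrib_left mult.commute)
qed (simp add: sum_nonneg)

text \<open>The partial derivatives are uniformly continuous because they have compact support; the
  mean value inequality on a small ball then gives a remainder that is uniform in x. Differentiation
  under the integral in \<open>Ck_kernel_integral\<close> depends on this uniformity, since the base
  point there varies with the integration variable.\<close>

lemma uniform_linearization:
  fixes f :: "'a::euclidean_space \<Rightarrow> real"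
  assumes "Ck (Suc k) f" and supp: "\<And>x. norm x > r \<Longrightarrow> f x = 0" and "e > 0"
  obtains d where "d > 0"
    "\<And>x h. norm h < d \<Longrightarrow> \<bar>f (x + h) - f x - frechet_derivative f (at x) h\<bar> \<le> e * norm h"
proof -
  note D = Ck_SucD(1)[OF assms(1)]
  let ?D = "\<lambda>x. frechet_derivative f (at x)"
  \<comment> \<open>The operator norm is at most the sum of the absolute values of the n partials,
    so each of them is allowed an error of e / n.\<close>
  define n where "n = real DIM('a)"
  have n: "n > 0" by (simp add: n_def)
  have "uniformly_continuous_on UNIV (\<lambda>x. ?D x b)" if "b \<in> Basis" for b
    using frechet_derivative_outside_support[OF D supp]
    by (intro compact_support_uniformly_continuous[of _ r] Ck_continuous[OF Ck_SucD(2)[OF assms(1)]] that) auto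
  then have "\<forall>b\<in>Basis. \<exists>d>0. \<forall>x y. dist y x < d \<longrightarrow> dist (?D y b) (?D x b) < e / n"
    using n \<open>e > 0\<close> unfolding uniformly_continuous_on_def by (metis UNIV_I divide_pos_pos)
  then obtain d where d: "\<And>b. b \<in> Basis \<Longrightarrow> d b > 0"
    "\<And>b x y. b \<in> Basis \<Longrightarrow> dist y x < d b \<Longrightarrow> dist (?D y b) (?D x b) < e / n" by metis
  define m where "m = Min (d ` Basis)"
  have m: "m > 0" "\<And>b. b \<in> Basis \<Longrightarrow> m \<le> d b" using d(1) by (auto simp: m_def)
  have "\<bar>f (x + h) - f x - ?D x h\<bar> \<le> e * norm h" if h: "norm h < m" for x h
  proof -
    have "norm (f (x + h) - f x - ?D x ((x + h) - x)) \<le> norm ((x + h) - x) * e"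
    proof (rule differentiable_bound_linearization[where S="ball x m"])
      fix t :: real assume t: "t \<in> {0..1}"
      have "t * norm h \<le> 1 * norm h" using t by (intro mult_right_mono) auto
      then show "x + t *\<^sub>R (x + h - x) \<in> ball x m" using t h by (auto simp: dist_norm)
    next
      fix y assume y: "y \<in> ball x m"
      have lin: "linear (\<lambda>h. ?D y h - ?D x h)"
        using D[THEN has_derivative_linear] by (intro linear_compose_sub) auto
      have "onorm (\<lambda>h. ?D y h - ?D x h) \<le> (\<Sum>b\<in>Basis. \<bar>?D y b - ?D x b\<bar>)"
        using onorm_le_sum_Basis[OF lin] .
      also have "\<dots> \<le> (\<Sum>b\<in>(Basis::'a set). e / n)"
      proof (rule sum_mono)
        fix b :: 'a assume "b \<in> Basis"
        then show "\<bar>?D y b - ?D x b\<bar> \<le> e / n"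
          using d(2)[of b y x] m(2)[of b] y by (simp add: dist_real_def dist_commute)
      qed
      also have "\<dots> = e" using n by (simp add: n_def)
      finally show "onorm (?D y - ?D x) \<le> e" by (simp add: fun_diff_def)
    qed (use D[THEN has_derivative_at_withinI] m in auto)
    then show ?thesis by (simp add: mult.commute)
  qed
  then show ?thesis using that m(1) by blast
qed

text \<open>All smoothness comes from the kernel \<open>f\<close>, so \<open>w\<close> need only be
  integrable. The argument \<open>a *\<^sub>R x - T z\<close> has the form that the mollification
  integral takes in \<open>mollify_kernel\<close>.\<close>

lemma Ck_kernel_integral:
  fixes f :: "'a::euclidean_space \<Rightarrow> real"
  assumes w: "integrable M w" and T: "T \<in> borel_measurable M"
  shows "Ck k f \<Longrightarrow> (\<And>x. norm x > r \<Longrightarrow> f x = 0) \<Longrightarrow> Ck k (\<lambda>x. LINT z|M. w z * f (a *\<^sub>R x - T z))"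
    and "Ck (Suc j) f \<Longrightarrow> (\<And>x. norm x > r \<Longrightarrow> f x = 0) \<Longrightarrow>
      ((\<lambda>x. LINT z|M. w z * f (a *\<^sub>R x - T z)) has_derivative
       (\<lambda>h. a * (LINT z|M. w z * frechet_derivative f (at (a *\<^sub>R x - T z)) h))) (at x)"
proof -
  have meas: "(\<lambda>z. g (a *\<^sub>R x - T z)) \<in> borel_measurable M" if "continuous_on UNIV g"
    for g :: "'a \<Rightarrow> real" and x
    using T borel_measurable_continuous_onI[OF that] by measurable
  have int: "integrable M (\<lambda>z. w z * g (a *\<^sub>R x - T z))"
    if g: "continuous_on UNIV g" "\<And>x. norm x > r \<Longrightarrow> g x = 0" for g x
  proof -
    obtain C where "C > 0" "\<And>x. \<bar>g x\<bar> \<le> C" using compact_support_bounded[OF g] by blast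
    then show ?thesis
      by (intro Bochner_Integration.integrable_bound[OF integrable_mult_right[OF w, of C]])
        (use w meas[OF g(1)] \<open>\<And>x. \<bar>g x\<bar> \<le> C\<close> \<open>C > 0\<close> in
          \<open>auto intro!: AE_I2 mult_right_mono simp: abs_mult mult.commute[of "\<bar>w _\<bar>"]\<close>)
  qed
  have der: "((\<lambda>x. LINT z|M. w z * f (a *\<^sub>R x - T z)) has_derivative
       (\<lambda>h. a * (LINT z|M. w z * frechet_derivative f (at (a *\<^sub>R x - T z)) h))) (at x)"
    if f: "Ck (Suc j) f" "\<And>x. norm x > r \<Longrightarrow> f x = 0" for f j x
  proof -
    let ?D = "\<lambda>x. frechet_derivative f (at x)"
    note D = Ck_SucD(1)[OF f(1)]
    have lin: "linear (?D y)" for y using D has_derivative_linear by blast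
    have intb: "integrable M (\<lambda>z. w z * ?D (a *\<^sub>R x - T z) b)" if "b \<in> Basis" for b
      using frechet_derivative_outside_support[OF D f(2)]
      by (intro int Ck_continuous[OF Ck_SucD(2)[OF f(1)]] that) auto
    have rep: "?D y h = (\<Sum>b\<in>Basis. (h \<bullet> b) * ?D y b)" for y h
    proof -
      have "?D y h = ?D y (\<Sum>b\<in>Basis. (h \<bullet> b) *\<^sub>R b)" by (simp add: euclidean_representation)
      then show ?thesis by (simp only: linear_sum[OF lin] linear_cmul[OF lin] real_scaleR_def)
    qed
    have intD: "integrable M (\<lambda>z. w z * ?D (a *\<^sub>R x - T z) h)" for h
    proof -
      have "integrable M (\<lambda>z. \<Sum>b\<in>Basis. (h \<bullet> b) * (w z * ?D (a *\<^sub>R x - T z) b))"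
        by (intro Bochner_Integration.integrable_sum integrable_mult_right intb)
      then show ?thesis by (subst rep) (simp add: sum_distrib_left mult.left_commute)
    qed
    let ?L = "\<lambda>h. \<integral>z. w z * ?D (a *\<^sub>R x - T z) h \<partial>M"
    have "linear ?L"
      by (rule linearI) (simp_all add: linear_add[OF lin] linear_cmul[OF lin] distrib_left intD
          Bochner_Integration.integral_add mult.left_commute)
    then have "linear (\<lambda>h. a * ?L h)" by (simp add: linear_compose_scale_right[of ?L a, simplified])
    then have bl: "bounded_linear (\<lambda>h. a * ?L h)"
      by (simp add: linear_conv_bounded_linear)
    have intf: "integrable M (\<lambda>z. w z * f (a *\<^sub>R y - T z))" for y
      using Ck_continuous[OF f(1)] f(2) by (rule int)
    show ?thesis unfolding has_derivative_at_alt
    proof (intro conjI bl allI impI)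
      fix e :: real assume e: "e > 0"
      \<comment> \<open>The summand 1 keeps the denominator of \<open>e'\<close> positive when w
        vanishes, and \<open>\<bar>a\<bar> + 1\<close> does the same for a = 0.\<close>
      define W where "W = (LINT z|M. \<bar>w z\<bar>) + 1"
      have W: "W > 0" unfolding W_def by (smt (verit) integral_nonneg_AE AE_I2)
      define e' where "e' = e / (W * (\<bar>a\<bar> + 1))"
      have e': "e' > 0" using e W by (auto simp: e'_def intro!: divide_pos_pos mult_pos_pos)
      obtain d where d: "d > 0"
        "\<And>x h. norm h < d \<Longrightarrow> \<bar>f (x + h) - f x - ?D x h\<bar> \<le> e' * norm h"
        using uniform_linearization[OF f e'] by blast
      show "\<exists>d>0. \<forall>y. norm (y - x) < d \<longrightarrow>
        norm ((LINT z|M. w z * f (a *\<^sub>R y - T z)) - (LINT z|M. w z * f (a *\<^sub>R x - T z)) - a * ?L (y - x))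
          \<le> e * norm (y - x)"
      proof (intro exI[of _ "d / (\<bar>a\<bar> + 1)"] conjI allI impI)
        fix y assume y: "norm (y - x) < d / (\<bar>a\<bar> + 1)"
        have "\<bar>a\<bar> * norm (y - x) \<le> (\<bar>a\<bar> + 1) * norm (y - x)" by (simp add: algebra_simps)
        also have "\<dots> < d" using y by (simp add: pos_less_divide_eq mult.commute add_pos_nonneg)
        finally have yd: "norm (a *\<^sub>R (y - x)) < d" by simp
        have *: "a * ?D v (y - x) = ?D v (a *\<^sub>R (y - x))" for v
          by (simp add: linear_cmul[OF lin])
        have "(LINT z|M. w z * f (a *\<^sub>R y - T z)) - (LINT z|M. w z * f (a *\<^sub>R x - T z)) - a * ?L (y - x)
          = (LINT z|M. w z * f (a *\<^sub>R y - T z) - w z * f (a *\<^sub>R x - T z)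
              - a * (w z * ?D (a *\<^sub>R x - T z) (y - x)))"
          using intf intD by (simp add: Bochner_Integration.integral_diff)
        also have "norm \<dots> \<le> (LINT z|M. \<bar>w z\<bar> * (e' * ((\<bar>a\<bar> + 1) * norm (y - x))))"
        proof (rule order_trans[OF integral_norm_bound integral_mono])
          fix z assume "z \<in> space M"
          have "norm (w z * f (a *\<^sub>R y - T z) - w z * f (a *\<^sub>R x - T z)
              - a * (w z * ?D (a *\<^sub>R x - T z) (y - x)))
            = \<bar>w z\<bar> * \<bar>f ((a *\<^sub>R x - T z) + a *\<^sub>R (y - x)) - f (a *\<^sub>R x - T z)
              - ?D (a *\<^sub>R x - T z) (a *\<^sub>R (y - x))\<bar>"
          proof -
            have 1: "(a *\<^sub>R x - T z) + a *\<^sub>R (y - x) = a *\<^sub>R y - T z" by (simp add: algebra_simps)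
            show ?thesis unfolding 1 *[symmetric] real_norm_def abs_mult[symmetric]
              by (simp only: right_diff_distrib mult.left_commute[of a])
          qed
          also have "\<dots> \<le> \<bar>w z\<bar> * (e' * norm (a *\<^sub>R (y - x)))"
            by (intro mult_left_mono d(2) yd) auto
          also have "\<dots> \<le> \<bar>w z\<bar> * (e' * ((\<bar>a\<bar> + 1) * norm (y - x)))"
            using e' by (intro mult_left_mono) (auto simp del: scaleR_diff_right simp: distrib_right)
          finally show "norm (w z * f (a *\<^sub>R y - T z) - w z * f (a *\<^sub>R x - T z)
              - a * (w z * ?D (a *\<^sub>R x - T z) (y - x))) \<le> \<bar>w z\<bar> * (e' * ((\<bar>a\<bar> + 1) * norm (y - x)))" .
        qed (use intf intD w in auto)
        also have "\<dots> = (W - 1) * (e' * (\<bar>a\<bar> + 1)) * norm (y - x)" by (simp add: W_def)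
        also have "\<dots> \<le> W * (e' * (\<bar>a\<bar> + 1)) * norm (y - x)"
          using e' by (intro mult_right_mono) auto
        also have "W * (e' * (\<bar>a\<bar> + 1)) = e"
        proof -
          have "\<bar>a\<bar> + 1 \<noteq> 0" "W \<noteq> 0" using W by linarith+
          then show ?thesis by (simp add: e'_def)
        qed
        finally show "norm ((LINT z|M. w z * f (a *\<^sub>R y - T z)) - (LINT z|M. w z * f (a *\<^sub>R x - T z))
            - a * ?L (y - x)) \<le> e * norm (y - x)" .
      qed (use d in auto)
    qed
  qed
  then show "Ck (Suc j) f \<Longrightarrow> (\<And>x. norm x > r \<Longrightarrow> f x = 0) \<Longrightarrow>
      ((\<lambda>x. LINT z|M. w z * f (a *\<^sub>R x - T z)) has_derivative
       (\<lambda>h. a * (LINT z|M. w z * frechet_derivative f (at (a *\<^sub>R x - T z)) h))) (at x)"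
    by blast
  show "Ck k f \<Longrightarrow> (\<And>x. norm x > r \<Longrightarrow> f x = 0) \<Longrightarrow> Ck k (\<lambda>x. LINT z|M. w z * f (a *\<^sub>R x - T z))"
  proof (induction k arbitrary: f)
    case 0
    then have cf: "continuous_on UNIV f" by simp
    obtain C where C: "C > 0" "\<And>x. \<bar>f x\<bar> \<le> C" using compact_support_bounded[OF cf 0(2)] by blast
    have "isCont (\<lambda>x. LINT z|M. w z * f (a *\<^sub>R x - T z)) x" for x
    proof (unfold continuous_at_sequentially o_def, intro allI impI)
      fix X :: "nat \<Rightarrow> 'a" assume X: "X \<longlonglongrightarrow> x"
      show "(\<lambda>n. LINT z|M. w z * f (a *\<^sub>R X n - T z)) \<longlonglongrightarrow> (LINT z|M. w z * f (a *\<^sub>R x - T z))"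
      proof (rule integral_dominated_convergence[where w="\<lambda>z. C * \<bar>w z\<bar>"])
        show "AE z in M. (\<lambda>n. w z * f (a *\<^sub>R X n - T z)) \<longlonglongrightarrow> w z * f (a *\<^sub>R x - T z)"
        proof (rule AE_I2, intro tendsto_intros)
          fix z
          show "(\<lambda>n. f (a *\<^sub>R X n - T z)) \<longlonglongrightarrow> f (a *\<^sub>R x - T z)"
            by (rule continuous_on_tendsto_compose[OF cf]) (auto intro!: tendsto_intros X)
        qed
        show "AE z in M. norm (w z * f (a *\<^sub>R X n - T z)) \<le> C * \<bar>w z\<bar>" for n
          using C by (auto simp: abs_mult mult.commute[of "\<bar>w _\<bar>"] intro!: AE_I2 mult_right_mono)
      qed (use meas[OF cf] w in auto)
    qed
    then show ?case by (simp add: continuous_at_imp_continuous_on)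
  next
    case (Suc k)
    show ?case
    proof (rule Ck_SucI[OF der[OF Suc.prems]])
      fix b :: 'a assume b: "b \<in> Basis"
      show "Ck k (\<lambda>x. a * (LINT z|M. w z * frechet_derivative f (at (a *\<^sub>R x - T z)) b))"
        using frechet_derivative_outside_support[OF Ck_SucD(1)[OF Suc.prems(1)] Suc.prems(2)]
        by (intro Ck_mult Ck_const Suc.IH Ck_SucD(2)[OF Suc.prems(1)] b) auto
    qed
  qed
qed

section \<open>Affine substitutions and approximation by continuous functions\<close>

lemma ball_in_sets_borel [measurable]: "ball (c::'a::euclidean_space) R \<in> sets borel"
  by simp

lemma lborel_nn_integral_affine:
  fixes t :: "'a::euclidean_space" and a :: real
  assumes [measurable]: "f \<in> borel_measurable borel" and "a \<noteq> 0"
  shows "(\<integral>\<^sup>+x. f x \<partial>lborel) = ennreal (\<bar>a\<bar> ^ DIM('a)) * (\<integral>\<^sup>+x. f (t + a *\<^sub>R x) \<partial>lborel)"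
  by (subst lborel_affine[OF assms(2), of t])
    (simp add: nn_integral_density nn_integral_distr nn_integral_cmult ennreal_power)

lemma lborel_integrable_affine:
  fixes t :: "'a::euclidean_space" and f :: "'a \<Rightarrow> real"
  assumes f: "integrable lborel f" and a: "a \<noteq> 0"
  shows "integrable lborel (\<lambda>x. f (t + a *\<^sub>R x))"
  using f f[THEN borel_measurable_integrable] a unfolding integrable_iff_bounded
  by (subst (asm) lborel_nn_integral_affine[where a=a and t=t]) (auto simp: ennreal_mult_less_top)

lemma lborel_integral_affine:
  fixes t :: "'a::euclidean_space" and f :: "'a \<Rightarrow> real"
  assumes [measurable]: "f \<in> borel_measurable borel" and a: "a \<noteq> 0"
  shows "(LINT x|lborel. f x) = \<bar>a\<bar> ^ DIM('a) * (LINT x|lborel. f (t + a *\<^sub>R x))"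
  by (subst lborel_affine[OF a, of t])
    (simp add: integral_density integral_distr ennreal_power)

lemma continuous_set_integrable_ball:
  fixes f :: "'a::euclidean_space \<Rightarrow> real"
  assumes "continuous_on (cball c R) f"
  shows "set_integrable lborel (ball c R) f"
proof -
  have "set_integrable lborel (cball c R) f"
    unfolding set_integrable_def using borel_integrable_compact[OF _ assms] by simp
  then show ?thesis by (rule set_integrable_subset) auto
qed

text \<open>Cutting w off at height n costs little in L2 by dominated convergence. The truncation is
  an almost everywhere limit of continuous functions, which is what \<open>measurable_on\<close>
  provides; cutting these off at the same height makes them bounded, so that dominated convergence
  applies again on the ball. Both errors are below e / 4, and (a + b)^2 \<le> 2 a^2 + 2 b^2 combines
  them to less than e.\<close>

lemma square_integrable_approx_continuous:
  fixes w :: "'a::euclidean_space \<Rightarrow> real"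
  assumes w[measurable]: "w \<in> borel_measurable borel" and supp: "\<And>x. x \<notin> ball c R \<Longrightarrow> w x = 0"
    and int: "integrable lborel (\<lambda>x. (w x)\<^sup>2)" and "e > 0"
  obtains g where "continuous_on UNIV g" "(LINT x:ball c R|lborel. (w x - g x)\<^sup>2) < e"
    "set_integrable lborel (ball c R) (\<lambda>x. (w x - g x)\<^sup>2)"
proof -
  let ?B = "ball c R"
  define clamp where "clamp n z = max (- real n) (min (real n) z)" for n and z :: real
  define t where "t n x = clamp n (w x)" for n x
  have [measurable]: "t n \<in> borel_measurable borel" for n by (simp add: t_def[abs_def] clamp_def[abs_def])
  have "(\<lambda>n. LINT x|lborel. (w x - t n x)\<^sup>2) \<longlonglongrightarrow> (LINT x|(lborel :: 'a measure). 0)"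
  proof (rule integral_dominated_convergence[where w="\<lambda>x. (w x)\<^sup>2"])
    show "AE x in lborel. (\<lambda>n. (w x - t n x)\<^sup>2) \<longlonglongrightarrow> 0"
    proof (rule AE_I2)
      fix x
      obtain N where "\<bar>w x\<bar> \<le> real N" using real_arch_simple by blast
      then have "\<forall>n\<ge>N. (w x - t n x)\<^sup>2 = 0" by (auto simp: t_def clamp_def)
      then show "(\<lambda>n. (w x - t n x)\<^sup>2) \<longlonglongrightarrow> 0"
        by (intro tendsto_eventually) (auto simp: eventually_sequentially)
    qed
    show "AE x in lborel. norm ((w x - t n x)\<^sup>2) \<le> (w x)\<^sup>2" for n
      by (intro AE_I2) (auto simp: t_def clamp_def abs_le_square_iff[symmetric])
  qed (use int in auto)
  then have "\<forall>\<^sub>F n in sequentially. (LINT x|lborel. (w x - t n x)\<^sup>2) < e / 4"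
    using \<open>e > 0\<close> by (intro order_tendstoD(2)[of _ 0]) auto
  then obtain n where n: "(LINT x|lborel. (w x - t n x)\<^sup>2) < e / 4"
    by (auto simp: eventually_sequentially)
  have int1: "integrable lborel (\<lambda>x. (w x - t n x)\<^sup>2)"
    by (rule Bochner_Integration.integrable_bound[OF int])
      (auto intro!: AE_I2 simp: t_def clamp_def abs_le_square_iff[symmetric])
  have "t n \<in> borel_measurable lebesgue" by (intro measurable_completion) simp
  then have "t n measurable_on UNIV" by (intro lebesgue_measurable_imp_measurable_on) auto
  then obtain N G where N: "negligible N" and G: "\<And>j. continuous_on UNIV (G j)"
    "\<And>x. x \<notin> N \<Longrightarrow> (\<lambda>j. G j x) \<longlonglongrightarrow> t n x"
    unfolding measurable_on_def by auto
  define H where "H j x = clamp n (G j x)" for j x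
  have contH: "continuous_on UNIV (H j)" for j
    unfolding H_def clamp_def by (intro continuous_intros G(1))
  have [measurable]: "H j \<in> borel_measurable borel" for j
    using contH borel_measurable_continuous_onI by blast
  have bd: "norm (indicator ?B x * (t n x - H j x)\<^sup>2) \<le> indicator ?B x * (2 * real n)\<^sup>2" for j x
  proof -
    have "\<bar>t n x - H j x\<bar> \<le> \<bar>2 * real n\<bar>" by (auto simp: t_def clamp_def H_def)
    then have "(t n x - H j x)\<^sup>2 \<le> (2 * real n)\<^sup>2" by (simp only: abs_le_square_iff)
    then show ?thesis by (auto simp: indicator_def)
  qed
  have intB: "integrable lborel (\<lambda>x. indicator ?B x * (2 * real n)\<^sup>2)"
    using continuous_set_integrable_ball[of c R "\<lambda>_. (2 * real n)\<^sup>2"] by (simp add: set_integrable_def)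
  have aeN: "AE x in lborel. x \<notin> N"
    using AE_not_in[OF N[unfolded negligible_iff_null_sets]] by (simp only: AE_completion_iff)
  have "(\<lambda>j. LINT x|lborel. indicator ?B x * (t n x - H j x)\<^sup>2) \<longlonglongrightarrow> (LINT x|(lborel :: 'a measure). 0)"
  proof (rule integral_dominated_convergence[where w="\<lambda>x. indicator ?B x * (2 * real n)\<^sup>2"])
    show "AE x in lborel. (\<lambda>j. indicator ?B x * (t n x - H j x)\<^sup>2) \<longlonglongrightarrow> 0"
      using aeN
    proof eventually_elim
      case (elim x)
      have "(\<lambda>j. H j x) \<longlonglongrightarrow> clamp n (t n x)"
        unfolding H_def clamp_def by (intro tendsto_intros G(2) elim)
      moreover have "clamp n (t n x) = t n x" by (auto simp: t_def clamp_def)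
      ultimately have "(\<lambda>j. indicator ?B x * (t n x - H j x)\<^sup>2) \<longlonglongrightarrow> indicator ?B x * (t n x - t n x)\<^sup>2"
        by (intro tendsto_intros) auto
      then show ?case by simp
    qed
    show "AE x in lborel. norm (indicator ?B x * (t n x - H j x)\<^sup>2) \<le> indicator ?B x * (2 * real n)\<^sup>2" for j
      using bd by (intro AE_I2)
  qed (use intB in measurable)
  then have "\<forall>\<^sub>F j in sequentially. (LINT x|lborel. indicator ?B x * (t n x - H j x)\<^sup>2) < e / 4"
    using \<open>e > 0\<close> by (intro order_tendstoD(2)[of _ 0]) auto
  then obtain j where j: "(LINT x|lborel. indicator ?B x * (t n x - H j x)\<^sup>2) < e / 4"
    by (auto simp: eventually_sequentially)
  have int2: "integrable lborel (\<lambda>x. indicator ?B x * (t n x - H j x)\<^sup>2)"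
    by (rule Bochner_Integration.integrable_bound[OF intB]) (use bd in auto)
  have le: "indicator ?B x * (w x - H j x)\<^sup>2 \<le> 2 * (w x - t n x)\<^sup>2 + 2 * (indicator ?B x * (t n x - H j x)\<^sup>2)" for x
  proof (cases "x \<in> ?B")
    case True
    then show ?thesis
      using zero_le_power2[of "(w x - t n x) - (t n x - H j x)"]
      by (simp add: power2_eq_square algebra_simps)
  qed simp
  have int3: "integrable lborel (\<lambda>x. indicator ?B x * (w x - H j x)\<^sup>2)"
    by (rule Bochner_Integration.integrable_bound[of _ "\<lambda>x. 2 * (w x - t n x)\<^sup>2 + 2 * (indicator ?B x * (t n x - H j x)\<^sup>2)"])
      (use int1 int2 le in \<open>auto intro!: AE_I2 simp: indicator_def\<close>)
  have "(LINT x|lborel. indicator ?B x * (w x - H j x)\<^sup>2)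
      \<le> (LINT x|lborel. 2 * (w x - t n x)\<^sup>2 + 2 * (indicator ?B x * (t n x - H j x)\<^sup>2))"
    by (intro integral_mono int3 Bochner_Integration.integrable_add integrable_mult_right int1 int2 le)
  also have "\<dots> = 2 * (LINT x|lborel. (w x - t n x)\<^sup>2) + 2 * (LINT x|lborel. indicator ?B x * (t n x - H j x)\<^sup>2)"
    using int1 int2 by simp
  also have "\<dots> < e" using n j by simp
  finally show ?thesis
    using that[of "H j"] contH int3 by (simp add: set_lebesgue_integral_def set_integrable_def)
qed


section \<open>Mollification inside the ball\<close>

definition unit_bump :: "'a::euclidean_space \<Rightarrow> real" where
  "unit_bump x = bump x / (LINT y|lborel. bump (y::'a))"

lemma bump_borel [measurable]: "bump \<in> borel_measurable borel"
  using smooth_continuous[OF smooth_bump] by (rule borel_measurable_continuous_onI)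

lemma integrable_bump: "integrable lborel (bump :: 'a::euclidean_space \<Rightarrow> real)"
proof -
  have "bump x = indicator (cball 0 1) x * bump x" for x :: 'a
    using bump_eq_0_iff[of x] by (auto simp: indicator_def)
  moreover have "integrable lborel (\<lambda>x::'a. indicator (cball 0 1) x *\<^sub>R (bump x :: real))"
    by (intro borel_integrable_compact continuous_on_subset[OF smooth_continuous[OF smooth_bump]]) auto
  ultimately show ?thesis by (metis (no_types, lifting) ext real_scaleR_def)
qed

lemma integral_bump_pos: "0 < (LINT x|lborel. bump (x::'a::euclidean_space))"
proof (rule ccontr)
  assume "\<not> ?thesis"
  then have "(LINT x|lborel. bump (x::'a)) = 0"
    by (intro antisym integral_nonneg_AE AE_I2 bump_nonneg) simp
  then have "AE x in lborel. bump (x::'a) = (0::real)"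
    using integral_nonneg_eq_0_iff_AE[OF integrable_bump] bump_nonneg by auto
  then have "AE x in lborel. x \<notin> ball (0::'a) 1"
    by eventually_elim (auto simp: bump_eq_0_iff)
  then have "ball (0::'a) 1 \<in> null_sets lborel"
    by (subst (asm) AE_iff_null) (auto simp: ball_def)
  then have "emeasure lborel (ball (0::'a) 1) = 0" by auto
  then show False by (simp add: emeasure_ball ennreal_eq_0_iff)
      (metis less_eq_real_def not_le unit_ball_vol_pos of_nat_0_le_iff)
qed

lemma smooth_unit_bump: "smooth unit_bump"
  unfolding unit_bump_def[abs_def] divide_inverse
  by (intro smooth_mult smooth_bump smooth_const)

lemma unit_bump_nonneg: "0 \<le> unit_bump x"
  using integral_bump_pos[where 'a='a] bump_nonneg[of x] by (simp add: unit_bump_def)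

lemma unit_bump_eq_0: "norm x \<ge> 1 \<Longrightarrow> unit_bump x = 0"
  by (simp add: unit_bump_def bump_eq_0_iff)

lemma integrable_unit_bump: "integrable lborel unit_bump"
  unfolding unit_bump_def[abs_def] using integrable_bump by auto

lemma integral_unit_bump: "(LINT x|lborel. unit_bump (x::'a::euclidean_space)) = 1"
  using integral_bump_pos[where 'a='a] by (simp add: unit_bump_def)

lemma unit_bump_borel [measurable]: "unit_bump \<in> borel_measurable borel"
  unfolding unit_bump_def[abs_def] by simp

lemma unit_bump_bounded:
  obtains C where "C > 0" "\<And>x::'a::euclidean_space. \<bar>unit_bump x\<bar> \<le> C"
  using compact_support_bounded[OF smooth_continuous[OF smooth_unit_bump], of 1] unit_bump_eq_0
  by (metis less_imp_le)


text \<open>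
  The contraction towards \<open>c\<close> keeps the points at which \<open>w\<close> is averaged inside \<open>ball c R\<close>, so
  that the mollification of an element of \<open>H\<^sup>1\<close> has the mollified gradient up to the boundary.
\<close>

definition mollify :: "'a::euclidean_space \<Rightarrow> real \<Rightarrow> nat \<Rightarrow> ('a \<Rightarrow> real) \<Rightarrow> 'a \<Rightarrow> real" where
  "mollify c R k w x = (LINT y|lborel. unit_bump y *
     w (c + (1 - 1 / (real k + 2)) *\<^sub>R (x - c - (R / (real k + 2)) *\<^sub>R y)))"

text \<open>With \<delta> = 1 / (k + 2), shifting by at most R \<delta> and contracting by 1 -
  \<delta> leaves the distance from c at most (1 - \<delta>) (R + R \<delta>) = R (1 - \<delta>^2) <
  R. Contraction factor and mollification radius are matched for this computation.\<close>

lemma mollify_point_in_ball: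
  fixes c x y :: "'a::euclidean_space"
  assumes "R > 0" "norm (x - c) \<le> R" "norm y \<le> 1"
  shows "c + (1 - 1 / (real k + 2)) *\<^sub>R (x - c - (R / (real k + 2)) *\<^sub>R y) \<in> ball c R"
proof -
  define d where "d = 1 / (real k + 2)"
  have d: "d > 0" "d < 1" by (auto simp: d_def)
  have "norm (x - c - (R * d) *\<^sub>R y) \<le> norm (x - c) + norm ((R * d) *\<^sub>R y)" by (rule norm_triangle_ineq4)
  also have "\<dots> \<le> R + R * d * 1"
    using assms d by (intro add_mono) (auto intro!: mult_left_mono)
  finally have "(1 - d) * norm (x - c - (R * d) *\<^sub>R y) \<le> (1 - d) * (R + R * d * 1)"
    using d by (intro mult_left_mono) auto
  also have "\<dots> = R * (1 - d * d)" by (simp add: algebra_simps)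
  also have "\<dots> < R * 1" using assms d by (intro mult_strict_left_mono) auto
  finally show ?thesis using d by (simp add: dist_norm d_def)
qed

text \<open>Substituting z for the point of evaluation, a dilation by -(l e) with Jacobian (l e)^N,
  moves the dependence on x from w into the smooth kernel. Smoothness of the mollification and its
  reading as an integral against a test function both rest on this form.\<close>

lemma mollify_kernel:
  fixes c :: "'a::euclidean_space"
    and k :: nat
  assumes "R > 0" and [measurable]: "w \<in> borel_measurable borel"
  defines "l \<equiv> 1 - 1 / (real k + 2)" and "e \<equiv> R / (real k + 2)"
  shows "mollify c R k w x = inverse ((l * e) ^ DIM('a)) *
    (LINT z|lborel. w z * unit_bump ((1 / e) *\<^sub>R x - ((1 / e) *\<^sub>R c + (1 / (l * e)) *\<^sub>R (z - c))))"
proof -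
  have l: "l > 0" and e: "e > 0" using assms(1) by (auto simp: l_def e_def)
  let ?g = "\<lambda>z. w z * unit_bump ((1 / e) *\<^sub>R x - ((1 / e) *\<^sub>R c + (1 / (l * e)) *\<^sub>R (z - c)))"
  have pt: "(1 / e) *\<^sub>R x - ((1 / e) *\<^sub>R c + (1 / (l * e)) *\<^sub>R ((c + l *\<^sub>R (x - c)) + (- (l * e)) *\<^sub>R y - c)) = y" for y
  proof -
    have "(1 / (l * e)) *\<^sub>R ((c + l *\<^sub>R (x - c)) + (- (l * e)) *\<^sub>R y - c) = (1 / e) *\<^sub>R (x - c) - y"
      using l e by (simp add: scaleR_diff_right algebra_simps)
    then show ?thesis by (simp add: algebra_simps)
  qed
  have "(LINT z|lborel. ?g z) = \<bar>- (l * e)\<bar> ^ DIM('a) * (LINT y|lborel. ?g ((c + l *\<^sub>R (x - c)) + (- (l * e)) *\<^sub>R y))"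
    using l e by (intro lborel_integral_affine) auto
  also have "\<dots> = (l * e) ^ DIM('a) * (LINT y|lborel. w ((c + l *\<^sub>R (x - c)) + (- (l * e)) *\<^sub>R y) * unit_bump y)"
    unfolding pt using l e by simp
  also have "(LINT y|lborel. w ((c + l *\<^sub>R (x - c)) + (- (l * e)) *\<^sub>R y) * unit_bump y) = mollify c R k w x"
    unfolding mollify_def l_def[symmetric] e_def[symmetric]
    by (intro Bochner_Integration.integral_cong) (auto simp: algebra_simps)
  finally show ?thesis using l e by simp
qed

lemma smooth_mollify:
  fixes c :: "'a::euclidean_space"
  assumes "R > 0" "integrable lborel w"
  shows "smooth (mollify c R k w)"
proof -
  have "Ck j (mollify c R k w)" for j
    unfolding mollify_kernel[OF assms(1) borel_measurable_integrable[OF assms(2), unfolded measurable_lborel2], abs_def]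
    by (intro Ck_mult Ck_const Ck_kernel_integral(1)[OF assms(2), where r=1] smooth_Ck smooth_unit_bump)
      (auto simp: unit_bump_eq_0)
  then show ?thesis by (simp add: smooth_def)
qed

lemma integrable_mollify_integrand:
  fixes c :: "'a::euclidean_space" and k :: nat
  assumes "R > 0" and f: "integrable lborel f"
  defines "l \<equiv> 1 - 1 / (real k + 2)" and "e \<equiv> R / (real k + 2)"
  shows "integrable lborel (\<lambda>y. unit_bump y * f (c + l *\<^sub>R (x - c - e *\<^sub>R y)))"
proof -
  have "l > 0" "e > 0" using assms(1) by (auto simp: l_def e_def)
  then have le: "l * e \<noteq> 0" by simp
  obtain C where C: "C > 0" "\<And>x::'a. \<bar>unit_bump x\<bar> \<le> C" using unit_bump_bounded by blast
  have "integrable lborel (\<lambda>y. f ((c + l *\<^sub>R (x - c)) + (- (l * e)) *\<^sub>R y))"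
    using f le by (intro lborel_integrable_affine) auto
  then have 1: "integrable lborel (\<lambda>y. f (c + l *\<^sub>R (x - c - e *\<^sub>R y)))"
    by (simp add: algebra_simps)
  show ?thesis
    by (rule Bochner_Integration.integrable_bound[OF integrable_mult_right[OF 1, of C]])
      (use 1 C in \<open>auto intro!: AE_I2 mult_mono simp: abs_mult\<close>)
qed

lemma mollify_diff:
  fixes c :: "'a::euclidean_space"
  assumes "R > 0" "integrable lborel v" "integrable lborel w"
  shows "mollify c R k (\<lambda>x. v x - w x) x = mollify c R k v x - mollify c R k w x"
  unfolding mollify_def right_diff_distrib
  by (intro Bochner_Integration.integral_diff integrable_mollify_integrand assms)

text \<open>Jensen's inequality for the probability density \<open>unit_bump\<close>, followed by
  Tonelli. The inner integral in x is an affine substitution with factor l; since l \<ge> 1/2, the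
  Jacobian l^(-N) is at most 2^N, and the bound does not depend on k.\<close>

lemma mollify_square_bound:
  fixes c :: "'a::euclidean_space"
  assumes R: "R > 0" and w: "integrable lborel w" and w2: "integrable lborel (\<lambda>x. (w x)\<^sup>2)"
  shows "integrable lborel (\<lambda>x. (mollify c R k w x)\<^sup>2)"
    and "(LINT x|lborel. (mollify c R k w x)\<^sup>2) \<le> 2 ^ DIM('a) * (LINT x|lborel. (w x)\<^sup>2)"
proof -
  define l e where "l = 1 - 1 / (real k + 2)" and "e = R / (real k + 2)"
  have l: "l \<ge> 1/2" and e: "e > 0" using R by (auto simp: l_def e_def field_simps)
  have [measurable]: "w \<in> borel_measurable borel" using borel_measurable_integrable[OF w] by simp
  define W where "W = (LINT x|lborel. (w x)\<^sup>2)"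
  note int = integrable_mollify_integrand[OF R, of _ c k, folded l_def e_def]
  have jensen: "(mollify c R k w x)\<^sup>2 \<le> (LINT y|lborel. unit_bump y * (w (c + l *\<^sub>R (x - c - e *\<^sub>R y)))\<^sup>2)" for x
  proof -
    define m where "m = mollify c R k w x"
    let ?t = "\<lambda>y. w (c + l *\<^sub>R (x - c - e *\<^sub>R y))"
    have m: "m = (LINT y|lborel. unit_bump y * ?t y)" by (simp add: m_def mollify_def l_def e_def)
    \<comment> \<open>Jensen's inequality for the square is the nonnegativity of this
      variance.\<close>
    have "0 \<le> (LINT y|lborel. unit_bump y * (?t y - m)\<^sup>2)"
      by (intro integral_nonneg_AE AE_I2 mult_nonneg_nonneg unit_bump_nonneg) auto
    also have "\<dots> = (LINT y|lborel. unit_bump y * (?t y)\<^sup>2 - 2 * m * (unit_bump y * ?t y) + m\<^sup>2 * unit_bump y)"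
      by (intro Bochner_Integration.integral_cong) (auto simp: power2_eq_square algebra_simps)
    also have "\<dots> = (LINT y|lborel. unit_bump y * (?t y)\<^sup>2)
        - 2 * m * (LINT y|lborel. unit_bump y * ?t y) + m\<^sup>2 * (LINT y|lborel. unit_bump (y::'a))"
      by (simp only: Bochner_Integration.integral_add Bochner_Integration.integral_diff
          Bochner_Integration.integrable_diff integrable_mult_right integral_mult_right_zero
          int[OF w] int[OF w2] integrable_unit_bump)
    also have "\<dots> = (LINT y|lborel. unit_bump y * (?t y)\<^sup>2) - 2 * m * m + m\<^sup>2 * 1"
      by (simp only: m[symmetric] integral_unit_bump)
    finally show ?thesis by (simp add: m_def power2_eq_square)
  qed
  have inner: "(\<integral>\<^sup>+x. ennreal ((w (c + l *\<^sub>R (x - c - e *\<^sub>R y)))\<^sup>2) \<partial>lborel) \<le> ennreal (2 ^ DIM('a) * W)" for y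
  proof -
    have "ennreal W = (\<integral>\<^sup>+x. ennreal ((w x)\<^sup>2) \<partial>lborel)"
      unfolding W_def using nn_integral_eq_integral[OF w2] by simp
    also have "\<dots> = ennreal (\<bar>l\<bar> ^ DIM('a)) * (\<integral>\<^sup>+x. ennreal ((w ((c - l *\<^sub>R (c + e *\<^sub>R y)) + l *\<^sub>R x))\<^sup>2) \<partial>lborel)"
      using l by (intro lborel_nn_integral_affine) auto
    also have "(\<integral>\<^sup>+x. ennreal ((w ((c - l *\<^sub>R (c + e *\<^sub>R y)) + l *\<^sub>R x))\<^sup>2) \<partial>lborel)
        = (\<integral>\<^sup>+x. ennreal ((w (c + l *\<^sub>R (x - c - e *\<^sub>R y)))\<^sup>2) \<partial>lborel)" (is "_ = ?I")
      by (simp add: algebra_simps)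
    finally have eq: "ennreal (l ^ DIM('a)) * ?I = ennreal W" using l by simp
    have "?I = ennreal (2 ^ DIM('a)) * (ennreal ((1/2) ^ DIM('a)) * ?I)"
      by (simp add: mult.assoc[symmetric] ennreal_mult'[symmetric] power_mult_distrib[symmetric])
    also have "\<dots> \<le> ennreal (2 ^ DIM('a)) * (ennreal (l ^ DIM('a)) * ?I)"
      using l by (intro mult_left_mono mult_right_mono ennreal_leI power_mono) auto
    finally show ?thesis by (simp add: eq ennreal_mult')
  qed
  have "(\<integral>\<^sup>+x. ennreal ((mollify c R k w x)\<^sup>2) \<partial>lborel)
      \<le> (\<integral>\<^sup>+x. \<integral>\<^sup>+y. ennreal (unit_bump y * (w (c + l *\<^sub>R (x - c - e *\<^sub>R y)))\<^sup>2) \<partial>lborel \<partial>lborel)"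
    using jensen int[OF w2] unit_bump_nonneg
    by (intro nn_integral_mono) (subst nn_integral_eq_integral, auto intro!: ennreal_leI AE_I2 mult_nonneg_nonneg)
  also have "\<dots> = (\<integral>\<^sup>+y. \<integral>\<^sup>+x. ennreal (unit_bump y * (w (c + l *\<^sub>R (x - c - e *\<^sub>R y)))\<^sup>2) \<partial>lborel \<partial>lborel)"
    by (rule lborel_pair.Fubini') measurable
  also have "\<dots> = (\<integral>\<^sup>+y. ennreal (unit_bump y) * (\<integral>\<^sup>+x. ennreal ((w (c + l *\<^sub>R (x - c - e *\<^sub>R y)))\<^sup>2) \<partial>lborel) \<partial>lborel)"
    unfolding ennreal_mult'[OF unit_bump_nonneg]
    by (intro nn_integral_cong nn_integral_cmult) measurable
  also have "\<dots> \<le> (\<integral>\<^sup>+y. ennreal (unit_bump (y::'a)) * ennreal (2 ^ DIM('a) * W) \<partial>lborel)"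
    by (intro nn_integral_mono mult_left_mono inner) auto
  also have "\<dots> = (\<integral>\<^sup>+y. ennreal (unit_bump (y::'a)) \<partial>lborel) * ennreal (2 ^ DIM('a) * W)"
    by (intro nn_integral_multc) auto
  also have "(\<integral>\<^sup>+y. ennreal (unit_bump (y::'a)) \<partial>lborel) = 1"
    using nn_integral_eq_integral[OF integrable_unit_bump[where 'a='a]]
      integral_unit_bump[where 'a='a] unit_bump_nonneg[where 'a='a] by simp
  finally have bound: "(\<integral>\<^sup>+x. ennreal ((mollify c R k w x)\<^sup>2) \<partial>lborel) \<le> ennreal (2 ^ DIM('a) * W)" by simp
  have meas[measurable]: "mollify c R k w \<in> borel_measurable borel"
    by (intro borel_measurable_continuous_onI smooth_continuous smooth_mollify R w)
  show "integrable lborel (\<lambda>x. (mollify c R k w x)\<^sup>2)"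
    using bound by (intro integrableI_bounded) (auto simp: order_le_less_trans[OF _ ennreal_less_top])
  have "W \<ge> 0" by (simp add: W_def)
  then show "(LINT x|lborel. (mollify c R k w x)\<^sup>2) \<le> 2 ^ DIM('a) * (LINT x|lborel. (w x)\<^sup>2)"
    unfolding W_def[symmetric] using bound
    by (subst integral_eq_nn_integral) (auto intro!: enn2real_leI)
qed


lemma square_integrable_imp_integrable_ball:
  fixes w :: "'a::euclidean_space \<Rightarrow> real"
  assumes [measurable]: "w \<in> borel_measurable borel" and supp: "\<And>x. x \<notin> ball c R \<Longrightarrow> w x = 0"
    and w2: "integrable lborel (\<lambda>x. (w x)\<^sup>2)"
  shows "integrable lborel w"
proof (rule Bochner_Integration.integrable_bound)
  show "integrable lborel (\<lambda>x. indicator (ball c R) x + (w x)\<^sup>2)"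
    using w2 continuous_set_integrable_ball[of c R "\<lambda>_. 1"]
    by (intro Bochner_Integration.integrable_add) (auto simp: set_integrable_def)
  have "\<bar>w x\<bar> \<le> indicator (ball c R) x + (w x)\<^sup>2" for x
  proof (cases "x \<in> ball c R")
    case True
    have "0 \<le> (\<bar>w x\<bar> - 1/2)\<^sup>2" by simp
    then have "\<bar>w x\<bar> \<le> 1 + (w x)\<^sup>2" by (simp add: power2_eq_square algebra_simps)
    then show ?thesis using True by simp
  qed (simp add: supp)
  then show "AE x in lborel. norm (w x) \<le> norm (indicator (ball c R) x + (w x)\<^sup>2)"
    by (intro AE_I2) (metis abs_ge_self order_trans real_norm_def)
qed simp

text \<open>For x in the ball the averaged values of g are taken at points within (1 - l) R + R / (k
  + 2) = 2 R / (k + 2) of x. These points stay in the ball, so the cut-off by the indicator is not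
  felt, and uniform continuity of g does the rest.\<close>

lemma mollify_continuous_uniform:
  fixes c :: "'a::euclidean_space"
  assumes R: "R > 0" and g: "continuous_on UNIV g" and "e > 0"
  shows "\<forall>\<^sub>F k in sequentially. \<forall>x\<in>ball c R. \<bar>mollify c R k (\<lambda>x. indicator (ball c R) x * g x) x - g x\<bar> \<le> e"
proof -
  let ?v = "\<lambda>x. indicator (ball c R) x * g x"
  have v: "integrable lborel ?v"
    using continuous_set_integrable_ball[OF continuous_on_subset[OF g], of c R] by (simp add: set_integrable_def)
  have "uniformly_continuous_on (cball c R) g"
    by (intro compact_uniformly_continuous continuous_on_subset[OF g]) auto
  then have "\<exists>d>0. \<forall>x\<in>cball c R. \<forall>y\<in>cball c R. dist y x < d \<longrightarrow> dist (g y) (g x) < e"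
    using \<open>e > 0\<close> unfolding uniformly_continuous_on_def by blast
  then obtain d where d: "d > 0"
    "\<And>x y. x \<in> cball c R \<Longrightarrow> y \<in> cball c R \<Longrightarrow> dist y x < d \<Longrightarrow> dist (g y) (g x) < e"
    by blast
  have "(\<lambda>k. 2 * R / (real k + 2)) \<longlonglongrightarrow> 0" by real_asymp
  then have "\<forall>\<^sub>F k in sequentially. 2 * R / (real k + 2) < d" using d(1) by (rule order_tendstoD)
  then show ?thesis
  proof eventually_elim
    case (elim k)
    define l r where "l = 1 - 1 / (real k + 2)" and "r = R / (real k + 2)"
    have l: "0 < l" "l < 1" and r: "r > 0" using R by (auto simp: l_def r_def)
    show ?case
    proof
      fix x assume x: "x \<in> ball c R"
      let ?T = "\<lambda>y. c + l *\<^sub>R (x - c - r *\<^sub>R y)"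
      note int = integrable_mollify_integrand[OF R v, of c k x, folded l_def r_def]
      have close: "\<bar>unit_bump y * (?v (?T y) - g x)\<bar> \<le> unit_bump y * e" for y
      proof (cases "norm y < 1")
        case True
        then have T: "?T y \<in> ball c R"
          using mollify_point_in_ball[OF R, of x c y k] x by (simp add: l_def r_def dist_norm norm_minus_commute)
        have "?T y - x = (- (1 - l)) *\<^sub>R (x - c) - (l * r) *\<^sub>R y" by (simp add: algebra_simps)
        then have "norm (?T y - x) \<le> norm ((- (1 - l)) *\<^sub>R (x - c)) + norm ((l * r) *\<^sub>R y)"
          by (metis norm_triangle_ineq4)
        also have "\<dots> = (1 - l) * norm (x - c) + l * r * norm y" using l r by simp
        also have "\<dots> \<le> (1 - l) * R + 1 * r * 1"
          using l r x True by (intro add_mono mult_mono) (auto simp: dist_norm norm_minus_commute)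
        also have "\<dots> = 2 * R / (real k + 2)" by (simp add: l_def r_def)
        finally have "dist (?T y) x < d" using elim by (simp add: dist_norm)
        then have "dist (g (?T y)) (g x) < e" using T x by (intro d(2)) auto
        then show ?thesis using T unit_bump_nonneg[of y]
          by (auto simp: abs_mult dist_real_def intro!: mult_left_mono)
      qed (simp add: unit_bump_eq_0)
      have int': "integrable lborel (\<lambda>y. unit_bump y * (?v (?T y) - g x))"
        unfolding right_diff_distrib
        by (intro Bochner_Integration.integrable_diff int integrable_mult_left integrable_unit_bump)
      have "mollify c R k ?v x - g x = (LINT y|lborel. unit_bump y * ?v (?T y)) - (LINT y|lborel. unit_bump (y::'a)) * g x"
        by (simp add: mollify_def l_def r_def integral_unit_bump)
      also have "\<dots> = (LINT y|lborel. unit_bump y * (?v (?T y) - g x))"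
        unfolding right_diff_distrib
        by (subst Bochner_Integration.integral_diff[OF int integrable_mult_left[OF integrable_unit_bump]]) simp
      also have "\<bar>\<dots>\<bar> \<le> (LINT y|lborel. unit_bump (y::'a) * e)"
        using int' integrable_unit_bump close
        by (intro order_trans[OF integral_abs_bound integral_mono]) auto
      finally show "\<bar>mollify c R k ?v x - g x\<bar> \<le> e" by (simp add: integral_unit_bump)
    qed
  qed
qed

text \<open>The usual three-term argument: a continuous g close to w in L2 is mollified uniformly
  well, and the mollification of w - g is controlled by \<open>mollify_square_bound\<close>
  uniformly in k.\<close>

lemma mollify_tendsto:
  fixes c :: "'a::euclidean_space"
  assumes R: "R > 0" and w[measurable]: "w \<in> borel_measurable borel"
    and supp: "\<And>x. x \<notin> ball c R \<Longrightarrow> w x = 0"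
    and w2: "integrable lborel (\<lambda>x. (w x)\<^sup>2)"
  shows "set_integrable lborel (ball c R) (\<lambda>x. (mollify c R k w x - w x)\<^sup>2)"
    and "(\<lambda>k. LINT x:ball c R|lborel. (mollify c R k w x - w x)\<^sup>2) \<longlonglongrightarrow> 0"
proof -
  let ?B = "ball c R" and ?K = "2 ^ DIM('a) :: real"
  have w1: "integrable lborel w" using w supp w2 by (rule square_integrable_imp_integrable_ball)
  have cont: "continuous_on UNIV (mollify c R k w)" for k
    by (intro smooth_continuous smooth_mollify R w1)
  have int: "integrable lborel (\<lambda>x. indicator ?B x * (mollify c R k w x - w x)\<^sup>2)" for k
  proof (rule Bochner_Integration.integrable_bound)
    show "integrable lborel (\<lambda>x. 2 * (mollify c R k w x)\<^sup>2 + 2 * (w x)\<^sup>2)"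
      using mollify_square_bound(1)[OF R w1 w2] w2 by simp
    have "(mollify c R k w x - w x)\<^sup>2 \<le> 2 * (mollify c R k w x)\<^sup>2 + 2 * (w x)\<^sup>2" for x
      using zero_le_power2[of "mollify c R k w x + w x"] by (simp add: power2_eq_square algebra_simps)
    then show "AE x in lborel. norm (indicator ?B x * (mollify c R k w x - w x)\<^sup>2)
        \<le> norm (2 * (mollify c R k w x)\<^sup>2 + 2 * (w x)\<^sup>2)"
      by (intro AE_I2) (auto simp: indicator_def)
    have "mollify c R k w \<in> borel_measurable borel" by (intro borel_measurable_continuous_onI cont)
    then show "(\<lambda>x. indicator ?B x * (mollify c R k w x - w x)\<^sup>2) \<in> borel_measurable lborel"
      unfolding measurable_lborel1
      by (intro borel_measurable_times borel_measurable_indicator borel_measurable_power borel_measurable_diff w) auto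
  qed
  show "set_integrable lborel ?B (\<lambda>x. (mollify c R k w x - w x)\<^sup>2)"
    using int by (simp add: set_integrable_def)
  show "(\<lambda>k. LINT x:?B|lborel. (mollify c R k w x - w x)\<^sup>2) \<longlonglongrightarrow> 0"
  proof (rule order_tendstoI)
    fix a :: real assume a: "a < 0"
    have "0 \<le> (LINT x:?B|lborel. (mollify c R k w x - w x)\<^sup>2)" for k
      unfolding set_lebesgue_integral_def by (intro integral_nonneg_AE AE_I2) auto
    then show "\<forall>\<^sub>F k in sequentially. a < (LINT x:?B|lborel. (mollify c R k w x - w x)\<^sup>2)"
      by (intro always_eventually allI order_less_le_trans[OF a])
  next
    fix a :: real assume a: "0 < a"
    define V where "V = measure lborel ?B + 1"
    have V: "V > 0" unfolding V_def by (simp add: add_nonneg_pos)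
    \<comment> \<open>The three terms will contribute 3 K h, 3 h and 3 h, where K = 2^N is the
      constant of \<open>mollify_square_bound\<close>; this choice makes their sum smaller than
      a.\<close>
    define h where "h = a / (9 * (?K + 1))"
    have K: "?K \<ge> 1" by simp
    have "9 * (?K + 1) > 0" by (intro mult_pos_pos add_pos_pos) auto
    then have h: "h > 0" "9 * (?K + 1) * h = a" using a by (simp_all add: h_def)
    obtain g where g: "continuous_on UNIV g" "(LINT x:?B|lborel. (w x - g x)\<^sup>2) < h"
      "set_integrable lborel ?B (\<lambda>x. (w x - g x)\<^sup>2)"
      using square_integrable_approx_continuous[OF w supp w2 h(1)] by blast
    have [measurable]: "g \<in> borel_measurable borel" using g(1) by (rule borel_measurable_continuous_onI)
    let ?v = "\<lambda>x. indicator ?B x * g x"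
    have v1: "integrable lborel ?v"
      using continuous_set_integrable_ball[OF continuous_on_subset[OF g(1)], of c R]
      by (simp add: set_integrable_def)
    have sq: "(w x - ?v x)\<^sup>2 = indicator ?B x * (w x - g x)\<^sup>2" for x
      using supp[of x] by (auto simp: indicator_def)
    have wv1: "integrable lborel (\<lambda>x. w x - ?v x)" using w1 v1 by simp
    have wv2: "integrable lborel (\<lambda>x. (w x - ?v x)\<^sup>2)" unfolding sq using g(3) by (simp add: set_integrable_def)
    have wvh: "(LINT x|lborel. (w x - ?v x)\<^sup>2) < h" unfolding sq using g(2) by (simp add: set_lebesgue_integral_def)
    \<comment> \<open>A uniform error s costs at most s^2 V = h after squaring and integrating over
      the ball, whose measure is below V.\<close>
    define s where "s = sqrt (h / V)"
    have s: "s > 0" "s\<^sup>2 = h / V" using h V by (auto simp: s_def)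
    have "\<forall>\<^sub>F k in sequentially. \<forall>x\<in>?B. \<bar>mollify c R k ?v x - g x\<bar> \<le> s"
      by (rule mollify_continuous_uniform[OF R g(1) s(1)])
    then show "\<forall>\<^sub>F k in sequentially. (LINT x:?B|lborel. (mollify c R k w x - w x)\<^sup>2) < a"
    proof eventually_elim
      case (elim k)
      let ?d = "mollify c R k (\<lambda>x. w x - ?v x)"
      have pt: "indicator ?B x * (mollify c R k w x - w x)\<^sup>2
          \<le> 3 * (?d x)\<^sup>2 + (3 * (h / V)) * indicator ?B x + 3 * (w x - ?v x)\<^sup>2" for x
      proof (cases "x \<in> ?B")
        case True
        define p q r where "p = ?d x" and "q = mollify c R k ?v x - g x" and "r = g x - w x"
        have eq: "mollify c R k w x - w x = p + q + r"
          unfolding p_def q_def r_def mollify_diff[OF R w1 v1] by simp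
        have "q\<^sup>2 \<le> s\<^sup>2" using elim True s(1) by (auto simp: q_def abs_le_square_iff[symmetric])
        moreover have "(p + q + r)\<^sup>2 \<le> 3 * p\<^sup>2 + 3 * q\<^sup>2 + 3 * r\<^sup>2"
          using zero_le_power2[of "p - q"] zero_le_power2[of "q - r"] zero_le_power2[of "p - r"]
          by (simp add: power2_eq_square algebra_simps)
        moreover have "r\<^sup>2 = (w x - ?v x)\<^sup>2" using True by (simp add: r_def power2_commute)
        ultimately show ?thesis using True s(2) by (simp add: eq p_def[symmetric])
      next
        case False
        have "0 \<le> 3 * (?d x)\<^sup>2 + 3 * (w x - ?v x)\<^sup>2" by simp
        then show ?thesis using False by simp
      qed
      note d = mollify_square_bound[OF R wv1 wv2, of c k]
      have intB: "integrable lborel (indicator ?B :: 'a \<Rightarrow> real)"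
        using continuous_set_integrable_ball[of c R "\<lambda>_. 1"] by (simp add: set_integrable_def)
      have "(LINT x:?B|lborel. (mollify c R k w x - w x)\<^sup>2)
          \<le> (LINT x|lborel. 3 * (?d x)\<^sup>2 + (3 * (h / V)) * indicator ?B x + 3 * (w x - ?v x)\<^sup>2)"
        unfolding set_lebesgue_integral_def real_scaleR_def
        by (intro integral_mono int pt Bochner_Integration.integrable_add integrable_mult_right d(1) wv2 intB)
      also have "\<dots> = 3 * (LINT x|lborel. (?d x)\<^sup>2) + (3 * (h / V)) * (LINT x|lborel. indicator ?B x)
          + 3 * (LINT x|lborel. (w x - ?v x)\<^sup>2)"
        by (simp only: Bochner_Integration.integral_add Bochner_Integration.integrable_add
            integrable_mult_right integral_mult_right_zero d(1) wv2 intB)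
      also have "\<dots> \<le> 3 * (?K * h) + 3 * h + 3 * h"
      proof (intro add_mono)
        show "3 * (LINT x|lborel. (?d x)\<^sup>2) \<le> 3 * (?K * h)"
        proof -
          have "?K * (LINT x|lborel. (w x - ?v x)\<^sup>2) \<le> ?K * h" using wvh by (intro mult_left_mono) auto
          then show ?thesis using d(2) by linarith
        qed
        have "(h / V) * measure lborel ?B \<le> (h / V) * V" using h V by (intro mult_left_mono) (auto simp: V_def)
        then show "(3 * (h / V)) * (LINT x|lborel. indicator ?B x) \<le> 3 * h" using V by simp
      qed (use wvh in auto)
      also have "\<dots> < 9 * (?K + 1) * h"
      proof -
        have "0 < ?K * h" using h by simp
        moreover have "9 * (?K + 1) * h = 9 * (?K * h) + 9 * h" by (simp add: algebra_simps)
        ultimately show ?thesis using h(1) by linarith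
      qed
      also note h(2)
      finally show ?case .
    qed
  qed
qed

section \<open>Borel representatives and square-integrable functions on the ball\<close>

lemma integral_lebesgue_on_ball_borel:
  fixes w :: "'a::euclidean_space \<Rightarrow> real"
  assumes [measurable]: "w \<in> borel_measurable borel"
  shows "integral\<^sup>L (lebesgue_on (ball c R)) w = (LINT x:ball c R|lborel. w x)"
    and "integrable (lebesgue_on (ball c R)) w \<longleftrightarrow> set_integrable lborel (ball c R) w"
proof -
  have m: "(\<lambda>x. indicator (ball c R) x * w x) \<in> borel_measurable lborel" by simp
  show "integral\<^sup>L (lebesgue_on (ball c R)) w = (LINT x:ball c R|lborel. w x)"
    unfolding set_lebesgue_integral_def
    by (subst integral_restrict_space) (auto simp: integral_completion[OF m])
  show "integrable (lebesgue_on (ball c R)) w \<longleftrightarrow> set_integrable lborel (ball c R) w"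
    unfolding set_integrable_def
    by (subst integrable_restrict_space) (auto simp: integrable_completion[OF m])
qed

lemma borel_measurable_lebesgue_on_borel:
  "w \<in> measurable borel N \<Longrightarrow> w \<in> measurable (lebesgue_on S) N"
  by (intro measurable_restrict_space1 measurable_completion) simp

lemma AE_lebesgue_on_ball_iff:
  "(AE x in lebesgue_on (ball c R). P x) \<longleftrightarrow> (AE x in lborel. x \<in> ball c R \<longrightarrow> P x)"
  by (subst AE_restrict_space_iff) (auto simp: AE_completion_iff)

text \<open>Elements of H1 are only Lebesgue measurable. A Borel version on the whole space that
  vanishes off the ball gives access to affine substitutions and Fubini for
  \<open>lborel\<close>.\<close>

lemma lebesgue_on_ball_borel_representative:
  fixes f :: "'a::euclidean_space \<Rightarrow> real"
  assumes "f \<in> borel_measurable (lebesgue_on (ball c R))"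
  obtains w where "w \<in> borel_measurable borel" "\<And>x. x \<notin> ball c R \<Longrightarrow> w x = 0"
    "AE x in lebesgue_on (ball c R). f x = w x"
proof -
  have "(\<lambda>x. if x \<in> ball c R then f x else 0) \<in> borel_measurable lebesgue"
    by (rule borel_measurable_if_I[OF assms]) auto
  then obtain g where [measurable]: "g \<in> borel_measurable borel"
    and ae: "AE x in lborel. (if x \<in> ball c R then f x else 0) = g x"
    using completion_ex_borel_measurable_real[of _ lborel] by auto
  show thesis
  proof (rule that[of "\<lambda>x. indicator (ball c R) x * g x"])
    show "AE x in lebesgue_on (ball c R). f x = indicator (ball c R) x * g x"
      unfolding AE_lebesgue_on_ball_iff using ae by eventually_elim auto
  qed auto
qed

lemma continuous_integrable_lebesgue_on_ball:
  fixes f :: "'a::euclidean_space \<Rightarrow> real"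
  assumes "continuous_on UNIV f"
  shows "integrable (lebesgue_on (ball c R)) f"
  using continuous_set_integrable_ball[OF continuous_on_subset[OF assms]]
  by (subst integral_lebesgue_on_ball_borel) (auto intro: borel_measurable_continuous_onI assms)

lemma L2_real_iff: "L2 M f \<longleftrightarrow> f \<in> borel_measurable M \<and> integrable M (\<lambda>x. (f x)\<^sup>2)" for f :: "_ \<Rightarrow> real"
  by (simp add: L2_def)

lemma L2_mult_integrable:
  fixes f g :: "'a \<Rightarrow> real"
  assumes "L2 M f" "L2 M g"
  shows "integrable M (\<lambda>x. f x * g x)"
proof (rule Bochner_Integration.integrable_bound)
  show "integrable M (\<lambda>x. (f x)\<^sup>2 + (g x)\<^sup>2)" using assms by (simp add: L2_real_iff)
  have "\<bar>f x * g x\<bar> \<le> (f x)\<^sup>2 + (g x)\<^sup>2" for x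
  proof -
    have "2 * (\<bar>f x\<bar> * \<bar>g x\<bar>) \<le> (f x)\<^sup>2 + (g x)\<^sup>2"
      using zero_le_power2[of "\<bar>f x\<bar> - \<bar>g x\<bar>"] by (simp add: power2_eq_square algebra_simps)
    moreover have "0 \<le> \<bar>f x\<bar> * \<bar>g x\<bar>" by simp
    ultimately show ?thesis unfolding abs_mult by linarith
  qed
  then show "AE x in M. norm (f x * g x) \<le> norm ((f x)\<^sup>2 + (g x)\<^sup>2)"
    by (intro AE_I2) (metis abs_ge_self order_trans real_norm_def)
qed (use assms in \<open>auto simp: L2_def intro!: borel_measurable_times borel_measurable_inner
    borel_measurable_power borel_measurable_norm borel_measurable_diff\<close>)

lemma L2_inner_integrable:
  fixes f g :: "'a \<Rightarrow> 'b::euclidean_space"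
  assumes "L2 M f" "L2 M g"
  shows "integrable M (\<lambda>x. f x \<bullet> g x)"
proof (rule Bochner_Integration.integrable_bound)
  show "integrable M (\<lambda>x. (norm (f x))\<^sup>2 + (norm (g x))\<^sup>2)" using assms by (simp add: L2_def)
  have "\<bar>f x \<bullet> g x\<bar> \<le> (norm (f x))\<^sup>2 + (norm (g x))\<^sup>2" for x
  proof -
    have "\<bar>f x \<bullet> g x\<bar> \<le> norm (f x) * norm (g x)" by (rule Cauchy_Schwarz_ineq2)
    also have "\<dots> \<le> (norm (f x))\<^sup>2 + (norm (g x))\<^sup>2"
    proof -
      have "2 * (norm (f x) * norm (g x)) \<le> (norm (f x))\<^sup>2 + (norm (g x))\<^sup>2"
        using zero_le_power2[of "norm (f x) - norm (g x)"] by (simp add: power2_eq_square algebra_simps)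
      moreover have "0 \<le> norm (f x) * norm (g x)" by simp
      ultimately show ?thesis by linarith
    qed
    finally show ?thesis .
  qed
  then show "AE x in M. norm (f x \<bullet> g x) \<le> norm ((norm (f x))\<^sup>2 + (norm (g x))\<^sup>2)"
    by (intro AE_I2) (metis abs_ge_self order_trans real_norm_def)
qed (use assms in \<open>auto simp: L2_def intro!: borel_measurable_times borel_measurable_inner
    borel_measurable_power borel_measurable_norm borel_measurable_diff\<close>)

lemma L2_diff:
  fixes f g :: "'a \<Rightarrow> 'b::euclidean_space"
  assumes "L2 M f" "L2 M g"
  shows "L2 M (\<lambda>x. f x - g x)"
proof -
  have "integrable M (\<lambda>x. (norm (f x - g x))\<^sup>2)"
  proof (rule Bochner_Integration.integrable_bound)
    show "integrable M (\<lambda>x. 2 * (norm (f x))\<^sup>2 + 2 * (norm (g x))\<^sup>2)" using assms by (simp add: L2_def)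
    have "(norm (f x - g x))\<^sup>2 \<le> 2 * (norm (f x))\<^sup>2 + 2 * (norm (g x))\<^sup>2" for x
      using zero_le_power2[of "norm (f x + g x)"] unfolding power2_norm_eq_inner
      by (simp add: inner_simps inner_commute)
    then show "AE x in M. norm ((norm (f x - g x))\<^sup>2) \<le> norm (2 * (norm (f x))\<^sup>2 + 2 * (norm (g x))\<^sup>2)"
      by (intro AE_I2) simp
  qed (use assms in \<open>auto simp: L2_def intro!: borel_measurable_times borel_measurable_inner
    borel_measurable_power borel_measurable_norm borel_measurable_diff\<close>)
  then show ?thesis
    using assms by (auto simp: L2_def intro!: borel_measurable_diff borel_measurable_inner)
qed

lemma L2_component:
  fixes G :: "'a \<Rightarrow> 'b::euclidean_space"
  assumes "L2 M G" "b \<in> Basis"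
  shows "L2 M (\<lambda>x. G x \<bullet> b)"
proof -
  have "integrable M (\<lambda>x. (G x \<bullet> b)\<^sup>2)"
  proof (rule Bochner_Integration.integrable_bound)
    show "integrable M (\<lambda>x. (norm (G x))\<^sup>2)" using assms by (simp add: L2_def)
    have "(G x \<bullet> b)\<^sup>2 \<le> (norm (G x))\<^sup>2" for x
      using Basis_le_norm[OF assms(2), of "G x"] by (simp add: abs_le_square_iff[symmetric])
    then show "AE x in M. norm ((G x \<bullet> b)\<^sup>2) \<le> norm ((norm (G x))\<^sup>2)" by (intro AE_I2) simp
  qed (use assms in \<open>auto simp: L2_def intro!: borel_measurable_times borel_measurable_inner
    borel_measurable_power borel_measurable_norm borel_measurable_diff\<close>)
  then show ?thesis
    using assms by (auto simp: L2_def intro!: borel_measurable_diff borel_measurable_inner)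
qed

lemma L2_continuous_ball:
  fixes f :: "'a::euclidean_space \<Rightarrow> 'b::euclidean_space"
  assumes "continuous_on UNIV f"
  shows "L2 (lebesgue_on (ball c R)) f"
  unfolding L2_def
  by (intro conjI continuous_integrable_lebesgue_on_ball continuous_intros assms)
    (intro borel_measurable_lebesgue_on_borel borel_measurable_continuous_onI assms)

lemma L2_integrable_ball:
  fixes f :: "'a::euclidean_space \<Rightarrow> real"
  assumes "L2 (lebesgue_on (ball c R)) f"
  shows "integrable (lebesgue_on (ball c R)) f"
  using L2_mult_integrable[OF assms L2_continuous_ball[OF continuous_on_const[of UNIV 1]]] by simp


section \<open>Integration by parts, weak gradients and their uniqueness\<close>

lemma integral_partial_compact_support:
  fixes F :: "'a::euclidean_space \<Rightarrow> real"
  assumes F: "Ck (Suc 0) F" and supp: "\<And>x. norm x > r \<Longrightarrow> F x = 0" and b: "b \<in> Basis"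
  shows "(LINT x|lborel. frechet_derivative F (at x) b) = 0"
proof -
  let ?D = "\<lambda>x. frechet_derivative F (at x) b"
  note D = Ck_SucD(1)[OF F]
  have cD: "continuous_on UNIV ?D" using Ck_SucD(2)[OF F b] by simp
  have cF: "continuous_on UNIV F" using Ck_continuous[OF F] .
  have sD: "norm x > r \<Longrightarrow> ?D x = 0" for x
    using frechet_derivative_outside_support[OF D supp] by blast
  obtain C where C: "C > 0" "\<And>x. \<bar>?D x\<bar> \<le> C"
    using compact_support_bounded[OF cD sD] by blast
  have [measurable]: "F \<in> borel_measurable borel" "?D \<in> borel_measurable borel"
    using cF cD by (auto intro: borel_measurable_continuous_onI)
  have intF: "integrable lborel F"
  proof -
    have "integrable lborel (\<lambda>x. indicator (cball 0 r) x *\<^sub>R F x)"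
      by (intro borel_integrable_compact continuous_on_subset[OF cF]) auto
    moreover have "(\<lambda>x. indicator (cball 0 r) x *\<^sub>R F x) = F"
      using supp by (intro ext) (auto simp: indicator_def not_le)
    ultimately show ?thesis by simp
  qed
  define h where "h n = 1 / real (Suc n)" for n
  have h: "h n > 0" "h n \<le> 1" for n by (auto simp: h_def)
  \<comment> \<open>Difference quotients in direction b: translation invariance of Lebesgue measure
    makes their integrals vanish, and they converge to the partial derivative.\<close>
  define q where "q n x = (F (h n *\<^sub>R b + 1 *\<^sub>R x) - F x) / h n" for n x
  have int_q: "(LINT x|lborel. q n x) = 0" for n
  proof -
    have "(LINT x|lborel. q n x) = ((LINT x|lborel. F (h n *\<^sub>R b + 1 *\<^sub>R x)) - (LINT x|lborel. F x)) / h n"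
      unfolding q_def using intF lborel_integrable_affine[OF intF, of 1 "h n *\<^sub>R b"] by simp
    then show ?thesis using lborel_integral_affine[of F 1 "h n *\<^sub>R b"] by simp
  qed
  have line: "((\<lambda>t. F (x + t *\<^sub>R b)) has_real_derivative ?D (x + t *\<^sub>R b)) (at t)" for x t
  proof -
    have "((\<lambda>t. F (x + t *\<^sub>R b)) has_derivative (\<lambda>s. frechet_derivative F (at (x + t *\<^sub>R b)) (s *\<^sub>R b))) (at t)"
      by (rule has_derivative_compose[OF _ D]) (auto intro!: derivative_eq_intros)
    then show ?thesis
      by (simp add: has_field_derivative_def linear_cmul[OF has_derivative_linear[OF D]] mult.commute[of _ "?D _"])
  qed
  have "(\<lambda>n. LINT x|lborel. q n x) \<longlonglongrightarrow> (LINT x|lborel. ?D x)"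
  \<comment> \<open>The steps are at most 1, so all quotients vanish outside radius r + 1; inside,
    the mean value theorem bounds them by C.\<close>
  proof (rule integral_dominated_convergence[where w="\<lambda>x. indicator (cball 0 (r + 1)) x * C"])
    show "integrable lborel (\<lambda>x::'a. indicator (cball 0 (r + 1)) x * C)"
      using borel_integrable_compact[of "cball (0::'a) (r+1)" "\<lambda>_. C"] by simp
    show "AE x in lborel. (\<lambda>n. q n x) \<longlonglongrightarrow> ?D x"
    proof (rule AE_I2)
      fix x
      have "((\<lambda>s. (F (x + s *\<^sub>R b) - F x) / s) \<longlongrightarrow> ?D x) (at 0)"
        using line[of x 0] by (simp add: has_field_derivative_iff)
      moreover have "filterlim h (at 0) sequentially"
      proof (rule filterlim_atI)
        show "h \<longlonglongrightarrow> 0" unfolding h_def using LIMSEQ_inverse_real_of_nat by (simp add: inverse_eq_divide)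
        show "\<forall>\<^sub>F n in sequentially. h n \<noteq> 0" using h(1) by (auto intro!: always_eventually simp: less_imp_neq[symmetric])
      qed
      ultimately have "(\<lambda>n. (F (x + h n *\<^sub>R b) - F x) / h n) \<longlonglongrightarrow> ?D x" by (rule filterlim_compose)
      then show "(\<lambda>n. q n x) \<longlonglongrightarrow> ?D x" by (simp add: q_def add.commute)
    qed
    show "AE x in lborel. norm (q n x) \<le> indicator (cball 0 (r + 1)) x * C" for n
    proof (rule AE_I2)
      fix x
      show "norm (q n x) \<le> indicator (cball 0 (r + 1)) x * C"
      proof (cases "norm x \<le> r + 1")
        case True
        obtain z where "F (x + h n *\<^sub>R b) - F (x + 0 *\<^sub>R b) = (h n - 0) * ?D (x + z *\<^sub>R b)"
          using MVT2[of 0 "h n" "\<lambda>t. F (x + t *\<^sub>R b)" "\<lambda>t. ?D (x + t *\<^sub>R b)"] h(1)[of n] line by blast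
        then have "q n x = ?D (x + z *\<^sub>R b)" using h(1)[of n] by (simp add: q_def add.commute)
        then show ?thesis using True C by simp
      next
        case False
        have "norm x \<le> norm (h n *\<^sub>R b + x) + norm (h n *\<^sub>R b)"
          using norm_triangle_ineq4[of "h n *\<^sub>R b + x" "h n *\<^sub>R b"] by simp
        then have "norm (h n *\<^sub>R b + x) > r" using False h[of n] b by simp
        then have "q n x = 0" using False supp by (simp add: q_def)
        then show ?thesis using C by simp
      qed
    qed
  qed (auto simp: q_def[abs_def])
  then show ?thesis using int_q LIMSEQ_unique[OF _ tendsto_const[of 0]] by simp
qed

definition grad :: "('a::euclidean_space \<Rightarrow> real) \<Rightarrow> 'a \<Rightarrow> 'a" where
  "grad f x = (\<Sum>b\<in>Basis. frechet_derivative f (at x) b *\<^sub>R b)"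

lemma grad_inner_Basis: "b \<in> Basis \<Longrightarrow> grad f x \<bullet> b = frechet_derivative f (at x) b"
  by (simp add: grad_def inner_sum_left inner_Basis if_distrib sum.delta cong: if_cong)

lemma has_derivative_grad:
  assumes "Ck (Suc 0) f"
  shows "(f has_derivative (\<lambda>h. grad f x \<bullet> h)) (at x)"
proof -
  note D = Ck_SucD(1)[OF assms, of x]
  have "frechet_derivative f (at x) h = grad f x \<bullet> h" for h
  proof -
    have "frechet_derivative f (at x) h = frechet_derivative f (at x) (\<Sum>b\<in>Basis. (h \<bullet> b) *\<^sub>R b)"
      by (simp add: euclidean_representation)
    also have "\<dots> = (\<Sum>b\<in>Basis. (h \<bullet> b) * frechet_derivative f (at x) b)"
      using has_derivative_linear[OF D] by (simp add: linear_sum linear_cmul)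
    also have "\<dots> = grad f x \<bullet> h"
      unfolding grad_def inner_sum_left inner_scaleR_left
      by (intro sum.cong refl) (simp add: inner_commute mult.commute)
    finally show ?thesis .
  qed
  then show ?thesis using D by presburger
qed

lemma grad_eqI:
  assumes "\<And>h. (f has_derivative (\<lambda>h. v \<bullet> h)) (at x)"
  shows "grad f x = v"
  using frechet_derivative_at[OF assms, symmetric] by (simp add: grad_def euclidean_representation)

lemma continuous_grad: "Ck (Suc 0) f \<Longrightarrow> continuous_on UNIV (grad f)"
  unfolding grad_def[abs_def] by (intro continuous_intros) simp

lemma Ck_Suc_0I:
  fixes f :: "'a::euclidean_space \<Rightarrow> real"
  assumes "\<And>x. (f has_derivative (\<lambda>h. g x \<bullet> h)) (at x)" "continuous_on UNIV g"
  shows "Ck (Suc 0) f"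
  by (rule Ck_SucI[OF assms(1)]) (auto intro!: continuous_intros assms(2))

lemma grad_diff:
  assumes "Ck (Suc 0) f" "Ck (Suc 0) g"
  shows "grad (\<lambda>x. f x - g x) x = grad f x - grad g x"
  using has_derivative_diff[OF has_derivative_grad[OF assms(1)] has_derivative_grad[OF assms(2)]]
  by (intro grad_eqI) (simp add: inner_diff_left)

lemma Ck_diff: "Ck k f \<Longrightarrow> Ck k g \<Longrightarrow> Ck k (\<lambda>x. f x - g x)"
  using Ck_add[OF _ Ck_mult[OF Ck_const[of k "-1"]], of f g] by simp

lemma test_functionD:
  assumes "test_function S \<phi>"
  obtains r where "\<And>x. norm x > r \<Longrightarrow> \<phi> x = 0" "r > 0"
proof -
  have "bounded (closure {x. \<phi> x \<noteq> 0})" using assms by (auto simp: test_function_def intro: compact_imp_bounded)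
  then obtain r where "r > 0" "\<forall>x\<in>closure {x. \<phi> x \<noteq> 0}. norm x \<le> r" by (auto simp: bounded_pos)
  then show thesis using closure_subset[of "{x. \<phi> x \<noteq> 0}"] by (intro that[of r]) (auto simp: subset_iff not_le[symmetric])
qed

lemma test_function_derivative_outside:
  assumes "test_function S \<phi>" "x \<notin> S"
  shows "\<phi> x = 0" "frechet_derivative \<phi> (at x) h = 0"
proof -
  let ?K = "closure {x. \<phi> x \<noteq> 0}"
  have x: "x \<in> - ?K" using assms by (auto simp: test_function_def)
  then show "\<phi> x = 0" using closure_subset[of "{x. \<phi> x \<noteq> 0}"] by blast
  have "((\<lambda>_. 0) has_derivative frechet_derivative \<phi> (at x)) (at x)"
  proof (rule has_derivative_transform_within_open[OF _ _ x])
    show "(\<phi> has_derivative frechet_derivative \<phi> (at x)) (at x)"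
      using assms by (intro smooth_has_derivative) (simp add: test_function_def)
    show "\<And>y. y \<in> - ?K \<Longrightarrow> \<phi> y = 0" using closure_subset[of "{x. \<phi> x \<noteq> 0}"] by blast
  qed (simp add: open_Compl)
  from has_derivative_unique[OF this has_derivative_const]
  show "frechet_derivative \<phi> (at x) h = 0" by simp
qed

text \<open>The product of u with a test function is C^1 with compact support, so its partial
  derivatives integrate to 0 over the whole space, and nothing is contributed from outside the
  ball.\<close>

lemma C1_has_weak_gradient:
  fixes u :: "'a::euclidean_space \<Rightarrow> real"
  assumes u: "Ck (Suc 0) u"
  shows "has_weak_gradient (ball c R) u (grad u)"
  unfolding has_weak_gradient_def
proof (intro allI impI ballI)
  fix \<phi> :: "'a \<Rightarrow> real" and b :: 'a assume phi: "test_function (ball c R) \<phi>" and b: "b \<in> Basis"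
  have sm: "smooth \<phi>" using phi by (simp add: test_function_def)
  obtain r where r: "\<And>x. norm x > r \<Longrightarrow> \<phi> x = 0" using test_functionD[OF phi] by blast
  let ?f = "\<lambda>x. u x * frechet_derivative \<phi> (at x) b" and ?g = "\<lambda>x. grad u x \<bullet> b * \<phi> x"
  have cont: "continuous_on UNIV ?f" "continuous_on UNIV ?g"
    by (intro continuous_intros Ck_continuous[OF u] smooth_continuous sm smooth_partial continuous_grad u b)+
  have out: "x \<notin> ball c R \<Longrightarrow> ?f x = 0" "x \<notin> ball c R \<Longrightarrow> ?g x = 0" for x
    using test_function_derivative_outside[OF phi] by auto
  note [measurable] = cont[THEN borel_measurable_continuous_onI]
  have eq: "indicator (ball c R) x *\<^sub>R ?f x = ?f x" "indicator (ball c R) x *\<^sub>R ?g x = ?g x" for x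
    using out[of x] by (auto simp: indicator_def)
  have int: "integrable lborel ?f" "integrable lborel ?g"
    using continuous_set_integrable_ball[OF continuous_on_subset[OF cont(1)], of c R]
      continuous_set_integrable_ball[OF continuous_on_subset[OF cont(2)], of c R]
    by (simp_all only: set_integrable_def eq subset_UNIV)
  have der: "frechet_derivative (\<lambda>x. u x * \<phi> x) (at x) b = ?f x + ?g x" for x
    by (subst frechet_derivative_at[OF has_derivative_mult[OF Ck_SucD(1)[OF u] smooth_has_derivative[OF sm]], symmetric])
      (simp add: grad_inner_Basis[OF b])
  have "(LINT x|lborel. ?f x + ?g x) = 0"
    unfolding der[symmetric]
    using r by (intro integral_partial_compact_support[where r=r] Ck_mult u smooth_Ck[OF sm] b) auto
  then have "(LINT x|lborel. ?f x) = - (LINT x|lborel. ?g x)" using int by simp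
  then show "integral\<^sup>L (lebesgue_on (ball c R)) ?f = - integral\<^sup>L (lebesgue_on (ball c R)) ?g"
    by (subst (1 2) integral_lebesgue_on_ball_borel) (auto simp: set_lebesgue_integral_def eq simp del: real_scaleR_def)
qed

lemma test_function_L2:
  assumes "test_function S \<phi>"
  shows "L2 (lebesgue_on (ball c R)) \<phi>" "b \<in> Basis \<Longrightarrow> L2 (lebesgue_on (ball c R)) (\<lambda>x. frechet_derivative \<phi> (at x) b)"
  using assms by (auto simp: test_function_def intro!: L2_continuous_ball smooth_continuous smooth_partial)

lemma has_weak_gradient_diff:
  assumes "L2 (lebesgue_on (ball c R)) u" "L2 (lebesgue_on (ball c R)) v"
    "L2 (lebesgue_on (ball c R)) G" "L2 (lebesgue_on (ball c R)) H"
    "has_weak_gradient (ball c R) u G" "has_weak_gradient (ball c R) v H"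
  shows "has_weak_gradient (ball c R) (\<lambda>x. u x - v x) (\<lambda>x. G x - H x)"
  unfolding has_weak_gradient_def
proof (intro allI impI ballI)
  fix \<phi> and b :: 'a assume phi: "test_function (ball c R) \<phi>" and b: "b \<in> Basis"
  note t = test_function_L2(1)[OF phi, of c R] test_function_L2(2)[OF phi b, of c R]
  show "(LINT x|lebesgue_on (ball c R). (u x - v x) * frechet_derivative \<phi> (at x) b)
      = - (LINT x|lebesgue_on (ball c R). ((G x - H x) \<bullet> b) * \<phi> x)"
    using assms(5,6)[unfolded has_weak_gradient_def, rule_format, OF phi b]
    by (simp add: left_diff_distrib inner_diff_left Bochner_Integration.integral_diff
        L2_mult_integrable[OF assms(1) t(2)] L2_mult_integrable[OF assms(2) t(2)]
        L2_mult_integrable[OF L2_component[OF assms(3) b] t(1)] L2_mult_integrable[OF L2_component[OF assms(4) b] t(1)])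
qed

text \<open>Where the kernel is nonzero, |z - c| is at most l R + l e = R (1 - \<delta>^2) with
  \<delta> = 1 / (k + 2). The support is therefore a compact subset of the open ball however close x
  is to the sphere, so the identity defining weak gradients may be applied to the kernel.\<close>

lemma test_function_kernel:
  fixes c x :: "'a::euclidean_space" and k :: nat
  assumes R: "R > 0" and x: "x \<in> ball c R"
  defines "l \<equiv> 1 - 1 / (real k + 2)" and "e \<equiv> R / (real k + 2)"
  shows "test_function (ball c R)
    (\<lambda>z. unit_bump ((1 / e) *\<^sub>R x - ((1 / e) *\<^sub>R c + (1 / (l * e)) *\<^sub>R (z - c))))"
    (is "test_function _ ?f")
proof -
  have l: "l > 0" and e: "e > 0" using R by (auto simp: l_def e_def)
  have eq: "?f = (\<lambda>z. unit_bump ((- (1 / (l * e))) *\<^sub>R z + ((1 / e) *\<^sub>R x - (1 / e) *\<^sub>R c + (1 / (l * e)) *\<^sub>R c)))"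
    by (intro ext arg_cong[where f=unit_bump]) (simp add: algebra_simps)
  have "smooth ?f" unfolding eq by (intro smooth_affine smooth_unit_bump)
  moreover have "{z. ?f z \<noteq> 0} \<subseteq> cball c (l * (R + e))"
  proof
    fix z assume "z \<in> {z. ?f z \<noteq> 0}"
    then have "norm ((1 / e) *\<^sub>R x - ((1 / e) *\<^sub>R c + (1 / (l * e)) *\<^sub>R (z - c))) < 1"
      using unit_bump_eq_0 not_le by blast
    also have "(1 / e) *\<^sub>R x - ((1 / e) *\<^sub>R c + (1 / (l * e)) *\<^sub>R (z - c)) = (1 / (l * e)) *\<^sub>R (l *\<^sub>R (x - c) - (z - c))"
      using l e by (simp add: algebra_simps)
    finally have *: "norm (l *\<^sub>R (x - c) - (z - c)) < l * e"
      using l e by (simp add: divide_less_eq)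
    have "norm (z - c) \<le> norm (l *\<^sub>R (x - c)) + norm (l *\<^sub>R (x - c) - (z - c))"
      by (metis norm_minus_commute norm_triangle_sub)
    also have "\<dots> \<le> l * R + l * e"
      using * l x by (intro add_mono) (auto simp: dist_norm norm_minus_commute)
    finally show "z \<in> cball c (l * (R + e))" by (simp add: dist_norm norm_minus_commute algebra_simps)
  qed
  then have cl: "closure {z. ?f z \<noteq> 0} \<subseteq> cball c (l * (R + e))" by (intro closure_minimal) auto
  moreover have "cball c (l * (R + e)) \<subseteq> ball c R"
  proof -
    define d where "d = 1 / (real k + 2)"
    have "l * (R + e) = R * (1 - d * d)" by (simp add: l_def e_def d_def algebra_simps)
    also have "\<dots> < R * 1" using R by (intro mult_strict_left_mono) (auto simp: d_def)
    finally show ?thesis by auto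
  qed
  moreover have "compact (closure {z. ?f z \<noteq> 0})"
    using cl by (meson bounded_cball bounded_subset compact_closure closure_subset subset_trans)
  ultimately show ?thesis unfolding test_function_def by blast
qed

lemma square_integrable_borel_representative:
  fixes f :: "'a::euclidean_space \<Rightarrow> real"
  assumes "L2 (lebesgue_on (ball c R)) f"
  obtains w where "w \<in> borel_measurable borel" "\<And>x. x \<notin> ball c R \<Longrightarrow> w x = 0"
    "AE x in lebesgue_on (ball c R). f x = w x" "integrable lborel (\<lambda>x. (w x)\<^sup>2)"
proof -
  obtain w where [measurable]: "w \<in> borel_measurable borel" and w: "\<And>x. x \<notin> ball c R \<Longrightarrow> w x = 0"
    "AE x in lebesgue_on (ball c R). f x = w x"
    using lebesgue_on_ball_borel_representative assms unfolding L2_def by blast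
  have f: "f \<in> borel_measurable (lebesgue_on (ball c R))" using assms by (simp add: L2_def)
  have wm: "w \<in> borel_measurable (lebesgue_on (ball c R))" by (simp add: borel_measurable_lebesgue_on_borel)
  have "integrable (lebesgue_on (ball c R)) (\<lambda>x. (w x)\<^sup>2)"
  proof (rule integrable_cong_AE_imp)
    show "integrable (lebesgue_on (ball c R)) (\<lambda>x. (f x)\<^sup>2)" using assms by (simp add: L2_real_iff)
    show "AE x in lebesgue_on (ball c R). (f x)\<^sup>2 = (w x)\<^sup>2" using w(2) by eventually_elim simp
  qed (use wm in simp)
  then have "set_integrable lborel (ball c R) (\<lambda>x. (w x)\<^sup>2)"
    by (subst (asm) integral_lebesgue_on_ball_borel(2)) auto
  moreover have "indicator (ball c R) x *\<^sub>R (w x)\<^sup>2 = (w x)\<^sup>2" for x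
    using w(1)[of x] by (auto simp: indicator_def)
  ultimately have "integrable lborel (\<lambda>x. (w x)\<^sup>2)" by (simp only: set_integrable_def)
  then show thesis by (intro that[of w]) (use w in auto)
qed

lemma mollify_eq_test_integral:
  fixes c x :: "'a::euclidean_space" and k :: nat
  assumes R: "R > 0" and w: "w \<in> borel_measurable borel" "\<And>x. x \<notin> ball c R \<Longrightarrow> w x = 0"
    and f: "AE x in lebesgue_on (ball c R). f x = w x" "f \<in> borel_measurable (lebesgue_on (ball c R))"
  defines "l \<equiv> 1 - 1 / (real k + 2)" and "e \<equiv> R / (real k + 2)"
  shows "mollify c R k w x = inverse ((l * e) ^ DIM('a)) * (LINT z|lebesgue_on (ball c R). f z *
    unit_bump ((1 / e) *\<^sub>R x - ((1 / e) *\<^sub>R c + (1 / (l * e)) *\<^sub>R (z - c))))"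
proof -
  let ?K = "\<lambda>z. unit_bump ((1 / e) *\<^sub>R x - ((1 / e) *\<^sub>R c + (1 / (l * e)) *\<^sub>R (z - c)))"
  note [measurable] = w(1)
  have K: "?K \<in> borel_measurable borel" by simp
  have "(LINT z|lebesgue_on (ball c R). f z * ?K z) = (LINT z|lebesgue_on (ball c R). w z * ?K z)"
    using f borel_measurable_lebesgue_on_borel[OF K] borel_measurable_lebesgue_on_borel[OF w(1)]
    by (intro integral_cong_AE) auto
  also have "\<dots> = (LINT z|lborel. w z * ?K z)"
    by (subst integral_lebesgue_on_ball_borel)
      (auto simp: set_lebesgue_integral_def indicator_def intro!: Bochner_Integration.integral_cong w(2))
  finally show ?thesis using mollify_kernel[OF R w(1)] by (simp add: l_def e_def)
qed

text \<open>By \<open>mollify_eq_test_integral\<close> all mollifications of f vanish on the ball,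
  while they converge to f in L2.\<close>

lemma fundamental_lemma_L2:
  fixes f :: "'a::euclidean_space \<Rightarrow> real"
  assumes R: "R > 0" and f: "L2 (lebesgue_on (ball c R)) f"
    and test: "\<And>\<phi>. test_function (ball c R) \<phi> \<Longrightarrow> (LINT x|lebesgue_on (ball c R). f x * \<phi> x) = 0"
  shows "AE x in lebesgue_on (ball c R). f x = 0"
proof -
  obtain w where w: "w \<in> borel_measurable borel" "\<And>x. x \<notin> ball c R \<Longrightarrow> w x = 0"
    "AE x in lebesgue_on (ball c R). f x = w x" and w2: "integrable lborel (\<lambda>x. (w x)\<^sup>2)"
    using square_integrable_borel_representative[OF f] by blast
  have fm: "f \<in> borel_measurable (lebesgue_on (ball c R))" using f by (simp add: L2_def)
  have "mollify c R k w x = 0" if "x \<in> ball c R" for k x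
    using test[OF test_function_kernel[OF R that, of k]]
    by (simp only: mollify_eq_test_integral[OF R w fm, of k x] mult_zero_right not_False_eq_True)
  then have eq: "(LINT x:ball c R|lborel. (mollify c R k w x - w x)\<^sup>2) = (LINT x|lborel. (w x)\<^sup>2)" for k
    unfolding set_lebesgue_integral_def using w(2)
    by (intro Bochner_Integration.integral_cong) (auto simp: indicator_def)
  have "(\<lambda>k. LINT x:ball c R|lborel. (mollify c R k w x - w x)\<^sup>2) \<longlonglongrightarrow> 0"
    by (rule mollify_tendsto(2)[OF R w(1) _ w2]) (rule w(2))
  then have "(LINT x|lborel. (w x)\<^sup>2) = 0"
    unfolding eq by (simp add: LIMSEQ_const_iff)
  then have "AE x in lborel. w x = 0"
    using integral_nonneg_eq_0_iff_AE[OF w2] by simp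
  then have "AE x in lebesgue_on (ball c R). w x = 0"
    unfolding AE_lebesgue_on_ball_iff by eventually_elim simp
  then show ?thesis using w(3) by eventually_elim simp
qed

text \<open>This turns the choice in \<open>weak_gradient\<close> into a function determined almost
  everywhere, so that any explicit weak gradient may take its place.\<close>

lemma weak_gradient_unique:
  fixes u :: "'a::euclidean_space \<Rightarrow> real"
  assumes R: "R > 0" and "L2 (lebesgue_on (ball c R)) G" "L2 (lebesgue_on (ball c R)) H"
    "has_weak_gradient (ball c R) u G" "has_weak_gradient (ball c R) u H"
  shows "AE x in lebesgue_on (ball c R). G x = H x"
proof -
  have "AE x in lebesgue_on (ball c R). G x \<bullet> b - H x \<bullet> b = 0" if b: "b \<in> Basis" for b
  proof (rule fundamental_lemma_L2[OF R])
    show "L2 (lebesgue_on (ball c R)) (\<lambda>x. G x \<bullet> b - H x \<bullet> b)"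
      by (intro L2_diff L2_component assms b)
    fix \<phi> :: "'a \<Rightarrow> real" assume phi: "test_function (ball c R) \<phi>"
    note t = test_function_L2(1)[OF phi, of c R]
    show "(LINT x|lebesgue_on (ball c R). (G x \<bullet> b - H x \<bullet> b) * \<phi> x) = 0"
      using assms(4,5)[unfolded has_weak_gradient_def, rule_format, OF phi b]
      by (simp add: left_diff_distrib Bochner_Integration.integral_diff
        L2_mult_integrable[OF L2_component[OF assms(2) b] t] L2_mult_integrable[OF L2_component[OF assms(3) b] t])
  qed
  then have "AE x in lebesgue_on (ball c R). \<forall>b\<in>Basis. G x \<bullet> b - H x \<bullet> b = 0"
    by (intro AE_finite_allI) auto
  then show ?thesis by eventually_elim (auto intro: euclidean_eqI)
qed

subsection \<open>The Sobolev space and the trace on a ball\<close>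

lemma H1_weak_gradient:
  assumes "u \<in> H1 S"
  shows "L2 (lebesgue_on S) u" "L2 (lebesgue_on S) (weak_gradient S u)" "has_weak_gradient S u (weak_gradient S u)"
proof -
  have "\<exists>G. L2 (lebesgue_on S) G \<and> has_weak_gradient S u G" using assms by (simp add: H1_def)
  from someI_ex[OF this] show "L2 (lebesgue_on S) (weak_gradient S u)" "has_weak_gradient S u (weak_gradient S u)"
    unfolding weak_gradient_def by auto
qed (use assms in \<open>simp add: H1_def\<close>)

lemma weak_gradient_AE:
  assumes "R > 0" "u \<in> H1 (ball c R)" "L2 (lebesgue_on (ball c R)) G" "has_weak_gradient (ball c R) u G"
  shows "AE x in lebesgue_on (ball c R). weak_gradient (ball c R) u x = G x"
  using weak_gradient_unique[OF assms(1) H1_weak_gradient(2)[OF assms(2)] assms(3) H1_weak_gradient(3)[OF assms(2)] assms(4)] .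

lemma C1_in_H1:
  fixes u :: "'a::euclidean_space \<Rightarrow> real"
  assumes "Ck (Suc 0) u"
  shows "u \<in> H1 (ball c R)" "L2 (lebesgue_on (ball c R)) (grad u)" "L2 (lebesgue_on (ball c R)) u"
proof -
  show 1: "L2 (lebesgue_on (ball c R)) (grad u)" by (intro L2_continuous_ball continuous_grad assms)
  show 2: "L2 (lebesgue_on (ball c R)) u" by (intro L2_continuous_ball Ck_continuous[OF assms])
  show "u \<in> H1 (ball c R)" using 1 2 C1_has_weak_gradient[OF assms] by (auto simp: H1_def)
qed

lemma weak_gradient_C1:
  fixes u :: "'a::euclidean_space \<Rightarrow> real"
  assumes "R > 0" "Ck (Suc 0) u"
  shows "AE x in lebesgue_on (ball c R). weak_gradient (ball c R) u x = grad u x"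
  by (rule weak_gradient_AE[OF assms(1) C1_in_H1(1,2)[OF assms(2)] C1_has_weak_gradient[OF assms(2)]])

lemma H1_diff:
  assumes "R > 0" "u \<in> H1 (ball c R)" "v \<in> H1 (ball c R)"
  shows "(\<lambda>x. u x - v x) \<in> H1 (ball c R)"
    "AE x in lebesgue_on (ball c R). weak_gradient (ball c R) (\<lambda>x. u x - v x) x =
      weak_gradient (ball c R) u x - weak_gradient (ball c R) v x"
proof -
  note u = H1_weak_gradient[OF assms(2)] and v = H1_weak_gradient[OF assms(3)]
  note w = has_weak_gradient_diff[OF u(1) v(1) u(2) v(2) u(3) v(3)]
  show "(\<lambda>x. u x - v x) \<in> H1 (ball c R)"
    using L2_diff[OF u(1) v(1)] L2_diff[OF u(2) v(2)] w by (auto simp: H1_def)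
  then show "AE x in lebesgue_on (ball c R). weak_gradient (ball c R) (\<lambda>x. u x - v x) x =
      weak_gradient (ball c R) u x - weak_gradient (ball c R) v x"
    using w L2_diff[OF u(2) v(2)] weak_gradient_AE[OF assms(1)] by blast
qed

lemma H1_norm_square:
  assumes "u \<in> H1 (ball c R)" "L2 (lebesgue_on (ball c R)) G"
    and "AE x in lebesgue_on (ball c R). weak_gradient (ball c R) u x = G x"
  shows "(H1_norm (ball c R) u)\<^sup>2 = (LINT x|lebesgue_on (ball c R). (u x)\<^sup>2) + (LINT x|lebesgue_on (ball c R). (norm (G x))\<^sup>2)"
proof -
  have "(LINT x|lebesgue_on (ball c R). (norm (weak_gradient (ball c R) u x))\<^sup>2) = (LINT x|lebesgue_on (ball c R). (norm (G x))\<^sup>2)"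
  proof (rule integral_cong_AE)
    show "AE x in lebesgue_on (ball c R). (norm (weak_gradient (ball c R) u x))\<^sup>2 = (norm (G x))\<^sup>2"
      using assms(3) by eventually_elim simp
  qed (use H1_weak_gradient(2)[OF assms(1)] assms(2) in \<open>auto simp: L2_def\<close>)
  then show ?thesis by (simp add: H1_norm_def)
qed

lemma norm_square_Basis: "(norm x)\<^sup>2 = (\<Sum>b\<in>Basis. (x \<bullet> b)\<^sup>2)" for x :: "'a::euclidean_space"
  unfolding power2_norm_eq_inner euclidean_inner[of x x] by (simp add: power2_eq_square)

text \<open>Differentiating the kernel in x gives the factor 1 / e, differentiating it in z the
  factor -1 / (l e). Exchanging the x-derivative for the z-derivative and applying the weak identity
  to the kernel moves the derivative onto v; the quotient of the two factors leaves the contraction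
  factor l.\<close>

lemma partial_mollify:
  fixes c x :: "'a::euclidean_space" and k :: nat
  assumes R: "R > 0" and v: "v \<in> borel_measurable (lebesgue_on (ball c R))"
    and w: "w \<in> borel_measurable borel" "\<And>x. x \<notin> ball c R \<Longrightarrow> w x = 0"
      "AE x in lebesgue_on (ball c R). v x = w x" "integrable lborel (\<lambda>x. (w x)\<^sup>2)"
    and G: "has_weak_gradient (ball c R) v G" "G \<in> borel_measurable (lebesgue_on (ball c R))" and b: "b \<in> Basis"
    and W: "W \<in> borel_measurable borel" "\<And>x. x \<notin> ball c R \<Longrightarrow> W x = 0"
      "AE x in lebesgue_on (ball c R). G x \<bullet> b = W x"
    and x: "x \<in> ball c R"
  shows "frechet_derivative (mollify c R k w) (at x) b = (1 - 1 / (real k + 2)) * mollify c R k W x"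
proof -
  define l e where "l = 1 - 1 / (real k + 2)" and "e = R / (real k + 2)"
  have l: "l > 0" and e: "e > 0" using R by (auto simp: l_def e_def)
  note [measurable] = w(1) W(1)
  define T where "T z = (1 / e) *\<^sub>R c + (1 / (l * e)) *\<^sub>R (z - c)" for z
  have T: "T \<in> borel_measurable borel" unfolding T_def by measurable
  define C where "C = inverse ((l * e) ^ DIM('a))"
  have C: "C > 0" using l e by (simp add: C_def)
  let ?D = "\<lambda>y h. frechet_derivative unit_bump (at y) (h::'a)"
  let ?psi = "\<lambda>z. unit_bump ((1 / e) *\<^sub>R x - T z)"
  have w1: "integrable lborel w"
    by (rule square_integrable_imp_integrable_ball[OF w(1) _ w(4)]) (rule w(2))
  have eqm: "mollify c R k w = (\<lambda>x. C * (LINT z|lborel. w z * unit_bump ((1 / e) *\<^sub>R x - T z)))"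
    using mollify_kernel[OF R w(1)] by (simp add: C_def T_def l_def e_def fun_eq_iff)
  have hd: "((\<lambda>x. C * (LINT z|lborel. w z * unit_bump ((1 / e) *\<^sub>R x - T z))) has_derivative
     (\<lambda>h. C * ((1 / e) * (LINT z|lborel. w z * ?D ((1 / e) *\<^sub>R x - T z) h)))) (at x)"
    using T by (intro has_derivative_mult_right Ck_kernel_integral(2)[OF w1 _ smooth_Ck[OF smooth_unit_bump, of "Suc 0"], where r=1])
      (auto simp: unit_bump_eq_0)
  have d: "frechet_derivative (mollify c R k w) (at x) b
      = C * ((1 / e) * (LINT z|lborel. w z * ?D ((1 / e) *\<^sub>R x - T z) b))"
    unfolding eqm frechet_derivative_at[OF hd, symmetric] by (rule refl)
  have dpsi: "frechet_derivative ?psi (at z) b = - (1 / (l * e)) * ?D ((1 / e) *\<^sub>R x - T z) b" for z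
  proof -
    have hz: "((\<lambda>z. (1 / e) *\<^sub>R x - T z) has_derivative (\<lambda>h. - (1 / (l * e)) *\<^sub>R h)) (at z)"
      unfolding T_def by (auto intro!: derivative_eq_intros)
    have "frechet_derivative ?psi (at z) b = ?D ((1 / e) *\<^sub>R x - T z) (- (1 / (l * e)) *\<^sub>R b)"
      unfolding frechet_derivative_at[OF has_derivative_compose[OF hz smooth_has_derivative[OF smooth_unit_bump]], symmetric]
      by (rule refl)
    then show ?thesis
      using has_derivative_linear[OF smooth_has_derivative[OF smooth_unit_bump[where 'a='a]]] by (simp add: linear_neg linear_cmul)
  qed
  have cD: "continuous_on UNIV (\<lambda>y. ?D y b)"
    by (intro smooth_continuous smooth_partial smooth_unit_bump b)
  note [measurable] = borel_measurable_continuous_onI[OF cD] T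
  have Dm: "(\<lambda>z. ?D ((1 / e) *\<^sub>R x - T z) b) \<in> borel_measurable borel"
    by (rule measurable_compose[OF _ borel_measurable_continuous_onI[OF cD]]) simp
  have psi: "test_function (ball c R) ?psi"
    using test_function_kernel[OF R x, of k] by (simp add: T_def l_def e_def)
  have "(LINT z|lebesgue_on (ball c R). v z * frechet_derivative ?psi (at z) b)
      = - (LINT z|lebesgue_on (ball c R). (G z \<bullet> b) * ?psi z)"
    using G(1)[unfolded has_weak_gradient_def, rule_format, OF psi b] .
  also have "(LINT z|lebesgue_on (ball c R). v z * frechet_derivative ?psi (at z) b)
      = (LINT z|lebesgue_on (ball c R). - (1 / (l * e)) * (w z * ?D ((1 / e) *\<^sub>R x - T z) b))"
    unfolding dpsi
  proof (rule integral_cong_AE)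
    show "AE z in lebesgue_on (ball c R). v z * (- (1 / (l * e)) * ?D ((1 / e) *\<^sub>R x - T z) b)
        = - (1 / (l * e)) * (w z * ?D ((1 / e) *\<^sub>R x - T z) b)"
      using w(3) by eventually_elim simp
  qed (intro borel_measurable_times borel_measurable_const v borel_measurable_lebesgue_on_borel[OF w(1)]
      borel_measurable_lebesgue_on_borel[OF Dm])+
  also have "\<dots> = - (1 / (l * e)) * (LINT z|lebesgue_on (ball c R). w z * ?D ((1 / e) *\<^sub>R x - T z) b)"
    by (rule integral_mult_right_zero)
  also have "(LINT z|lebesgue_on (ball c R). w z * ?D ((1 / e) *\<^sub>R x - T z) b) = (LINT z|lborel. w z * ?D ((1 / e) *\<^sub>R x - T z) b)"
    using Dm by (subst integral_lebesgue_on_ball_borel)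
      (auto simp: set_lebesgue_integral_def indicator_def intro!: Bochner_Integration.integral_cong w(2))
  finally have eq: "(1 / (l * e)) * (LINT z|lborel. w z * ?D ((1 / e) *\<^sub>R x - T z) b)
      = (LINT z|lebesgue_on (ball c R). (G z \<bullet> b) * ?psi z)" by simp
  have m: "mollify c R k W x = C * (LINT z|lebesgue_on (ball c R). (G z \<bullet> b) * ?psi z)"
    unfolding C_def T_def l_def e_def
    by (rule mollify_eq_test_integral[OF R W(1) _ W(3)]) (use W(2) G(2) in auto)
  have "C * ((1 / e) * (LINT z|lborel. w z * ?D ((1 / e) *\<^sub>R x - T z) b))
      = l * (C * ((1 / (l * e)) * (LINT z|lborel. w z * ?D ((1 / e) *\<^sub>R x - T z) b)))"
    using l by simp
  then show ?thesis unfolding d eq m[symmetric] by (simp add: l_def)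
qed

text \<open>The scalars \<open>s k\<close> cover the factor 1 - 1 / (k + 2) that
  \<open>partial_mollify\<close> leaves in front of the mollified gradient; with the constant
  sequence 1 the lemma serves for the function itself.\<close>

lemma mollify_scaled_tendsto:
  fixes c :: "'a::euclidean_space"
  assumes R: "R > 0" and f: "AE x in lebesgue_on (ball c R). f x = w x" "f \<in> borel_measurable (lebesgue_on (ball c R))"
    and w: "w \<in> borel_measurable borel" "\<And>x. x \<notin> ball c R \<Longrightarrow> w x = 0" "integrable lborel (\<lambda>x. (w x)\<^sup>2)"
    and s: "\<And>k. \<bar>s k\<bar> \<le> 1" "s \<longlonglongrightarrow> 1"
  shows "(\<lambda>k. LINT x|lebesgue_on (ball c R). (s k * mollify c R k w x - f x)\<^sup>2) \<longlonglongrightarrow> 0"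
proof (rule tendsto_sandwich)
  let ?B = "ball c R"
  have w1: "integrable lborel w"
    by (rule square_integrable_imp_integrable_ball[OF w(1) _ w(3)]) (rule w(2))
  note mt = mollify_tendsto[OF R w(1) _ w(3)]
  have mm: "mollify c R k w \<in> borel_measurable borel" for k
    by (intro borel_measurable_continuous_onI smooth_continuous smooth_mollify R w1)
  note [measurable] = mm w(1) borel_measurable_lebesgue_on_borel[OF mm] borel_measurable_lebesgue_on_borel[OF w(1)]
  show "\<forall>\<^sub>F k in sequentially. 0 \<le> (LINT x|lebesgue_on ?B. (s k * mollify c R k w x - f x)\<^sup>2)"
    by (intro always_eventually allI integral_nonneg_AE AE_I2) simp
  have "(LINT x|lebesgue_on ?B. (s k * mollify c R k w x - f x)\<^sup>2)
     \<le> 2 * (LINT x:?B|lborel. (mollify c R k w x - w x)\<^sup>2) + 2 * (1 - s k)\<^sup>2 * (LINT x|lborel. (w x)\<^sup>2)" for k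
  proof -
    have int1: "integrable lborel (\<lambda>x. indicator ?B x * (mollify c R k w x - w x)\<^sup>2)"
      using mt(1)[of c k] w(2) by (simp add: set_integrable_def)
    have pt: "indicator ?B x * (s k * mollify c R k w x - w x)\<^sup>2
      \<le> 2 * (indicator ?B x * (mollify c R k w x - w x)\<^sup>2) + 2 * (1 - s k)\<^sup>2 * (w x)\<^sup>2" for x
    proof (cases "x \<in> ?B")
      case True
      define p q where "p = s k * (mollify c R k w x - w x)" and "q = (1 - s k) * w x"
      have eq: "s k * mollify c R k w x - w x = p - q" by (simp add: p_def q_def algebra_simps)
      have "(p - q)\<^sup>2 \<le> 2 * p\<^sup>2 + 2 * q\<^sup>2"
        using zero_le_power2[of "p + q"] by (simp add: power2_eq_square algebra_simps)
      moreover have "p\<^sup>2 \<le> (mollify c R k w x - w x)\<^sup>2"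
        unfolding p_def power_mult_distrib using s(1)[of k]
        by (intro mult_left_le_one_le) (auto simp: abs_square_le_1)
      moreover have "q\<^sup>2 = (1 - s k)\<^sup>2 * (w x)\<^sup>2" by (simp add: q_def power_mult_distrib)
      ultimately show ?thesis using True by (simp add: eq)
    qed simp
    have "(LINT x|lebesgue_on ?B. (s k * mollify c R k w x - f x)\<^sup>2) = (LINT x|lebesgue_on ?B. (s k * mollify c R k w x - w x)\<^sup>2)"
      using f by (intro integral_cong_AE) auto
    also have "\<dots> = (LINT x|lborel. indicator ?B x * (s k * mollify c R k w x - w x)\<^sup>2)"
      by (subst integral_lebesgue_on_ball_borel) (auto simp: set_lebesgue_integral_def)
    also have "\<dots> \<le> (LINT x|lborel. 2 * (indicator ?B x * (mollify c R k w x - w x)\<^sup>2) + 2 * (1 - s k)\<^sup>2 * (w x)\<^sup>2)"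
    proof (rule integral_mono)
      show i: "integrable lborel (\<lambda>x. 2 * (indicator ?B x * (mollify c R k w x - w x)\<^sup>2) + 2 * (1 - s k)\<^sup>2 * (w x)\<^sup>2)"
        by (intro Bochner_Integration.integrable_add integrable_mult_right int1 w)
      show "integrable lborel (\<lambda>x. indicator ?B x * (s k * mollify c R k w x - w x)\<^sup>2)"
        by (rule Bochner_Integration.integrable_bound[OF i])
          (use pt in \<open>auto intro!: AE_I2 order_trans[OF _ abs_ge_self] simp: abs_mult\<close>)
    qed (rule pt)
    also have "\<dots> = 2 * (LINT x:?B|lborel. (mollify c R k w x - w x)\<^sup>2) + 2 * (1 - s k)\<^sup>2 * (LINT x|lborel. (w x)\<^sup>2)"
      unfolding set_lebesgue_integral_def real_scaleR_def
      by (simp only: Bochner_Integration.integral_add integrable_mult_right int1 w integral_mult_right_zero)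
    finally show ?thesis .
  qed
  then show "\<forall>\<^sub>F k in sequentially. (LINT x|lebesgue_on ?B. (s k * mollify c R k w x - f x)\<^sup>2)
     \<le> 2 * (LINT x:?B|lborel. (mollify c R k w x - w x)\<^sup>2) + 2 * (1 - s k)\<^sup>2 * (LINT x|lborel. (w x)\<^sup>2)"
    by (intro always_eventually allI)
  have "(\<lambda>k. 2 * (LINT x:?B|lborel. (mollify c R k w x - w x)\<^sup>2) + 2 * (1 - s k)\<^sup>2 * (LINT x|lborel. (w x)\<^sup>2))
    \<longlonglongrightarrow> 2 * 0 + 2 * (1 - 1)\<^sup>2 * (LINT x|lborel. (w x)\<^sup>2)"
    using mt(2)[of c] w(2) by (intro tendsto_intros s(2)) auto
  then show "(\<lambda>k. 2 * (LINT x:?B|lborel. (mollify c R k w x - w x)\<^sup>2) + 2 * (1 - s k)\<^sup>2 * (LINT x|lborel. (w x)\<^sup>2)) \<longlonglongrightarrow> 0"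
    by simp
qed simp

text \<open>The squared H1 distance splits into N + 1 squared L2 distances, one for the function and
  one for each component of the gradient, and \<open>mollify_scaled_tendsto\<close> handles each of
  them.\<close>

theorem smooth_dense_H1:
  fixes c :: "'a::euclidean_space"
  assumes R: "R > 0" and v: "v \<in> H1 (ball c R)"
  obtains \<phi> where "\<And>k::nat. smooth (\<phi> k)" "(\<lambda>k. H1_norm (ball c R) (\<lambda>x. \<phi> k x - v x)) \<longlonglongrightarrow> 0"
proof -
  let ?B = "ball c R" and ?G = "weak_gradient (ball c R) v"
  note G = H1_weak_gradient[OF v]
  have Gm: "?G \<in> borel_measurable (lebesgue_on ?B)" using G(2) by (simp add: L2_def)
  have vm: "v \<in> borel_measurable (lebesgue_on ?B)" using G(1) by (simp add: L2_def)
  obtain w where w: "w \<in> borel_measurable borel" "\<And>x. x \<notin> ?B \<Longrightarrow> w x = 0"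
    "AE x in lebesgue_on ?B. v x = w x" "integrable lborel (\<lambda>x. (w x)\<^sup>2)"
    using square_integrable_borel_representative[OF G(1)] by blast
  have w1: "integrable lborel w"
    by (rule square_integrable_imp_integrable_ball[OF w(1) _ w(4)]) (rule w(2))
  let ?P = "\<lambda>b W. W \<in> borel_measurable borel \<and> (\<forall>x. x \<notin> ?B \<longrightarrow> W x = 0) \<and>
    (AE x in lebesgue_on ?B. ?G x \<bullet> b = W x) \<and> integrable lborel (\<lambda>x. (W x)\<^sup>2)"
  have "\<forall>b\<in>Basis. \<exists>W. ?P b W"
  proof
    fix b :: 'a assume "b \<in> Basis"
    obtain W where "W \<in> borel_measurable borel" "\<And>x. x \<notin> ?B \<Longrightarrow> W x = 0"
      "AE x in lebesgue_on ?B. ?G x \<bullet> b = W x" "integrable lborel (\<lambda>x. (W x)\<^sup>2)"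
      using square_integrable_borel_representative[OF L2_component[OF G(2) \<open>b \<in> Basis\<close>]] by blast
    then show "\<exists>W. ?P b W" by (intro exI[of _ W]) simp
  qed
  from bchoice[OF this] obtain W where W_all: "\<forall>b\<in>Basis. ?P b (W b)" ..
  have W: "\<And>b. b \<in> Basis \<Longrightarrow> W b \<in> borel_measurable borel"
    "\<And>b x. b \<in> Basis \<Longrightarrow> x \<notin> ?B \<Longrightarrow> W b x = 0"
    "\<And>b. b \<in> Basis \<Longrightarrow> AE x in lebesgue_on ?B. ?G x \<bullet> b = W b x"
    "\<And>b. b \<in> Basis \<Longrightarrow> integrable lborel (\<lambda>x. (W b x)\<^sup>2)"
    by (rule W_all[rule_format, THEN conjunct1] W_all[rule_format, THEN conjunct2, THEN conjunct1, rule_format]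
        W_all[rule_format, THEN conjunct2, THEN conjunct2, THEN conjunct1]
        W_all[rule_format, THEN conjunct2, THEN conjunct2, THEN conjunct2]; assumption)+
  define \<phi> where "\<phi> k = mollify c R k w" for k
  have sm: "smooth (\<phi> k)" for k unfolding \<phi>_def by (intro smooth_mollify R w1)
  have C1: "Ck (Suc 0) (\<phi> k)" for k using smooth_Ck[OF sm] .
  note gr = C1_in_H1[OF C1, where c=c and R=R]
  have dH: "(\<lambda>x. \<phi> k x - v x) \<in> H1 ?B" for k by (intro H1_diff R gr v)
  have dG: "AE x in lebesgue_on ?B. weak_gradient ?B (\<lambda>x. \<phi> k x - v x) x = grad (\<phi> k) x - ?G x" for k
    using H1_diff(2)[OF R gr(1)[of k] v] weak_gradient_C1[OF R C1[of k], of c] by eventually_elim simp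
  define l where "l k = 1 - 1 / (real k + 2)" for k :: nat
  have l: "\<bar>l k\<bar> \<le> 1" for k by (auto simp: l_def field_simps)
  have l1: "l \<longlonglongrightarrow> 1" unfolding l_def by real_asymp
  have "(H1_norm ?B (\<lambda>x. \<phi> k x - v x))\<^sup>2 = (LINT x|lebesgue_on ?B. (\<phi> k x - v x)\<^sup>2)
    + (\<Sum>b\<in>Basis. (LINT x|lebesgue_on ?B. (l k * mollify c R k (W b) x - ?G x \<bullet> b)\<^sup>2))" for k
  proof -
    have L: "L2 (lebesgue_on ?B) (\<lambda>x. grad (\<phi> k) x - ?G x)" by (intro L2_diff gr G)
    have "(H1_norm ?B (\<lambda>x. \<phi> k x - v x))\<^sup>2 = (LINT x|lebesgue_on ?B. (\<phi> k x - v x)\<^sup>2)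
      + (LINT x|lebesgue_on ?B. (norm (grad (\<phi> k) x - ?G x))\<^sup>2)"
      by (rule H1_norm_square[OF dH L dG])
    also have "(LINT x|lebesgue_on ?B. (norm (grad (\<phi> k) x - ?G x))\<^sup>2)
      = (\<Sum>b\<in>Basis. (LINT x|lebesgue_on ?B. ((grad (\<phi> k) x - ?G x) \<bullet> b)\<^sup>2))"
      unfolding norm_square_Basis using L2_component[OF L] by (intro Bochner_Integration.integral_sum) (simp add: L2_real_iff)
    also have "\<dots> = (\<Sum>b\<in>Basis. (LINT x|lebesgue_on ?B. (l k * mollify c R k (W b) x - ?G x \<bullet> b)\<^sup>2))"
    proof (intro sum.cong refl Bochner_Integration.integral_cong)
      fix b x :: 'a assume b: "b \<in> Basis" and "x \<in> space (lebesgue_on ?B)"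
      then have x: "x \<in> ?B" by simp
      have "frechet_derivative (\<phi> k) (at x) b = l k * mollify c R k (W b) x"
        unfolding \<phi>_def l_def
        by (rule partial_mollify[OF R vm w(1) _ w(3,4) G(3) Gm b W(1)[OF b] _ W(3)[OF b] x])
          (use w(2) W(2)[OF b] in auto)
      then show "((grad (\<phi> k) x - ?G x) \<bullet> b)\<^sup>2 = (l k * mollify c R k (W b) x - ?G x \<bullet> b)\<^sup>2"
        by (simp add: inner_diff_left grad_inner_Basis[OF b])
    qed
    finally show ?thesis .
  qed
  moreover have "(\<lambda>k. (LINT x|lebesgue_on ?B. (\<phi> k x - v x)\<^sup>2)
    + (\<Sum>b\<in>Basis. (LINT x|lebesgue_on ?B. (l k * mollify c R k (W b) x - ?G x \<bullet> b)\<^sup>2))) \<longlonglongrightarrow> 0 + (\<Sum>b\<in>(Basis::'a set). 0)"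
  proof (intro tendsto_add tendsto_sum)
    show "(\<lambda>k. LINT x|lebesgue_on ?B. (\<phi> k x - v x)\<^sup>2) \<longlonglongrightarrow> 0"
      using mollify_scaled_tendsto[OF R w(3) vm w(1) _ w(4), of "\<lambda>_. 1"] w(2) by (simp add: \<phi>_def)
    fix b :: 'a assume b: "b \<in> Basis"
    show "(\<lambda>k. LINT x|lebesgue_on ?B. (l k * mollify c R k (W b) x - ?G x \<bullet> b)\<^sup>2) \<longlonglongrightarrow> 0"
      using l l1 W(2)[OF b] L2_component[OF G(2) b]
      by (intro mollify_scaled_tendsto[OF R W(3)[OF b] _ W(1)[OF b] _ W(4)[OF b]]) (auto simp: L2_def)
  qed
  ultimately have "(\<lambda>k. (H1_norm ?B (\<lambda>x. \<phi> k x - v x))\<^sup>2) \<longlonglongrightarrow> 0" by simp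
  then have "(\<lambda>k. sqrt ((H1_norm ?B (\<lambda>x. \<phi> k x - v x))\<^sup>2)) \<longlonglongrightarrow> sqrt 0" by (rule tendsto_real_sqrt)
  moreover have "H1_norm ?B f \<ge> 0" for f by (simp add: H1_norm_def)
  ultimately show thesis using that[of \<phi>] sm by simp
qed


section \<open>Surface measure and the radial divergence identity\<close>

lemma scale_measure_eq_density:
  "0 \<le> a \<Longrightarrow> scale_measure (ennreal a) M = density M (\<lambda>_. ennreal a)"
  by (rule measure_eqI) (auto simp: emeasure_density nn_integral_cmult_indicator)

lemma borel_measurable_projection [measurable]:
  fixes c :: "'a::euclidean_space"
  shows "(\<lambda>x. c + (R / norm (x - c)) *\<^sub>R (x - c)) \<in> borel_measurable borel"
  by measurable

lemma surface_integral:
  fixes c :: "'a::euclidean_space" and f :: "'a \<Rightarrow> real"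
  assumes R: "R > 0" and f[measurable]: "f \<in> borel_measurable borel"
  shows "(LINT x|surface_measure c R. f x) = real DIM('a) / R *
      (LINT x:ball c R|lborel. f (c + (R / norm (x - c)) *\<^sub>R (x - c)))"
    and "integrable (surface_measure c R) f \<longleftrightarrow> set_integrable lborel (ball c R) (\<lambda>x. f (c + (R / norm (x - c)) *\<^sub>R (x - c)))"
    and "(AE x in surface_measure c R. f x = 0) \<longleftrightarrow> (AE x in lebesgue_on (ball c R). f (c + (R / norm (x - c)) *\<^sub>R (x - c)) = 0)"
proof -
  let ?p = "\<lambda>x. c + (R / norm (x - c)) *\<^sub>R (x - c)"
  have p: "?p \<in> borel_measurable (lebesgue_on (ball c R))"
    by (intro borel_measurable_lebesgue_on_borel) simp
  have fp: "(\<lambda>x. f (?p x)) \<in> borel_measurable borel" by measurable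
  have pos: "real DIM('a) / R > 0" using R by (simp add: DIM_positive)
  have sm: "surface_measure c R = density (distr (lebesgue_on (ball c R)) borel ?p) (\<lambda>_. ennreal (real DIM('a) / R))"
    unfolding surface_measure_def using pos by (intro scale_measure_eq_density) simp
  show "(LINT x|surface_measure c R. f x) = real DIM('a) / R * (LINT x:ball c R|lborel. f (?p x))"
    unfolding sm using R p by (subst integral_density) (auto simp: integral_distr integral_lebesgue_on_ball_borel(1)[OF fp])
  show "integrable (surface_measure c R) f \<longleftrightarrow> set_integrable lborel (ball c R) (\<lambda>x. f (?p x))"
  proof -
    have "integrable (surface_measure c R) f \<longleftrightarrow>
        integrable (distr (lebesgue_on (ball c R)) borel ?p) (\<lambda>x. (real DIM('a) / R) *\<^sub>R f x)"
      unfolding sm using R by (subst integrable_density) auto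
    also have "\<dots> \<longleftrightarrow> integrable (lebesgue_on (ball c R)) (\<lambda>x. (real DIM('a) / R) *\<^sub>R f (?p x))"
      using p by (subst integrable_distr_eq) auto
    also have "\<dots> \<longleftrightarrow> integrable (lebesgue_on (ball c R)) (\<lambda>x. f (?p x))"
      using R unfolding real_scaleR_def integrable_mult_left_iff by simp
    finally show ?thesis unfolding integral_lebesgue_on_ball_borel(2)[OF fp] .
  qed
  show "(AE x in surface_measure c R. f x = 0) \<longleftrightarrow> (AE x in lebesgue_on (ball c R). f (?p x) = 0)"
    unfolding sm using p pos by (subst AE_density) (auto simp: AE_distr_iff)
qed

lemma integral_square_Cauchy_Schwarz:
  fixes f g :: "'a \<Rightarrow> 'b::euclidean_space"
  assumes f: "L2 M f" and g: "L2 M g"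
  shows "(LINT x|M. f x \<bullet> g x)\<^sup>2 \<le> (LINT x|M. (norm (f x))\<^sup>2) * (LINT x|M. (norm (g x))\<^sup>2)"
proof -
  define A B C where "A = (LINT x|M. (norm (f x))\<^sup>2)" and "B = (LINT x|M. f x \<bullet> g x)"
    and "C = (LINT x|M. (norm (g x))\<^sup>2)"
  have i: "integrable M (\<lambda>x. (norm (f x))\<^sup>2)" "integrable M (\<lambda>x. (norm (g x))\<^sup>2)"
    "integrable M (\<lambda>x. f x \<bullet> g x)"
    using f g L2_inner_integrable by (auto simp: L2_def)
  have quad: "0 \<le> t\<^sup>2 * A + 2 * t * B + C" for t
  proof -
    have "0 \<le> (LINT x|M. t\<^sup>2 * (norm (f x))\<^sup>2 + 2 * t * (f x \<bullet> g x) + (norm (g x))\<^sup>2)"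
    proof (intro integral_nonneg_AE AE_I2)
      fix x
      have "0 \<le> (norm (t *\<^sub>R f x + g x))\<^sup>2" by simp
      then show "0 \<le> t\<^sup>2 * (norm (f x))\<^sup>2 + 2 * t * (f x \<bullet> g x) + (norm (g x))\<^sup>2"
        unfolding power2_norm_eq_inner by (simp add: inner_simps inner_commute power2_eq_square algebra_simps)
    qed
    also have "\<dots> = t\<^sup>2 * A + 2 * t * B + C"
      unfolding A_def B_def C_def
      by (simp only: Bochner_Integration.integral_add Bochner_Integration.integrable_add i
          integrable_mult_right integral_mult_right_zero)
    finally show ?thesis .
  qed
  have C: "C \<ge> 0" by (simp add: C_def)
  have A: "A \<ge> 0" by (simp add: A_def)
  have "B\<^sup>2 \<le> A * C"
  proof (cases "A = 0")
    case True
    show ?thesis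
    proof (cases "B = 0")
      case False
      \<comment> \<open>If A = 0 the quadratic is the affine function 2 t B + C; at this t it takes
        the value -1.\<close>
      have "0 \<le> 2 * (- (C + 1) / (2 * B)) * B + C" using quad[of "- (C + 1) / (2 * B)"] True by simp
      also have "\<dots> = -1" using False by (simp add: field_simps)
      finally show ?thesis by simp
    qed (use A C in simp)
  next
    case False
    have "0 \<le> A * ((- B / A)\<^sup>2 * A + 2 * (- B / A) * B + C)"
      using quad[of "- B / A"] A by (intro mult_nonneg_nonneg) auto
    also have "\<dots> = A * C - B\<^sup>2" using False by (simp add: power2_eq_square field_simps)
    finally show ?thesis by simp
  qed
  then show ?thesis by (simp add: A_def B_def C_def)
qed

lemma L2_tendsto_integral_inner:
  fixes h :: "'a \<Rightarrow> 'b::euclidean_space"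
  assumes h: "L2 M h" and f: "\<And>k::nat. L2 M (f k)" "L2 M g"
    and lim: "(\<lambda>k. LINT x|M. (norm (f k x - g x))\<^sup>2) \<longlonglongrightarrow> 0"
  shows "(\<lambda>k. LINT x|M. h x \<bullet> f k x) \<longlonglongrightarrow> (LINT x|M. h x \<bullet> g x)"
proof -
  have "(\<lambda>k. (LINT x|M. h x \<bullet> (f k x - g x))\<^sup>2) \<longlonglongrightarrow> 0"
  proof (rule tendsto_sandwich)
    show "\<forall>\<^sub>F k in sequentially. 0 \<le> (LINT x|M. h x \<bullet> (f k x - g x))\<^sup>2" by simp
    show "\<forall>\<^sub>F k in sequentially. (LINT x|M. h x \<bullet> (f k x - g x))\<^sup>2
        \<le> (LINT x|M. (norm (h x))\<^sup>2) * (LINT x|M. (norm (f k x - g x))\<^sup>2)"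
      by (intro always_eventually allI integral_square_Cauchy_Schwarz h L2_diff f)
    show "(\<lambda>k. (LINT x|M. (norm (h x))\<^sup>2) * (LINT x|M. (norm (f k x - g x))\<^sup>2)) \<longlonglongrightarrow> 0"
      using tendsto_mult_right_zero[OF lim] by simp
  qed auto
  then have "(\<lambda>k. sqrt ((LINT x|M. h x \<bullet> (f k x - g x))\<^sup>2)) \<longlonglongrightarrow> sqrt 0" by (rule tendsto_real_sqrt)
  then have "(\<lambda>k. LINT x|M. h x \<bullet> (f k x - g x)) \<longlonglongrightarrow> 0" by (simp add: tendsto_rabs_zero_iff)
  moreover have "(LINT x|M. h x \<bullet> (f k x - g x)) = (LINT x|M. h x \<bullet> f k x) - (LINT x|M. h x \<bullet> g x)" for k
    unfolding inner_diff_right by (intro Bochner_Integration.integral_diff L2_inner_integrable h f)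
  ultimately show ?thesis by (simp add: LIM_zero_iff)
qed

text \<open>This weight remains in \<open>radial_divergence\<close> after the scaling: s^(-N) is the
  Jacobian, and a further 1 / s comes from the chain rule.\<close>

lemma integral_inverse_power_atLeast_1:
  fixes n :: nat
  assumes n: "n > 0"
  shows "integrable lborel (\<lambda>s::real. indicator {1..} s * (1 / s ^ Suc n))"
    and "(LINT s|(lborel :: real measure). indicator {1..} s * (1 / s ^ Suc n)) = 1 / n"
proof -
  have *: "(\<integral>\<^sup>+s. ennreal (1 / s ^ Suc n) * indicator {1..} s \<partial>lborel) = ennreal (0 - - (1 / (real n * 1 ^ n)))"
  proof (rule nn_integral_FTC_atLeast[where F="\<lambda>s. - (1 / (real n * s ^ n))"])
    fix s :: real assume s: "1 \<le> s"
    have "((\<lambda>s. - (1 / (real n * s ^ n))) has_real_derivative (real n * (real n * s ^ (n - 1))) / (real n * s ^ n)\<^sup>2) (at s)"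
      using s n by (auto intro!: derivative_eq_intros simp: power2_eq_square)
    moreover have "(real n * (real n * s ^ (n - 1))) / (real n * s ^ n)\<^sup>2 = 1 / s ^ Suc n"
      using s n by (cases n) (auto simp: power2_eq_square divide_simps simp del: of_nat_Suc)
    ultimately show "((\<lambda>s. - (1 / (real n * s ^ n))) has_real_derivative 1 / s ^ Suc n) (at s)" by simp
    show "0 \<le> 1 / s ^ Suc n" using s by simp
  next
    have "((\<lambda>s::real. - (1 / (real n * s ^ n))) \<longlongrightarrow> - 0) at_top"
      using n by (intro tendsto_minus tendsto_divide_0[OF tendsto_const] filterlim_at_top_imp_at_infinity
          filterlim_tendsto_pos_mult_at_top[OF tendsto_const] filterlim_pow_at_top filterlim_ident) auto
    then show "((\<lambda>s::real. - (1 / (real n * s ^ n))) \<longlongrightarrow> 0) at_top" by simp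
  qed simp
  have nn: "(\<integral>\<^sup>+s. ennreal (indicator {1..} s * (1 / s ^ Suc n)) \<partial>lborel) = ennreal (1 / n)"
  proof -
    have "ennreal (1 / s ^ Suc n) * indicator {1..} s = ennreal (indicator {1..} s * (1 / s ^ Suc n))" for s :: real
      by (simp split: split_indicator)
    then show ?thesis using * by (simp only:) simp
  qed
  show int: "integrable lborel (\<lambda>s::real. indicator {1..} s * (1 / s ^ Suc n))"
    by (rule integrableI_nn_integral_finite[OF _ _ nn]) (auto intro!: AE_I2 simp: indicator_def)
  show "(LINT s|(lborel :: real measure). indicator {1..} s * (1 / s ^ Suc n)) = 1 / n"
    using nn nn_integral_eq_integral[OF int] by (subst integral_eq_nn_integral) (auto intro!: AE_I2 simp: indicator_def)
qed

text \<open>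
  The surface measure being a radial projection of Lebesgue measure, the identity is the
  fundamental theorem of calculus along the ray through \<open>x\<close>, from \<open>x\<close> to the sphere, integrated
  over the ball; the scaling \<open>y = c + s (x - c)\<close> then evaluates the integral over \<open>s\<close>.
\<close>

lemma radial_divergence:
  fixes c :: "'a::euclidean_space" and f D :: "'a \<Rightarrow> real"
  assumes R: "R > 0" and f[measurable]: "f \<in> borel_measurable borel" and D[measurable]: "D \<in> borel_measurable borel"
    and bf: "\<And>x. x \<in> cball c R \<Longrightarrow> \<bar>f x\<bar> \<le> C" and bD: "\<And>x. x \<in> cball c R \<Longrightarrow> \<bar>D x\<bar> \<le> C"
    and der: "\<And>x. x \<in> cball c R \<Longrightarrow> x \<noteq> c \<Longrightarrow> ((\<lambda>s. f (c + s *\<^sub>R (x - c))) has_real_derivative D x) (at 1)"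
  shows "R * (LINT x|surface_measure c R. f x) =
    real DIM('a) * (LINT x:ball c R|lborel. f x) + (LINT x:ball c R|lborel. D x)"
proof -
  let ?B = "ball c R" and ?N = "DIM('a)"
  let ?p = "\<lambda>x. c + (R / norm (x - c)) *\<^sub>R (x - c)"
  have N: "?N > 0" by simp
  have C: "C \<ge> 0" using bf[of c] R by simp
  have intB: "integrable lborel (\<lambda>x. indicator ?B x * (C::real))"
    using continuous_set_integrable_ball[of c R "\<lambda>_. C"] by (simp add: set_integrable_def)
  have bdd: "integrable lborel (\<lambda>x. indicator ?B x * g x)" if "g \<in> borel_measurable borel" "\<And>x. x \<in> ?B \<Longrightarrow> \<bar>g x\<bar> \<le> C" for g :: "'a \<Rightarrow> real"
    by (rule Bochner_Integration.integrable_bound[OF intB]) (use that C in \<open>auto intro!: AE_I2 simp: indicator_def\<close>)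
  \<comment> \<open>\<open>D y\<close> is the derivative of f along the dilation t -> c + t (y - c)
    at t = 1. At y = c + s (x - c) the quotient \<open>D y / s\<close> is therefore the derivative
    in s of f along the ray through x. The two indicators start the ray at x and cut it off at the
    sphere.\<close>
  define k where "k s x = indicator {1..} s * (indicator ?B (c + s *\<^sub>R (x - c)) * D (c + s *\<^sub>R (x - c)) / s)"
    for s :: real and x :: 'a
  have km[measurable]: "(\<lambda>(s, x). k s x) \<in> borel_measurable (lborel \<Otimes>\<^sub>M lborel)"
    unfolding k_def by measurable
  have affine: "(LINT x|lborel. g (c + s *\<^sub>R (x - c))) = (LINT x|lborel. g x) / s ^ ?N"
    "integrable lborel g \<Longrightarrow> integrable lborel (\<lambda>x. g (c + s *\<^sub>R (x - c)))"
    if "s \<ge> 1" "g \<in> borel_measurable borel" for g :: "'a \<Rightarrow> real" and s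
  proof -
    have eq: "(c - s *\<^sub>R c) + s *\<^sub>R x = c + s *\<^sub>R (x - c)" for x by (simp add: algebra_simps)
    show "(LINT x|lborel. g (c + s *\<^sub>R (x - c))) = (LINT x|lborel. g x) / s ^ ?N"
      using lborel_integral_affine[of g s "c - s *\<^sub>R c"] that unfolding eq by simp
    show "integrable lborel g \<Longrightarrow> integrable lborel (\<lambda>x. g (c + s *\<^sub>R (x - c)))"
      using lborel_integrable_affine[of g s "c - s *\<^sub>R c"] that unfolding eq by simp
  qed
  define ID where "ID = (LINT x|lborel. indicator ?B x * D x)"
  define IA where "IA = (LINT x|lborel. indicator ?B x * \<bar>D x\<bar>)"
  have kx: "(LINT x|lborel. k s x) = ID * (indicator {1..} s * (1 / s ^ Suc ?N))"
    "(LINT x|lborel. norm (k s x)) = IA * (indicator {1..} s * (1 / s ^ Suc ?N))"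
    "integrable lborel (k s)" for s
  proof -
    show "(LINT x|lborel. k s x) = ID * (indicator {1..} s * (1 / s ^ Suc ?N))"
    proof (cases "s \<ge> 1")
      case True
      then show ?thesis using affine(1)[of s "\<lambda>x. indicator ?B x * D x"]
        by (simp add: k_def ID_def[symmetric] integral_divide_zero)
    qed (simp add: k_def)
    show "(LINT x|lborel. norm (k s x)) = IA * (indicator {1..} s * (1 / s ^ Suc ?N))"
    proof (cases "s \<ge> 1")
      case True
      then show ?thesis using affine(1)[of s "\<lambda>x. indicator ?B x * \<bar>D x\<bar>"]
        by (simp add: k_def IA_def[symmetric] abs_mult integral_divide_zero)
    qed (simp add: k_def)
    show "integrable lborel (k s)"
    proof (cases "s \<ge> 1")
      case True
      have eq: "k s = (\<lambda>x. (\<lambda>y. indicator ?B y * D y) (c + s *\<^sub>R (x - c)) / s)"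
        using True by (simp add: k_def fun_eq_iff)
      show ?thesis unfolding eq
        by (intro integrable_divide affine(2) True bdd D bD) (use D in auto)
    qed (simp add: k_def[abs_def])
  qed
  have prod: "integrable (lborel \<Otimes>\<^sub>M lborel) (\<lambda>(s, x). k s x)"
  proof (rule lborel_pair.Fubini_integrable[OF km])
    show "integrable lborel (\<lambda>s. LINT x|lborel. norm (case (s, x) of (s, x) \<Rightarrow> k s x))"
      unfolding split kx(2) by (intro integrable_mult_right integral_inverse_power_atLeast_1 N)
    show "AE s in lborel. integrable lborel (\<lambda>x. case (s, x) of (s, x) \<Rightarrow> k s x)"
      using kx(3) by (intro AE_I2) simp
  qed
  have "(LINT x|lborel. LINT s|lborel. k s x) = (LINT s|lborel. LINT x|lborel. k s x)"
    using lborel_pair.Fubini_integral[OF prod] .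
  also have "\<dots> = ID / ?N"
    unfolding kx(1) integral_mult_right_zero integral_inverse_power_atLeast_1(2)[OF N] by simp
  finally have I1: "(LINT x|lborel. LINT s|lborel. k s x) = ID / ?N" .
  have ks: "(LINT s|lborel. k s x) = indicator ?B x * (f (?p x) - f x)" if "x \<noteq> c" for x
  proof (cases "x \<in> ?B")
    case True
    define S where "S = R / norm (x - c)"
    have nx: "norm (x - c) > 0" "norm (x - c) < R" using that True by (auto simp: dist_norm norm_minus_commute)
    then have S: "S > 1" by (simp add: S_def)
    have inB: "c + s *\<^sub>R (x - c) \<in> ?B \<longleftrightarrow> s < S" "c + s *\<^sub>R (x - c) \<in> cball c R \<longleftrightarrow> s \<le> S" if "s \<ge> 1" for s
    proof -
      have "dist c (c + s *\<^sub>R (x - c)) = s * norm (x - c)" using that by (simp add: dist_norm)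
      then show "c + s *\<^sub>R (x - c) \<in> ?B \<longleftrightarrow> s < S" "c + s *\<^sub>R (x - c) \<in> cball c R \<longleftrightarrow> s \<le> S"
        using nx by (simp_all add: S_def pos_less_divide_eq pos_le_divide_eq)
    qed
    have fd: "((\<lambda>t. f (c + t *\<^sub>R (x - c))) has_real_derivative D (c + s *\<^sub>R (x - c)) / s) (at s)"
      if s: "1 \<le> s" "s \<le> S" for s
    proof -
      let ?y = "c + s *\<^sub>R (x - c)"
      have y: "?y \<in> cball c R" "?y \<noteq> c" using inB(2)[of s] s that \<open>x \<noteq> c\<close> by auto
      have ss: "s / s = 1" using s by simp
      have "((\<lambda>t. f (c + (t / s) *\<^sub>R (?y - c))) has_real_derivative D ?y * (1 / s)) (at s)"
      proof (rule DERIV_chain2[where f="\<lambda>u. f (c + u *\<^sub>R (?y - c))" and g="\<lambda>t. t / s"])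
        show "((\<lambda>u. f (c + u *\<^sub>R (?y - c))) has_real_derivative D ?y) (at (s / s))"
          unfolding ss by (rule der[OF y])
        show "((\<lambda>t. t / s) has_real_derivative 1 / s) (at s)"
          using s by (auto intro!: derivative_eq_intros)
      qed
      moreover have "(\<lambda>t. f (c + (t / s) *\<^sub>R (?y - c))) = (\<lambda>t. f (c + t *\<^sub>R (x - c)))"
      proof
        fix t
        have "(t / s) *\<^sub>R (?y - c) = t *\<^sub>R (x - c)" using s by simp
        then show "f (c + (t / s) *\<^sub>R (?y - c)) = f (c + t *\<^sub>R (x - c))" by (simp only:)
      qed
      ultimately show ?thesis by (simp only: times_divide_eq_right mult_1_right)
    qed
    have hi: "((\<lambda>s. D (c + s *\<^sub>R (x - c)) / s) has_integral f (c + S *\<^sub>R (x - c)) - f (c + 1 *\<^sub>R (x - c))) {1..S}"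
    proof (rule fundamental_theorem_of_calculus)
      fix s assume "s \<in> {1..S}"
      then show "((\<lambda>t. f (c + t *\<^sub>R (x - c))) has_vector_derivative D (c + s *\<^sub>R (x - c)) / s) (at s within {1..S})"
        unfolding has_real_derivative_iff_has_vector_derivative[symmetric]
        by (intro has_field_derivative_at_within[OF fd]) auto
    qed (use S in simp)
    have si: "set_integrable lborel {1..S} (\<lambda>s. D (c + s *\<^sub>R (x - c)) / s)"
      unfolding set_integrable_def real_scaleR_def
    proof (rule Bochner_Integration.integrable_bound)
      show "integrable lborel (\<lambda>s. indicator {1..S} s * C)"
        using borel_integrable_compact[of "{1..S}" "\<lambda>_. C"] by simp
      have "\<bar>D (c + s *\<^sub>R (x - c)) / s\<bar> \<le> C" if "1 \<le> s" "s \<le> S" for s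
      proof -
        have "\<bar>D (c + s *\<^sub>R (x - c))\<bar> \<le> C" using inB(2)[of s] that by (intro bD) auto
        moreover have "C * 1 \<le> C * s" using that C by (intro mult_left_mono) auto
        ultimately show ?thesis using that by (simp add: abs_divide divide_le_eq)
      qed
      then show "AE s in lborel. norm (indicator {1..S} s * (D (c + s *\<^sub>R (x - c)) / s)) \<le> norm (indicator {1..S} s * C)"
        using C by (intro AE_I2) (auto simp: indicator_def)
    qed measurable
    have "(LINT s|lborel. k s x) = (LINT s:{1..S}|lborel. D (c + s *\<^sub>R (x - c)) / s)"
      unfolding set_lebesgue_integral_def
    proof (rule integral_cong_AE)
      \<comment> \<open>The ray leaves the open ball at s = S, the only parameter at which the two
        integrands can differ.\<close>
      show "AE s in lborel. k s x = indicator {1..S} s *\<^sub>R (D (c + s *\<^sub>R (x - c)) / s)"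
        using AE_lborel_singleton[of S]
      proof eventually_elim
        case (elim s)
        then show ?case using inB(1)[of s] by (cases "1 \<le> s") (auto simp: k_def indicator_def)
      qed
    qed (use km in measurable)
    also have "\<dots> = f (c + S *\<^sub>R (x - c)) - f (c + 1 *\<^sub>R (x - c))"
      using set_borel_integral_eq_integral(2)[OF si] hi by (simp add: integral_unique)
    finally show ?thesis using True by (simp add: S_def)
  next
    case False
    have "k s x = 0" for s
    proof (cases "s \<ge> 1")
      case True
      have "1 * norm (x - c) \<le> s * norm (x - c)" using True by (intro mult_right_mono) auto
      then have "c + s *\<^sub>R (x - c) \<notin> ?B" using False True by (simp add: dist_norm norm_minus_commute)
      then show ?thesis by (simp add: k_def)
    qed (simp add: k_def)
    then show ?thesis using False by simp
  qed
  have pc: "?p x \<in> cball c R" for x using R by (cases "x = c") (auto simp: dist_norm)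
  have fp[measurable]: "(\<lambda>x. f (?p x)) \<in> borel_measurable borel" by measurable
  have "(LINT x|lborel. LINT s|lborel. k s x) = (LINT x|lborel. indicator ?B x * f (?p x) - indicator ?B x * f x)"
  proof (rule integral_cong_AE)
    show "AE x in lborel. (LINT s|lborel. k s x) = indicator ?B x * f (?p x) - indicator ?B x * f x"
      using AE_lborel_singleton[of c] by eventually_elim (simp add: ks right_diff_distrib)
  qed (use km in measurable)
  also have "\<dots> = (LINT x|lborel. indicator ?B x * f (?p x)) - (LINT x|lborel. indicator ?B x * f x)"
    by (intro Bochner_Integration.integral_diff bdd f fp bf pc) (use ball_subset_cball in blast)
  finally have "(LINT x|lborel. indicator ?B x * f (?p x)) = (LINT x|lborel. indicator ?B x * f x) + ID / ?N"
    using I1 by simp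
  then show ?thesis
    unfolding surface_integral(1)[OF R f] set_lebesgue_integral_def real_scaleR_def ID_def
    using R by (simp add: field_simps)
qed

section \<open>Trace inequality and existence of the trace\<close>

lemma bounded_set_integrable_ball:
  fixes g :: "'a::euclidean_space \<Rightarrow> real"
  assumes g: "g \<in> borel_measurable borel" and bd: "\<And>x. x \<in> ball c R \<Longrightarrow> \<bar>g x\<bar> \<le> C"
  shows "set_integrable lborel (ball c R) g"
  unfolding set_integrable_def real_scaleR_def
proof (rule Bochner_Integration.integrable_bound)
  show "integrable lborel (\<lambda>x. indicator (ball c R) x * C)"
    using continuous_set_integrable_ball[of c R "\<lambda>_. C"] by (simp add: set_integrable_def)
  show "AE x in lborel. norm (indicator (ball c R) x * g x) \<le> norm (indicator (ball c R) x * C)"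
    using bd by (intro AE_I2) (auto simp: indicator_def intro: order_trans[OF _ abs_ge_self])
qed (use g in measurable)

lemma projection_in_cball:
  fixes c :: "'a::euclidean_space"
  assumes "R > 0" shows "c + (R / norm (x - c)) *\<^sub>R (x - c) \<in> cball c R"
  using assms by (cases "x = c") (auto simp: dist_norm)

lemma borel_measurable_surface_measure:
  "borel_measurable (surface_measure c R) = (borel_measurable borel :: ('a::euclidean_space \<Rightarrow> real) set)"
  by (rule measurable_cong_sets) (simp_all add: surface_measure_def)

lemma AE_surface_measure_sphere:
  fixes c :: "'a::euclidean_space"
  assumes "R > 0"
  shows "AE x in surface_measure c R. norm (x - c) = R"
proof -
  let ?f = "\<lambda>x::'a. indicator {x. norm (x - c) \<noteq> R} x :: real"
  have "{x. norm (x - c) \<noteq> R} \<in> sets borel" by measurable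
  then have [measurable]: "?f \<in> borel_measurable borel" by measurable
  have "AE x in lborel. x \<in> ball c R \<longrightarrow> ?f (c + (R / norm (x - c)) *\<^sub>R (x - c)) = 0"
    using AE_lborel_singleton[of c] by eventually_elim (use assms in simp)
  then have "AE x in surface_measure c R. ?f x = 0"
    by (subst surface_integral(3)[OF assms]) (auto simp: AE_lebesgue_on_ball_iff)
  then show ?thesis by eventually_elim (auto simp: indicator_def split: if_splits)
qed

lemma continuous_bounded_cball:
  fixes f :: "'a::euclidean_space \<Rightarrow> real"
  assumes "continuous_on UNIV f"
  obtains C where "C \<ge> 0" "\<And>x. x \<in> cball c R \<Longrightarrow> \<bar>f x\<bar> \<le> C"
proof -
  have "compact (f ` cball c R)" by (intro compact_continuous_image continuous_on_subset[OF assms]) auto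
  then obtain C where "\<forall>y\<in>f ` cball c R. norm y \<le> C" using compact_imp_bounded bounded_iff by blast
  then show thesis by (intro that[of "max C 0"]) (auto intro: order_trans[of _ C])
qed

lemma surface_integrable_continuous:
  fixes c :: "'a::euclidean_space" and f :: "'a \<Rightarrow> real"
  assumes R: "R > 0" and f: "continuous_on UNIV f"
  shows "integrable (surface_measure c R) f"
proof -
  have [measurable]: "f \<in> borel_measurable borel" using f by (rule borel_measurable_continuous_onI)
  obtain C where C: "\<And>x. x \<in> cball c R \<Longrightarrow> \<bar>f x\<bar> \<le> C" using continuous_bounded_cball[OF f] by blast
  have "\<bar>f (c + (R / norm (x - c)) *\<^sub>R (x - c))\<bar> \<le> C" for x
    by (rule C) (rule projection_in_cball[OF R])
  then show ?thesis
    by (subst surface_integral(2)[OF R], measurable) (intro bounded_set_integrable_ball[where C=C], measurable)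
qed

lemma L2_surface_continuous:
  fixes c :: "'a::euclidean_space" and f :: "'a \<Rightarrow> real"
  assumes R: "R > 0" and f: "continuous_on UNIV f"
  shows "L2 (surface_measure c R) f"
  unfolding L2_real_iff borel_measurable_surface_measure
  by (intro conjI borel_measurable_continuous_onI f surface_integrable_continuous R continuous_intros)

lemma finite_measure_surface:
  assumes R: "R > 0" shows "finite_measure (surface_measure (c::'a::euclidean_space) R)"
proof (rule finite_measureI)
  have "integrable (surface_measure c R) (\<lambda>_. 1::real)" by (intro surface_integrable_continuous R continuous_intros)
  then show "emeasure (surface_measure c R) (space (surface_measure c R)) \<noteq> \<infinity>"
    by (simp add: integrable_iff_bounded)
qed

lemma C1_H1_norm_square:
  fixes c :: "'a::euclidean_space"
  assumes "R > 0" "Ck (Suc 0) w"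
  shows "(H1_norm (ball c R) w)\<^sup>2 = (LINT x:ball c R|lborel. (w x)\<^sup>2) + (LINT x:ball c R|lborel. (norm (grad w x))\<^sup>2)"
proof -
  have "(\<lambda>x. (w x)\<^sup>2) \<in> borel_measurable borel" "(\<lambda>x. (norm (grad w x))\<^sup>2) \<in> borel_measurable borel"
    by (intro borel_measurable_continuous_onI continuous_intros Ck_continuous[OF assms(2)] continuous_grad assms)+
  then show ?thesis
    using H1_norm_square[OF C1_in_H1(1,2)[OF assms(2)] weak_gradient_C1[OF assms]]
    by (simp add: integral_lebesgue_on_ball_borel(1))
qed

lemma radial_line_derivative:
  fixes c x :: "'a::euclidean_space"
  assumes "Ck (Suc 0) w"
  shows "((\<lambda>s. w (c + s *\<^sub>R (x - c))) has_real_derivative grad w x \<bullet> (x - c)) (at 1)"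
proof -
  have 1: "((\<lambda>s. c + s *\<^sub>R (x - c)) has_derivative (\<lambda>h. h *\<^sub>R (x - c))) (at 1)"
    by (auto intro!: derivative_eq_intros)
  have "((\<lambda>s. w (c + s *\<^sub>R (x - c))) has_derivative (\<lambda>h. grad w x \<bullet> (h *\<^sub>R (x - c)))) (at 1)"
    using has_derivative_compose[OF 1 has_derivative_grad[OF assms]] by simp
  then show ?thesis by (simp add: has_field_derivative_def mult.commute[of _ "grad w x \<bullet> (x - c)"])
qed

text \<open>\<open>radial_divergence\<close> for w^2, whose dilation derivative is 2 w times the
  inner product of grad w with x - c. As |x - c| \<le> R, this is at most w^2 + R^2 |grad w|^2, and
  dividing N + 1 + R^2 by R gives the constant.\<close>

lemma trace_inequality:
  fixes c :: "'a::euclidean_space"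
  assumes R: "R > 0" and w: "Ck (Suc 0) w"
  shows "(LINT x|surface_measure c R. (w x)\<^sup>2) \<le> ((real DIM('a) + 1) / R + R) * (H1_norm (ball c R) w)\<^sup>2"
proof -
  let ?D = "\<lambda>x. 2 * w x * (grad w x \<bullet> (x - c))"
  note cw = Ck_continuous[OF w] and cg = continuous_grad[OF w]
  have c: "continuous_on UNIV (\<lambda>x. (w x)\<^sup>2)" "continuous_on UNIV ?D" "continuous_on UNIV (\<lambda>x. (norm (grad w x))\<^sup>2)"
    by (intro continuous_intros cw cg)+
  obtain C1 where C1: "\<And>x. x \<in> cball c R \<Longrightarrow> \<bar>(w x)\<^sup>2\<bar> \<le> C1" using continuous_bounded_cball[OF c(1)] by blast
  obtain C2 where C2: "\<And>x. x \<in> cball c R \<Longrightarrow> \<bar>?D x\<bar> \<le> C2" using continuous_bounded_cball[OF c(2)] by blast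
  have "R * (LINT x|surface_measure c R. (w x)\<^sup>2)
      = real DIM('a) * (LINT x:ball c R|lborel. (w x)\<^sup>2) + (LINT x:ball c R|lborel. ?D x)"
  proof (rule radial_divergence[OF R, where C="max C1 C2"])
    fix x assume x: "x \<in> cball c R"
    show "\<bar>(w x)\<^sup>2\<bar> \<le> max C1 C2" "\<bar>?D x\<bar> \<le> max C1 C2" using C1[OF x] C2[OF x] by auto
    show "((\<lambda>s. (w (c + s *\<^sub>R (x - c)))\<^sup>2) has_real_derivative ?D x) (at 1)"
      using DERIV_power[OF radial_line_derivative[OF w, of c x], of 2] by (simp add: mult_ac)
  qed (use c in \<open>auto intro: borel_measurable_continuous_onI\<close>)
  also have "(LINT x:ball c R|lborel. ?D x) \<le> (LINT x:ball c R|lborel. (w x)\<^sup>2 + R\<^sup>2 * (norm (grad w x))\<^sup>2)"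
  proof (rule set_integral_mono)
    show "set_integrable lborel (ball c R) ?D" "set_integrable lborel (ball c R) (\<lambda>x. (w x)\<^sup>2 + R\<^sup>2 * (norm (grad w x))\<^sup>2)"
      by (intro continuous_set_integrable_ball continuous_on_subset[OF c(2)] subset_UNIV
          continuous_on_add continuous_on_mult continuous_on_const continuous_on_subset[OF c(1)] continuous_on_subset[OF c(3)])+
    fix x assume x: "x \<in> ball c R"
    have "\<bar>grad w x \<bullet> (x - c)\<bar> \<le> norm (grad w x) * norm (x - c)" by (rule Cauchy_Schwarz_ineq2)
    also have "\<dots> \<le> norm (grad w x) * R" using x by (intro mult_left_mono) (auto simp: dist_norm norm_minus_commute)
    finally have 1: "\<bar>grad w x \<bullet> (x - c)\<bar> \<le> R * norm (grad w x)" by (simp add: mult.commute)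
    have "?D x \<le> 2 * (\<bar>w x\<bar> * \<bar>grad w x \<bullet> (x - c)\<bar>)"
      using abs_ge_self[of "?D x"] by (simp add: abs_mult)
    also have "\<dots> \<le> 2 * (\<bar>w x\<bar> * (R * norm (grad w x)))" using 1 by (intro mult_left_mono) auto
    also have "\<dots> \<le> (w x)\<^sup>2 + R\<^sup>2 * (norm (grad w x))\<^sup>2"
      using zero_le_power2[of "\<bar>w x\<bar> - R * norm (grad w x)"] by (simp add: power2_eq_square algebra_simps)
    finally show "?D x \<le> (w x)\<^sup>2 + R\<^sup>2 * (norm (grad w x))\<^sup>2" .
  qed
  also have "\<dots> = (LINT x:ball c R|lborel. (w x)\<^sup>2) + R\<^sup>2 * (LINT x:ball c R|lborel. (norm (grad w x))\<^sup>2)"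
    by (subst set_integral_add)
      (auto intro!: continuous_set_integrable_ball continuous_on_subset[OF c(1)] continuous_on_mult
        continuous_on_const continuous_on_subset[OF c(3)])
  finally have le: "R * (LINT x|surface_measure c R. (w x)\<^sup>2)
     \<le> (real DIM('a) + 1) * (LINT x:ball c R|lborel. (w x)\<^sup>2) + R\<^sup>2 * (LINT x:ball c R|lborel. (norm (grad w x))\<^sup>2)"
    by (simp add: algebra_simps)
  define A B where "A = (LINT x:ball c R|lborel. (w x)\<^sup>2)" and "B = (LINT x:ball c R|lborel. (norm (grad w x))\<^sup>2)"
  have AB: "A \<ge> 0" "B \<ge> 0" by (auto simp: A_def B_def set_lebesgue_integral_def intro!: integral_nonneg_AE AE_I2)
  have "R * (LINT x|surface_measure c R. (w x)\<^sup>2) \<le> (real DIM('a) + 1) * A + R\<^sup>2 * B"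
    using le by (simp add: A_def B_def)
  also have "\<dots> \<le> ((real DIM('a) + 1) + R\<^sup>2) * (A + B)" using AB by (simp add: algebra_simps)
  also have "\<dots> = R * (((real DIM('a) + 1) / R + R) * (A + B))" using R by (simp add: field_simps power2_eq_square)
  finally show ?thesis
    unfolding C1_H1_norm_square[OF R w] A_def[symmetric] B_def[symmetric] using R by simp
qed

text \<open>Completeness of L2 for rapidly Cauchy sequences. The consecutive differences satisfy d
  \<le> 2^(-k) + 2^k d^2, so their integrals are summable and the sequence converges almost
  everywhere; Fatou's lemma carries the Cauchy bound over to the limit.\<close>

lemma L2_Cauchy_limit:
  fixes f :: "nat \<Rightarrow> 'a \<Rightarrow> real"
  assumes fin: "finite_measure M" and f: "\<And>k. L2 M (f k)" and "A \<ge> 0"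
    and cau: "\<And>j k. k \<le> j \<Longrightarrow> (LINT x|M. (f j x - f k x)\<^sup>2) \<le> A / 4 ^ k"
  obtains g where "L2 M g" "(\<lambda>k. LINT x|M. (f k x - g x)\<^sup>2) \<longlonglongrightarrow> 0"
proof -
  interpret finite_measure M by fact
  have [measurable]: "f k \<in> borel_measurable M" for k using f by (simp add: L2_def)
  have sq: "integrable M (\<lambda>x. (f j x - f k x)\<^sup>2)" for j k
    using L2_diff[OF f f] by (simp add: L2_real_iff)
  have nsq: "(\<integral>\<^sup>+x. ennreal ((f j x - f k x)\<^sup>2) \<partial>M) \<le> ennreal (A / 4 ^ k)" if "k \<le> j" for j k
    using cau[OF that] by (subst nn_integral_eq_integral[OF sq]) (auto intro: ennreal_leI)
  define d where "d k x = \<bar>f (Suc k) x - f k x\<bar>" for k x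
  have [measurable]: "d k \<in> borel_measurable M" for k unfolding d_def[abs_def] by measurable
  define m where "m = measure M (space M)"
  have dk: "(\<integral>\<^sup>+x. ennreal (d k x) \<partial>M) \<le> ennreal ((m + A) * (1/2) ^ k)" for k
  proof -
    have "(\<integral>\<^sup>+x. ennreal (d k x) \<partial>M) \<le> (\<integral>\<^sup>+x. ennreal ((1/2) ^ k + 2 ^ k * (f (Suc k) x - f k x)\<^sup>2) \<partial>M)"
    proof (intro nn_integral_mono ennreal_leI)
      fix x
      define t where "t = 2 ^ k * d k x"
      have "0 \<le> (t - 1/2)\<^sup>2" by simp
      then have "t \<le> 1 + t\<^sup>2" by (simp add: power2_eq_square algebra_simps)
      then have "(1/2)^k * t \<le> (1/2)^k * (1 + t\<^sup>2)" by (intro mult_left_mono) auto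
      moreover have "(1/2)^k * t = d k x" by (simp add: t_def mult.assoc[symmetric] power_mult_distrib[symmetric])
      moreover have "(1/2)^k * t\<^sup>2 = 2 ^ k * (f (Suc k) x - f k x)\<^sup>2"
        by (simp add: t_def d_def power2_eq_square mult.assoc[symmetric] power_mult_distrib[symmetric])
      ultimately show "d k x \<le> (1/2) ^ k + 2 ^ k * (f (Suc k) x - f k x)\<^sup>2" by (simp add: distrib_left)
    qed
    also have "\<dots> = ennreal (LINT x|M. (1/2) ^ k + 2 ^ k * (f (Suc k) x - f k x)\<^sup>2)"
      by (intro nn_integral_eq_integral Bochner_Integration.integrable_add integrable_mult_right sq) auto
    also have "(LINT x|M. (1/2) ^ k + 2 ^ k * (f (Suc k) x - f k x)\<^sup>2) = m * (1/2) ^ k + 2 ^ k * (LINT x|M. (f (Suc k) x - f k x)\<^sup>2)"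
      using sq by (subst Bochner_Integration.integral_add) (auto simp: m_def)
    also have "ennreal \<dots> \<le> ennreal (m * (1/2) ^ k + 2 ^ k * (A / 4 ^ k))"
      using cau[of k "Suc k"] by (intro ennreal_leI add_left_mono mult_left_mono) auto
    also have "2 ^ k * (A / 4 ^ k) = A * (1/2) ^ k"
    proof -
      have "(4::real) ^ k = 2 ^ k * 2 ^ k" by (simp add: power_mult_distrib[symmetric])
      then show ?thesis by (simp add: power_one_over)
    qed
    also have "m * (1/2) ^ k + A * (1/2) ^ k = (m + A) * (1/2) ^ k" by (simp add: algebra_simps)
    finally show ?thesis .
  qed
  have "(\<integral>\<^sup>+x. (\<Sum>k. ennreal (d k x)) \<partial>M) = (\<Sum>k. \<integral>\<^sup>+x. ennreal (d k x) \<partial>M)"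
    by (intro nn_integral_suminf) auto
  also have "\<dots> \<le> (\<Sum>k. ennreal ((m + A) * (1/2) ^ k))" by (intro suminf_le dk) auto
  also have "\<dots> < top"
  proof -
    have "summable (\<lambda>k. (m + A) * (1/2) ^ k)" by (intro summable_mult summable_geometric) auto
    then have "(\<Sum>k. ennreal ((m + A) * (1/2) ^ k)) \<noteq> top"
      using \<open>A \<ge> 0\<close> by (intro ennreal_suminf_neq_top) (auto simp: m_def)
    then show ?thesis by (simp add: top.not_eq_extremum)
  qed
  finally have "AE x in M. (\<Sum>k. ennreal (d k x)) \<noteq> \<infinity>"
    by (intro nn_integral_PInf_AE) auto
  then have conv: "AE x in M. convergent (\<lambda>k. f k x)"
  proof eventually_elim
    case (elim x)
    have "summable (\<lambda>k. d k x)"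
      using elim by (intro summable_suminf_not_top) (auto simp: d_def)
    then have "summable (\<lambda>k. f (Suc k) x - f k x)" unfolding d_def by (rule summable_rabs_cancel)
    then have "convergent (\<lambda>n. \<Sum>k<n. f (Suc k) x - f k x)" by (simp add: summable_iff_convergent)
    then have "convergent (\<lambda>n. f n x - f 0 x)" 
      using sum_lessThan_telescope[of "\<lambda>k. f k x"] by simp
    then show ?case by (simp add: convergent_diff_const_right_iff)
  qed
  define g where "g x = lim (\<lambda>k. f k x)" for x
  have [measurable]: "g \<in> borel_measurable M" unfolding g_def[abs_def] by measurable
  have bound: "(\<integral>\<^sup>+x. ennreal ((f k x - g x)\<^sup>2) \<partial>M) \<le> ennreal (A / 4 ^ k)" for k
  proof -
    have "(\<integral>\<^sup>+x. ennreal ((f k x - g x)\<^sup>2) \<partial>M) = (\<integral>\<^sup>+x. liminf (\<lambda>j. ennreal ((f j x - f k x)\<^sup>2)) \<partial>M)"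
    proof (rule nn_integral_cong_AE)
      show "AE x in M. ennreal ((f k x - g x)\<^sup>2) = liminf (\<lambda>j. ennreal ((f j x - f k x)\<^sup>2))"
        using conv
      proof eventually_elim
        case (elim x)
        then have "(\<lambda>j. f j x) \<longlonglongrightarrow> g x" by (simp add: g_def convergent_LIMSEQ_iff)
        then have "(\<lambda>j. ennreal ((f j x - f k x)\<^sup>2)) \<longlonglongrightarrow> ennreal ((g x - f k x)\<^sup>2)"
          by (intro tendsto_ennrealI tendsto_intros)
        from lim_imp_Liminf[OF _ this] show ?case by (simp only: power2_commute[of "f k x"] trivial_limit_sequentially not_False_eq_True)
      qed
    qed
    also have "\<dots> \<le> liminf (\<lambda>j. \<integral>\<^sup>+x. ennreal ((f j x - f k x)\<^sup>2) \<partial>M)" by (intro nn_integral_liminf) auto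
    also have "\<dots> \<le> ennreal (A / 4 ^ k)"
      using nsq by (intro Liminf_le) (auto simp: eventually_sequentially intro!: exI[of _ k])
    finally show ?thesis .
  qed
  have int: "integrable M (\<lambda>x. (f k x - g x)\<^sup>2)" for k
    using bound[of k] by (intro integrableI_bounded) (auto simp: order_le_less_trans[OF _ ennreal_less_top])
  have "L2 M (\<lambda>x. f 0 x - g x)" using int[of 0] by (simp add: L2_real_iff)
  from L2_diff[OF f[of 0] this] have "L2 M g" by simp
  moreover have "(\<lambda>k. LINT x|M. (f k x - g x)\<^sup>2) \<longlonglongrightarrow> 0"
  proof (rule tendsto_sandwich)
    show "\<forall>\<^sub>F k in sequentially. 0 \<le> (LINT x|M. (f k x - g x)\<^sup>2)" by simp
    have "(LINT x|M. (f k x - g x)\<^sup>2) \<le> A / 4 ^ k" for k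
      using bound[of k] \<open>A \<ge> 0\<close> by (subst (asm) nn_integral_eq_integral[OF int]) (auto simp: ennreal_le_iff)
    then show "\<forall>\<^sub>F k in sequentially. (LINT x|M. (f k x - g x)\<^sup>2) \<le> A / 4 ^ k" by simp
    show "(\<lambda>k. A / 4 ^ k) \<longlonglongrightarrow> 0" by real_asymp
  qed simp
  ultimately show thesis by (rule that)
qed

lemma H1_norm_nonneg: "0 \<le> H1_norm S u" by (simp add: H1_norm_def)

lemma H1_dist_C1_square:
  fixes c :: "'a::euclidean_space"
  assumes R: "R > 0" and p: "Ck (Suc 0) p" and v: "v \<in> H1 (ball c R)"
  shows "(H1_norm (ball c R) (\<lambda>x. p x - v x))\<^sup>2 = (LINT x|lebesgue_on (ball c R). (p x - v x)\<^sup>2)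
      + (LINT x|lebesgue_on (ball c R). (norm (grad p x - weak_gradient (ball c R) v x))\<^sup>2)"
proof (rule H1_norm_square)
  note gp = C1_in_H1[OF p, where c=c and R=R]
  show "(\<lambda>x. p x - v x) \<in> H1 (ball c R)" by (rule H1_diff(1)[OF R gp(1) v])
  show "L2 (lebesgue_on (ball c R)) (\<lambda>x. grad p x - weak_gradient (ball c R) v x)"
    by (intro L2_diff gp H1_weak_gradient v)
  show "AE x in lebesgue_on (ball c R). weak_gradient (ball c R) (\<lambda>x. p x - v x) x = grad p x - weak_gradient (ball c R) v x"
    using H1_diff(2)[OF R gp(1) v] weak_gradient_C1[OF R p, of c] by eventually_elim simp
qed

lemma H1_norm_C1_diff_le:
  fixes c :: "'a::euclidean_space"
  assumes R: "R > 0" and p: "Ck (Suc 0) p" and q: "Ck (Suc 0) q" and v: "v \<in> H1 (ball c R)"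
  shows "(H1_norm (ball c R) (\<lambda>x. p x - q x))\<^sup>2
    \<le> 2 * (H1_norm (ball c R) (\<lambda>x. p x - v x))\<^sup>2 + 2 * (H1_norm (ball c R) (\<lambda>x. q x - v x))\<^sup>2"
proof -
  let ?M = "lebesgue_on (ball c R)" and ?G = "weak_gradient (ball c R) v"
  note gp = C1_in_H1[OF p, where c=c and R=R] and gq = C1_in_H1[OF q, where c=c and R=R] and gv = H1_weak_gradient[OF v]
  have par: "(LINT x|?M. (norm (f x - g x))\<^sup>2) \<le> 2 * (LINT x|?M. (norm (f x - h x))\<^sup>2) + 2 * (LINT x|?M. (norm (g x - h x))\<^sup>2)"
    if "L2 ?M f" "L2 ?M g" "L2 ?M h" for f g h :: "'a \<Rightarrow> 'b::euclidean_space"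
  proof -
    have i: "integrable ?M (\<lambda>x. (norm (f x - g x))\<^sup>2)" "integrable ?M (\<lambda>x. (norm (f x - h x))\<^sup>2)"
      "integrable ?M (\<lambda>x. (norm (g x - h x))\<^sup>2)"
      using L2_diff[OF that(1,2)] L2_diff[OF that(1,3)] L2_diff[OF that(2,3)] by (auto simp: L2_def)
    have "(LINT x|?M. (norm (f x - g x))\<^sup>2) \<le> (LINT x|?M. 2 * (norm (f x - h x))\<^sup>2 + 2 * (norm (g x - h x))\<^sup>2)"
    proof (intro integral_mono i Bochner_Integration.integrable_add integrable_mult_right)
      fix x
      define a b where "a = f x - h x" and "b = g x - h x"
      have "f x - g x = a - b" by (simp add: a_def b_def)
      moreover have "(norm (a - b))\<^sup>2 \<le> 2 * (norm a)\<^sup>2 + 2 * (norm b)\<^sup>2"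
        using zero_le_power2[of "norm (a + b)"] unfolding power2_norm_eq_inner
        by (simp add: inner_simps inner_commute)
      ultimately show "(norm (f x - g x))\<^sup>2 \<le> 2 * (norm (f x - h x))\<^sup>2 + 2 * (norm (g x - h x))\<^sup>2"
        by (simp add: a_def b_def)
    qed
    then show ?thesis using i by simp
  qed
  have eq: "(H1_norm (ball c R) (\<lambda>x. p x - q x))\<^sup>2 = (LINT x|?M. (p x - q x)\<^sup>2) + (LINT x|?M. (norm (grad p x - grad q x))\<^sup>2)"
  proof (rule H1_norm_square)
    show "L2 ?M (\<lambda>x. grad p x - grad q x)" by (intro L2_diff gp gq)
    show "(\<lambda>x. p x - q x) \<in> H1 (ball c R)" by (intro H1_diff R gp gq)
    show "AE x in ?M. weak_gradient (ball c R) (\<lambda>x. p x - q x) x = grad p x - grad q x"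
      using weak_gradient_C1[OF R Ck_diff[OF p q], of c] by (simp add: grad_diff[OF p q])
  qed
  show ?thesis
    unfolding eq H1_dist_C1_square[OF R p v] H1_dist_C1_square[OF R q v]
    using par[OF gp(3) gq(3) gv(1)] par[OF gp(2) gq(2) gv(2)] by simp
qed

text \<open>Approximants with H1 error below 2^(-k) are Cauchy in L2 of the sphere by the trace
  inequality, at the rate that \<open>L2_Cauchy_limit\<close> asks for. The conclusion makes the
  choice in \<open>trace_on_sphere\<close> meaningful.\<close>

theorem trace_exists:
  fixes c :: "'a::euclidean_space"
  assumes R: "R > 0" and v: "v \<in> H1 (ball c R)"
  shows "has_trace c R v (trace_on_sphere c R v)"
proof -
  obtain \<psi> where psi: "\<And>k::nat. smooth (\<psi> k)" "(\<lambda>k. H1_norm (ball c R) (\<lambda>x. \<psi> k x - v x)) \<longlonglongrightarrow> 0"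
    using smooth_dense_H1[OF R v] by blast
  have "\<exists>j. H1_norm (ball c R) (\<lambda>x. \<psi> j x - v x) < (1/2) ^ k" for k :: nat
  proof -
    have "\<forall>\<^sub>F j in sequentially. H1_norm (ball c R) (\<lambda>x. \<psi> j x - v x) < (1/2) ^ k"
      using psi(2) by (rule order_tendstoD) simp
    then show ?thesis by (auto simp: eventually_sequentially)
  qed
  then obtain J where J: "\<And>k. H1_norm (ball c R) (\<lambda>x. \<psi> (J k) x - v x) < (1/2) ^ k" by metis
  define \<phi> where "\<phi> k = \<psi> (J k)" for k
  have sm: "smooth (\<phi> k)" for k by (simp add: \<phi>_def psi)
  have C1: "Ck (Suc 0) (\<phi> k)" for k by (rule smooth_Ck[OF sm])
  have small: "(H1_norm (ball c R) (\<lambda>x. \<phi> k x - v x))\<^sup>2 \<le> 1 / 4 ^ k" for k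
  proof -
    have "(H1_norm (ball c R) (\<lambda>x. \<phi> k x - v x))\<^sup>2 \<le> ((1/2) ^ k)\<^sup>2"
      using J[of k] by (intro power_mono) (auto simp: \<phi>_def H1_norm_nonneg)
    also have "((1/2) ^ k)\<^sup>2 = 1 / (4::real) ^ k" by (simp add: power2_eq_square power_one_over power_mult_distrib[symmetric])
    finally show ?thesis .
  qed
  define K where "K = (real DIM('a) + 1) / R + R"
  have K: "K > 0" using R by (simp add: K_def add_pos_pos)
  \<comment> \<open>Two approximants with indices at least k differ by at most 2 / 4^k + 2 / 4^k in
    squared H1 norm, hence the factor 4.\<close>
  obtain g where g: "L2 (surface_measure c R) g" "(\<lambda>k. LINT x|surface_measure c R. (\<phi> k x - g x)\<^sup>2) \<longlonglongrightarrow> 0"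
  proof (rule L2_Cauchy_limit[where M="surface_measure c R" and f=\<phi> and A="K * 4"])
    show "finite_measure (surface_measure c R)" by (rule finite_measure_surface[OF R])
    show "L2 (surface_measure c R) (\<phi> k)" for k by (intro L2_surface_continuous R smooth_continuous sm)
    show "0 \<le> K * 4" using K by simp
    fix j k :: nat assume "k \<le> j"
    then have "1 / 4 ^ j \<le> 1 / (4::real) ^ k" by (simp add: frac_le)
    then have "(H1_norm (ball c R) (\<lambda>x. \<phi> j x - \<phi> k x))\<^sup>2 \<le> 4 / 4 ^ k"
      using H1_norm_C1_diff_le[OF R C1[of j] C1[of k] v] small[of j] small[of k] by simp
    then have "K * (H1_norm (ball c R) (\<lambda>x. \<phi> j x - \<phi> k x))\<^sup>2 \<le> K * (4 / 4 ^ k)"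
      using K by (intro mult_left_mono) auto
    then show "(LINT x|surface_measure c R. (\<phi> j x - \<phi> k x)\<^sup>2) \<le> K * 4 / 4 ^ k"
      using trace_inequality[OF R Ck_diff[OF C1 C1], of c j k] by (simp add: K_def)
  qed
  have "(\<lambda>k. H1_norm (ball c R) (\<lambda>x. \<phi> k x - v x)) \<longlonglongrightarrow> 0"
  proof (rule tendsto_sandwich)
    show "\<forall>\<^sub>F k in sequentially. 0 \<le> H1_norm (ball c R) (\<lambda>x. \<phi> k x - v x)" by (simp add: H1_norm_nonneg)
    show "\<forall>\<^sub>F k in sequentially. H1_norm (ball c R) (\<lambda>x. \<phi> k x - v x) \<le> (1/2) ^ k"
      using J less_imp_le by (intro always_eventually allI) (auto simp: \<phi>_def intro: less_imp_le)
  qed (auto intro: LIMSEQ_power_zero)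
  then have "has_trace c R v g" unfolding has_trace_def using g sm by blast
  then show ?thesis unfolding trace_on_sphere_def by (rule someI[where P="has_trace c R v"])
qed

text \<open>The approximants converge on the sphere to g by definition of the trace, and to w by the
  trace inequality applied to their differences from w. With this, boundary integrals can be
  evaluated for C^1 functions.\<close>

lemma trace_C1:
  fixes c :: "'a::euclidean_space"
  assumes R: "R > 0" and w: "Ck (Suc 0) w" and tr: "has_trace c R w g"
  shows "AE x in surface_measure c R. g x = w x"
proof -
  let ?S = "surface_measure c R"
  obtain \<phi> where g: "L2 ?S g" and sm: "\<And>k::nat. smooth (\<phi> k)"
    and lim1: "(\<lambda>k. H1_norm (ball c R) (\<lambda>x. \<phi> k x - w x)) \<longlonglongrightarrow> 0"
    and lim2: "(\<lambda>k. LINT x|?S. (\<phi> k x - g x)\<^sup>2) \<longlonglongrightarrow> 0"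
    using tr unfolding has_trace_def by blast
  define K where "K = (real DIM('a) + 1) / R + R"
  have L: "L2 ?S (\<phi> k)" "L2 ?S w" for k
    by (intro L2_surface_continuous R smooth_continuous sm Ck_continuous[OF w])+
  have i: "integrable ?S (\<lambda>x. (g x - w x)\<^sup>2)" "integrable ?S (\<lambda>x. (\<phi> k x - g x)\<^sup>2)" "integrable ?S (\<lambda>x. (\<phi> k x - w x)\<^sup>2)" for k
    using L2_diff[OF g L(2)] L2_diff[OF L(1) g] L2_diff[OF L] by (auto simp: L2_real_iff)
  have bound: "(LINT x|?S. (g x - w x)\<^sup>2) \<le> 2 * (LINT x|?S. (\<phi> k x - g x)\<^sup>2) + 2 * (K * (H1_norm (ball c R) (\<lambda>x. \<phi> k x - w x))\<^sup>2)" for k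
  proof -
    have "(LINT x|?S. (g x - w x)\<^sup>2) \<le> (LINT x|?S. 2 * (\<phi> k x - g x)\<^sup>2 + 2 * (\<phi> k x - w x)\<^sup>2)"
    proof (intro integral_mono i Bochner_Integration.integrable_add integrable_mult_right)
      fix x
      define a b where "a = \<phi> k x - g x" and "b = \<phi> k x - w x"
      have "g x - w x = b - a" by (simp add: a_def b_def)
      moreover have "(b - a)\<^sup>2 \<le> 2 * a\<^sup>2 + 2 * b\<^sup>2"
        using zero_le_power2[of "a + b"] by (simp add: power2_eq_square algebra_simps)
      ultimately show "(g x - w x)\<^sup>2 \<le> 2 * (\<phi> k x - g x)\<^sup>2 + 2 * (\<phi> k x - w x)\<^sup>2"
        by (simp add: a_def b_def)
    qed
    also have "\<dots> = 2 * (LINT x|?S. (\<phi> k x - g x)\<^sup>2) + 2 * (LINT x|?S. (\<phi> k x - w x)\<^sup>2)" using i by simp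
    finally show ?thesis
      using trace_inequality[OF R Ck_diff[OF smooth_Ck[OF sm] w], of c k] by (simp add: K_def)
  qed
  have "(\<lambda>k. 2 * (LINT x|?S. (\<phi> k x - g x)\<^sup>2) + 2 * (K * (H1_norm (ball c R) (\<lambda>x. \<phi> k x - w x))\<^sup>2)) \<longlonglongrightarrow> 2 * 0 + 2 * (K * 0\<^sup>2)"
    by (intro tendsto_intros lim1 lim2)
  then have "(LINT x|?S. (g x - w x)\<^sup>2) \<le> 0" using bound by (intro LIMSEQ_le_const) auto
  then have "(LINT x|?S. (g x - w x)\<^sup>2) = 0" by (intro antisym) auto
  then have "AE x in ?S. (g x - w x)\<^sup>2 = 0" using integral_nonneg_eq_0_iff_AE[OF i(1)] by simp
  then show ?thesis by eventually_elim simp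
qed

subsection \<open>Radial functions and radial weak solutions\<close>

text \<open>The divergence theorem for the field a(|x - c|) p(x) (x - c), obtained from
  \<open>radial_divergence\<close> for a(|x - c|) p(x). The hypothesis \<open>der\<close> says b(r)
  = r a'(r), so N a + b = r^(1-N) (r^N a)'.\<close>

lemma green_radial_C1:
  fixes c :: "'a::euclidean_space" and a b :: "real \<Rightarrow> real"
  assumes R: "R > 0" and p: "Ck (Suc 0) p"
    and [measurable]: "a \<in> borel_measurable borel" "b \<in> borel_measurable borel"
    and bd: "\<And>r. 0 \<le> r \<Longrightarrow> r \<le> R \<Longrightarrow> \<bar>a r\<bar> \<le> A" "\<And>r. 0 \<le> r \<Longrightarrow> r \<le> R \<Longrightarrow> \<bar>b r\<bar> \<le> A"
    and der: "\<And>r. 0 < r \<Longrightarrow> r \<le> R \<Longrightarrow> (a has_real_derivative b r / r) (at r)"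
  shows "R * a R * (LINT x|surface_measure c R. p x)
    = (LINT x|lebesgue_on (ball c R). (real DIM('a) * a (norm (x - c)) + b (norm (x - c))) * p x)
    + (LINT x|lebesgue_on (ball c R). a (norm (x - c)) * (grad p x \<bullet> (x - c)))"
proof -
  let ?f = "\<lambda>x. a (norm (x - c)) * p x"
  let ?D = "\<lambda>x. b (norm (x - c)) * p x + a (norm (x - c)) * (grad p x \<bullet> (x - c))"
  have A: "A \<ge> 0" using bd(1)[of 0] R by simp
  note cp = Ck_continuous[OF p] and cg = continuous_grad[OF p]
  have cd: "continuous_on UNIV (\<lambda>x. grad p x \<bullet> (x - c))" by (intro continuous_intros cg)
  note [measurable] = borel_measurable_continuous_onI[OF cp] borel_measurable_continuous_onI[OF cd]
  obtain C1 where C1: "C1 \<ge> 0" "\<And>x. x \<in> cball c R \<Longrightarrow> \<bar>p x\<bar> \<le> C1" using continuous_bounded_cball[OF cp] by blast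
  obtain C2 where C2: "C2 \<ge> 0" "\<And>x. x \<in> cball c R \<Longrightarrow> \<bar>grad p x \<bullet> (x - c)\<bar> \<le> C2" using continuous_bounded_cball[OF cd] by blast
  have bounds: "\<bar>a (norm (x - c)) * p x\<bar> \<le> A * C1" "\<bar>b (norm (x - c)) * p x\<bar> \<le> A * C1"
    "\<bar>a (norm (x - c)) * (grad p x \<bullet> (x - c))\<bar> \<le> A * C2" if "x \<in> cball c R" for x
    unfolding abs_mult using bd[of "norm (x - c)"] C1(2)[OF that] C2(2)[OF that] that A
    by (auto intro!: mult_mono simp: dist_norm norm_minus_commute)
  have rd: "R * (LINT x|surface_measure c R. ?f x) = real DIM('a) * (LINT x:ball c R|lborel. ?f x) + (LINT x:ball c R|lborel. ?D x)"
  proof (rule radial_divergence[OF R, where C="A * C1 + A * C2"])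
    fix x assume x: "x \<in> cball c R"
    have nn: "A * C1 \<ge> 0" "A * C2 \<ge> 0" using A C1 C2 by auto
    show "\<bar>?f x\<bar> \<le> A * C1 + A * C2" using bounds(1)[OF x] nn by linarith
    show "\<bar>?D x\<bar> \<le> A * C1 + A * C2" using bounds(2,3)[OF x] by linarith
    assume xc: "x \<noteq> c"
    define r where "r = norm (x - c)"
    have r: "r > 0" "r \<le> R" using x xc by (auto simp: r_def dist_norm norm_minus_commute)
    have "((\<lambda>s. a (s * r)) has_real_derivative b r / r * r) (at 1)"
      by (rule DERIV_chain2[where f=a and g="\<lambda>s. s * r"]) (use der[OF r] in \<open>auto intro!: derivative_eq_intros\<close>)
    then have "((\<lambda>s. a (s * r)) has_real_derivative b r) (at 1)" using r by simp
    then have 1: "((\<lambda>s. a (norm (c + s *\<^sub>R (x - c) - c))) has_real_derivative b r) (at 1)"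
      by (rule has_field_derivative_transform_within_open[where S="{0<..}"]) (auto simp: r_def)
    show "((\<lambda>s. ?f (c + s *\<^sub>R (x - c))) has_real_derivative ?D x) (at 1)"
      using DERIV_mult[OF 1 radial_line_derivative[OF p, of c x]] by (simp add: r_def algebra_simps)
  qed measurable
  have surf: "(LINT x|surface_measure c R. ?f x) = a R * (LINT x|surface_measure c R. p x)"
  proof -
    have "(LINT x|surface_measure c R. ?f x) = (LINT x|surface_measure c R. a R * p x)"
    proof (rule integral_cong_AE)
      show "AE x in surface_measure c R. ?f x = a R * p x"
        using AE_surface_measure_sphere[OF R] by eventually_elim simp
    qed (simp_all add: borel_measurable_surface_measure)
    then show ?thesis by simp
  qed
  have si: "set_integrable lborel (ball c R) ?f" "set_integrable lborel (ball c R) (\<lambda>x. b (norm (x - c)) * p x)"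
    "set_integrable lborel (ball c R) (\<lambda>x. a (norm (x - c)) * (grad p x \<bullet> (x - c)))"
    by (rule bounded_set_integrable_ball, measurable, rule bounds, use ball_subset_cball in blast)+
  have "(LINT x|lebesgue_on (ball c R). (real DIM('a) * a (norm (x - c)) + b (norm (x - c))) * p x)
      = (LINT x:ball c R|lborel. real DIM('a) * ?f x + b (norm (x - c)) * p x)"
    by (subst integral_lebesgue_on_ball_borel(1)) (auto simp: algebra_simps)
  also have "\<dots> = real DIM('a) * (LINT x:ball c R|lborel. ?f x) + (LINT x:ball c R|lborel. b (norm (x - c)) * p x)"
    using si by (subst set_integral_add) auto
  finally have 1: "(LINT x|lebesgue_on (ball c R). (real DIM('a) * a (norm (x - c)) + b (norm (x - c))) * p x) =
    real DIM('a) * (LINT x:ball c R|lborel. ?f x) + (LINT x:ball c R|lborel. b (norm (x - c)) * p x)" .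
  have 2: "(LINT x|lebesgue_on (ball c R). a (norm (x - c)) * (grad p x \<bullet> (x - c)))
      = (LINT x:ball c R|lborel. a (norm (x - c)) * (grad p x \<bullet> (x - c)))"
    by (subst integral_lebesgue_on_ball_borel(1)) auto
  have 3: "(LINT x:ball c R|lborel. ?D x) = (LINT x:ball c R|lborel. b (norm (x - c)) * p x)
     + (LINT x:ball c R|lborel. a (norm (x - c)) * (grad p x \<bullet> (x - c)))"
    by (rule set_integral_add(2)[OF si(2,3)])
  show ?thesis using rd unfolding 1 2 3 surf by simp
qed

lemma H1_approx_components:
  fixes c :: "'a::euclidean_space"
  assumes R: "R > 0" and v: "v \<in> H1 (ball c R)" and sm: "\<And>k::nat. smooth (\<phi> k)"
    and lim: "(\<lambda>k. H1_norm (ball c R) (\<lambda>x. \<phi> k x - v x)) \<longlonglongrightarrow> 0"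
  shows "(\<lambda>k. LINT x|lebesgue_on (ball c R). (norm (\<phi> k x - v x))\<^sup>2) \<longlonglongrightarrow> 0"
    and "(\<lambda>k. LINT x|lebesgue_on (ball c R). (norm (grad (\<phi> k) x - weak_gradient (ball c R) v x))\<^sup>2) \<longlonglongrightarrow> 0"
proof -
  let ?a = "\<lambda>k. \<integral>x. (norm (\<phi> k x - v x))\<^sup>2 \<partial>lebesgue_on (ball c R)"
  let ?b = "\<lambda>k. \<integral>x. (norm (grad (\<phi> k) x - weak_gradient (ball c R) v x))\<^sup>2 \<partial>lebesgue_on (ball c R)"
  have "(\<lambda>k. (H1_norm (ball c R) (\<lambda>x. \<phi> k x - v x))\<^sup>2) \<longlonglongrightarrow> 0\<^sup>2" by (intro tendsto_intros lim)
  moreover have "(H1_norm (ball c R) (\<lambda>x. \<phi> k x - v x))\<^sup>2 = ?a k + ?b k" for k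
    using H1_dist_C1_square[OF R smooth_Ck[OF sm] v] by simp
  ultimately have s: "(\<lambda>k. ?a k + ?b k) \<longlonglongrightarrow> 0" by simp
  have nn: "?a k \<ge> 0" "?b k \<ge> 0" for k by auto
  show "?a \<longlonglongrightarrow> 0"
    by (rule tendsto_sandwich[OF _ _ tendsto_const s]) (use nn in auto)
  show "?b \<longlonglongrightarrow> 0"
    by (rule tendsto_sandwich[OF _ _ tendsto_const s]) (use nn in auto)
qed

lemma L2_bounded_borel_ball:
  fixes h :: "'a::euclidean_space \<Rightarrow> 'b::euclidean_space"
  assumes h: "h \<in> borel_measurable borel" and bd: "\<And>x. x \<in> ball c R \<Longrightarrow> norm (h x) \<le> C"
  shows "L2 (lebesgue_on (ball c R)) h"
  unfolding L2_def
proof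
  show "h \<in> borel_measurable (lebesgue_on (ball c R))" by (intro borel_measurable_lebesgue_on_borel h)
  have m: "(\<lambda>x. (norm (h x))\<^sup>2) \<in> borel_measurable borel" using h by measurable
  show "integrable (lebesgue_on (ball c R)) (\<lambda>x. (norm (h x))\<^sup>2)"
    unfolding integral_lebesgue_on_ball_borel(2)[OF m]
    by (rule bounded_set_integrable_ball[OF m, where C="C\<^sup>2"]) (use bd in \<open>auto intro!: power_mono\<close>)
qed

text \<open>All three integrals are continuous with respect to the convergence in
  \<open>has_trace\<close>, so the identity passes from smooth functions to H1. It is used with a(r)
  = r^(2j) to compute moments of a given solution, and with a(r) = \<phi>'(r) / r to verify the weak
  equation for the constructed one.\<close>

lemma green_radial:
  fixes c :: "'a::euclidean_space" and a b :: "real \<Rightarrow> real"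
  assumes R: "R > 0" and v: "v \<in> H1 (ball c R)" and tr: "has_trace c R v g"
    and [measurable]: "a \<in> borel_measurable borel" "b \<in> borel_measurable borel"
    and bd: "\<And>r. 0 \<le> r \<Longrightarrow> r \<le> R \<Longrightarrow> \<bar>a r\<bar> \<le> A" "\<And>r. 0 \<le> r \<Longrightarrow> r \<le> R \<Longrightarrow> \<bar>b r\<bar> \<le> A"
    and der: "\<And>r. 0 < r \<Longrightarrow> r \<le> R \<Longrightarrow> (a has_real_derivative b r / r) (at r)"
  shows "R * a R * (LINT x|surface_measure c R. g x)
    = (LINT x|lebesgue_on (ball c R). (real DIM('a) * a (norm (x - c)) + b (norm (x - c))) * v x)
    + (LINT x|lebesgue_on (ball c R). a (norm (x - c)) * (weak_gradient (ball c R) v x \<bullet> (x - c)))"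
proof -
  let ?M = "lebesgue_on (ball c R)" and ?S = "surface_measure c R" and ?G = "weak_gradient (ball c R) v"
  obtain \<phi> where g: "L2 ?S g" and sm: "\<And>k::nat. smooth (\<phi> k)"
    and lim1: "(\<lambda>k. H1_norm (ball c R) (\<lambda>x. \<phi> k x - v x)) \<longlonglongrightarrow> 0"
    and lim2: "(\<lambda>k. LINT x|?S. (\<phi> k x - g x)\<^sup>2) \<longlonglongrightarrow> 0"
    using tr unfolding has_trace_def by blast
  note gv = H1_weak_gradient[OF v] and C1 = smooth_Ck[OF sm, of "Suc 0"]
  note gp = C1_in_H1[OF C1, where c=c and R=R]
  note lims = H1_approx_components[OF R v sm lim1]
  define h1 where "h1 x = real DIM('a) * a (norm (x - c)) + b (norm (x - c))" for x
  define h2 where "h2 x = a (norm (x - c)) *\<^sub>R (x - c)" for x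
  have A: "A \<ge> 0" using bd(1)[of 0] R by simp
  have h1: "L2 ?M h1"
  proof (rule L2_bounded_borel_ball[where C="real DIM('a) * A + A"])
    fix x assume "x \<in> ball c R"
    then have x: "norm (x - c) \<le> R" by (simp add: dist_norm norm_minus_commute)
    have "\<bar>real DIM('a) * a (norm (x - c))\<bar> \<le> real DIM('a) * A"
      unfolding abs_mult using bd(1)[of "norm (x - c)"] x by (intro mult_mono) auto
    then show "norm (h1 x) \<le> real DIM('a) * A + A"
      using bd(2)[of "norm (x - c)"] x by (simp add: h1_def)
  qed (simp add: h1_def[abs_def])
  have h2: "L2 ?M h2"
  proof (rule L2_bounded_borel_ball[where C="A * R"])
    fix x assume "x \<in> ball c R"
    then have x: "norm (x - c) \<le> R" by (simp add: dist_norm norm_minus_commute)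
    show "norm (h2 x) \<le> A * R"
      unfolding h2_def norm_scaleR using bd(1)[of "norm (x - c)"] x A by (intro mult_mono) auto
  qed (simp add: h2_def[abs_def])
  have 1: "(\<lambda>k. LINT x|?M. h1 x \<bullet> \<phi> k x) \<longlonglongrightarrow> (LINT x|?M. h1 x \<bullet> v x)"
    by (intro L2_tendsto_integral_inner h1 gp gv lims)
  have 2: "(\<lambda>k. LINT x|?M. h2 x \<bullet> grad (\<phi> k) x) \<longlonglongrightarrow> (LINT x|?M. h2 x \<bullet> ?G x)"
    by (intro L2_tendsto_integral_inner h2 gp gv lims)
  have 3: "(\<lambda>k. LINT x|?S. (1::real) \<bullet> \<phi> k x) \<longlonglongrightarrow> (LINT x|?S. (1::real) \<bullet> g x)"
    using lim2 by (intro L2_tendsto_integral_inner L2_surface_continuous R g continuous_intros smooth_continuous sm) simp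
  have "R * a R * (LINT x|?S. (1::real) \<bullet> \<phi> k x) = (LINT x|?M. h1 x \<bullet> \<phi> k x) + (LINT x|?M. h2 x \<bullet> grad (\<phi> k) x)" for k
    using green_radial_C1[OF R C1[of k] assms(4,5) bd der, of c]
    by (simp add: h1_def h2_def inner_commute)
  then have "(\<lambda>k. R * a R * (LINT x|?S. (1::real) \<bullet> \<phi> k x)) \<longlonglongrightarrow> (LINT x|?M. h1 x \<bullet> v x) + (LINT x|?M. h2 x \<bullet> ?G x)"
    using tendsto_add[OF 1 2] by simp
  moreover have "(\<lambda>k. R * a R * (LINT x|?S. (1::real) \<bullet> \<phi> k x)) \<longlonglongrightarrow> R * a R * (LINT x|?S. (1::real) \<bullet> g x)"
    by (intro tendsto_intros 3)
  ultimately have "R * a R * (LINT x|?S. (1::real) \<bullet> g x) = (LINT x|?M. h1 x \<bullet> v x) + (LINT x|?M. h2 x \<bullet> ?G x)"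
    by (rule LIMSEQ_unique[rotated])
  then show ?thesis by (simp add: h1_def h2_def inner_commute)
qed

section \<open>Polar coordinates, moments and radial profiles\<close>

definition sphere_area :: "nat \<Rightarrow> real" where
  "sphere_area n = real n * unit_ball_vol (real n)"

lemma sphere_area_pos: "n > 0 \<Longrightarrow> sphere_area n > 0"
  by (simp add: sphere_area_def)

text \<open>It is enough to compare the measures on half-lines {t<..}, where they are finite. For 0
  \<le> t < R the left side is the volume V (R^N - t^N) of a shell, and the density integrates to
  the same value by the fundamental theorem of calculus.\<close>

lemma distr_norm_ball:
  fixes c :: "'a::euclidean_space"
  assumes R: "R > 0"
  shows "distr (restrict_space lborel (ball c R)) borel (\<lambda>x. norm (x - c)) =
    density lborel (\<lambda>r. ennreal (indicator {0<..<R} r * (sphere_area DIM('a) * r ^ (DIM('a) - 1))))"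
    (is "?L = ?D")
proof (rule measure_eqI_lessThan)
  let ?N = "DIM('a)" and ?V = "unit_ball_vol (real DIM('a))"
  have N: "?N > 0" by simp
  show "sets ?L = sets borel" "sets ?D = sets borel" by auto
  have meas: "(\<lambda>x. norm (x - c)) \<in> measurable (restrict_space lborel (ball c R)) borel"
    by (intro measurable_restrict_space1) measurable
  have L: "emeasure ?L {t<..} = (if t < 0 then ennreal (?V * R ^ ?N) else ennreal (?V * (max t R ^ ?N - t ^ ?N)))
      \<and> emeasure ?L {t<..} < \<infinity>" for t
  proof -
    have vim: "(\<lambda>x. norm (x - c)) -` {t<..} \<inter> space (restrict_space lborel (ball c R)) = ball c R - cball c t"
      by (auto simp: space_restrict_space dist_norm norm_minus_commute)
    have "emeasure ?L {t<..} = emeasure (restrict_space lborel (ball c R)) (ball c R - cball c t)"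
      using emeasure_distr[OF meas, of "{t<..}"] unfolding vim by simp
    also have "\<dots> = emeasure lborel (ball c R - cball c t)"
      by (subst emeasure_restrict_space) auto
    also have "\<dots> = (if t < 0 then ennreal (?V * R ^ ?N) else ennreal (?V * (max t R ^ ?N - t ^ ?N)))"
    proof -
      consider "t < 0" | "0 \<le> t" "t < R" | "0 \<le> t" "R \<le> t" by linarith
      then show ?thesis
      proof cases
        case 1 then show ?thesis using R by (simp add: emeasure_ball)
      next
        case 2
        have "emeasure lborel (ball c R - cball c t) = emeasure lborel (ball c R) - emeasure lborel (cball c t)"
          using 2 by (intro emeasure_Diff) (auto simp: emeasure_cball)
        then show ?thesis using 2 by (simp add: emeasure_ball emeasure_cball ennreal_minus algebra_simps)
      next
        case 3
        then have "ball c R - cball c t = {}" by auto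
        then have "emeasure lborel (ball c R - cball c t) = 0" by (simp only: emeasure_empty)
        then show ?thesis using 3 R by simp
      qed
    qed
    finally show ?thesis by auto
  qed
  show "emeasure ?L {t<..} < \<infinity>" for t using L by blast
  fix t :: real
  have FTC: "(\<integral>\<^sup>+r. ennreal (sphere_area ?N * r ^ (?N - 1)) * indicator {s..R} r \<partial>lborel) = ennreal (?V * R ^ ?N - ?V * s ^ ?N)"
    if "0 \<le> s" "s \<le> R" for s
  proof (rule nn_integral_FTC_Icc[where F="\<lambda>r. ?V * r ^ ?N"])
    fix r assume "r \<in> {s..R}"
    show "((\<lambda>r. ?V * r ^ ?N) has_real_derivative sphere_area ?N * r ^ (?N - 1)) (at r)"
      by (auto intro!: derivative_eq_intros simp: sphere_area_def)
    show "0 \<le> sphere_area ?N * r ^ (?N - 1)" using \<open>r \<in> {s..R}\<close> that by (simp add: sphere_area_def)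
  qed (use that in auto)
  have "emeasure ?D {t<..} = (\<integral>\<^sup>+r. ennreal (indicator {0<..<R} r * (sphere_area ?N * r ^ (?N - 1))) * indicator {t<..} r \<partial>lborel)"
    by (subst emeasure_density) auto
  also have "\<dots> = (if t < 0 then ennreal (?V * R ^ ?N) else ennreal (?V * (max t R ^ ?N - t ^ ?N)))"
  proof (cases "t < R")
    case True
    define s where "s = max t 0"
    have s: "0 \<le> s" "s < R" using True R by (auto simp: s_def)
    have "(\<integral>\<^sup>+r. ennreal (indicator {0<..<R} r * (sphere_area ?N * r ^ (?N - 1))) * indicator {t<..} r \<partial>lborel)
      = (\<integral>\<^sup>+r. ennreal (sphere_area ?N * r ^ (?N - 1)) * indicator {s..R} r \<partial>lborel)"
    proof (rule nn_integral_cong_AE)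
      show "AE r in lborel. ennreal (indicator {0<..<R} r * (sphere_area ?N * r ^ (?N - 1))) * indicator {t<..} r
        = ennreal (sphere_area ?N * r ^ (?N - 1)) * indicator {s..R} r"
        using AE_lborel_singleton[of s] AE_lborel_singleton[of R]
        by eventually_elim (auto simp: s_def indicator_def split: if_splits)
    qed
    also have "\<dots> = ennreal (?V * R ^ ?N - ?V * s ^ ?N)" using s by (intro FTC) auto
    finally show ?thesis using True R N by (auto simp: s_def max_def algebra_simps)
  next
    case False
    have z: "ennreal (indicator {0<..<R} r * (sphere_area ?N * r ^ (?N - 1))) * indicator {t<..} r = 0" for r
      using False by (auto simp: indicator_def)
    then have "(\<integral>\<^sup>+r. ennreal (indicator {0<..<R} r * (sphere_area ?N * r ^ (?N - 1))) * indicator {t<..} r \<partial>lborel) = 0"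
      by (simp only: z) simp
    then show ?thesis using False R by (simp add: max_def)
  qed
  finally show "emeasure ?L {t<..} = emeasure ?D {t<..}" using L by simp
qed

lemma radial_integral:
  fixes c :: "'a::euclidean_space" and f :: "real \<Rightarrow> real"
  assumes R: "R > 0" and f[measurable]: "f \<in> borel_measurable borel"
  shows "(LINT x|lebesgue_on (ball c R). f (norm (x - c))) = (LINT r:{0<..<R}|lborel. sphere_area DIM('a) * r ^ (DIM('a) - 1) * f r)"
    and "integrable (lebesgue_on (ball c R)) (\<lambda>x. f (norm (x - c)))
      \<longleftrightarrow> set_integrable lborel {0<..<R} (\<lambda>r. sphere_area DIM('a) * r ^ (DIM('a) - 1) * f r)"
    and "(AE x in lebesgue_on (ball c R). f (norm (x - c)) = 0) \<longleftrightarrow> (AE r in lborel. r \<in> {0<..<R} \<longrightarrow> f r = 0)"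
proof -
  let ?N = "DIM('a)" and ?R = "restrict_space lborel (ball c R)"
  have sp: "sphere_area ?N > 0" by (simp add: sphere_area_pos)
  have fm: "(\<lambda>x. f (norm (x - c))) \<in> borel_measurable borel" by measurable
  have meas: "(\<lambda>x. norm (x - c)) \<in> measurable ?R borel"
    by (intro measurable_restrict_space1) measurable
  have nn: "0 \<le> indicator {0<..<R} r * (sphere_area ?N * r ^ (?N - 1))" for r
    using sp by (auto simp: indicator_def)
  note D = distr_norm_ball[OF R, of c]
  have "(LINT x|lebesgue_on (ball c R). f (norm (x - c))) = (LINT x|?R. f (norm (x - c)))"
    unfolding integral_lebesgue_on_ball_borel(1)[OF fm] set_lebesgue_integral_def
    by (subst integral_restrict_space) auto
  also have "\<dots> = (\<integral>r. f r \<partial>distr ?R borel (\<lambda>x. norm (x - c)))"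
    by (subst integral_distr[OF meas]) auto
  also have "\<dots> = (LINT r:{0<..<R}|lborel. sphere_area ?N * r ^ (?N - 1) * f r)"
    unfolding D set_lebesgue_integral_def using nn by (subst integral_density) (auto simp: mult_ac)
  finally show "(LINT x|lebesgue_on (ball c R). f (norm (x - c))) = (LINT r:{0<..<R}|lborel. sphere_area ?N * r ^ (?N - 1) * f r)" .
  have "integrable (lebesgue_on (ball c R)) (\<lambda>x. f (norm (x - c))) \<longleftrightarrow> integrable ?R (\<lambda>x. f (norm (x - c)))"
    unfolding integral_lebesgue_on_ball_borel(2)[OF fm] set_integrable_def
    by (subst integrable_restrict_space) auto
  also have "\<dots> \<longleftrightarrow> integrable (distr ?R borel (\<lambda>x. norm (x - c))) f"
    by (subst integrable_distr_eq[OF meas]) auto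
  also have "\<dots> \<longleftrightarrow> set_integrable lborel {0<..<R} (\<lambda>r. sphere_area ?N * r ^ (?N - 1) * f r)"
    unfolding D set_integrable_def using nn by (subst integrable_density) (auto simp: mult_ac)
  finally show "integrable (lebesgue_on (ball c R)) (\<lambda>x. f (norm (x - c)))
      \<longleftrightarrow> set_integrable lborel {0<..<R} (\<lambda>r. sphere_area ?N * r ^ (?N - 1) * f r)" .
  have "(AE x in lebesgue_on (ball c R). f (norm (x - c)) = 0) \<longleftrightarrow> (AE x in ?R. f (norm (x - c)) = 0)"
    unfolding AE_lebesgue_on_ball_iff by (subst AE_restrict_space_iff) auto
  also have "\<dots> \<longleftrightarrow> (AE r in distr ?R borel (\<lambda>x. norm (x - c)). f r = 0)"
    by (subst AE_distr_iff[OF meas]) auto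
  also have "\<dots> \<longleftrightarrow> (AE r in lborel. r \<in> {0<..<R} \<longrightarrow> f r = 0)"
    unfolding D using sp by (subst AE_density) (auto simp: indicator_def intro!: AE_cong)
  finally show "(AE x in lebesgue_on (ball c R). f (norm (x - c)) = 0) \<longleftrightarrow> (AE r in lborel. r \<in> {0<..<R} \<longrightarrow> f r = 0)" .
qed

text \<open>By the Stone-Weierstrass theorem e is uniformly close to a polynomial on {0..T}, and the
  error of either integral is at most d times the L1 norm of its weight. The two measure spaces are
  kept separate so that moments over the ball can be compared with moments over an interval.\<close>

lemma moments_determine_continuous:
  fixes p :: "'a \<Rightarrow> real" and q :: "'b \<Rightarrow> real"
  assumes p: "integrable M p" and q: "integrable M' q"
    and s: "s \<in> borel_measurable M" "\<And>x. x \<in> space M \<Longrightarrow> s x \<in> {0..T}"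
    and t: "t \<in> borel_measurable M'" "\<And>x. x \<in> space M' \<Longrightarrow> t x \<in> {0..T}"
    and mom: "\<And>j. (LINT x|M. p x * s x ^ j) = (LINT x|M'. q x * t x ^ j)"
    and e: "continuous_on UNIV e"
  shows "(LINT x|M. p x * e (s x)) = (LINT x|M'. q x * e (t x))"
proof -
  have int: "integrable N (\<lambda>x. w x * h (z x))" if "integrable N w" "z \<in> borel_measurable N" "\<And>x. x \<in> space N \<Longrightarrow> z x \<in> {0..T}"
    "continuous_on UNIV h" for N :: "'c measure" and w z and h :: "real \<Rightarrow> real"
  proof -
    have "compact (h ` {0..T})" by (intro compact_continuous_image continuous_on_subset[OF that(4)]) auto
    then obtain C where C: "\<forall>y\<in>h ` {0..T}. norm y \<le> C" using compact_imp_bounded bounded_iff by blast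
    have hm: "(\<lambda>x. h (z x)) \<in> borel_measurable N"
      using measurable_compose[OF that(2) borel_measurable_continuous_onI[OF that(4)]] .
    show ?thesis
    proof (rule Bochner_Integration.integrable_bound[OF integrable_mult_left[OF that(1), of C]])
      show "AE x in N. norm (w x * h (z x)) \<le> norm (w x * C)"
      proof (rule AE_I2)
        fix x assume "x \<in> space N"
        then have "\<bar>h (z x)\<bar> \<le> \<bar>C\<bar>" using C that(3) by (metis abs_ge_self image_eqI order_trans real_norm_def)
        then show "norm (w x * h (z x)) \<le> norm (w x * C)" by (simp add: abs_mult mult_left_mono)
      qed
    qed (use that(1) hm in auto)
  qed
  define P Q where "P = (LINT x|M. \<bar>p x\<bar>)" and "Q = (LINT x|M'. \<bar>q x\<bar>)"
  have PQ: "P \<ge> 0" "Q \<ge> 0" by (auto simp: P_def Q_def)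
  have small: "\<bar>(LINT x|M. p x * e (s x)) - (LINT x|M'. q x * e (t x))\<bar> \<le> d * (P + Q)" if d: "d > 0" for d
  proof -
    have "continuous_on {0..T} e" using e by (rule continuous_on_subset) simp
    then obtain h where h: "real_polynomial_function h" "\<And>x. x \<in> {0..T} \<Longrightarrow> \<bar>e x - h x\<bar> < d"
      using Stone_Weierstrass_real_polynomial_function[of "{0..T}" e d] d by auto
    obtain a n where hs: "h = (\<lambda>x. \<Sum>i\<le>n. a i * x ^ i)"
      using h(1) real_polynomial_function_iff_sum by blast
    have ch: "continuous_on UNIV h" unfolding hs by (intro continuous_intros)
    have poly: "(LINT x|N. w x * h (z x)) = (\<Sum>i\<le>n. a i * (LINT x|N. w x * z x ^ i))"
      if "integrable N w" "z \<in> borel_measurable N" "\<And>x. x \<in> space N \<Longrightarrow> z x \<in> {0..T}" for N :: "'c measure" and w z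
    proof -
      have "integrable N (\<lambda>x. w x * z x ^ i)" for i
        by (rule int[OF that, of "\<lambda>y. y ^ i"]) (auto intro!: continuous_intros)
      then have "(LINT x|N. (\<Sum>i\<le>n. a i * (w x * z x ^ i))) = (\<Sum>i\<le>n. a i * (LINT x|N. w x * z x ^ i))"
        by (subst Bochner_Integration.integral_sum) auto
      then show ?thesis by (simp add: hs sum_distrib_left mult.left_commute)
    qed
    have close: "\<bar>(LINT x|N. w x * e (z x)) - (LINT x|N. w x * h (z x))\<bar> \<le> d * (LINT x|N. \<bar>w x\<bar>)"
      if "integrable N w" "z \<in> borel_measurable N" "\<And>x. x \<in> space N \<Longrightarrow> z x \<in> {0..T}" for N :: "'c measure" and w z
    proof -
      note i = int[OF that e] int[OF that ch]
      have "\<bar>(LINT x|N. w x * e (z x)) - (LINT x|N. w x * h (z x))\<bar> = \<bar>\<integral>x. w x * e (z x) - w x * h (z x) \<partial>N\<bar>"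
        using i by simp
      also have "\<dots> \<le> (LINT x|N. d * \<bar>w x\<bar>)"
      proof (rule order_trans[OF integral_abs_bound integral_mono])
        fix x assume "x \<in> space N"
        then have "\<bar>w x\<bar> * \<bar>e (z x) - h (z x)\<bar> \<le> \<bar>w x\<bar> * d"
          using h(2)[OF that(3)] by (intro mult_left_mono) (auto intro: less_imp_le)
        then show "\<bar>w x * e (z x) - w x * h (z x)\<bar> \<le> d * \<bar>w x\<bar>"
          by (simp add: abs_mult[symmetric] right_diff_distrib mult.commute)
      qed (use i that(1) in auto)
      finally show ?thesis by simp
    qed
    have "(LINT x|M. p x * h (s x)) = (LINT x|M'. q x * h (t x))"
      using poly[OF p s] poly[OF q t] mom by simp
    then show ?thesis using close[OF p s] close[OF q t] by (simp add: P_def Q_def algebra_simps abs_le_iff)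
  qed
  show ?thesis
  proof (rule ccontr)
    assume "\<not> ?thesis"
    then have pos: "\<bar>(LINT x|M. p x * e (s x)) - (LINT x|M'. q x * e (t x))\<bar> > 0" (is "?x > 0") by simp
    \<comment> \<open>The error is chosen so that a positive difference would be bounded by half of
      itself.\<close>
    have "?x \<le> ?x / (2 * (P + Q + 1)) * (P + Q)" using pos PQ by (intro small divide_pos_pos) auto
    also have "\<dots> \<le> ?x / 2" using pos PQ by (simp add: field_simps)
    finally show False using pos by simp
  qed
qed

text \<open>\<open>radial_on_ball\<close> gives a profile without any measurability. A Borel version
  w of u agrees with it off a null set N, and by Tonelli almost every ray from c meets N in a null
  set of radii; w restricted to one such ray is a Borel profile.\<close>

lemma radial_borel_profile:
  fixes c :: "'a::euclidean_space" and u :: "'a \<Rightarrow> real"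
  assumes R: "R > 0" and u: "u \<in> borel_measurable (lebesgue_on (ball c R))" and rad: "radial_on_ball c R u"
  obtains g where "g \<in> borel_measurable borel" "AE x in lebesgue_on (ball c R). u x = g (norm (x - c))"
proof -
  obtain \<gamma> where \<gamma>: "AE x in lebesgue_on (ball c R). u x = \<gamma> (norm (x - c))"
    using rad by (auto simp: radial_on_ball_def dist_norm norm_minus_commute)
  obtain w where [measurable]: "w \<in> borel_measurable borel" and w: "\<And>x. x \<notin> ball c R \<Longrightarrow> w x = 0"
    "AE x in lebesgue_on (ball c R). u x = w x"
    using lebesgue_on_ball_borel_representative[OF u] by blast
  have "AE x in lebesgue_on (ball c R). w x = \<gamma> (norm (x - c))" using \<gamma> w(2) by eventually_elim simp
  then have "AE x in lborel. x \<in> ball c R \<longrightarrow> w x = \<gamma> (norm (x - c))" by (simp only: AE_lebesgue_on_ball_iff)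
  from AE_E[OF this] obtain N where N0: "{x \<in> space lborel. \<not> (x \<in> ball c R \<longrightarrow> w x = \<gamma> (norm (x - c)))} \<subseteq> N"
    "emeasure lborel N = 0" "N \<in> sets lborel" .
  note N = N0(1) null_setsI[OF N0(2,3)]
  then have [measurable]: "N \<in> sets borel" by auto
  have NW: "w x = \<gamma> (norm (x - c))" if "x \<in> ball c R" "x \<notin> N" for x using N(1) that by auto
  \<comment> \<open>Rays are indexed by points x of the shell between radii R and 2 R: the shell has
    positive measure, and for |x - c| \<ge> R the parameters 0 < s < 1 cover all radii below
    R.\<close>
  define Z where "Z = (\<integral>\<^sup>+x. \<integral>\<^sup>+s. indicator {0<..<1::real} s * indicator (ball c (2 * R) - ball c R) x * indicator N (c + s *\<^sub>R (x - c)) \<partial>lborel \<partial>(lborel :: 'a measure))"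
  have "Z = (\<integral>\<^sup>+s. \<integral>\<^sup>+x. indicator {0<..<1::real} s * indicator (ball c (2 * R) - ball c R) x * indicator N (c + s *\<^sub>R (x - c)) \<partial>(lborel :: 'a measure) \<partial>lborel)"
    unfolding Z_def by (rule lborel_pair.Fubini'[symmetric]) measurable
  also have "\<dots> = 0"
  proof -
    have "(\<integral>\<^sup>+x. indicator {0<..<1::real} s * indicator (ball c (2 * R) - ball c R) x * indicator N (c + s *\<^sub>R (x - c)) \<partial>(lborel :: 'a measure)) = 0" for s
    proof (cases "s \<in> {0<..<1}")
      case True
      have "0 = (\<integral>\<^sup>+x. indicator N x \<partial>(lborel :: 'a measure))" using N0(2,3) by simp
      also have "\<dots> = ennreal (\<bar>s\<bar> ^ DIM('a)) * (\<integral>\<^sup>+x. indicator N ((c - s *\<^sub>R c) + s *\<^sub>R x) \<partial>lborel)"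
        using True by (intro lborel_nn_integral_affine) auto
      finally have "(\<integral>\<^sup>+x. indicator N ((c - s *\<^sub>R c) + s *\<^sub>R x) \<partial>(lborel :: 'a measure)) = 0" using True by simp
      moreover have "(c - s *\<^sub>R c) + s *\<^sub>R x = c + s *\<^sub>R (x - c)" for x by (simp add: algebra_simps)
      ultimately have 0: "(\<integral>\<^sup>+x. indicator N (c + s *\<^sub>R (x - c)) \<partial>(lborel :: 'a measure)) = 0" by simp
      have "(\<integral>\<^sup>+x. indicator {0<..<1::real} s * indicator (ball c (2 * R) - ball c R) x * indicator N (c + s *\<^sub>R (x - c)) \<partial>(lborel :: 'a measure))
          \<le> (\<integral>\<^sup>+x. indicator N (c + s *\<^sub>R (x - c)) \<partial>(lborel :: 'a measure))"
        by (intro nn_integral_mono) (auto simp: indicator_def)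
      then show ?thesis using 0 by simp
    qed simp
    then show ?thesis by simp
  qed
  finally have "AE x in lborel. (\<integral>\<^sup>+s. indicator {0<..<1::real} s * indicator (ball c (2 * R) - ball c R) (x::'a) * indicator N (c + s *\<^sub>R (x - c)) \<partial>lborel) = 0"
    unfolding Z_def by (subst (asm) nn_integral_0_iff_AE) auto
  moreover have "\<not> (AE x in lborel. x \<notin> ball c (2 * R) - ball c R)"
  proof
    assume "AE x in lborel. x \<notin> ball c (2 * R) - ball c R"
    then have "ball c (2 * R) - ball c R \<in> null_sets lborel"
      by (subst (asm) AE_iff_null) (auto simp: set_diff_eq)
    then have "emeasure lborel (ball c (2 * R) - ball c R) = 0" by auto
    moreover have "emeasure lborel (ball c (2 * R) - ball c R) = emeasure lborel (ball c (2 * R)) - emeasure lborel (ball c R)"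
      using R by (intro emeasure_Diff) (auto simp: emeasure_ball)
    moreover have "\<dots> = ennreal (unit_ball_vol DIM('a) * (2 * R) ^ DIM('a) - unit_ball_vol DIM('a) * R ^ DIM('a))"
      using R by (simp add: emeasure_ball ennreal_minus)
    moreover have "R ^ DIM('a) < (2 * R) ^ DIM('a)" using R by (intro power_strict_mono) auto
    then have "unit_ball_vol DIM('a) * R ^ DIM('a) < unit_ball_vol DIM('a) * (2 * R) ^ DIM('a)"
      by (intro mult_strict_left_mono) auto
    ultimately show False by (simp add: ennreal_eq_0_iff)
  qed
  ultimately obtain x where x: "x \<in> ball c (2 * R) - ball c R"
    "(\<integral>\<^sup>+s. indicator {0<..<1::real} s * indicator (ball c (2 * R) - ball c R) x * indicator N (c + s *\<^sub>R (x - c)) \<partial>lborel) = 0"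
    by (metis (mono_tags, lifting) eventually_mono)
  then have "(\<integral>\<^sup>+s. indicator {0<..<1::real} s * indicator N (c + s *\<^sub>R (x - c)) \<partial>lborel) = 0" by simp
  then have aes: "AE s in lborel. indicator {0<..<1::real} s * indicator N (c + s *\<^sub>R (x - c)) = (0::ennreal)"
    by (subst (asm) nn_integral_0_iff_AE) auto
  define e where "e = x - c"
  have e: "norm e \<ge> R" using x(1) by (auto simp: e_def dist_norm norm_minus_commute)
  define g where "g r = w (c + (r / norm e) *\<^sub>R e)" for r
  have gm: "g \<in> borel_measurable borel" unfolding g_def[abs_def] by measurable
  have ne: "norm e > 0" using e R by linarith
  text \<open>Along the ray through \<open>x\<close>, \<open>\<gamma>\<close> agrees almost everywhere with a Borel function.\<close>
  have "AE r in lborel. r \<in> {0<..<R} \<longrightarrow> c + (r / norm e) *\<^sub>R e \<notin> N"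
  proof -
    have m: "Measurable.pred borel (\<lambda>s. indicator {0<..<1::real} s * indicator N (c + s *\<^sub>R (x - c)) = (0::ennreal))" by measurable
    have "AE r in lborel. indicator {0<..<1::real} (0 + (1 / norm e) * r) * indicator N (c + (0 + (1 / norm e) * r) *\<^sub>R (x - c)) = (0::ennreal)"
      by (rule AE_borel_affine[OF _ m aes]) (use ne in simp)
    then show ?thesis
    proof eventually_elim
      case (elim r)
      then show ?case using e ne by (auto simp: e_def[symmetric] indicator_def divide_less_eq split: if_splits)
    qed
  qed
  then have "AE r in lborel. r \<in> {0<..<R} \<longrightarrow> g r = \<gamma> r"
  proof eventually_elim
    case (elim r)
    show ?case
    proof
      assume r: "r \<in> {0<..<R}"
      have n: "norm ((r / norm e) *\<^sub>R e) = r" using r ne by simp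
      then have "c + (r / norm e) *\<^sub>R e \<in> ball c R" using r by (simp add: dist_norm)
      from NW[OF this] have "w (c + (r / norm e) *\<^sub>R e) = \<gamma> (norm (c + (r / norm e) *\<^sub>R e - c))" using elim r ne by auto
      then show "g r = \<gamma> r" using n by (simp only: g_def add_diff_cancel_left')
    qed
  qed
  from AE_E[OF this] obtain N' where N0': "{r \<in> space lborel. \<not> (r \<in> {0<..<R} \<longrightarrow> g r = \<gamma> r)} \<subseteq> N'"
    "emeasure lborel N' = 0" "N' \<in> sets lborel" .
  note N' = N0'(1) null_setsI[OF N0'(2,3)]
  have gN: "g r = \<gamma> r" if "r \<in> {0<..<R}" "r \<notin> N'" for r using N'(1) that by auto
  have "AE x in lebesgue_on (ball c R). indicator N' (norm (x - c)) = (0::real)"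
    using AE_not_in[OF N'(2)] N'(2) by (subst radial_integral(3)[OF R]) (auto simp: indicator_def elim: eventually_mono)
  moreover have "AE x in lebesgue_on (ball c R). x \<in> ball c R \<and> x \<noteq> c"
    unfolding AE_lebesgue_on_ball_iff using AE_lborel_singleton[of c] by eventually_elim auto
  ultimately have "AE x in lebesgue_on (ball c R). u x = g (norm (x - c))"
    using \<gamma>
  proof eventually_elim
    case (elim x)
    then have "norm (x - c) \<in> {0<..<R}" "norm (x - c) \<notin> N'"
      by (auto simp: dist_norm norm_minus_commute indicator_def split: if_splits)
    then have "g (norm (x - c)) = \<gamma> (norm (x - c))" by (rule gN)
    then show ?case using elim by simp
  qed
  then show thesis using that gm by blast
qed

abbreviation "line_on R \<equiv> restrict_space lborel {0<..<R::real}"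

lemma line_on_integral:
  fixes f :: "real \<Rightarrow> real"
  shows "integral\<^sup>L (line_on R) f = (LINT r:{0<..<R}|lborel. f r)"
    "integrable (line_on R) f \<longleftrightarrow> set_integrable lborel {0<..<R} f"
  by (simp_all add: set_lebesgue_integral_def set_integrable_def integral_restrict_space integrable_restrict_space)

text \<open>By \<open>moments_determine_continuous\<close> q integrates to 0 against every
  continuous function of r^2, and on r > 0 these include all continuous functions of r. Continuous
  functions bounded by 1 that converge almost everywhere to the sign of q then show that the
  integral of |q| is 0.\<close>

lemma moments_zero_imp_AE_zero:
  fixes q :: "real \<Rightarrow> real"
  assumes R: "R > 0" and [measurable]: "q \<in> borel_measurable borel" and int: "set_integrable lborel {0<..<R} q"
    and mom: "\<And>j. (LINT r:{0<..<R}|lborel. q r * (r\<^sup>2) ^ j) = 0"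
  shows "AE r in lborel. r \<in> {0<..<R} \<longrightarrow> q r = 0"
proof -
  let ?q = "\<lambda>r. indicator {0<..<R} r * q r"
  have i: "integrable lborel ?q" using int by (simp add: set_integrable_def)
  have cont: "(LINT r:{0<..<R}|lborel. q r * e (r\<^sup>2)) = 0" if "continuous_on UNIV e" for e
  proof -
    have "(LINT r|line_on R. q r * e (r\<^sup>2)) = (LINT r|line_on R. 0 * e (r\<^sup>2))"
    proof (rule moments_determine_continuous[where T="R\<^sup>2", OF _ _ _ _ _ _ _ that])
      show "integrable (line_on R) q" using int by (simp add: line_on_integral)
      show "(\<lambda>r. r\<^sup>2) \<in> borel_measurable (line_on R)" by (intro measurable_restrict_space1) simp
      then show "(\<lambda>r. r\<^sup>2) \<in> borel_measurable (line_on R)" .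
      show "(LINT r|line_on R. q r * (r\<^sup>2) ^ j) = (LINT r|line_on R. 0 * (r\<^sup>2) ^ j)" for j
        using mom[of j] by (simp add: line_on_integral)
    qed (auto simp: space_restrict_space intro!: power_mono)
    then show ?thesis by (simp add: line_on_integral)
  qed
  have "(\<lambda>r. sgn (?q r)) \<in> borel_measurable borel" unfolding sgn_real_def by measurable
  then have "(\<lambda>r. sgn (?q r)) \<in> borel_measurable lebesgue" by (intro measurable_completion) simp
  then have "(\<lambda>r. sgn (?q r)) measurable_on UNIV" by (intro lebesgue_measurable_imp_measurable_on) auto
  then obtain N G where N: "negligible N" and G: "\<And>j::nat. continuous_on UNIV (G j)"
    "\<And>r. r \<notin> N \<Longrightarrow> (\<lambda>j. G j r) \<longlonglongrightarrow> sgn (?q r)"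
    unfolding measurable_on_def by auto
  define H where "H j r = max (-1) (min 1 (G j r))" for j r
  have cH: "continuous_on UNIV (H j)" for j unfolding H_def by (intro continuous_intros G)
  note [measurable] = borel_measurable_continuous_onI[OF cH]
  have "(\<lambda>j. LINT r|lborel. ?q r * H j r) \<longlonglongrightarrow> (LINT r|lborel. \<bar>?q r\<bar>)"
  proof (rule integral_dominated_convergence[where w="\<lambda>r. \<bar>?q r\<bar>"])
    have "AE r in lborel. r \<notin> N"
      using AE_not_in[OF N[unfolded negligible_iff_null_sets]] by (simp only: AE_completion_iff)
    then show "AE r in lborel. (\<lambda>j. ?q r * H j r) \<longlonglongrightarrow> \<bar>?q r\<bar>"
    proof eventually_elim
      case (elim r)
      have "(\<lambda>j. H j r) \<longlonglongrightarrow> max (-1) (min 1 (sgn (?q r)))"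
        unfolding H_def by (intro tendsto_intros G(2) elim)
      then have "(\<lambda>j. ?q r * H j r) \<longlonglongrightarrow> ?q r * max (-1) (min 1 (sgn (?q r)))" by (intro tendsto_intros)
      moreover have "?q r * max (-1) (min 1 (sgn (?q r))) = \<bar>?q r\<bar>" by (auto simp: sgn_real_def abs_real_def)
      ultimately show ?case by simp
    qed
    show "AE r in lborel. norm (?q r * H j r) \<le> \<bar>?q r\<bar>" for j
      by (intro AE_I2) (auto simp: abs_mult H_def intro!: mult_left_le)
  qed (use i in auto)
  moreover have "(LINT r|lborel. ?q r * H j r) = 0" for j
  proof -
    have "continuous_on UNIV (\<lambda>t. H j (sqrt t))"
      by (rule continuous_on_compose2[OF cH]) (auto intro!: continuous_intros)
    from cont[OF this] have "(LINT r|lborel. indicator {0<..<R} r * (q r * H j (sqrt (r\<^sup>2)))) = 0"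
      by (simp add: set_lebesgue_integral_def)
    moreover have "(LINT r|lborel. ?q r * H j r) = (LINT r|lborel. indicator {0<..<R} r * (q r * H j (sqrt (r\<^sup>2))))"
      by (intro Bochner_Integration.integral_cong) (auto simp: indicator_def)
    ultimately show ?thesis by simp
  qed
  ultimately have "(LINT r|lborel. \<bar>?q r\<bar>) = 0" by (simp add: LIMSEQ_const_iff)
  then have "AE r in lborel. \<bar>?q r\<bar> = 0"
    using integral_nonneg_eq_0_iff_AE[OF integrable_abs[OF i]] by auto
  then show ?thesis by eventually_elim (auto simp: indicator_def)
qed

text \<open>R^(k+1) - r^(k+1) is the integral of (k+1) t^k over [r, R]; exchanging the integrations
  replaces the source q by its primitive. This converts moments of the source term into moments of
  the flux.\<close>

lemma integral_power_weight_Fubini: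
  fixes q :: "real \<Rightarrow> real" and k :: nat
  assumes R: "R > 0" and [measurable]: "q \<in> borel_measurable borel" and int: "set_integrable lborel {0<..<R} q"
  shows "(LINT r:{0<..<R}|lborel. q r * (R ^ Suc k - r ^ Suc k)) =
    (LINT t:{0<..<R}|lborel. (real (Suc k) * t ^ k) * (LINT r:{0<..<t}|lborel. q r))"
proof -
  define K where "K r t = indicator {0<..<R} r * q r * ((real (Suc k) * t ^ k) * indicator {r..R} t)" for r t
  have [measurable]: "(\<lambda>(r, t). K r t) \<in> borel_measurable (lborel \<Otimes>\<^sub>M lborel)"
  proof -
    have "(\<lambda>(r, t). K r t) = (\<lambda>z. indicator {0<..<R} (fst z) * q (fst z) * ((real (Suc k) * snd z ^ k) * (if fst z \<le> snd z \<and> snd z \<le> R then 1 else 0)))"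
      by (auto simp: K_def indicator_def fun_eq_iff)
    then show ?thesis by simp
  qed
  have FTC: "(LINT t|lborel. (real (Suc k) * t ^ k) * indicator {r..R} t) = R ^ Suc k - r ^ Suc k"
    "integrable lborel (\<lambda>t. (real (Suc k) * t ^ k) * indicator {r..R} t)" if "r \<in> {0<..<R}" for r
  proof -
    have "has_bochner_integral lborel (\<lambda>t. (real (Suc k) * t ^ k) * indicator {r..R} t) (R ^ Suc k - r ^ Suc k)"
    proof (rule has_bochner_integral_FTC_Icc_nonneg)
      fix x assume "x \<in> {r..R}"
      show "((\<lambda>t. t ^ Suc k) has_real_derivative real (Suc k) * x ^ k) (at x)"
        by (rule DERIV_cong[OF DERIV_pow]) simp
      show "0 \<le> real (Suc k) * x ^ k" using \<open>x \<in> {r..R}\<close> that by simp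
    qed (use that in auto)
    then show "(LINT t|lborel. (real (Suc k) * t ^ k) * indicator {r..R} t) = R ^ Suc k - r ^ Suc k"
      "integrable lborel (\<lambda>t. (real (Suc k) * t ^ k) * indicator {r..R} t)"
      by (auto simp: has_bochner_integral_iff)
  qed
  have Kt: "(LINT t|lborel. K r t) = indicator {0<..<R} r * (q r * (R ^ Suc k - r ^ Suc k))" for r
  proof (cases "r \<in> {0<..<R}")
    case True
    then show ?thesis unfolding K_def using FTC(1)[OF True] by (simp del: of_nat_Suc power_Suc)
  qed (simp add: K_def)
  have Kabs: "(LINT t|lborel. norm (K r t)) = indicator {0<..<R} r * (\<bar>q r\<bar> * (R ^ Suc k - r ^ Suc k))" for r
  proof (cases "r \<in> {0<..<R}")
    case True
    have "norm (K r t) = \<bar>q r\<bar> * ((real (Suc k) * t ^ k) * indicator {r..R} t)" for t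
      using True by (auto simp: K_def abs_mult indicator_def)
    then show ?thesis using FTC(1)[OF True] True by (simp del: of_nat_Suc power_Suc)
  qed (simp add: K_def)
  have iq: "integrable lborel (\<lambda>r. indicator {0<..<R} r * q r)" using int by (simp add: set_integrable_def)
  have prod: "integrable (lborel \<Otimes>\<^sub>M lborel) (\<lambda>(r, t). K r t)"
  proof (rule lborel_pair.Fubini_integrable)
    show "integrable lborel (\<lambda>r. LINT t|lborel. norm (case (r, t) of (r, t) \<Rightarrow> K r t))"
      unfolding split Kabs
    proof (rule Bochner_Integration.integrable_bound[OF integrable_mult_right[OF iq, of "R ^ Suc k"]])
      show "AE r in lborel. norm (indicator {0<..<R} r * (\<bar>q r\<bar> * (R ^ Suc k - r ^ Suc k))) \<le> norm (R ^ Suc k * (indicator {0<..<R} r * q r))"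
      proof (rule AE_I2)
        fix r
        have "\<bar>R ^ Suc k - r ^ Suc k\<bar> \<le> R ^ Suc k" if "r \<in> {0<..<R}"
        proof -
          have "0 \<le> r ^ Suc k" "r ^ Suc k \<le> R ^ Suc k" using that by (auto intro!: power_mono simp del: power_Suc)
          then show ?thesis by linarith
        qed
        then show "norm (indicator {0<..<R} r * (\<bar>q r\<bar> * (R ^ Suc k - r ^ Suc k))) \<le> norm (R ^ Suc k * (indicator {0<..<R} r * q r))"
          using R by (cases "r \<in> {0<..<R}") (auto simp: abs_mult mult.commute[of "R ^ Suc k"] simp del: power_Suc intro!: mult_left_mono)
      qed
    qed measurable
    show "AE r in lborel. integrable lborel (\<lambda>t. case (r, t) of (r, t) \<Rightarrow> K r t)"
    proof (rule AE_I2)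
      fix r
      show "integrable lborel (\<lambda>t. case (r, t) of (r, t) \<Rightarrow> K r t)"
      proof (cases "r \<in> {0<..<R}")
        case True
        show ?thesis unfolding split K_def by (intro integrable_mult_right FTC(2) True)
      qed (simp add: K_def)
    qed
  qed measurable
  have Kr: "(LINT r|lborel. K r t) = indicator {0<..<R} t * ((real (Suc k) * t ^ k) * (LINT r:{0<..<t}|lborel. q r))" if "t \<noteq> R" for t
  proof (cases "t \<in> {0<..<R}")
    case True
    have "(LINT r|lborel. K r t) = (LINT r|lborel. (real (Suc k) * t ^ k) * (indicator {0<..<t} r * q r))"
    proof (rule integral_cong_AE)
      show "AE r in lborel. K r t = (real (Suc k) * t ^ k) * (indicator {0<..<t} r * q r)"
        using AE_lborel_singleton[of t]
        by eventually_elim (use True in \<open>auto simp: K_def indicator_def\<close>)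
      show "(\<lambda>r. K r t) \<in> borel_measurable lborel"
      proof -
        have "(\<lambda>r. K r t) = (\<lambda>r. indicator {0<..<R} r * q r * ((real (Suc k) * t ^ k) * (if r \<le> t \<and> t \<le> R then 1 else 0)))"
          by (auto simp: K_def indicator_def fun_eq_iff)
        then show ?thesis by simp
      qed
    qed measurable
    then show ?thesis using True by (simp add: set_lebesgue_integral_def del: of_nat_Suc)
  next
    case False
    have "K r t = 0" for r using False that by (auto simp: K_def indicator_def)
    then show ?thesis using False by simp
  qed
  have "(LINT r:{0<..<R}|lborel. q r * (R ^ Suc k - r ^ Suc k)) = (LINT r|lborel. LINT t|lborel. K r t)"
    by (simp add: Kt set_lebesgue_integral_def)
  also have "\<dots> = (LINT t|lborel. LINT r|lborel. K r t)"
    using lborel_pair.Fubini_integral[OF prod] by simp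
  also have "\<dots> = (LINT t|lborel. indicator {0<..<R} t * ((real (Suc k) * t ^ k) * (LINT r:{0<..<t}|lborel. q r)))"
  proof (rule integral_cong_AE)
    show "AE t in lborel. (LINT r|lborel. K r t) = indicator {0<..<R} t * ((real (Suc k) * t ^ k) * (LINT r:{0<..<t}|lborel. q r))"
      using AE_lborel_singleton[of R] by eventually_elim (rule Kr)
    have "(\<lambda>t. indicator {0<..<R} t * ((real (Suc k) * t ^ k) * (LINT r|lborel. (if 0 < r \<and> r < t then q r else 0)))) \<in> borel_measurable lborel"
      by measurable
    moreover have "(LINT r:{0<..<t}|lborel. q r) = (LINT r|lborel. (if 0 < r \<and> r < t then q r else 0))" for t
      unfolding set_lebesgue_integral_def by (intro Bochner_Integration.integral_cong) (auto simp: indicator_def)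
    ultimately show "(\<lambda>t. indicator {0<..<R} t * ((real (Suc k) * t ^ k) * (LINT r:{0<..<t}|lborel. q r))) \<in> borel_measurable lborel"
      by simp
  qed measurable
  finally show ?thesis by (simp add: set_lebesgue_integral_def)
qed

lemma power_norm_square_grad:
  fixes c :: "'a::euclidean_space"
  shows "smooth (\<lambda>x. ((norm (x - c))\<^sup>2) ^ j)"
    and "grad (\<lambda>x. ((norm (x - c))\<^sup>2) ^ j) x = (2 * real j * ((norm (x - c))\<^sup>2) ^ (j - 1)) *\<^sub>R (x - c)"
proof -
  show "smooth (\<lambda>x. ((norm (x - c))\<^sup>2) ^ j)" by (intro smooth_power smooth_norm_square)
  have 1: "((\<lambda>x. (norm (x - c))\<^sup>2) has_derivative (\<lambda>h. 2 * ((x - c) \<bullet> h))) (at x)"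
    unfolding power2_norm_eq_inner by (auto intro!: derivative_eq_intros simp: inner_commute)
  have "((\<lambda>x. ((norm (x - c))\<^sup>2) ^ j) has_derivative (\<lambda>h. ((2 * real j * ((norm (x - c))\<^sup>2) ^ (j - 1)) *\<^sub>R (x - c)) \<bullet> h)) (at x)"
    by (rule has_derivative_eq_rhs[OF has_derivative_power[OF 1]]) (simp add: fun_eq_iff mult_ac)
  then show "grad (\<lambda>x. ((norm (x - c))\<^sup>2) ^ j) x = (2 * real j * ((norm (x - c))\<^sup>2) ^ (j - 1)) *\<^sub>R (x - c)"
    by (intro grad_eqI)
qed

text \<open>The test functions are |x - c|^(2j+2), even powers being smooth at c. Their gradient is
  2 (j+1) |x - c|^(2j) (x - c), and on the sphere they equal R^(2j+2), so the boundary term reduces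
  to \<beta> T, which the test function 1 expresses through f. The last clause is
  \<open>green_radial\<close> with a(r) = r^(2j).\<close>

lemma weak_Robin_power_moments:
  fixes c :: "'a::euclidean_space"
  assumes R: "R > 0" and sol: "weak_Robin_solution c R \<beta> f u"
  defines "T \<equiv> (LINT x|surface_measure c R. trace_on_sphere c R u x)"
    and "G \<equiv> \<lambda>x. weak_gradient (ball c R) u x \<bullet> (x - c)"
  shows "integrable (lebesgue_on (ball c R)) f"
    and "\<beta> * T = (LINT x|lebesgue_on (ball c R). f x)"
    and "2 * (real j + 1) * (LINT x|lebesgue_on (ball c R). G x * ((norm (x - c))\<^sup>2) ^ j) =
      (LINT x|lebesgue_on (ball c R). f x * ((norm (x - c))\<^sup>2) ^ Suc j) - (R\<^sup>2) ^ Suc j * (LINT x|lebesgue_on (ball c R). f x)"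
    and "(real DIM('a) + 2 * real j) * (LINT x|lebesgue_on (ball c R). u x * ((norm (x - c))\<^sup>2) ^ j) =
      R * (R\<^sup>2) ^ j * T - (LINT x|lebesgue_on (ball c R). G x * ((norm (x - c))\<^sup>2) ^ j)"
proof -
  let ?M = "lebesgue_on (ball c R)" and ?S = "surface_measure c R"
  have u: "u \<in> H1 (ball c R)" using sol by (simp add: weak_Robin_solution_def)
  note gu = H1_weak_gradient[OF u]
  have tr: "has_trace c R u (trace_on_sphere c R u)" by (rule trace_exists[OF R u])
  have trm: "trace_on_sphere c R u \<in> borel_measurable ?S" using tr by (simp add: has_trace_def L2_def)
  have test: "integrable ?M (\<lambda>x. f x * v x) \<and>
      (LINT x|?M. weak_gradient (ball c R) u x \<bullet> grad v x) + \<beta> * (LINT x|?S. trace_on_sphere c R u x * v x) = (LINT x|?M. f x * v x)"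
    if v: "smooth v" for v
  proof -
    note C1 = smooth_Ck[OF v, of "Suc 0"]
    have vH: "v \<in> H1 (ball c R)" by (rule C1_in_H1(1)[OF C1])
    have e1: "(LINT x|?M. weak_gradient (ball c R) u x \<bullet> weak_gradient (ball c R) v x) = (LINT x|?M. weak_gradient (ball c R) u x \<bullet> grad v x)"
    proof (rule integral_cong_AE)
      show "AE x in ?M. weak_gradient (ball c R) u x \<bullet> weak_gradient (ball c R) v x = weak_gradient (ball c R) u x \<bullet> grad v x"
        using weak_gradient_C1[OF R C1, of c] by eventually_elim simp
    qed (use gu(2) H1_weak_gradient(2)[OF vH] C1_in_H1(2)[OF C1, of c R] in \<open>auto simp: L2_def intro!: borel_measurable_inner\<close>)
    have e2: "(LINT x|?S. trace_on_sphere c R u x * trace_on_sphere c R v x) = (LINT x|?S. trace_on_sphere c R u x * v x)"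
    proof (rule integral_cong_AE)
      show "AE x in ?S. trace_on_sphere c R u x * trace_on_sphere c R v x = trace_on_sphere c R u x * v x"
        using trace_C1[OF R C1 trace_exists[OF R vH]] by eventually_elim simp
    qed (use trm trace_exists[OF R vH] borel_measurable_continuous_onI[OF smooth_continuous[OF v]]
        in \<open>auto simp: has_trace_def L2_def borel_measurable_surface_measure\<close>)
    show ?thesis using sol vH unfolding weak_Robin_solution_def e1[symmetric] e2[symmetric] by blast
  qed
  have g1: "grad (\<lambda>x::'a. 1) x = 0" for x by (intro grad_eqI) simp
  show fi: "integrable ?M f" using test[of "\<lambda>_. 1"] by simp
  show b0: "\<beta> * T = (LINT x|?M. f x)" using test[of "\<lambda>_. 1"] by (simp add: g1 T_def)
  show "2 * (real j + 1) * (LINT x|?M. G x * ((norm (x - c))\<^sup>2) ^ j) =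
      (LINT x|?M. f x * ((norm (x - c))\<^sup>2) ^ Suc j) - (R\<^sup>2) ^ Suc j * (LINT x|?M. f x)"
  proof -
    let ?v = "\<lambda>x. ((norm (x - c))\<^sup>2) ^ Suc j"
    have "(LINT x|?M. weak_gradient (ball c R) u x \<bullet> grad ?v x) = (LINT x|?M. 2 * (real j + 1) * (G x * ((norm (x - c))\<^sup>2) ^ j))"
      unfolding power_norm_square_grad(2) by (intro Bochner_Integration.integral_cong) (auto simp: G_def mult_ac)
    also have "\<dots> = 2 * (real j + 1) * (LINT x|?M. G x * ((norm (x - c))\<^sup>2) ^ j)" by (rule integral_mult_right_zero)
    finally have 1: "(LINT x|?M. weak_gradient (ball c R) u x \<bullet> grad ?v x) = 2 * (real j + 1) * (LINT x|?M. G x * ((norm (x - c))\<^sup>2) ^ j)" .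
    have "(LINT x|?S. trace_on_sphere c R u x * ?v x) = (LINT x|?S. (R\<^sup>2) ^ Suc j * trace_on_sphere c R u x)"
    proof (rule integral_cong_AE)
      show "AE x in ?S. trace_on_sphere c R u x * ?v x = (R\<^sup>2) ^ Suc j * trace_on_sphere c R u x"
        using AE_surface_measure_sphere[OF R, of c] by eventually_elim simp
    qed (use trm in \<open>auto simp: borel_measurable_surface_measure\<close>)
    then have 2: "\<beta> * (LINT x|?S. trace_on_sphere c R u x * ?v x) = (R\<^sup>2) ^ Suc j * (\<beta> * T)"
      by (simp add: T_def)
    show ?thesis using test[OF power_norm_square_grad(1)[of c "Suc j"]] unfolding 1 2 b0 by linarith
  qed
  show "(real DIM('a) + 2 * real j) * (LINT x|?M. u x * ((norm (x - c))\<^sup>2) ^ j) =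
      R * (R\<^sup>2) ^ j * T - (LINT x|?M. G x * ((norm (x - c))\<^sup>2) ^ j)"
  proof -
    define a where "a r = (r\<^sup>2) ^ j" for r :: real
    define b where "b r = 2 * real j * (r\<^sup>2) ^ j" for r :: real
    have "R * a R * T = (LINT x|?M. (real DIM('a) * a (norm (x - c)) + b (norm (x - c))) * u x)
      + (LINT x|?M. a (norm (x - c)) * (weak_gradient (ball c R) u x \<bullet> (x - c)))"
      unfolding T_def
    proof (rule green_radial[OF R u tr])
      show "a \<in> borel_measurable borel" "b \<in> borel_measurable borel" unfolding a_def[abs_def] b_def[abs_def] by measurable
      fix r :: real
      { assume r: "0 \<le> r" "r \<le> R"
        have "(r\<^sup>2) ^ j \<le> (R\<^sup>2) ^ j" using r by (intro power_mono) auto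
        moreover have "2 * real j * (r\<^sup>2) ^ j \<le> 2 * real j * (R\<^sup>2) ^ j" using calculation by (intro mult_left_mono) auto
        moreover have "0 \<le> (r\<^sup>2) ^ j" "0 \<le> 2 * real j * (r\<^sup>2) ^ j" by simp_all
        ultimately show "\<bar>a r\<bar> \<le> (R\<^sup>2) ^ j + 2 * real j * (R\<^sup>2) ^ j" "\<bar>b r\<bar> \<le> (R\<^sup>2) ^ j + 2 * real j * (R\<^sup>2) ^ j"
          unfolding a_def b_def by linarith+ }
      assume r: "0 < r"
      have "((\<lambda>r. r ^ (2 * j)) has_real_derivative real (2 * j) * r ^ (2 * j) / r) (at r)"
        by (rule DERIV_cong[OF DERIV_pow]) (use r in \<open>cases j; simp\<close>)
      then show "(a has_real_derivative b r / r) (at r)" by (simp add: a_def[abs_def] b_def power_mult[symmetric])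
    qed
    also have "(LINT x|?M. (real DIM('a) * a (norm (x - c)) + b (norm (x - c))) * u x) =
        (LINT x|?M. (real DIM('a) + 2 * real j) * (u x * ((norm (x - c))\<^sup>2) ^ j))"
      by (intro Bochner_Integration.integral_cong) (auto simp: a_def b_def algebra_simps)
    also have "\<dots> = (real DIM('a) + 2 * real j) * (LINT x|?M. u x * ((norm (x - c))\<^sup>2) ^ j)" by (rule integral_mult_right_zero)
    finally show ?thesis by (simp add: a_def G_def mult.commute)
  qed
qed

lemma integral_split_interval:
  fixes f :: "real \<Rightarrow> real"
  assumes "f integrable_on {a..c}" "a \<le> b" "b \<le> c"
  shows "integral {a..c} f = integral {a..b} f + integral {b..c} f"
  using Henstock_Kurzweil_Integration.integral_combine[OF assms(2,3,1)] by simp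

text \<open>
  Moments against \<open>|x - c|\<^sup>2\<^sup>j\<close> turn the weak equation into the integrated radial equation
  \<open>r\<^sup>N\<^sup>-\<^sup>1 H' = - \<mu>\<close>; the last clause is the Cauchy--Schwarz bound that carries the information
  that \<open>u\<close> has finite energy.
\<close>

theorem weak_radial_solution_ode:
  fixes c :: "'a::euclidean_space" and d :: nat
  assumes R: "R > 0" and N: "DIM('a) = d + 2" and sol: "weak_Robin_solution c R \<beta> f u"
    and g[measurable]: "g \<in> borel_measurable borel" and ug: "AE x in lebesgue_on (ball c R). u x = g (norm (x - c))"
    and F[measurable]: "F \<in> borel_measurable borel" and fF: "AE x in lebesgue_on (ball c R). f x = F (norm (x - c))"
  obtains H \<mu> where "set_integrable lborel {0<..<R} (\<lambda>s. s ^ (d + 1) * F s)"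
    "\<And>r. r \<in> {0..R} \<Longrightarrow> \<mu> r = (LINT s:{0<..<r}|lborel. s ^ (d + 1) * F s)"
    "continuous_on {0..R} \<mu>" "\<mu> 0 = 0" "continuous_on {0<..R} H"
    "\<And>r. r \<in> {0<..<R} \<Longrightarrow> (H has_real_derivative - \<mu> r / r ^ (d + 1)) (at r)"
    "\<mu> R = \<beta> * R ^ (d + 1) * H R" "((\<lambda>r. r ^ (d + 1) * H r) \<longlongrightarrow> 0) (at_right 0)"
    "AE r in lborel. r \<in> {0<..<R} \<longrightarrow> g r = H r"
    "\<exists>K. \<forall>e. continuous_on UNIV e \<longrightarrow> (LINT t:{0<..<R}|lborel. t * \<mu> t * e (t\<^sup>2))\<^sup>2 \<le> K * (LINT t:{0<..<R}|lborel. t ^ (d + 3) * (e (t\<^sup>2))\<^sup>2)"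
proof -
  let ?M = "lebesgue_on (ball c R)"
  define \<omega> where "\<omega> = sphere_area DIM('a)"
  have w: "\<omega> > 0" by (simp add: \<omega>_def sphere_area_pos)
  define T where "T = (LINT x|surface_measure c R. trace_on_sphere c R u x)"
  define G where "G x = weak_gradient (ball c R) u x \<bullet> (x - c)" for x
  note mom = weak_Robin_power_moments[OF R sol, folded T_def, folded G_def]
  have uH: "u \<in> H1 (ball c R)" using sol by (simp add: weak_Robin_solution_def)
  note gu = H1_weak_gradient[OF uH]
  have um: "u \<in> borel_measurable ?M" using gu(1) by (simp add: L2_def)
  have N1: "DIM('a) - 1 = d + 1" using N by simp
  have radial: "(LINT x|?M. h x * k (norm (x - c))) = \<omega> * (LINT r:{0<..<R}|lborel. r ^ (d + 1) * (h' r * k r))"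
    if "AE x in ?M. h x = h' (norm (x - c))" "h \<in> borel_measurable ?M" and [measurable]: "h' \<in> borel_measurable borel" "k \<in> borel_measurable borel"
    for h :: "'a \<Rightarrow> real" and h' k :: "real \<Rightarrow> real"
  proof -
    have m: "(\<lambda>x. k (norm (x - c))) \<in> borel_measurable ?M" "(\<lambda>x. h' (norm (x - c))) \<in> borel_measurable ?M"
      by (intro borel_measurable_lebesgue_on_borel; measurable)+
    have "(LINT x|?M. h x * k (norm (x - c))) = (LINT x|?M. h' (norm (x - c)) * k (norm (x - c)))"
    proof (rule integral_cong_AE)
      show "AE x in ?M. h x * k (norm (x - c)) = h' (norm (x - c)) * k (norm (x - c))"
        using that(1) by eventually_elim simp
    qed (use that(2) m in auto)
    also have "\<dots> = (LINT r:{0<..<R}|lborel. \<omega> * (r ^ (d + 1) * (h' r * k r)))"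
      using radial_integral(1)[OF R, of "\<lambda>r. h' r * k r" c] by (simp add: \<omega>_def N1[simplified] mult.assoc)
    finally show ?thesis by simp
  qed
  have fm: "f \<in> borel_measurable ?M" using mom(1) by auto
  have intF: "set_integrable lborel {0<..<R} (\<lambda>s. s ^ (d + 1) * F s)"
  proof -
    have "integrable ?M (\<lambda>x. F (norm (x - c)))"
      by (rule integrable_cong_AE_imp[OF mom(1) _ fF]) (intro borel_measurable_lebesgue_on_borel; measurable)
    then have "set_integrable lborel {0<..<R} (\<lambda>s. \<omega> * (s ^ (d + 1) * F s))"
      by (subst (asm) radial_integral(2)[OF R]) (simp_all add: \<omega>_def N1[simplified] mult.assoc)
    then show ?thesis using w by simp
  qed
  have intg: "set_integrable lborel {0<..<R} (\<lambda>s. s ^ (d + 1) * g s)"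
  proof -
    have "integrable ?M (\<lambda>x. g (norm (x - c)))"
      by (rule integrable_cong_AE_imp[OF L2_integrable_ball[OF gu(1)] _ ug]) (intro borel_measurable_lebesgue_on_borel; measurable)
    then have "set_integrable lborel {0<..<R} (\<lambda>s. \<omega> * (s ^ (d + 1) * g s))"
      by (subst (asm) radial_integral(2)[OF R]) (simp_all add: \<omega>_def N1[simplified] mult.assoc)
    then show ?thesis using w by simp
  qed
  define \<mu> where "\<mu> r = (LINT s:{0<..<r}|lborel. s ^ (d + 1) * F s)" for r
  have hk: "(\<lambda>s. if s \<in> {0<..<R} then s ^ (d + 1) * F s else 0) integrable_on UNIV"
    using set_borel_integral_eq_integral(1)[OF intF] by (simp only: integrable_restrict_UNIV)
  define q where "q s = (if s \<in> {0<..<R} then s ^ (d + 1) * F s else 0)" for s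
  have qi: "q integrable_on {0..R}" using hk unfolding q_def[abs_def] by (rule integrable_on_subinterval) simp
  have muq: "\<mu> r = integral {0..r} q" if r: "r \<in> {0..R}" for r
  proof -
    have "set_integrable lborel {0<..<r} (\<lambda>s. s ^ (d + 1) * F s)" using r by (intro set_integrable_subset[OF intF]) auto
    then have "\<mu> r = integral {0<..<r} (\<lambda>s. s ^ (d + 1) * F s)"
      unfolding \<mu>_def by (rule set_borel_integral_eq_integral(2))
    also have "\<dots> = integral {0<..<r} q" using r by (intro Henstock_Kurzweil_Integration.integral_cong) (auto simp: q_def)
    also have "\<dots> = integral {0..r} q"
      using integral_open_interval_real[of 0 r q] by (simp add: box_real cbox_interval)
    finally show ?thesis .
  qed
  have cmu: "continuous_on {0..R} \<mu>"
    using indefinite_integral_continuous_1[OF qi] by (rule continuous_on_eq) (simp add: muq)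
  have mu0: "\<mu> 0 = 0" by (simp add: \<mu>_def set_lebesgue_integral_def)
  obtain B where B: "B \<ge> 0" "\<And>r. r \<in> {0..R} \<Longrightarrow> \<bar>\<mu> r\<bar> \<le> B"
  proof -
    have "compact (\<mu> ` {0..R})" by (intro compact_continuous_image cmu) auto
    then obtain B where "\<forall>y\<in>\<mu> ` {0..R}. norm y \<le> B" using compact_imp_bounded bounded_iff by blast
    then show ?thesis using R by (intro that[of "max B 0"]) (auto intro: order_trans[of _ B])
  qed
  have cquot: "continuous_on {0<..R} (\<lambda>s. \<mu> s / s ^ (d + 1))"
    by (intro continuous_intros continuous_on_subset[OF cmu]) auto
  \<comment> \<open>U is the primitive of - \<mu> / r^(d+1) that vanishes at R; H will be U plus a
    constant.\<close>
  define U where "U r = integral {r..R} (\<lambda>s. \<mu> s / s ^ (d + 1))" for r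
  have quot_int: "(\<lambda>s. \<mu> s / s ^ (d + 1)) integrable_on {r..s}" if "0 < r" "s \<le> R" for r s
    using that by (intro integrable_continuous_real continuous_on_subset[OF cquot]) auto
  have dU: "(U has_real_derivative - \<mu> r / r ^ (d + 1)) (at r)" if r: "r \<in> {0<..<R}" for r
  proof -
    define a where "a = r / 2"
    have a: "0 < a" "a < r" using r by (auto simp: a_def)
    have eq: "U s = integral {a..R} (\<lambda>s. \<mu> s / s ^ (d + 1)) - integral {a..s} (\<lambda>s. \<mu> s / s ^ (d + 1))" if "s \<in> {a<..<R}" for s
      using integral_split_interval[OF quot_int, of a R s] a that by (simp add: U_def)
    have "((\<lambda>s. integral {a..s} (\<lambda>s. \<mu> s / s ^ (d + 1))) has_real_derivative \<mu> r / r ^ (d + 1)) (at r within {a..R})"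
      using a r by (intro integral_has_real_derivative continuous_on_subset[OF cquot]) auto
    moreover have "at r within {a..R} = at r" using a r by (intro at_within_interior) auto
    ultimately have "((\<lambda>s. integral {a..R} (\<lambda>s. \<mu> s / s ^ (d + 1)) - integral {a..s} (\<lambda>s. \<mu> s / s ^ (d + 1))) has_real_derivative 0 - \<mu> r / r ^ (d + 1)) (at r)"
      by (intro DERIV_diff DERIV_const) simp
    then have "(U has_real_derivative 0 - \<mu> r / r ^ (d + 1)) (at r)"
      by (rule has_field_derivative_transform_within_open[where S="{a<..<R}"]) (use eq a r in auto)
    then show ?thesis by simp
  qed
  have cU: "continuous_on {0<..R} U"
    unfolding continuous_on_eq_continuous_within
  proof
    fix r assume r: "r \<in> {0<..R}"
    define a where "a = r / 2"
    have a: "0 < a" "a < r" using r by (auto simp: a_def)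
    have c1: "continuous_on {a..R} (\<lambda>s. integral {a..R} (\<lambda>s. \<mu> s / s ^ (d + 1)) - integral {a..s} (\<lambda>s. \<mu> s / s ^ (d + 1)))"
      using a by (intro continuous_intros indefinite_integral_continuous_1 quot_int) auto
    have e1: "U s = integral {a..R} (\<lambda>s. \<mu> s / s ^ (d + 1)) - integral {a..s} (\<lambda>s. \<mu> s / s ^ (d + 1))" if "s \<in> {a..R}" for s
      using integral_split_interval[OF quot_int, of a R s] a that by (simp add: U_def)
    have "continuous_on {a..R} U" by (rule continuous_on_eq[OF c1]) (rule e1[symmetric])
    then have "continuous (at r within {a..R}) U" using a r by (simp add: continuous_on_eq_continuous_within)
    moreover have "at r within {0<..R} = at r within {a..R}"
      by (rule at_within_nhd[of _ "{a<..}"]) (use a in auto)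
    ultimately show "continuous (at r within {0<..R}) U" by simp
  qed
  have UR: "U R = 0" by (simp add: U_def)
  \<comment> \<open>Only |\<mu>| \<le> B is available. Of s^(-d-1) the factor s^(-d) is estimated by
    r^(-d) and 1 / s is integrated; this treats d = 0 and d > 0 alike and still lets r^(d+1) U tend
    to 0.\<close>
  have Ubound: "\<bar>r ^ (d + 1) * U r\<bar> \<le> B * r * (ln R - ln r)" if r: "r \<in> {0<..R}" for r
  proof -
    have hi: "((\<lambda>s. B / r ^ d * (1 / s)) has_integral B / r ^ d * (ln R - ln r)) {r..R}"
      using r by (intro has_integral_mult_right fundamental_theorem_of_calculus)
        (auto intro!: derivative_eq_intros simp: has_real_derivative_iff_has_vector_derivative[symmetric])
    have "norm (U r) \<le> integral {r..R} (\<lambda>s. B / r ^ d * (1 / s))"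
      unfolding U_def
    proof (rule integral_norm_bound_integral)
      fix s assume s: "s \<in> {r..R}"
      then have s0: "s > 0" using r by auto
      have "\<bar>\<mu> s\<bar> / s ^ (d + 1) \<le> B / s ^ (d + 1)" using B(2)[of s] s r by (intro divide_right_mono) auto
      also have "\<dots> = B / s ^ d * (1 / s)" by simp
      also have "\<dots> \<le> B / r ^ d * (1 / s)"
        using s r B(1) by (intro mult_right_mono divide_left_mono power_mono mult_pos_pos) auto
      finally show "norm (\<mu> s / s ^ (d + 1)) \<le> B / r ^ d * (1 / s)" using s0 by (simp add: abs_divide)
    qed (use hi quot_int r in auto)
    also have "\<dots> = B / r ^ d * (ln R - ln r)" by (rule integral_unique[OF hi])
    finally have "r ^ (d + 1) * \<bar>U r\<bar> \<le> r ^ (d + 1) * (B / r ^ d * (ln R - ln r))" using r by (intro mult_left_mono) auto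
    also have "\<dots> = B * r * (ln R - ln r)" using r by simp
    finally show ?thesis using r by (simp add: abs_mult)
  qed
  have lnlim: "((\<lambda>r. B * r * (ln R - ln r)) \<longlongrightarrow> 0) (at_right 0)" by real_asymp
  have Ulim: "((\<lambda>r. r ^ (d + 1) * U r) \<longlongrightarrow> 0) (at_right 0)"
  proof (rule Lim_null_comparison[OF _ lnlim])
    show "\<forall>\<^sub>F r in at_right 0. norm (r ^ (d + 1) * U r) \<le> B * r * (ln R - ln r)"
      using Ubound R by (intro eventually_at_rightI[of 0 R]) auto
  qed
  define U' where "U' r = indicator {0<..R} r * U r" for r
  have [measurable]: "U' \<in> borel_measurable borel"
    unfolding U'_def[abs_def] using borel_measurable_continuous_on_indicator[OF _ cU] by simp
  have mum[measurable]: "(\<lambda>r. indicator {0..R} r * \<mu> r) \<in> borel_measurable borel"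
    using borel_measurable_continuous_on_indicator[OF _ cmu] by simp
  define \<mu>' where "\<mu>' r = indicator {0..R} r * \<mu> r" for r
  have [measurable]: "\<mu>' \<in> borel_measurable borel" using mum by (simp add: \<mu>'_def[abs_def])
  have bint: "set_integrable lborel {0<..<R} h" if "h \<in> borel_measurable borel" "\<And>r. r \<in> {0<..<R} \<Longrightarrow> \<bar>h r\<bar> \<le> C" for h :: "real \<Rightarrow> real" and C
    unfolding set_integrable_def real_scaleR_def
  proof (rule Bochner_Integration.integrable_bound)
    show "integrable lborel (\<lambda>r. indicator {0<..<R} r * C)"
      using R by (intro integrable_mult_left integrable_real_indicator) simp_all
    show "AE r in lborel. norm (indicator {0<..<R} r * h r) \<le> norm (indicator {0<..<R} r * C)"
      using that(2) by (intro AE_I2) (auto simp: indicator_def intro: order_trans[OF _ abs_ge_self])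
  qed (use that(1) in measurable)
  have times_pow: "set_integrable lborel {0<..<R} (\<lambda>r. h r * (r\<^sup>2) ^ j)" if "set_integrable lborel {0<..<R} h" "h \<in> borel_measurable borel" for h j
    unfolding set_integrable_def real_scaleR_def
  proof (rule Bochner_Integration.integrable_bound)
    show "integrable lborel (\<lambda>r. (R\<^sup>2) ^ j * (indicator {0<..<R} r * h r))"
      using that(1) by (intro integrable_mult_right) (simp add: set_integrable_def)
    show "AE r in lborel. norm (indicator {0<..<R} r * (h r * (r\<^sup>2) ^ j)) \<le> norm ((R\<^sup>2) ^ j * (indicator {0<..<R} r * h r))"
    proof (rule AE_I2)
      fix r
      show "norm (indicator {0<..<R} r * (h r * (r\<^sup>2) ^ j)) \<le> norm ((R\<^sup>2) ^ j * (indicator {0<..<R} r * h r))"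
      proof (cases "r \<in> {0<..<R}")
        case True
        then have "(r\<^sup>2) ^ j \<le> (R\<^sup>2) ^ j" by (intro power_mono) auto
        then have "\<bar>h r\<bar> * (r\<^sup>2) ^ j \<le> \<bar>h r\<bar> * (R\<^sup>2) ^ j" by (intro mult_left_mono) auto
        then show ?thesis using True by (simp add: abs_mult mult_ac)
      qed simp
    qed
  qed (use that(2) in measurable)
  have Uint_set: "set_integrable lborel {0<..<R} (\<lambda>r. r ^ (d + 1) * U' r)"
  proof (rule bint[where C="B * R"])
    fix r assume r: "r \<in> {0<..<R}"
    have "ln (R / r) \<le> R / r - 1" using r by (intro ln_le_minus_one) auto
    then have "r * (ln R - ln r) \<le> r * (R / r)" using r by (intro mult_left_mono) (auto simp: ln_div)
    then have "B * (r * (ln R - ln r)) \<le> B * R" using r B(1) by (intro mult_left_mono) auto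
    then show "\<bar>r ^ (d + 1) * U' r\<bar> \<le> B * R" using Ubound[of r] r by (simp add: mult.assoc U'_def)
  qed measurable
  text \<open>Moments of \<open>\<mu>\<close>: Fubini for the source term, integration by parts for \<open>U\<close>.\<close>
  have muint: "(LINT x|?M. G x * ((norm (x - c))\<^sup>2) ^ j) = - \<omega> * (LINT t:{0<..<R}|lborel. t * \<mu> t * (t\<^sup>2) ^ j)" for j
  proof -
    have eqR: "(R\<^sup>2) ^ Suc j = R ^ Suc (2 * j + 1)" "(r\<^sup>2) ^ Suc j = r ^ Suc (2 * j + 1)" for r :: real
      by (simp_all only: power_mult[symmetric] mult_Suc_right) simp_all
    have f1: "(LINT x|?M. f x * ((norm (x - c))\<^sup>2) ^ Suc j) = \<omega> * (LINT r:{0<..<R}|lborel. r ^ (d + 1) * (F r * (r\<^sup>2) ^ Suc j))"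
      by (rule radial[OF fF fm, where k="\<lambda>r. (r\<^sup>2) ^ Suc j"]) measurable
    have f0: "(LINT x|?M. f x) = \<omega> * (LINT r:{0<..<R}|lborel. r ^ (d + 1) * F r)"
      using radial[OF fF fm, where k="\<lambda>r. 1"] by simp
    have i1: "set_integrable lborel {0<..<R} (\<lambda>r. r ^ (d + 1) * (F r * (r\<^sup>2) ^ Suc j))"
      using times_pow[OF intF _, of "Suc j"] by (simp add: mult.assoc)
    have i0: "set_integrable lborel {0<..<R} (\<lambda>r. (R\<^sup>2) ^ Suc j * (r ^ (d + 1) * F r))" using intF by (intro set_integrable_mult_right) auto
    have "(LINT r:{0<..<R}|lborel. r ^ (d + 1) * (F r * (r\<^sup>2) ^ Suc j)) - (R\<^sup>2) ^ Suc j * (LINT r:{0<..<R}|lborel. r ^ (d + 1) * F r)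
      = (LINT r:{0<..<R}|lborel. r ^ (d + 1) * (F r * (r\<^sup>2) ^ Suc j) - (R\<^sup>2) ^ Suc j * (r ^ (d + 1) * F r))"
      using set_integral_diff(2)[OF i1 i0] by simp
    also have "\<dots> = (LINT r:{0<..<R}|lborel. - ((r ^ (d + 1) * F r) * (R ^ Suc (2 * j + 1) - r ^ Suc (2 * j + 1))))"
      unfolding eqR by (simp only: right_diff_distrib minus_diff_eq mult_ac)
    also have "\<dots> = - (LINT r:{0<..<R}|lborel. (r ^ (d + 1) * F r) * (R ^ Suc (2 * j + 1) - r ^ Suc (2 * j + 1)))"
      by (simp add: set_lebesgue_integral_def del: power_Suc)
    also have "(LINT r:{0<..<R}|lborel. (r ^ (d + 1) * F r) * (R ^ Suc (2 * j + 1) - r ^ Suc (2 * j + 1)))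
       = (LINT t:{0<..<R}|lborel. (real (Suc (2 * j + 1)) * t ^ (2 * j + 1)) * \<mu> t)"
      unfolding \<mu>_def by (rule integral_power_weight_Fubini[OF R _ intF]) measurable
    also have "\<dots> = 2 * (real j + 1) * (LINT t:{0<..<R}|lborel. t * \<mu> t * (t\<^sup>2) ^ j)"
    proof -
      have eqt: "(real (Suc (2 * j + 1)) * t ^ (2 * j + 1)) * \<mu> t = 2 * (real j + 1) * (t * \<mu> t * (t\<^sup>2) ^ j)" for t
        by (simp add: power_mult[symmetric] algebra_simps)
      show ?thesis unfolding eqt by (rule set_integral_mult_right)
    qed
    finally have ch: "(LINT r:{0<..<R}|lborel. r ^ (d + 1) * (F r * (r\<^sup>2) ^ Suc j)) - (R\<^sup>2) ^ Suc j * (LINT r:{0<..<R}|lborel. r ^ (d + 1) * F r)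
        = - (2 * (real j + 1) * (LINT t:{0<..<R}|lborel. t * \<mu> t * (t\<^sup>2) ^ j))" .
    have alg: "w * x - k * (w * y) = - w * z" if "x - k * y = - z" for w x y k z :: real
    proof -
      have "w * x - k * (w * y) = w * (x - k * y)" by (simp add: right_diff_distrib mult_ac)
      then show ?thesis using that by simp
    qed
    have "(LINT x|?M. f x * ((norm (x - c))\<^sup>2) ^ Suc j) - (R\<^sup>2) ^ Suc j * (LINT x|?M. f x)
        = - \<omega> * (2 * (real j + 1) * (LINT t:{0<..<R}|lborel. t * \<mu> t * (t\<^sup>2) ^ j))"
      unfolding f1 f0 by (rule alg[OF ch])
    then have "2 * (real j + 1) * (LINT x|?M. G x * ((norm (x - c))\<^sup>2) ^ j) = 2 * (real j + 1) * (- \<omega> * (LINT t:{0<..<R}|lborel. t * \<mu> t * (t\<^sup>2) ^ j))"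
      using mom(3)[of j] by (simp only: mult_ac)
    then show ?thesis by (simp only: mult_cancel_left) auto
  qed
  have Uint: "(real DIM('a) + 2 * real j) * (LINT r:{0<..<R}|lborel. r ^ (d + 1) * U r * (r\<^sup>2) ^ j) = (LINT t:{0<..<R}|lborel. t * \<mu> t * (t\<^sup>2) ^ j)" for j
  proof -
    \<comment> \<open>E = r^(2j+d+2) U is a primitive of \<open>Lr r - Rr r\<close>. It vanishes at
      R because U does, and at 0 by \<open>Ulim\<close>.\<close>
    define E where "E r = (if r = 0 then 0 else r * (r\<^sup>2) ^ j * (r ^ (d + 1) * U r))" for r
    define Lr where "Lr r = (real DIM('a) + 2 * real j) * (r ^ (d + 1) * U r * (r\<^sup>2) ^ j)" for r
    define Rr where "Rr r = r * \<mu> r * (r\<^sup>2) ^ j" for r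
    have "((\<lambda>r. Lr r - Rr r) has_integral E R - E 0) {0..R}"
    proof (rule fundamental_theorem_of_calculus_interior)
      show "continuous_on {0..R} E"
        unfolding continuous_on_eq_continuous_within
      proof
        fix r assume r: "r \<in> {0..R}"
        show "continuous (at r within {0..R}) E"
        proof (cases "r = 0")
          case False
          have "continuous_on {0<..R} E"
            by (rule continuous_on_eq[of _ "\<lambda>r. r * (r\<^sup>2) ^ j * (r ^ (d + 1) * U r)"]) (auto intro!: continuous_intros cU simp: E_def)
          then have "continuous (at r within {0<..R}) E" using False r by (simp add: continuous_on_eq_continuous_within)
          moreover have "at r within {0..R} = at r within {0<..R}"
            by (rule at_within_nhd[of _ "{0<..}"]) (use False r in auto)
          ultimately show ?thesis by simp
        next
          case True
          have "((\<lambda>r. r * (r\<^sup>2) ^ j * (r ^ (d + 1) * U r)) \<longlongrightarrow> 0 * (0\<^sup>2) ^ j * 0) (at_right 0)"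
            by (intro tendsto_intros Ulim)
          then have "((\<lambda>r. r * (r\<^sup>2) ^ j * (r ^ (d + 1) * U r)) \<longlongrightarrow> 0) (at_right 0)" by simp
          then have "(E \<longlongrightarrow> 0) (at_right 0)"
            by (rule Lim_transform_eventually) (auto simp: E_def intro!: eventually_at_rightI[of 0 1])
          then have "(E \<longlongrightarrow> 0) (at 0 within {0..R})"
            using R by (simp add: at_within_Icc_at_right)
          then show ?thesis using True by (simp add: continuous_within E_def)
        qed
      qed
      fix r assume r: "r \<in> {0<..<R}"
      have p1: "((\<lambda>r. r ^ (2 * j + d + 2)) has_real_derivative real (2 * j + d + 2) * r ^ (2 * j + d + 1)) (at r)"
        by (rule DERIV_cong[OF DERIV_pow]) simp
      have "((\<lambda>r. r ^ (2 * j + d + 2) * U r) has_real_derivative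
          real (2 * j + d + 2) * r ^ (2 * j + d + 1) * U r + (- \<mu> r / r ^ (d + 1)) * r ^ (2 * j + d + 2)) (at r)"
        by (rule DERIV_mult[OF p1 dU[OF r]])
      moreover have "real (2 * j + d + 2) * r ^ (2 * j + d + 1) * U r + (- \<mu> r / r ^ (d + 1)) * r ^ (2 * j + d + 2) = Lr r - Rr r"
      proof -
        have "r ^ (2 * j + d + 1) = (r\<^sup>2) ^ j * r ^ (d + 1)" "r ^ (2 * j + d + 2) = r * (r\<^sup>2) ^ j * r ^ (d + 1)"
          by (simp_all add: power_mult[symmetric] power_add[symmetric] mult_ac) (simp_all add: power_add mult_ac)
        then show ?thesis using r by (simp add: Lr_def Rr_def N algebra_simps)
      qed
      ultimately have "((\<lambda>r. r ^ (2 * j + d + 2) * U r) has_real_derivative Lr r - Rr r) (at r)" by simp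
      then have "(E has_real_derivative Lr r - Rr r) (at r)"
        by (rule has_field_derivative_transform_within_open[where S="{0<..}"])
          (use r in \<open>auto simp: E_def power_mult[symmetric] power_add mult_ac\<close>)
      then show "(E has_vector_derivative Lr r - Rr r) (at r)" by (simp add: has_real_derivative_iff_has_vector_derivative)
    qed (use R in simp)
    moreover have "E R = 0" "E 0 = 0" using UR by (auto simp: E_def)
    ultimately have hi: "((\<lambda>r. Lr r - Rr r) has_integral 0) {0..R}" by simp
    have "set_integrable lborel {0<..<R} (\<lambda>r. r ^ (d + 1) * U' r * (r\<^sup>2) ^ j)"
      by (rule times_pow[OF Uint_set]) measurable
    then have sL: "set_integrable lborel {0<..<R} (\<lambda>r. r ^ (d + 1) * U r * (r\<^sup>2) ^ j)"
      by (rule set_integrable_cong[THEN iffD1, rotated -1]) (auto simp: U'_def)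
    have sR: "set_integrable lborel {0<..<R} Rr"
    proof -
      have "set_integrable lborel {0<..<R} (\<lambda>r. r * \<mu>' r * (r\<^sup>2) ^ j)"
      proof (rule bint[where C="R * B * (R\<^sup>2) ^ j"])
        fix r assume r: "r \<in> {0<..<R}"
        have "\<bar>r\<bar> * \<bar>\<mu> r\<bar> * (r\<^sup>2) ^ j \<le> R * B * (R\<^sup>2) ^ j"
          using B(2)[of r] B(1) r by (intro mult_mono power_mono mult_nonneg_nonneg) auto
        then show "\<bar>r * \<mu>' r * (r\<^sup>2) ^ j\<bar> \<le> R * B * (R\<^sup>2) ^ j" using r by (simp add: \<mu>'_def abs_mult)
      qed measurable
      then show ?thesis by (rule set_integrable_cong[THEN iffD1, rotated -1]) (auto simp: \<mu>'_def Rr_def)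
    qed
    have sL': "set_integrable lborel {0<..<R} Lr" unfolding Lr_def[abs_def] using sL by (intro set_integrable_mult_right) auto
    have sd: "set_integrable lborel {0<..<R} (\<lambda>r. Lr r - Rr r)" by (rule set_integral_diff(1)[OF sL' sR])
    have "(LINT r:{0<..<R}|lborel. Lr r - Rr r) = integral {0<..<R} (\<lambda>r. Lr r - Rr r)"
      by (rule set_borel_integral_eq_integral(2)[OF sd])
    also have "\<dots> = integral {0..R} (\<lambda>r. Lr r - Rr r)"
      by (simp only: integral_open_interval_real)
    also have "\<dots> = 0" using hi by (rule integral_unique)
    finally have "(LINT r:{0<..<R}|lborel. Lr r) = (LINT r:{0<..<R}|lborel. Rr r)"
      using set_integral_diff(2)[OF sL' sR] by simp
    then show ?thesis by (simp add: Lr_def Rr_def)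
  qed
  \<comment> \<open>The mean of the trace over the sphere, whose area is \<omega> R^(d+1).\<close>
  define C where "C = T / (\<omega> * R ^ (d + 1))"
  have Cint: "(real DIM('a) + 2 * real j) * (LINT r:{0<..<R}|lborel. r ^ (d + 1) * C * (r\<^sup>2) ^ j) = R * (R\<^sup>2) ^ j * T / \<omega>"
    "set_integrable lborel {0<..<R} (\<lambda>r. r ^ (d + 1) * C * (r\<^sup>2) ^ j)" for j
  proof -
    have hb: "has_bochner_integral lborel (\<lambda>r. (real (Suc (2 * j + d + 1)) * r ^ (2 * j + d + 1)) * indicator {0..R} r) (R ^ Suc (2 * j + d + 1) - 0 ^ Suc (2 * j + d + 1))"
    proof (rule has_bochner_integral_FTC_Icc_nonneg)
      fix x assume "x \<in> {0..R}"
      show "((\<lambda>t. t ^ Suc (2 * j + d + 1)) has_real_derivative real (Suc (2 * j + d + 1)) * x ^ (2 * j + d + 1)) (at x)"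
        by (rule DERIV_cong[OF DERIV_pow]) simp
      show "0 \<le> real (Suc (2 * j + d + 1)) * x ^ (2 * j + d + 1)" using \<open>x \<in> {0..R}\<close> by simp
    qed (use R in auto)
    have ae: "AE r in lborel. (real (Suc (2 * j + d + 1)) * r ^ (2 * j + d + 1)) * indicator {0..R} r
      = (real DIM('a) + 2 * real j) * (indicator {0<..<R} r * (r ^ (d + 1) * (r\<^sup>2) ^ j))"
      using AE_lborel_singleton[of 0] AE_lborel_singleton[of R]
      by eventually_elim (auto simp: indicator_def N power_mult[symmetric] power_add mult_ac)
    have "(LINT r|lborel. (real DIM('a) + 2 * real j) * (indicator {0<..<R} r * (r ^ (d + 1) * (r\<^sup>2) ^ j))) = R ^ Suc (2 * j + d + 1)"
      using integral_cong_AE[OF _ _ ae] hb by (simp add: has_bochner_integral_iff)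
    moreover have "R ^ Suc (2 * j + d + 1) = R * (R\<^sup>2) ^ j * R ^ (d + 1)"
      by (simp add: power_mult[symmetric] power_add mult_ac)
    ultimately have 1: "(real DIM('a) + 2 * real j) * (LINT r:{0<..<R}|lborel. r ^ (d + 1) * (r\<^sup>2) ^ j) = R * (R\<^sup>2) ^ j * R ^ (d + 1)"
      unfolding set_lebesgue_integral_def real_scaleR_def integral_mult_right_zero by (simp only:)
    have 2: "set_integrable lborel {0<..<R} (\<lambda>r. r ^ (d + 1) * (r\<^sup>2) ^ j)"
    proof (rule bint[where C="R ^ (d + 1) * (R\<^sup>2) ^ j"])
      fix r assume "r \<in> {0<..<R}"
      then show "\<bar>r ^ (d + 1) * (r\<^sup>2) ^ j\<bar> \<le> R ^ (d + 1) * (R\<^sup>2) ^ j"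
        by (auto simp: abs_mult simp del: power_Suc intro!: mult_mono power_mono)
    qed measurable
    have eq: "r ^ (d + 1) * C * (r\<^sup>2) ^ j = C * (r ^ (d + 1) * (r\<^sup>2) ^ j)" for r by (simp add: mult_ac)
    show "set_integrable lborel {0<..<R} (\<lambda>r. r ^ (d + 1) * C * (r\<^sup>2) ^ j)"
      unfolding eq using 2 by (intro set_integrable_mult_right) auto
    have "(real DIM('a) + 2 * real j) * (LINT r:{0<..<R}|lborel. r ^ (d + 1) * C * (r\<^sup>2) ^ j)
       = C * ((real DIM('a) + 2 * real j) * (LINT r:{0<..<R}|lborel. r ^ (d + 1) * (r\<^sup>2) ^ j))"
      unfolding eq by simp
    also have "\<dots> = C * (R * (R\<^sup>2) ^ j * R ^ (d + 1))" by (simp only: 1)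
    also have "\<dots> = R * (R\<^sup>2) ^ j * T / \<omega>" using R w by (simp add: C_def)
    finally show "(real DIM('a) + 2 * real j) * (LINT r:{0<..<R}|lborel. r ^ (d + 1) * C * (r\<^sup>2) ^ j) = R * (R\<^sup>2) ^ j * T / \<omega>" .
  qed
  \<comment> \<open>All moments of Q against powers of r^2 vanish: those of g are known from
    \<open>mom(4)\<close> and \<open>muint\<close>, those of U and C from \<open>Uint\<close> and
    \<open>Cint\<close>. Hence g = C + U almost everywhere.\<close>
  define Q where "Q r = r ^ (d + 1) * (g r - U' r - C)" for r
  have Qm: "Q \<in> borel_measurable borel" unfolding Q_def[abs_def] by measurable
  have i1: "set_integrable lborel {0<..<R} (\<lambda>r. r ^ (d + 1) * g r * (r\<^sup>2) ^ j)"
    "set_integrable lborel {0<..<R} (\<lambda>r. r ^ (d + 1) * U' r * (r\<^sup>2) ^ j)" for j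
    using times_pow[OF intg] times_pow[OF Uint_set] by simp_all
  have Qi: "set_integrable lborel {0<..<R} Q"
  proof -
    have "set_integrable lborel {0<..<R} (\<lambda>r. r ^ (d + 1) * g r * (r\<^sup>2) ^ 0 - r ^ (d + 1) * U' r * (r\<^sup>2) ^ 0 - r ^ (d + 1) * C * (r\<^sup>2) ^ 0)"
      by (intro set_integral_diff(1) i1 Cint(2))
    then show ?thesis by (simp add: Q_def[abs_def] right_diff_distrib)
  qed
  have "AE r in lborel. r \<in> {0<..<R} \<longrightarrow> Q r = 0"
  proof (rule moments_zero_imp_AE_zero[OF R Qm Qi])
    fix j
    define n where "n = real DIM('a) + 2 * real j"
    have n: "n > 0" by (simp add: n_def add_pos_nonneg)
    define A1 A2 A3 where "A1 = (LINT r:{0<..<R}|lborel. r ^ (d + 1) * g r * (r\<^sup>2) ^ j)"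
      and "A2 = (LINT r:{0<..<R}|lborel. r ^ (d + 1) * U' r * (r\<^sup>2) ^ j)"
      and "A3 = (LINT r:{0<..<R}|lborel. r ^ (d + 1) * C * (r\<^sup>2) ^ j)"
    have "(LINT x|?M. u x * ((norm (x - c))\<^sup>2) ^ j) = \<omega> * A1"
      using radial[OF ug um g, of "\<lambda>r. (r\<^sup>2) ^ j"] by (simp add: A1_def mult.assoc)
    then have e1: "n * (\<omega> * A1) = R * (R\<^sup>2) ^ j * T + \<omega> * (LINT t:{0<..<R}|lborel. t * \<mu> t * (t\<^sup>2) ^ j)"
      using mom(4)[of j] muint[of j] by (simp add: n_def)
    have "A2 = (LINT r:{0<..<R}|lborel. r ^ (d + 1) * U r * (r\<^sup>2) ^ j)"
      unfolding A2_def by (intro set_lebesgue_integral_cong) (auto simp: U'_def)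
    then have e2: "n * A2 = (LINT t:{0<..<R}|lborel. t * \<mu> t * (t\<^sup>2) ^ j)" using Uint[of j] by (simp add: n_def)
    have e3: "n * A3 = R * (R\<^sup>2) ^ j * T / \<omega>" using Cint(1)[of j] by (simp add: n_def A3_def)
    have "n * \<omega> * (A1 - A2 - A3) = n * (\<omega> * A1) - \<omega> * (n * A2) - \<omega> * (n * A3)" by (simp add: algebra_simps)
    also have "\<dots> = 0" unfolding e1 e2 e3 using w by simp
    finally have "A1 - A2 - A3 = 0" using n w by simp
    moreover have "(LINT r:{0<..<R}|lborel. Q r * (r\<^sup>2) ^ j) = (LINT r:{0<..<R}|lborel. r ^ (d + 1) * g r * (r\<^sup>2) ^ j - r ^ (d + 1) * U' r * (r\<^sup>2) ^ j - r ^ (d + 1) * C * (r\<^sup>2) ^ j)"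
      by (simp add: Q_def algebra_simps)
    moreover have "\<dots> = A1 - A2 - A3"
      unfolding A1_def A2_def A3_def
      by (subst set_integral_diff(2)[OF set_integral_diff(1)[OF i1] Cint(2)], subst set_integral_diff(2)[OF i1]) simp
    ultimately show "(LINT r:{0<..<R}|lborel. Q r * (r\<^sup>2) ^ j) = 0" by simp
  qed
  then have gH: "AE r in lborel. r \<in> {0<..<R} \<longrightarrow> g r = C + U r"
    by eventually_elim (auto simp: Q_def U'_def)
  show thesis
  proof (rule that[of \<mu> "\<lambda>r. C + U r"])
    show "continuous_on {0<..R} (\<lambda>r. C + U r)" by (intro continuous_intros cU)
    show "((\<lambda>r. C + U r) has_real_derivative - \<mu> r / r ^ (d + 1)) (at r)" if "r \<in> {0<..<R}" for r
      using DERIV_add[OF DERIV_const dU[OF that], of C] by simp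
    have "(LINT x|?M. f x) = \<omega> * \<mu> R"
      using radial[OF fF fm F, of "\<lambda>_. 1"] by (simp add: \<mu>_def)
    then have "\<mu> R = \<beta> * T / \<omega>" using mom(2) w by (simp add: field_simps)
    then show "\<mu> R = \<beta> * R ^ (d + 1) * (C + U R)" using R w by (simp add: UR C_def)
    have "((\<lambda>r. r ^ (d + 1) * C + r ^ (d + 1) * U r) \<longlongrightarrow> 0 ^ (d + 1) * C + 0) (at_right 0)"
      by (intro tendsto_intros Ulim)
    then show "((\<lambda>r. r ^ (d + 1) * (C + U r)) \<longlongrightarrow> 0) (at_right 0)" by (simp add: distrib_left)
    have LG: "L2 ?M (weak_gradient (ball c R) u)" by (rule gu(2))
    have Gi: "integrable ?M G"
      unfolding G_def by (intro L2_inner_integrable LG L2_continuous_ball continuous_intros)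
    define K0 where "K0 = (LINT x|?M. (norm (weak_gradient (ball c R) u x))\<^sup>2)"
    show "\<exists>K. \<forall>e. continuous_on UNIV e \<longrightarrow> (LINT t:{0<..<R}|lborel. t * \<mu> t * e (t\<^sup>2))\<^sup>2 \<le> K * (LINT t:{0<..<R}|lborel. t ^ (d + 3) * (e (t\<^sup>2))\<^sup>2)"
    proof (intro exI[of _ "K0 / \<omega>"] allI impI)
      \<comment> \<open>The energy enters through the Cauchy-Schwarz inequality for the weak
        gradient against the field e(|x - c|^2) (x - c). Their inner product is known for powers by
        \<open>muint\<close> and extends to continuous e by
        \<open>moments_determine_continuous\<close>.\<close>
      fix e :: "real \<Rightarrow> real" assume e: "continuous_on UNIV e"
      have [measurable]: "e \<in> borel_measurable borel" using e by (rule borel_measurable_continuous_onI)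
      have "(LINT x|?M. G x * e ((norm (x - c))\<^sup>2)) = (LINT t|line_on R. (- \<omega> * (t * \<mu>' t)) * e (t\<^sup>2))"
      proof (rule moments_determine_continuous[where T="R\<^sup>2", OF Gi _ _ _ _ _ _ e])
        have "set_integrable lborel {0<..<R} (\<lambda>t. - \<omega> * (t * \<mu>' t))"
        proof (rule bint[where C="\<omega> * (R * B)"])
          fix r assume r: "r \<in> {0<..<R}"
          have "\<omega> * (\<bar>r\<bar> * \<bar>\<mu> r\<bar>) \<le> \<omega> * (R * B)"
            using B(2)[of r] r w by (intro mult_left_mono mult_mono) auto
          then show "\<bar>- \<omega> * (r * \<mu>' r)\<bar> \<le> \<omega> * (R * B)" using r w by (simp add: \<mu>'_def abs_mult)
        qed measurable
        then show "integrable (line_on R) (\<lambda>t. - \<omega> * (t * \<mu>' t))" by (simp only: line_on_integral)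
        show "(\<lambda>x. (norm (x - c))\<^sup>2) \<in> borel_measurable ?M" by (intro borel_measurable_lebesgue_on_borel) measurable
        show "(\<lambda>r. r\<^sup>2) \<in> borel_measurable (line_on R)" by (intro measurable_restrict_space1) simp
        show "(norm (x - c))\<^sup>2 \<in> {0..R\<^sup>2}" if "x \<in> space ?M" for x
          using that by (auto simp: dist_norm norm_minus_commute intro!: power_mono)
        show "t\<^sup>2 \<in> {0..R\<^sup>2}" if "t \<in> space (line_on R)" for t
          using that by (auto simp: space_restrict_space intro!: power_mono)
        fix j
        have "(LINT t|line_on R. (- \<omega> * (t * \<mu>' t)) * (t\<^sup>2) ^ j) = (LINT t:{0<..<R}|lborel. - \<omega> * (t * \<mu> t * (t\<^sup>2) ^ j))"
          unfolding line_on_integral by (intro set_lebesgue_integral_cong) (auto simp: \<mu>'_def mult_ac)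
        also have "\<dots> = - \<omega> * (LINT t:{0<..<R}|lborel. t * \<mu> t * (t\<^sup>2) ^ j)" by (rule set_integral_mult_right)
        finally show "(LINT x|?M. G x * ((norm (x - c))\<^sup>2) ^ j) = (LINT t|line_on R. (- \<omega> * (t * \<mu>' t)) * (t\<^sup>2) ^ j)"
          using muint[of j] by simp
      qed
      also have "\<dots> = (LINT t:{0<..<R}|lborel. - \<omega> * (t * \<mu> t * e (t\<^sup>2)))"
        unfolding line_on_integral by (intro set_lebesgue_integral_cong) (auto simp: \<mu>'_def mult_ac)
      also have "\<dots> = - \<omega> * (LINT t:{0<..<R}|lborel. t * \<mu> t * e (t\<^sup>2))" by (rule set_integral_mult_right)
      finally have Ge: "(LINT x|?M. G x * e ((norm (x - c))\<^sup>2)) = - \<omega> * (LINT t:{0<..<R}|lborel. t * \<mu> t * e (t\<^sup>2))" .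
      define X where "X x = e ((norm (x - c))\<^sup>2) *\<^sub>R (x - c)" for x
      have "continuous_on UNIV X"
        unfolding X_def by (intro continuous_intros continuous_on_compose2[OF e]) auto
      then have LX: "L2 ?M X" by (rule L2_continuous_ball)
      have "(LINT x|?M. G x * e ((norm (x - c))\<^sup>2)) = (LINT x|?M. weak_gradient (ball c R) u x \<bullet> X x)"
        by (simp add: G_def X_def mult.commute)
      then have CS: "(- \<omega> * (LINT t:{0<..<R}|lborel. t * \<mu> t * e (t\<^sup>2)))\<^sup>2 \<le> K0 * (LINT x|?M. (norm (X x))\<^sup>2)"
        using integral_square_Cauchy_Schwarz[OF LG LX] unfolding Ge K0_def by simp
      have "(LINT x|?M. (norm (X x))\<^sup>2) = (LINT x|?M. (norm (x - c))\<^sup>2 * (e ((norm (x - c))\<^sup>2))\<^sup>2)"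
        by (simp add: X_def power_mult_distrib mult.commute)
      also have "\<dots> = (LINT r:{0<..<R}|lborel. \<omega> * (r ^ (d + 1) * (r\<^sup>2 * (e (r\<^sup>2))\<^sup>2)))"
        using radial_integral(1)[OF R, of "\<lambda>r. r\<^sup>2 * (e (r\<^sup>2))\<^sup>2" c] by (simp add: \<omega>_def N1[simplified] mult.assoc)
      also have "\<dots> = \<omega> * (LINT r:{0<..<R}|lborel. r ^ (d + 3) * (e (r\<^sup>2))\<^sup>2)"
      proof -
        have eq: "\<omega> * (r ^ (d + 1) * (r\<^sup>2 * (e (r\<^sup>2))\<^sup>2)) = \<omega> * (r ^ (d + 3) * (e (r\<^sup>2))\<^sup>2)" for r
          by (simp add: power_add power2_eq_square power3_eq_cube mult_ac)
        show ?thesis unfolding eq by (rule set_integral_mult_right)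
      qed
      finally have "\<omega>\<^sup>2 * (LINT t:{0<..<R}|lborel. t * \<mu> t * e (t\<^sup>2))\<^sup>2 \<le> K0 * (\<omega> * (LINT r:{0<..<R}|lborel. r ^ (d + 3) * (e (r\<^sup>2))\<^sup>2))"
        using CS by (simp add: power_mult_distrib)
      then have "\<omega> * (\<omega> * (LINT t:{0<..<R}|lborel. t * \<mu> t * e (t\<^sup>2))\<^sup>2) \<le> \<omega> * (K0 * (LINT r:{0<..<R}|lborel. r ^ (d + 3) * (e (r\<^sup>2))\<^sup>2))"
        by (simp add: power2_eq_square mult_ac)
      then have "\<omega> * (LINT t:{0<..<R}|lborel. t * \<mu> t * e (t\<^sup>2))\<^sup>2 \<le> K0 * (LINT r:{0<..<R}|lborel. r ^ (d + 3) * (e (r\<^sup>2))\<^sup>2)"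
        using w by simp
      then show "(LINT t:{0<..<R}|lborel. t * \<mu> t * e (t\<^sup>2))\<^sup>2 \<le> K0 / \<omega> * (LINT t:{0<..<R}|lborel. t ^ (d + 3) * (e (t\<^sup>2))\<^sup>2)"
        using w by (simp add: field_simps)
    qed
  qed (use intF cmu mu0 gH in \<open>auto simp: \<mu>_def\<close>)
qed

subsection \<open>The radial equation: monotonicity of the logarithmic slope\<close>

text \<open>Here d = N - 2 and m = - r^(N-1) \<phi>'. The third condition is p < (N + 2) / (N - 2)
  written as the sign of the Pohozaev coefficient, a form that also makes sense for d = 0. The
  bounds with K express regularity at the centre, and intervals are open at 0 so that no value has
  to be assigned there.\<close>

definition profile :: "nat \<Rightarrow> real \<Rightarrow> real \<Rightarrow> (real \<Rightarrow> real) \<Rightarrow> (real \<Rightarrow> real) \<Rightarrow> bool" where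
  "profile d p R \<phi> m \<longleftrightarrow> R > 0 \<and> p > 1 \<and> (real d + 2) / (p + 1) > real d / 2 \<and>
     continuous_on {0<..R} \<phi> \<and> continuous_on {0<..R} m \<and>
     (\<forall>r\<in>{0<..R}. \<phi> r > 0) \<and>
     (\<exists>K. \<forall>r\<in>{0<..R}. \<phi> r \<le> K \<and> \<bar>m r\<bar> \<le> K * r ^ (d + 2)) \<and>
     (\<forall>r\<in>{0<..<R}. (\<phi> has_real_derivative - m r / r ^ (d + 1)) (at r) \<and>
        (m has_real_derivative r ^ (d + 1) * \<phi> r powr p) (at r))"

lemma power_has_derivative_pos:
  "r > 0 \<Longrightarrow> ((\<lambda>r::real. r ^ d) has_real_derivative real d * r ^ d / r) (at r)"
  by (rule DERIV_cong[OF DERIV_pow]) (cases d; simp)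

lemma powr_compose_has_derivative:
  assumes "(f has_real_derivative f') (at r)" "f r > 0"
  shows "((\<lambda>r. f r powr a) has_real_derivative a * f r powr (a - 1) * f') (at r)"
  using DERIV_chain2[OF has_real_derivative_powr[OF assms(2)] assms(1)] .

lemma derivative_nonneg_imp_le:
  fixes f :: "real \<Rightarrow> real"
  assumes "a \<le> b" and c: "continuous_on {a..b} f"
    and d: "\<And>x. a < x \<Longrightarrow> x < b \<Longrightarrow> \<exists>y. (f has_real_derivative y) (at x) \<and> y \<ge> 0"
  shows "f a \<le> f b"
proof (cases "a = b")
  case False
  then have "a < b" using assms by simp
  then obtain l z where z: "a < z" "z < b" "(f has_real_derivative l) (at z)" "f b - f a = (b - a) * l"
    using MVT[OF _ c] d by (metis real_differentiable_def)
  obtain y where "(f has_real_derivative y) (at z)" "y \<ge> 0" using d[OF z(1,2)] by blast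
  then have "l \<ge> 0" using DERIV_unique[OF z(3)] by blast
  then show ?thesis using z(4) \<open>a < b\<close> by (smt (verit) mult_nonneg_nonneg)
qed simp

lemma derivative_nonneg_at_0_limit:
  fixes f :: "real \<Rightarrow> real"
  assumes "R > 0" and c: "continuous_on {0<..R} f" and lim: "(f \<longlongrightarrow> l) (at_right 0)"
    and d: "\<And>r. r \<in> {0<..<R} \<Longrightarrow> \<exists>y. (f has_real_derivative y) (at r) \<and> y \<ge> 0"
    and r: "r \<in> {0<..R}"
  shows "l \<le> f r"
proof (rule tendsto_upperbound[OF lim])
  show "\<forall>\<^sub>F s in at_right 0. f s \<le> f r"
  proof (rule eventually_at_rightI[of 0 r])
    fix s assume s: "s \<in> {0<..<r}"
    show "f s \<le> f r"
    proof (rule derivative_nonneg_imp_le[where f=f and a=s and b=r])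
      show "s \<le> r" using s by simp
      show "continuous_on {s..r} f" by (rule continuous_on_subset[OF c]) (use s r in auto)
      show "\<And>x. s < x \<Longrightarrow> x < r \<Longrightarrow> \<exists>y. (f has_real_derivative y) (at x) \<and> 0 \<le> y" using d s r by auto
    qed
  qed (use r in auto)
qed simp

text \<open>With r^(N-1) \<phi>' = - m this is the classical r^N (\<phi>'^2 / 2 + \<phi>^(p+1) /
  (p+1)) + (N-2) / 2 r^(N-1) \<phi> \<phi>'.\<close>

definition pohozaev :: "nat \<Rightarrow> real \<Rightarrow> (real \<Rightarrow> real) \<Rightarrow> (real \<Rightarrow> real) \<Rightarrow> real \<Rightarrow> real" where
  "pohozaev d p \<phi> m r = (m r)\<^sup>2 / (2 * r ^ d) + r\<^sup>2 * r ^ d * \<phi> r powr (p + 1) / (p + 1) - real d / 2 * \<phi> r * m r"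

text \<open>Everything cancels except multiples of r^(N-1) \<phi>^(p+1); the remaining coefficient N
  / (p+1) - (N-2) / 2 is positive exactly in the subcritical range.\<close>

lemma pohozaev_derivative:
  assumes "r > 0" "\<phi> r > 0" "p > 1" "(\<phi> has_real_derivative - m r / r ^ (d + 1)) (at r)"
    "(m has_real_derivative r ^ (d + 1) * \<phi> r powr p) (at r)"
  shows "(pohozaev d p \<phi> m has_real_derivative
    ((real d + 2) / (p + 1) - real d / 2) * (r ^ (d + 1) * \<phi> r powr (p + 1))) (at r)"
proof -
  define q where "q r = r ^ d" for r :: real
  define Q where "Q r = \<phi> r powr (p + 1)" for r
  define X where "X = \<phi> r powr p"
  have qp: "q r > 0" using assms by (simp add: q_def)
  have rd: "r ^ (d + 1) = r * q r" by (simp add: q_def)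
  have QX: "Q r = X * \<phi> r" using assms(2) by (simp add: Q_def X_def powr_add)
  have d1: "(q has_real_derivative real d * q r / r) (at r)"
    using power_has_derivative_pos[OF assms(1)] by (simp add: q_def[abs_def])
  have d2: "(Q has_real_derivative (p + 1) * X * (- m r / (r * q r))) (at r)"
    using powr_compose_has_derivative[OF assms(4,2), of "p + 1"] unfolding Q_def[abs_def] X_def rd by simp
  have d3: "(\<phi> has_real_derivative - m r / (r * q r)) (at r)" "(m has_real_derivative r * q r * X) (at r)"
    using assms(4,5) by (simp_all only: X_def rd)
  have eq: "pohozaev d p \<phi> m = (\<lambda>r. (m r)\<^sup>2 / (2 * q r) + r\<^sup>2 * q r * Q r / (p + 1) - real d / 2 * \<phi> r * m r)"
    by (simp add: pohozaev_def[abs_def] q_def Q_def)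
  define s where "s = p + 1"
  have s: "s > 0" using assms by (simp add: s_def)
  have "((\<lambda>r. (m r)\<^sup>2 / (2 * q r) + r\<^sup>2 * q r * Q r / s - real d / 2 * \<phi> r * m r) has_real_derivative
     ((real d + 2) / s - real d / 2) * (r * q r * Q r)) (at r)"
    using assms(1) qp s unfolding s_def[symmetric]
    by (auto intro!: derivative_eq_intros d1 d2[folded s_def] d3 simp: QX) (simp add: field_simps power2_eq_square)
  then show ?thesis unfolding eq Q_def[symmetric] rd s_def .
qed

text \<open>The bounds in \<open>profile\<close> make the function tend to 0 at the centre, and its
  derivative is positive.\<close>

lemma profile_pohozaev_pos:
  assumes P: "profile d p R \<phi> m" and r: "r \<in> {0<..R}"
  shows "pohozaev d p \<phi> m r > 0"
proof -
  let ?P = "pohozaev d p \<phi> m"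
  obtain K where K: "\<And>r. r \<in> {0<..R} \<Longrightarrow> \<phi> r \<le> K" "\<And>r. r \<in> {0<..R} \<Longrightarrow> \<bar>m r\<bar> \<le> K * r ^ (d + 2)"
    using P unfolding profile_def by metis
  have R: "R > 0" and p: "p > 1" and kap: "(real d + 2) / (p + 1) - real d / 2 > 0"
    and cphi: "continuous_on {0<..R} \<phi>" and cm: "continuous_on {0<..R} m"
    and pos: "\<And>r. r \<in> {0<..R} \<Longrightarrow> \<phi> r > 0"
    and der: "\<And>r. r \<in> {0<..<R} \<Longrightarrow> (\<phi> has_real_derivative - m r / r ^ (d + 1)) (at r)"
      "\<And>r. r \<in> {0<..<R} \<Longrightarrow> (m has_real_derivative r ^ (d + 1) * \<phi> r powr p) (at r)"
    using P by (auto simp: profile_def)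
  have cP: "continuous_on {0<..R} ?P"
    unfolding pohozaev_def[abs_def] by (intro continuous_intros cphi cm) (use pos p in force)+
  have dP: "(?P has_real_derivative ((real d + 2) / (p + 1) - real d / 2) * (r ^ (d + 1) * \<phi> r powr (p + 1))) (at r)"
    if "r \<in> {0<..<R}" for r using that by (intro pohozaev_derivative der pos p) auto
  have Kp: "K > 0" using K(1)[of R] pos[of R] R by auto
  have lim: "(?P \<longlongrightarrow> 0) (at_right 0)"
  proof (rule Lim_null_comparison)
    let ?C = "K\<^sup>2 / 2 + K powr (p + 1) / (p + 1) + real d / 2 * K * K"
    show "\<forall>\<^sub>F r in at_right 0. norm (?P r) \<le> ?C * r\<^sup>2 * max 1 (R ^ (d + 2))"
    proof (rule eventually_at_rightI[of 0 "min 1 R"])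
      fix r assume "r \<in> {0<..<min 1 R}"
      then have r: "0 < r" "r < 1" "r \<in> {0<..R}" by auto
      have r1: "r ^ k \<le> 1" for k using r by (intro power_le_one) auto
      have r2: "r ^ (d + 2) \<le> r\<^sup>2" using r by (intro power_decreasing) auto
      have m2: "\<bar>m r\<bar> \<le> K * (r\<^sup>2 * r ^ d)" using K(2)[OF r(3)] by (simp add: power_add power2_eq_square mult_ac)
      have "\<bar>(m r)\<^sup>2 / (2 * r ^ d)\<bar> \<le> (K * (r\<^sup>2 * r ^ d))\<^sup>2 / (2 * r ^ d)"
        using m2 r by (auto intro!: divide_right_mono simp: abs_le_square_iff[symmetric] abs_mult abs_of_pos[OF Kp])
      also have "\<dots> = K\<^sup>2 / 2 * (r\<^sup>2 * (r\<^sup>2 * r ^ d))" using r by (simp add: power2_eq_square field_simps)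
      also have "\<dots> \<le> K\<^sup>2 / 2 * (r\<^sup>2 * 1)"
        using r1[of "2 + d"] by (intro mult_left_mono) (auto simp: power_add power2_eq_square mult.assoc)
      finally have a1: "\<bar>(m r)\<^sup>2 / (2 * r ^ d)\<bar> \<le> K\<^sup>2 / 2 * r\<^sup>2" by simp
      have "\<bar>r\<^sup>2 * r ^ d * \<phi> r powr (p + 1) / (p + 1)\<bar> \<le> r\<^sup>2 * 1 * K powr (p + 1) / (p + 1)"
        using r r1[of d] K(1)[OF r(3)] pos[OF r(3)] p
        by (auto intro!: divide_right_mono mult_mono powr_mono2 simp: abs_mult)
      then have a2: "\<bar>r\<^sup>2 * r ^ d * \<phi> r powr (p + 1) / (p + 1)\<bar> \<le> K powr (p + 1) / (p + 1) * r\<^sup>2" by (simp add: mult.commute)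
      have "\<bar>real d / 2 * \<phi> r * m r\<bar> \<le> real d / 2 * K * (K * r\<^sup>2)"
        unfolding abs_mult using K(1)[OF r(3)] pos[OF r(3)] K(2)[OF r(3)] r2 Kp
        by (intro mult_mono) (auto intro: order_trans[OF _ mult_left_mono])
      then have a3: "\<bar>real d / 2 * \<phi> r * m r\<bar> \<le> real d / 2 * K * K * r\<^sup>2" by (simp add: mult.assoc)
      have "norm (?P r) \<le> ?C * r\<^sup>2"
        using a1 a2 a3 unfolding pohozaev_def real_norm_def distrib_right by linarith
      also have "\<dots> \<le> ?C * r\<^sup>2 * max 1 (R ^ (d + 2))"
        using Kp p by (subst mult.right_neutral[symmetric], intro mult_left_mono) auto
      finally show "norm (?P r) \<le> ?C * r\<^sup>2 * max 1 (R ^ (d + 2))" .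
    qed (use R in auto)
    have "((\<lambda>r. ?C * r\<^sup>2 * max 1 (R ^ (d + 2))) \<longlongrightarrow> ?C * 0\<^sup>2 * max 1 (R ^ (d + 2))) (at_right 0)"
      by (intro tendsto_intros)
    then show "((\<lambda>r. ?C * r\<^sup>2 * max 1 (R ^ (d + 2))) \<longlongrightarrow> 0) (at_right 0)" by simp
  qed
  \<comment> \<open>The limit at 0 yields only a weak inequality; strictness is gained on
    [r / 2, r].\<close>
  have half: "r / 2 \<in> {0<..R}" using r by auto
  have "0 \<le> ?P (r / 2)"
  proof (rule derivative_nonneg_at_0_limit[OF R cP lim _ half])
    fix s assume s: "s \<in> {0<..<R}"
    show "\<exists>y. (?P has_real_derivative y) (at s) \<and> y \<ge> 0"
      by (intro exI conjI, rule dP[OF s]) (use kap s in auto)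
  qed
  also have "?P (r / 2) < ?P r"
  proof (rule DERIV_pos_imp_increasing_open[where f="?P" and a="r / 2" and b=r])
    show "continuous_on {r / 2..r} ?P" by (rule continuous_on_subset[OF cP]) (use r in auto)
    fix s assume "r / 2 < s" "s < r"
    then have s: "s \<in> {0<..<R}" "s > 0" using r by auto
    then have "\<phi> s powr (p + 1) > 0" using pos[of s] by auto
    then have "((real d + 2) / (p + 1) - real d / 2) * (s ^ (d + 1) * \<phi> s powr (p + 1)) > 0"
      using kap s(2) by simp
    then show "\<exists>y. (?P has_real_derivative y) (at s) \<and> 0 < y" using dP[OF s(1)] by blast
  qed (use r in auto)
  finally show ?thesis .
qed

text \<open>The Robin condition m(R) = \<beta> R^(d+1) \<phi>(R) says that this quotient equals
  \<beta> R at R. Its value for a U(l r) at r is its value for U at l r, so rescaling only moves the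
  point of evaluation.\<close>

definition log_slope :: "nat \<Rightarrow> (real \<Rightarrow> real) \<Rightarrow> (real \<Rightarrow> real) \<Rightarrow> real \<Rightarrow> real" where
  "log_slope d \<phi> m r = m r / (r ^ d * \<phi> r)"

text \<open>For the slope L the equation gives the Riccati identity r L' = L^2 - d L + r^2
  \<phi>^(p-1). Splitting the last coefficient as 1 = 2 / (p+1) + (p-1) / (p+1) isolates a multiple
  of the Pohozaev function, so that both summands are positive for a profile.\<close>

lemma log_slope_derivative:
  assumes "r > 0" "\<phi> r > 0" "p > 1" "(\<phi> has_real_derivative - m r / r ^ (d + 1)) (at r)"
    "(m has_real_derivative r ^ (d + 1) * \<phi> r powr p) (at r)"
  shows "(log_slope d \<phi> m has_real_derivative
    (2 * pohozaev d p \<phi> m r / (r ^ d * (\<phi> r)\<^sup>2) + (p - 1) / (p + 1) * (r\<^sup>2 * \<phi> r powr (p - 1))) / r) (at r)"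
    "2 * pohozaev d p \<phi> m r / (r ^ d * (\<phi> r)\<^sup>2) =
      (log_slope d \<phi> m r)\<^sup>2 - real d * log_slope d \<phi> m r + 2 / (p + 1) * (r\<^sup>2 * \<phi> r powr (p - 1))"
proof -
  define q where "q r = r ^ d" for r :: real
  define X where "X = \<phi> r powr p"
  have qp: "q r > 0" using assms by (simp add: q_def)
  have rd: "r ^ (d + 1) = r * q r" by (simp add: q_def)
  have X: "\<phi> r powr (p + 1) = X * \<phi> r" "\<phi> r powr (p - 1) = X / \<phi> r"
    using assms(2) by (simp_all add: X_def powr_add powr_diff)
  have d1: "(q has_real_derivative real d * q r / r) (at r)"
    using power_has_derivative_pos[OF assms(1)] by (simp add: q_def[abs_def])
  have d3: "(\<phi> has_real_derivative - m r / (r * q r)) (at r)" "(m has_real_derivative r * q r * X) (at r)"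
    using assms(4,5) by (simp_all only: X_def rd)
  have eq: "log_slope d \<phi> m = (\<lambda>r. m r / (q r * \<phi> r))"
    by (simp add: log_slope_def[abs_def] q_def)
  have pn: "p + 1 \<noteq> 0" using assms by simp
  show *: "2 * pohozaev d p \<phi> m r / (r ^ d * (\<phi> r)\<^sup>2) =
      (log_slope d \<phi> m r)\<^sup>2 - real d * log_slope d \<phi> m r + 2 / (p + 1) * (r\<^sup>2 * \<phi> r powr (p - 1))"
  proof -
    define s where "s = p + 1"
    have "s > 0" using assms by (simp add: s_def)
    then show ?thesis
      unfolding pohozaev_def log_slope_def s_def[symmetric] X[folded s_def] q_def[symmetric] using assms(1,2) qp
      by (simp add: field_simps power2_eq_square)
  qed
  have "2 / (p + 1) + (p - 1) / (p + 1) = 1" using pn by (simp add: add_divide_distrib[symmetric])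
  then have "2 / (p + 1) * y + (p - 1) / (p + 1) * y = y" for y by (metis distrib_right mult_1)
  with * have eq2: "(2 * pohozaev d p \<phi> m r / (r ^ d * (\<phi> r)\<^sup>2) + (p - 1) / (p + 1) * (r\<^sup>2 * \<phi> r powr (p - 1))) / r
     = ((log_slope d \<phi> m r)\<^sup>2 - real d * log_slope d \<phi> m r + r\<^sup>2 * \<phi> r powr (p - 1)) / r"
    by (simp only: add.assoc)
  show "(log_slope d \<phi> m has_real_derivative
    (2 * pohozaev d p \<phi> m r / (r ^ d * (\<phi> r)\<^sup>2) + (p - 1) / (p + 1) * (r\<^sup>2 * \<phi> r powr (p - 1))) / r) (at r)"
    unfolding eq2 unfolding X unfolding eq using assms(1,2) qp
    by (auto intro!: derivative_eq_intros d1 d3) (simp add: field_simps power2_eq_square)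
qed

text \<open>\<open>W\<close> is the Wronskian r^(N-1) (h z' - h' z). It is constant and tends to 0
  at the centre, so W(R) = 0, which by the Robin condition for h reads h(R) times a bracket. With L
  the slope of \<phi>, the bracket equals - R^d \<phi>(R) times L^2 - d L + R^2 \<phi>^(p-1) at R,
  hence is negative. Thus h and k vanish at R, and then everywhere.\<close>

lemma profile_nondegenerate:
  assumes P: "profile d p R \<phi> m" and b: "m R = \<beta> * R ^ (d + 1) * \<phi> R"
    and ch: "continuous_on {0<..R} h" and ck: "continuous_on {0<..R} k"
    and dh: "\<And>r. r \<in> {0<..<R} \<Longrightarrow> (h has_real_derivative - k r / r ^ (d + 1)) (at r)"
    and dk: "\<And>r. r \<in> {0<..<R} \<Longrightarrow> (k has_real_derivative r ^ (d + 1) * (p * \<phi> r powr (p - 1) * h r)) (at r)"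
    and k0: "(k \<longlongrightarrow> 0) (at_right 0)" and h0: "((\<lambda>r. r ^ (d + 1) * h r) \<longlongrightarrow> 0) (at_right 0)"
    and kR: "k R = \<beta> * R ^ (d + 1) * h R" and r: "r \<in> {0<..R}"
  shows "h r = 0"
proof -
  obtain K where K: "\<And>r. r \<in> {0<..R} \<Longrightarrow> \<phi> r \<le> K" "\<And>r. r \<in> {0<..R} \<Longrightarrow> \<bar>m r\<bar> \<le> K * r ^ (d + 2)"
    using P unfolding profile_def by metis
  have R: "R > 0" and p: "p > 1"
    and cphi: "continuous_on {0<..R} \<phi>" and cm: "continuous_on {0<..R} m"
    and pos: "\<And>r. r \<in> {0<..R} \<Longrightarrow> \<phi> r > 0"
    and der: "\<And>r. r \<in> {0<..<R} \<Longrightarrow> (\<phi> has_real_derivative - m r / r ^ (d + 1)) (at r)"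
      "\<And>r. r \<in> {0<..<R} \<Longrightarrow> (m has_real_derivative r ^ (d + 1) * \<phi> r powr p) (at r)"
    using P by (auto simp: profile_def)
  have Kp: "K > 0" using K(1)[of R] pos[of R] R by auto
  \<comment> \<open>The exponent for which s^e \<phi>(s r) solves the same equation as \<phi>, that
    is, e p = e + 2.\<close>
  define e where "e = 2 / (p - 1)"
  have ep: "e * (p - 1) = 2" using p nonzero_eq_divide_eq[of "p - 1" e 2] by (simp add: e_def)
  text \<open>\<open>z\<close> is the generator of the scaling \<open>\<phi> \<mapsto> s\<^sup>e \<phi> (s r)\<close>, a solution of the linearized equation; \<open>\<zeta> = r\<^sup>N\<^sup>-\<^sup>1 z'\<close>.\<close>
  define z where "z r = e * \<phi> r - m r / r ^ d" for r
  define \<zeta> where "\<zeta> r = (real d - e) * m r - r\<^sup>2 * r ^ d * \<phi> r powr p" for r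
  define W where "W r = k r * z r + h r * \<zeta> r" for r
  have cW: "continuous_on {0<..R} W"
    unfolding W_def z_def \<zeta>_def by (intro continuous_intros ch ck cphi cm) (use pos p in force)+
  have dW: "(W has_real_derivative 0) (at r)" if r: "r \<in> {0<..<R}" for r
  proof -
    have r0: "r > 0" "\<phi> r > 0" using r pos[of r] by auto
    define q where "q r = r ^ d" for r :: real
    define Q where "Q r = \<phi> r powr p" for r
    define X where "X = \<phi> r powr (p - 1)"
    have qp: "q r > 0" using r0 by (simp add: q_def)
    have rd: "r ^ (d + 1) = r * q r" by (simp add: q_def)
    have QX: "Q r = X * \<phi> r" using r0 by (simp add: Q_def X_def powr_diff)
    have d1: "(q has_real_derivative real d * q r / r) (at r)"
      using power_has_derivative_pos[OF r0(1)] by (simp add: q_def[abs_def])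
    have d2: "(Q has_real_derivative p * X * (- m r / (r * q r))) (at r)"
      using powr_compose_has_derivative[OF der(1)[OF r] r0(2), of p] unfolding Q_def[abs_def] X_def rd by simp
    have d3: "(\<phi> has_real_derivative - m r / (r * q r)) (at r)" "(m has_real_derivative r * q r * (X * \<phi> r)) (at r)"
      "(h has_real_derivative - k r / (r * q r)) (at r)" "(k has_real_derivative r * q r * (p * X * h r)) (at r)"
      using der[OF r] dh[OF r] dk[OF r] by (simp_all only: X_def[symmetric] rd QX[unfolded Q_def])
    have eq: "W = (\<lambda>r. k r * (e * \<phi> r - m r / q r) + h r * ((real d - e) * m r - r\<^sup>2 * q r * Q r))"
      by (simp add: W_def[abs_def] z_def \<zeta>_def q_def Q_def)
    have ep': "e * p = 2 + e" using ep by (simp add: algebra_simps)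
    have dz: "((\<lambda>r. e * \<phi> r - m r / q r) has_real_derivative ((real d - e) * m r / (r * q r) - r * (X * \<phi> r))) (at r)"
      using r0 qp by (auto intro!: derivative_eq_intros d1 d3) (simp add: field_simps)
    have dzeta: "((\<lambda>r. (real d - e) * m r - r\<^sup>2 * q r * Q r) has_real_derivative (- p * (r * q r) * X * (e * \<phi> r - m r / q r))) (at r)"
    proof -
      have "((\<lambda>r. (real d - e) * m r - r\<^sup>2 * q r * Q r) has_real_derivative
          ((real d - e) * (r * q r * (X * \<phi> r)) - ((2 * r * q r + r\<^sup>2 * (real d * q r / r)) * Q r + r\<^sup>2 * q r * (p * X * (- m r / (r * q r)))))) (at r)"
        by (auto intro!: derivative_eq_intros d1 d2 d3) (simp add: algebra_simps)
      moreover have "(real d - e) * (r * q r * (X * \<phi> r)) - ((2 * r * q r + r\<^sup>2 * (real d * q r / r)) * Q r + r\<^sup>2 * q r * (p * X * (- m r / (r * q r))))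
          = - ((2 + e) * (r * q r) * X * \<phi> r) + p * X * r * m r"
        unfolding QX using r0 qp by (simp add: field_simps power2_eq_square)
      moreover have "- p * (r * q r) * X * (e * \<phi> r - m r / q r) = - ((e * p) * (r * q r) * X * \<phi> r) + p * X * r * m r"
        using qp by (simp add: field_simps)
      ultimately show ?thesis by (simp only: ep')
    qed
    show ?thesis
      unfolding eq
      by (rule DERIV_cong[OF DERIV_add[OF DERIV_mult[OF d3(4) dz] DERIV_mult[OF d3(3) dzeta]]])
        (use r0 qp in \<open>simp add: QX field_simps power2_eq_square\<close>)
  qed
  have limW: "(W \<longlongrightarrow> 0) (at_right 0)"
  proof -
    have zb: "\<forall>\<^sub>F r in at_right 0. norm (k r * z r) \<le> \<bar>k r\<bar> * (\<bar>e\<bar> * K + K * R\<^sup>2)"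
    proof (rule eventually_at_rightI[of 0 R])
      fix r assume "r \<in> {0<..<R}"
      then have r: "r > 0" "r \<le> R" "r \<in> {0<..R}" by auto
      have "\<bar>m r / r ^ d\<bar> \<le> K * r ^ (d + 2) / r ^ d" using divide_right_mono[OF K(2)[OF r(3)], of "r ^ d"] r by (simp add: abs_divide)
      also have "\<dots> = K * r\<^sup>2" using r by (simp add: power_add power2_eq_square)
      also have "\<dots> \<le> K * R\<^sup>2" using r Kp by (intro mult_left_mono power_mono) auto
      finally have 1: "\<bar>m r / r ^ d\<bar> \<le> K * R\<^sup>2" .
      have "\<bar>e * \<phi> r\<bar> \<le> \<bar>e\<bar> * K" unfolding abs_mult using K(1)[OF r(3)] pos[OF r(3)] by (intro mult_left_mono) auto
      then have "\<bar>z r\<bar> \<le> \<bar>e\<bar> * K + K * R\<^sup>2" using 1 unfolding z_def by linarith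
      then show "norm (k r * z r) \<le> \<bar>k r\<bar> * (\<bar>e\<bar> * K + K * R\<^sup>2)" by (simp add: abs_mult mult_left_mono)
    qed (rule R)
    have "((\<lambda>r. \<bar>k r\<bar> * (\<bar>e\<bar> * K + K * R\<^sup>2)) \<longlongrightarrow> 0) (at_right 0)"
      using tendsto_mult_left_zero[OF tendsto_rabs_zero[OF k0]] .
    with zb have 1: "((\<lambda>r. k r * z r) \<longlongrightarrow> 0) (at_right 0)" by (rule Lim_null_comparison)
    let ?C = "\<bar>real d - e\<bar> * K * R + R * K powr p"
    have zb: "\<forall>\<^sub>F r in at_right 0. norm (h r * \<zeta> r) \<le> \<bar>r ^ (d + 1) * h r\<bar> * ?C"
    proof (rule eventually_at_rightI[of 0 R])
      fix r assume "r \<in> {0<..<R}"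
      then have r: "r > 0" "r \<le> R" "r \<in> {0<..R}" by auto
      have "\<bar>(real d - e) * m r\<bar> \<le> \<bar>real d - e\<bar> * (K * r ^ (d + 2))"
        unfolding abs_mult using K(2)[OF r(3)] by (intro mult_left_mono) auto
      also have "K * r ^ (d + 2) = r ^ (d + 1) * (K * r)" by (simp add: power_add power2_eq_square)
      also have "\<bar>real d - e\<bar> * (r ^ (d + 1) * (K * r)) \<le> \<bar>real d - e\<bar> * (r ^ (d + 1) * (K * R))"
        using r Kp by (intro mult_left_mono) auto
      finally have 1: "\<bar>(real d - e) * m r\<bar> \<le> r ^ (d + 1) * (\<bar>real d - e\<bar> * K * R)" by (simp add: mult_ac)
      have "\<phi> r powr p \<le> K powr p" using K(1)[OF r(3)] pos[OF r(3)] p by (intro powr_mono2) auto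
      then have "r ^ (d + 1) * (r * \<phi> r powr p) \<le> r ^ (d + 1) * (R * K powr p)"
        using r by (intro mult_left_mono mult_mono) auto
      then have 2: "\<bar>r\<^sup>2 * r ^ d * \<phi> r powr p\<bar> \<le> r ^ (d + 1) * (R * K powr p)"
        using r by (simp add: power2_eq_square mult_ac abs_mult)
      have "\<bar>\<zeta> r\<bar> \<le> r ^ (d + 1) * ?C" using 1 2 unfolding \<zeta>_def by (simp only: distrib_left)
      then have "\<bar>h r\<bar> * \<bar>\<zeta> r\<bar> \<le> \<bar>h r\<bar> * (r ^ (d + 1) * ?C)" by (intro mult_left_mono) auto
      then show "norm (h r * \<zeta> r) \<le> \<bar>r ^ (d + 1) * h r\<bar> * ?C" using r by (simp add: abs_mult mult_ac)
    qed (rule R)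
    have "((\<lambda>r. \<bar>r ^ (d + 1) * h r\<bar> * ?C) \<longlongrightarrow> 0) (at_right 0)"
      using tendsto_mult_left_zero[OF tendsto_rabs_zero[OF h0]] .
    with zb have 2: "((\<lambda>r. h r * \<zeta> r) \<longlongrightarrow> 0) (at_right 0)" by (rule Lim_null_comparison)
    show ?thesis using tendsto_add[OF 1 2] by (simp add: W_def[abs_def])
  qed
  have RR: "R \<in> {0<..R}" using R by simp
  have "0 \<le> W R"
    by (rule derivative_nonneg_at_0_limit[OF R cW limW _ RR]) (use dW in blast)
  moreover have "0 \<le> - W R"
  proof (rule derivative_nonneg_at_0_limit[OF R _ _ _ RR, of "\<lambda>r. - W r"])
    show "((\<lambda>r. - W r) \<longlongrightarrow> 0) (at_right 0)" using tendsto_minus[OF limW] by simp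
    show "\<exists>y. ((\<lambda>r. - W r) has_real_derivative y) (at r) \<and> 0 \<le> y" if "r \<in> {0<..<R}" for r
      using DERIV_minus[OF dW[OF that]] by force
  qed (intro continuous_intros cW)
  ultimately have W0: "W R = 0" by simp
  have PR: "pohozaev d p \<phi> m R > 0" by (rule profile_pohozaev_pos[OF P RR])
  have phiR: "\<phi> R > 0" using pos[OF RR] .
  have "\<beta> * R ^ (d + 1) * z R + \<zeta> R < 0"
  proof -
    define Y where "Y = R ^ d"
    define X where "X = \<phi> R powr p"
    have Y: "Y > 0" using R by (simp add: Y_def)
    have X: "X > 0" using phiR by (simp add: X_def)
    have mR: "m R = \<beta> * (R * Y) * \<phi> R" using b by (simp add: Y_def)
    have "2 * pohozaev d p \<phi> m R / \<phi> R = (m R)\<^sup>2 / (Y * \<phi> R) + 2 / (p + 1) * (R\<^sup>2 * Y * X) - real d * m R"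
    proof -
      define s where "s = p + 1"
      have s: "s > 0" using p by (simp add: s_def)
      have Xs: "\<phi> R powr s = X * \<phi> R" using phiR by (simp add: s_def X_def powr_add)
      show ?thesis
        unfolding pohozaev_def s_def[symmetric] Xs Y_def[symmetric] using phiR Y s
        by (simp add: field_simps power2_eq_square)
    qed
    moreover have "2 * pohozaev d p \<phi> m R / \<phi> R > 0" using PR phiR by simp
    \<comment> \<open>The Pohozaev function carries the coefficient 2 / (p+1), the bracket the
      coefficient 1; since p > 1 the difference has the favourable sign.\<close>
    moreover have "2 / (p + 1) * (R\<^sup>2 * Y * X) \<le> 1 * (R\<^sup>2 * Y * X)" using p X Y by (intro mult_right_mono) auto
    ultimately have "(m R)\<^sup>2 / (Y * \<phi> R) + R\<^sup>2 * Y * X - real d * m R > 0" by linarith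
    moreover have "\<beta> * R ^ (d + 1) * z R + \<zeta> R = - ((m R)\<^sup>2 / (Y * \<phi> R) + R\<^sup>2 * Y * X - real d * m R)"
    proof -
      have bR: "\<beta> * R ^ (d + 1) = m R / \<phi> R" using phiR mR by (simp add: Y_def)
      show ?thesis
        unfolding bR z_def \<zeta>_def Y_def[symmetric] X_def[symmetric] using phiR Y
        by (simp add: field_simps power2_eq_square)
    qed
    ultimately show ?thesis by simp
  qed
  moreover have "h R * (\<beta> * R ^ (d + 1) * z R + \<zeta> R) = 0"
    using W0 kR by (simp add: W_def algebra_simps)
  ultimately have hR: "h R = 0" by simp
  then have kR0: "k R = 0" using kR by simp
  show "h r = 0"
  proof -
    have r0: "0 < r" "r \<le> R" using r by auto
    \<comment> \<open>A backward Gronwall argument: C bounds both coefficients of the linear system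
      for (h, k) on [r, R], so (h^2 + k^2) e^(C s) is nondecreasing there, and it vanishes at
      R.\<close>
    define C where "C = 1 / r ^ (d + 1) + R ^ (d + 1) * (p * K powr (p - 1))"
    have C: "C \<ge> 0" using r0 R Kp p by (auto simp: C_def)
    define E where "E s = ((h s)\<^sup>2 + (k s)\<^sup>2) * exp (C * s)" for s
    have cE: "continuous_on {0<..R} E" unfolding E_def by (intro continuous_intros ch ck)
    have "E r \<le> E R"
    proof (rule derivative_nonneg_imp_le[where f=E, OF r0(2)])
      show "continuous_on {r..R} E" by (rule continuous_on_subset[OF cE]) (use r0 in auto)
      fix s assume "r < s" "s < R"
      then have s: "s \<in> {0<..<R}" "s \<in> {0<..R}" "s > 0" "r < s" "s < R" using r0 by auto
      let ?A = "- k s / s ^ (d + 1)" and ?B = "s ^ (d + 1) * (p * \<phi> s powr (p - 1) * h s)"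
      have "(E has_real_derivative (2 * h s * ?A + 2 * k s * ?B + C * ((h s)\<^sup>2 + (k s)\<^sup>2)) * exp (C * s)) (at s)"
        unfolding E_def
        by (auto intro!: derivative_eq_intros dh dk s simp del: power_Suc power_add) (simp add: algebra_simps)
      moreover have "0 \<le> 2 * h s * ?A + 2 * k s * ?B + C * ((h s)\<^sup>2 + (k s)\<^sup>2)"
      proof -
        have i1: "1 / s ^ (d + 1) \<le> 1 / r ^ (d + 1)"
          using s r0 by (intro divide_left_mono power_mono mult_pos_pos zero_less_power) auto
        have i2: "s ^ (d + 1) * (p * \<phi> s powr (p - 1)) \<le> R ^ (d + 1) * (p * K powr (p - 1))"
          using s p K(1)[OF s(2)] pos[OF s(2)] by (intro mult_mono power_mono powr_mono2) auto
        have hk: "2 * (\<bar>h s\<bar> * \<bar>k s\<bar>) \<le> (h s)\<^sup>2 + (k s)\<^sup>2"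
          using zero_le_power2[of "\<bar>h s\<bar> - \<bar>k s\<bar>"] by (simp add: power2_eq_square algebra_simps)
        define t where "t = s ^ (d + 1) * (p * \<phi> s powr (p - 1)) - 1 / s ^ (d + 1)"
        have nn: "0 \<le> s ^ (d + 1) * (p * \<phi> s powr (p - 1))" "0 \<le> 1 / s ^ (d + 1)" using s p by auto
        have t: "\<bar>t\<bar> \<le> C" using i1 i2 nn unfolding t_def C_def by linarith
        have "\<bar>2 * h s * ?A + 2 * k s * ?B\<bar> = \<bar>t\<bar> * (2 * (\<bar>h s\<bar> * \<bar>k s\<bar>))"
        proof -
          have "2 * h s * ?A + 2 * k s * ?B = t * (2 * (h s * k s))" by (simp add: t_def algebra_simps)
          then show ?thesis by (simp add: abs_mult)
        qed
        also have "\<dots> \<le> C * ((h s)\<^sup>2 + (k s)\<^sup>2)" using t hk C by (intro mult_mono) auto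
        finally show ?thesis by linarith
      qed
      then have "0 \<le> (2 * h s * ?A + 2 * k s * ?B + C * ((h s)\<^sup>2 + (k s)\<^sup>2)) * exp (C * s)" by simp
      ultimately show "\<exists>y. (E has_real_derivative y) (at s) \<and> 0 \<le> y" by blast
    qed
    also have "E R = 0" using hR kR0 by (simp add: E_def)
    finally have "(h r)\<^sup>2 + (k r)\<^sup>2 \<le> 0" by (simp add: E_def mult_le_0_iff)
    then show ?thesis by (smt (verit) zero_le_power2 power2_eq_iff_nonneg zero_eq_power2)
  qed
qed

subsection \<open>The Lane--Emden function\<close>

lemma powr_diff_le:
  fixes x y p A :: real
  assumes "0 \<le> x" "x \<le> y" "y \<le> A" "p > 1"
  shows "y powr p - x powr p \<le> p * A powr (p - 1) * (y - x)"
proof (cases "x = y")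
  case False
  then have xy: "x < y" using assms by simp
  have "\<exists>l z. x < z \<and> z < y \<and> ((\<lambda>z. z powr p) has_real_derivative l) (at z) \<and> y powr p - x powr p = (y - x) * l"
  proof (rule MVT[OF xy])
    show "continuous_on {x..y} (\<lambda>z. z powr p)"
      using assms by (intro continuous_on_powr' continuous_intros) auto
    show "(\<lambda>z. z powr p) differentiable (at z)" if "x < z" for z
      using has_real_derivative_powr[of z p] that assms by (auto simp: real_differentiable_def)
  qed
  then obtain l z where z: "x < z" "z < y" "((\<lambda>z. z powr p) has_real_derivative l) (at z)"
    "y powr p - x powr p = (y - x) * l" by blast
  have "l = p * z powr (p - 1)"
    using DERIV_unique[OF z(3) has_real_derivative_powr[of z p]] z assms by simp
  also have "\<dots> \<le> p * A powr (p - 1)" using z assms by (intro mult_left_mono powr_mono2) auto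
  finally have "(y - x) * l \<le> (y - x) * (p * A powr (p - 1))" using xy by (intro mult_left_mono) auto
  then show ?thesis using z(4) by (simp add: mult.commute)
qed simp

text \<open>Cutting z off to [0, 1] makes the power bounded and Lipschitz with constant p on the
  whole line, so the initial value problem has a global solution that may pass through zero. Up to
  its first zero the solution lies in (0, 1], where the cut-off is invisible.\<close>

definition trunc_powr :: "real \<Rightarrow> real \<Rightarrow> real" where
  "trunc_powr p z = max 0 (min 1 z) powr p"

lemma trunc_powr_bounds: "p > 1 \<Longrightarrow> 0 \<le> trunc_powr p z \<and> trunc_powr p z \<le> 1"
  by (auto simp: trunc_powr_def powr_le_one_le intro!: powr_le1)

lemma trunc_powr_eq: "0 < z \<Longrightarrow> z \<le> 1 \<Longrightarrow> trunc_powr p z = z powr p"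
  by (simp add: trunc_powr_def)

lemma trunc_powr_lipschitz:
  assumes "p > 1" shows "\<bar>trunc_powr p x - trunc_powr p y\<bar> \<le> p * \<bar>x - y\<bar>"
proof -
  have *: "\<bar>trunc_powr p x - trunc_powr p y\<bar> \<le> p * \<bar>x - y\<bar>" if "x \<le> y" for x y
  proof -
    define a b where "a = max 0 (min 1 x)" and "b = max 0 (min 1 y)"
    have ab: "0 \<le> a" "a \<le> b" "b \<le> 1" "b - a \<le> y - x" using that by (auto simp: a_def b_def)
    have "a powr p \<le> b powr p" using ab assms by (intro powr_mono2) auto
    moreover have "b powr p - a powr p \<le> p * 1 powr (p - 1) * (b - a)" using ab assms by (intro powr_diff_le) auto
    moreover have "p * (b - a) \<le> p * (y - x)" using ab assms by (intro mult_left_mono) auto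
    ultimately show ?thesis using that by (simp add: trunc_powr_def a_def b_def)
  qed
  show ?thesis using *[of x y] *[of y x] by (cases "x \<le> y") (auto simp: abs_minus_commute)
qed

lemma continuous_trunc_powr:
  assumes "p > 1" "continuous_on S u" shows "continuous_on S (\<lambda>s. trunc_powr p (u s))"
  unfolding trunc_powr_def using assms by (intro continuous_on_powr' continuous_intros) auto

text \<open>U is the regular radial solution normalised by U(0) = 1, and M = - r^(N-1) U' its flux.
  Subcriticality is included so that \<open>profile\<close> follows from this predicate and
  positivity.\<close>

definition lane_emden :: "nat \<Rightarrow> real \<Rightarrow> (real \<Rightarrow> real) \<Rightarrow> (real \<Rightarrow> real) \<Rightarrow> bool" where
  "lane_emden d p U M \<longleftrightarrow> p > 1 \<and> (real d + 2) / (p + 1) > real d / 2 \<and>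
     continuous_on {0..} U \<and> U 0 = 1 \<and> continuous_on {0..} M \<and>
     (\<forall>r\<ge>0. 0 \<le> M r \<and> M r \<le> r ^ (d + 2)) \<and>
     (\<forall>r>0. (U has_real_derivative - M r / r ^ (d + 1)) (at r) \<and>
        (M has_real_derivative r ^ (d + 1) * trunc_powr p (U r)) (at r))"

definition flux :: "nat \<Rightarrow> real \<Rightarrow> (real \<Rightarrow> real) \<Rightarrow> real \<Rightarrow> real" where
  "flux d p u t = integral {0..t} (\<lambda>s. s ^ (d + 1) * trunc_powr p (u s))"

lemma integral_derivative_at:
  fixes f :: "real \<Rightarrow> real"
  assumes "continuous_on {0..} f" "t > 0"
  shows "((\<lambda>t. integral {0..t} f) has_real_derivative f t) (at t)"
proof -
  have "((\<lambda>t. integral {0..t} f) has_real_derivative f t) (at t within {0..t + 1})"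
    using assms by (intro integral_has_real_derivative continuous_on_subset[OF assms(1)]) auto
  moreover have "at t within {0..t + 1} = at t" using assms by (intro at_within_interior) auto
  ultimately show ?thesis by simp
qed

lemma integral_continuous_from_0:
  fixes f :: "real \<Rightarrow> real"
  assumes f: "continuous_on {0..} f"
  shows "continuous_on {0..} (\<lambda>t. integral {0..t} f)"
  unfolding continuous_on_eq_continuous_within
proof
  fix t :: real assume t: "t \<in> {0..}"
  have "f integrable_on {0..t + 1}" by (intro integrable_continuous_real continuous_on_subset[OF f]) auto
  then have "continuous_on {0..t + 1} (\<lambda>t. integral {0..t} f)" by (rule indefinite_integral_continuous_1)
  then have "continuous (at t within {0..t + 1}) (\<lambda>t. integral {0..t} f)"
    using t by (simp add: continuous_on_eq_continuous_within)
  moreover have "at t within {0..t + 1} = at t within {0..}"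
    by (rule at_within_nhd[of _ "{..<t + 1}"]) auto
  ultimately show "continuous (at t within {0..}) (\<lambda>t. integral {0..t} f)" by simp
qed

lemma flux_facts:
  assumes p: "p > 1" and u: "continuous_on {0..} u"
  shows "continuous_on {0..} (flux d p u)"
    "t > 0 \<Longrightarrow> (flux d p u has_real_derivative t ^ (d + 1) * trunc_powr p (u t)) (at t)"
    "t \<ge> 0 \<Longrightarrow> 0 \<le> flux d p u t \<and> flux d p u t \<le> t ^ (d + 2)"
    "continuous_on {0..} (\<lambda>t. flux d p u t / t ^ (d + 1))"
proof -
  let ?f = "\<lambda>s. s ^ (d + 1) * trunc_powr p (u s)"
  have f: "continuous_on {0..} ?f" by (intro continuous_intros continuous_trunc_powr p u)
  show c: "continuous_on {0..} (flux d p u)"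
    unfolding flux_def[abs_def] by (rule integral_continuous_from_0[OF f])
  show "(flux d p u has_real_derivative t ^ (d + 1) * trunc_powr p (u t)) (at t)" if "t > 0"
    unfolding flux_def[abs_def] by (rule integral_derivative_at[OF f that])
  show b: "0 \<le> flux d p u t \<and> flux d p u t \<le> t ^ (d + 2)" if "t \<ge> 0" for t
  proof
    have i: "?f integrable_on {0..t}" by (intro integrable_continuous_real continuous_on_subset[OF f]) auto
    show "0 \<le> flux d p u t"
      unfolding flux_def using trunc_powr_bounds[OF p] by (intro integral_nonneg i) auto
    have "?f s \<le> t ^ (d + 1)" if "s \<in> {0..t}" for s
    proof -
      have "?f s \<le> t ^ (d + 1) * 1"
        using that trunc_powr_bounds[OF p, of "u s"] by (intro mult_mono power_mono) auto
      then show ?thesis by simp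
    qed
    then have "flux d p u t \<le> integral {0..t} (\<lambda>s. t ^ (d + 1))"
      unfolding flux_def by (intro integral_le i) auto
    then show "flux d p u t \<le> t ^ (d + 2)" using that by (simp add: mult_ac)
  qed
  show "continuous_on {0..} (\<lambda>t. flux d p u t / t ^ (d + 1))"
    unfolding continuous_on_eq_continuous_within
  proof
    fix t :: real assume t: "t \<in> {0..}"
    show "continuous (at t within {0..}) (\<lambda>t. flux d p u t / t ^ (d + 1))"
    proof (cases "t = 0")
      case False
      have "continuous (at t within {0..}) (flux d p u)" using c t by (simp add: continuous_on_eq_continuous_within)
      then show ?thesis using False by (intro continuous_intros) auto
    next
      case True
      have "((\<lambda>t. flux d p u t / t ^ (d + 1)) \<longlongrightarrow> 0) (at 0 within {0..})"
      proof (rule Lim_null_comparison)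
        have "norm (flux d p u t / t ^ (d + 1)) \<le> t" if "t \<ge> 0" for t
          using b[OF that] that by (cases "t = 0") (auto simp: divide_le_eq mult_ac)
        then show "\<forall>\<^sub>F t in at 0 within {0..}. norm (flux d p u t / t ^ (d + 1)) \<le> t"
          by (auto simp: eventually_at_filter)
        show "((\<lambda>t::real. t) \<longlongrightarrow> 0) (at 0 within {0..})" by (rule tendsto_ident_at)
      qed
      then show ?thesis using True by (simp add: continuous_within)
    qed
  qed
qed

text \<open>Each integration gains a factor 1 / k against the weight e^(k t); \<open>picard\<close>
  integrates twice and thus gains 1 / k^2.\<close>

lemma exp_integral_le:
  fixes f g :: "real \<Rightarrow> real"
  assumes f: "continuous_on {0..} f" and g: "continuous_on {0..} g" and k: "k > 0" and t: "t \<ge> 0" and "C \<ge> 0"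
    and le: "\<And>s. s \<in> {0..t} \<Longrightarrow> \<bar>f s - g s\<bar> \<le> C * exp (k * s)"
  shows "\<bar>integral {0..t} f - integral {0..t} g\<bar> \<le> C * exp (k * t) / k"
proof -
  have i: "f integrable_on {0..t}" "g integrable_on {0..t}"
    by (intro integrable_continuous_real continuous_on_subset[OF f] continuous_on_subset[OF g]; auto)+
  have h: "((\<lambda>s. C * exp (k * s)) has_integral (C * exp (k * t) / k - C * exp (k * 0) / k)) {0..t}"
    using k t by (intro fundamental_theorem_of_calculus)
      (auto intro!: derivative_eq_intros simp: has_real_derivative_iff_has_vector_derivative[symmetric])
  have "\<bar>integral {0..t} f - integral {0..t} g\<bar> = norm (integral {0..t} (\<lambda>s. f s - g s))"
    using i by (simp add: Henstock_Kurzweil_Integration.integral_diff)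
  also have "\<dots> \<le> integral {0..t} (\<lambda>s. C * exp (k * s))"
    using h le by (intro integral_norm_bound_integral Henstock_Kurzweil_Integration.integrable_diff i) auto
  also have "\<dots> = C * exp (k * t) / k - C * exp (k * 0) / k" by (rule integral_unique[OF h])
  also have "\<dots> \<le> C * exp (k * t) / k" using \<open>C \<ge> 0\<close> k by simp
  finally show ?thesis .
qed

definition picard :: "nat \<Rightarrow> real \<Rightarrow> (real \<Rightarrow> real) \<Rightarrow> real \<Rightarrow> real" where
  "picard d p u r = 1 - integral {0..r} (\<lambda>t. flux d p u t / t ^ (d + 1))"

lemma picard_bound:
  assumes p: "p > 1" and u: "continuous_on {0..} u" and r: "r \<ge> 0"
  shows "\<bar>picard d p u r\<bar> \<le> 1 + r\<^sup>2"
proof -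
  let ?V = "\<lambda>t. flux d p u t / t ^ (d + 1)"
  have V: "0 \<le> ?V t \<and> ?V t \<le> r" if "t \<in> {0..r}" for t
  proof -
    have "?V t \<le> t" using flux_facts(3)[OF p u, of t d] that by (cases "t = 0") (auto simp: divide_le_eq mult_ac)
    then show ?thesis using flux_facts(3)[OF p u, of t d] that by auto
  qed
  have i: "?V integrable_on {0..r}"
    by (intro integrable_continuous_real continuous_on_subset[OF flux_facts(4)[OF p u]]) auto
  have "0 \<le> integral {0..r} ?V" using V by (intro integral_nonneg i) auto
  moreover have "integral {0..r} ?V \<le> integral {0..r} (\<lambda>t. r)" using V by (intro integral_le i) auto
  ultimately show ?thesis using r by (simp add: picard_def power2_eq_square)
qed

text \<open>For s \<le> t the weight s^(d+1) of the inner integral is at most the t^(d+1) by which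
  it is divided, so the singular coefficient at 0 does not affect the Lipschitz estimate.\<close>

lemma picard_contraction:
  assumes p: "p > 1" and u: "continuous_on {0..} u" and v: "continuous_on {0..} v" and k: "k > 0" and D: "D \<ge> 0"
    and le: "\<And>s. s \<ge> 0 \<Longrightarrow> \<bar>u s - v s\<bar> \<le> D * exp (k * s)" and r: "r \<ge> 0"
  shows "\<bar>picard d p u r - picard d p v r\<bar> \<le> p * D / k\<^sup>2 * exp (k * r)"
proof -
  have fl: "\<bar>flux d p u t / t ^ (d + 1) - flux d p v t / t ^ (d + 1)\<bar> \<le> p * D / k * exp (k * t)" if t: "t \<ge> 0" for t
  proof (cases "t = 0")
    case False
    then have t0: "t > 0" using t by simp
    have cu: "continuous_on {0..} (\<lambda>s. s ^ (d + 1) * trunc_powr p (u s))" "continuous_on {0..} (\<lambda>s. s ^ (d + 1) * trunc_powr p (v s))"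
      by (intro continuous_intros continuous_trunc_powr p u v)+
    have "\<bar>flux d p u t - flux d p v t\<bar> \<le> (t ^ (d + 1) * (p * D)) * exp (k * t) / k"
      unfolding flux_def
    proof (rule exp_integral_le[OF cu k t])
      fix s assume s: "s \<in> {0..t}"
      have "\<bar>trunc_powr p (u s) - trunc_powr p (v s)\<bar> \<le> p * (D * exp (k * s))"
        using trunc_powr_lipschitz[OF p, of "u s" "v s"] le[of s] s p by (smt (verit) atLeastAtMost_iff mult_left_mono)
      then have "s ^ (d + 1) * \<bar>trunc_powr p (u s) - trunc_powr p (v s)\<bar> \<le> t ^ (d + 1) * (p * (D * exp (k * s)))"
        using s by (intro mult_mono power_mono) auto
      then show "\<bar>s ^ (d + 1) * trunc_powr p (u s) - s ^ (d + 1) * trunc_powr p (v s)\<bar> \<le> (t ^ (d + 1) * (p * D)) * exp (k * s)"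
        using s by (simp add: right_diff_distrib[symmetric] abs_mult mult.assoc)
    qed (use t D p in auto)
    then have "\<bar>flux d p u t - flux d p v t\<bar> / t ^ (d + 1) \<le> (t ^ (d + 1) * (p * D)) * exp (k * t) / k / t ^ (d + 1)"
      using t0 by (intro divide_right_mono) auto
    then show ?thesis using t0 by (simp add: diff_divide_distrib[symmetric] abs_divide mult_ac)
  qed (use D p k in auto)
  have "\<bar>picard d p u r - picard d p v r\<bar> = \<bar>integral {0..r} (\<lambda>t. flux d p u t / t ^ (d + 1)) - integral {0..r} (\<lambda>t. flux d p v t / t ^ (d + 1))\<bar>"
    by (simp add: picard_def abs_minus_commute)
  also have "\<dots> \<le> p * D / k * exp (k * r) / k"
    using fl D p k by (intro exp_integral_le flux_facts p u v r) auto
  finally show ?thesis by (simp add: power2_eq_square)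
qed

theorem lane_emden_exists:
  assumes p: "p > 1" and sub: "(real d + 2) / (p + 1) > real d / 2"
  obtains U M where "lane_emden d p U M"
proof -
  \<comment> \<open>This makes the contraction constant p / k^2 = 1 / (4 p) less than 1/2, and k > 2
    gives 1 + r^2 \<le> e^(k r), so that the weighted iterates stay bounded.\<close>
  define k where "k = 2 * p"
  have k: "k > 2" using p by (simp add: k_def)
  define lift where "lift (W :: real \<Rightarrow>\<^sub>C real) s = exp (k * s) * apply_bcontfun W s" for W s
  have cl: "continuous_on {0..} (lift W)" for W
    unfolding lift_def by (intro continuous_intros continuous_on_apply_bcontfun)
  \<comment> \<open>The unknown is W = e^(-k r) U, whose sup norm is the weighted norm of U. Bounded
    continuous functions live on the whole line, so the iterate is extended constantly to the left
    by \<open>max 0 r\<close>.\<close>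
  define G where "G W r = exp (- k * max 0 r) * picard d p (lift W) (max 0 r)" for W r
  have cP: "continuous_on {0..} (picard d p u)" if "continuous_on {0..} u" for u
    unfolding picard_def[abs_def] by (intro continuous_intros integral_continuous_from_0 flux_facts p that)
  have Gb: "G W \<in> bcontfun" for W
  proof (rule bcontfun_normI)
    have "continuous_on UNIV (\<lambda>r. picard d p (lift W) (max 0 r))"
      by (rule continuous_on_compose2[OF cP[OF cl]]) (auto intro!: continuous_intros)
    then show "continuous_on UNIV (G W)" unfolding G_def[abs_def] by (intro continuous_intros)
    fix r :: real
    define s where "s = max 0 r"
    have s: "s \<ge> 0" by (simp add: s_def)
    have "2 * s \<le> k * s" using k s by (intro mult_right_mono) auto
    then have "(2 * s)\<^sup>2 \<le> (k * s)\<^sup>2" using s by (intro power_mono) auto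
    then have "4 * s\<^sup>2 \<le> (k * s)\<^sup>2" by (simp add: power_mult_distrib)
    moreover have "0 \<le> k * s" "0 \<le> s\<^sup>2" using k s by auto
    ultimately have "1 + s\<^sup>2 \<le> 1 + k * s + (k * s)\<^sup>2 / 2" by linarith
    also have "\<dots> \<le> exp (k * s)" using k s by (intro exp_lower_Taylor_quadratic) auto
    finally have "exp (- (k * s)) * \<bar>picard d p (lift W) s\<bar> \<le> exp (- (k * s)) * exp (k * s)"
      using picard_bound[OF p cl s, of d W] by (intro mult_left_mono) auto
    also have "\<dots> = 1" by (simp add: exp_minus)
    finally show "norm (G W r) \<le> 1" by (simp add: G_def s_def abs_mult)
  qed
  define \<Phi> where "\<Phi> W = Bcontfun (G W)" for W
  have app: "apply_bcontfun (\<Phi> W) = G W" for W using Gb by (simp add: \<Phi>_def Bcontfun_inverse)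
  have "\<exists>!W. \<Phi> W = W"
  proof (rule banach_fix_type[of "1/2"])
    show "\<forall>V W. dist (\<Phi> V) (\<Phi> W) \<le> 1/2 * dist V W"
    proof (intro allI dist_bound)
      fix V W and r :: real
      define s where "s = max 0 r"
      have s: "s \<ge> 0" by (simp add: s_def)
      have "\<bar>picard d p (lift V) s - picard d p (lift W) s\<bar> \<le> p * dist V W / k\<^sup>2 * exp (k * s)"
      proof (rule picard_contraction[OF p cl cl _ _ _ s])
        fix t :: real
        have "\<bar>lift V t - lift W t\<bar> = exp (k * t) * dist (apply_bcontfun V t) (apply_bcontfun W t)"
          by (simp add: lift_def dist_real_def right_diff_distrib[symmetric] abs_mult)
        also have "\<dots> \<le> exp (k * t) * dist V W" by (intro mult_left_mono dist_bounded) auto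
        finally show "\<bar>lift V t - lift W t\<bar> \<le> dist V W * exp (k * t)" by (simp add: mult.commute)
      qed (use k in auto)
      then have "exp (- (k * s)) * \<bar>picard d p (lift V) s - picard d p (lift W) s\<bar> \<le> exp (- (k * s)) * (p * dist V W / k\<^sup>2 * exp (k * s))"
        by (intro mult_left_mono) auto
      also have "\<dots> = p / k\<^sup>2 * dist V W" by (simp add: exp_minus)
      also have "\<dots> \<le> 1/2 * dist V W"
      proof (rule mult_right_mono)
        have "p / k\<^sup>2 = 1 / (4 * p)" using p by (simp add: k_def power2_eq_square)
        also have "\<dots> \<le> 1 / 2" using p by simp
        finally show "p / k\<^sup>2 \<le> 1 / 2" .
      qed simp
      finally show "dist (apply_bcontfun (\<Phi> V) r) (apply_bcontfun (\<Phi> W) r) \<le> 1/2 * dist V W"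
        by (simp add: app G_def s_def dist_real_def right_diff_distrib[symmetric] abs_mult)
    qed
  qed auto
  then obtain W where W: "\<Phi> W = W" by blast
  define U where "U = lift W"
  have cU: "continuous_on {0..} U" using cl by (simp add: U_def)
  have fix_eq: "U r = picard d p U r" if "r \<ge> 0" for r
  proof -
    have "apply_bcontfun W r = G W r" using app[of W] W by simp
    then show ?thesis using that by (simp add: U_def lift_def G_def mult.assoc[symmetric] exp_add[symmetric])
  qed
  have "lane_emden d p U (flux d p U)"
    unfolding lane_emden_def
  proof (intro conjI allI impI)
    show "U 0 = 1" using fix_eq[of 0] by (simp add: picard_def)
    fix r :: real assume r: "0 < r"
    have "((\<lambda>r. 1 - integral {0..r} (\<lambda>t. flux d p U t / t ^ (d + 1))) has_real_derivative 0 - flux d p U r / r ^ (d + 1)) (at r)"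
      by (intro DERIV_diff DERIV_const integral_derivative_at flux_facts p cU r)
    then have "(picard d p U has_real_derivative - flux d p U r / r ^ (d + 1)) (at r)"
      by (simp add: picard_def[abs_def])
    then show "(U has_real_derivative - flux d p U r / r ^ (d + 1)) (at r)"
      by (rule has_field_derivative_transform_within_open[where S="{0<..}"]) (use r fix_eq in auto)
  qed (use p sub cU flux_facts[OF p cU] in auto)
  then show thesis by (rule that)
qed

text \<open>U decreases from 1 because M \<ge> 0. While it is positive it therefore lies in (0, 1],
  where the truncated and the true power agree.\<close>

lemma lane_emden_profile:
  assumes L: "lane_emden d p U M" and S: "S > 0" and pos: "\<And>r. r \<in> {0..S} \<Longrightarrow> U r > 0"
  shows "profile d p S U M" "\<And>r. r \<in> {0..S} \<Longrightarrow> U r \<le> 1"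
proof -
  have le1: "U r \<le> 1" if "r \<in> {0..S}" for r
  proof -
    have "- U 0 \<le> - U r"
    proof (rule derivative_nonneg_imp_le[where f="\<lambda>r. - U r" and a=0 and b=r])
      show "continuous_on {0..r} (\<lambda>r. - U r)"
        using L unfolding lane_emden_def by (auto intro!: continuous_intros intro: continuous_on_subset)
      fix x assume x: "0 < x" "x < r"
      have "((\<lambda>r. - U r) has_real_derivative - (- M x / x ^ (d + 1))) (at x)"
        using L x unfolding lane_emden_def by (intro DERIV_minus) auto
      moreover have "0 \<le> - (- M x / x ^ (d + 1))" using L x unfolding lane_emden_def by auto
      ultimately show "\<exists>y. ((\<lambda>r. - U r) has_real_derivative y) (at x) \<and> 0 \<le> y" by blast
    qed (use that in auto)
    then show ?thesis using L by (simp add: lane_emden_def)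
  qed
  then show "\<And>r. r \<in> {0..S} \<Longrightarrow> U r \<le> 1" .
  have "\<exists>K. \<forall>r\<in>{0<..S}. U r \<le> K \<and> \<bar>M r\<bar> \<le> K * r ^ (d + 2)"
    using L le1 by (intro exI[of _ 1]) (auto simp: lane_emden_def)
  moreover have "(M has_real_derivative r ^ (d + 1) * U r powr p) (at r)" if "r \<in> {0<..<S}" for r
    using L that pos[of r] le1[of r] trunc_powr_eq[of "U r" p] by (auto simp: lane_emden_def)
  ultimately show "profile d p S U M"
    using L S pos unfolding lane_emden_def profile_def
    by (auto intro: continuous_on_subset)
qed

section \<open>Existence and uniqueness of the radius at which the Robin condition holds\<close>

lemma profile_log_slope_increasing:
  assumes P: "profile d p S \<phi> m" and r: "0 < r" "r < s" "s \<le> S"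
  shows "log_slope d \<phi> m r < log_slope d \<phi> m s"
proof (rule DERIV_pos_imp_increasing_open[where f="log_slope d \<phi> m", OF r(2)])
  have pos: "\<And>r. r \<in> {0<..S} \<Longrightarrow> \<phi> r > 0" and p: "p > 1" using P by (auto simp: profile_def)
  have c: "continuous_on {r..s} \<phi>" "continuous_on {r..s} m"
    using P r unfolding profile_def by (auto intro: continuous_on_subset)
  show "continuous_on {r..s} (log_slope d \<phi> m)"
    unfolding log_slope_def[abs_def]
  proof (intro continuous_intros c ballI)
    fix x assume "x \<in> {r..s}"
    then show "x ^ d * \<phi> x \<noteq> 0" using pos[of x] r by auto
  qed
  fix x assume x: "r < x" "x < s"
  then have x': "x \<in> {0<..<S}" "x \<in> {0<..S}" "x > 0" using r by auto
  have "2 * pohozaev d p \<phi> m x / (x ^ d * (\<phi> x)\<^sup>2) > 0"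
    using profile_pohozaev_pos[OF P x'(2)] x' pos[OF x'(2)] by simp
  moreover have "(p - 1) / (p + 1) * (x\<^sup>2 * \<phi> x powr (p - 1)) > 0" using p x' pos[OF x'(2)] by simp
  ultimately have "(2 * pohozaev d p \<phi> m x / (x ^ d * (\<phi> x)\<^sup>2) + (p - 1) / (p + 1) * (x\<^sup>2 * \<phi> x powr (p - 1))) / x > 0"
    using x'(3) by simp
  moreover have "(log_slope d \<phi> m has_real_derivative
    (2 * pohozaev d p \<phi> m x / (x ^ d * (\<phi> x)\<^sup>2) + (p - 1) / (p + 1) * (x\<^sup>2 * \<phi> x powr (p - 1))) / x) (at x)"
    using P x' pos[OF x'(2)] unfolding profile_def by (intro log_slope_derivative) auto
  ultimately show "\<exists>y. (log_slope d \<phi> m has_real_derivative y) (at x) \<and> 0 < y" by blast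
qed

text \<open>The condition says that the logarithmic slope equals b at S and at T, and on the larger
  of the two intervals this slope is strictly increasing.\<close>

lemma lane_emden_root_unique:
  assumes L: "lane_emden d p U M" and S: "0 < S" "\<And>r. r \<in> {0..S} \<Longrightarrow> U r > 0" "M S = b * S ^ d * U S"
    and T: "0 < T" "\<And>r. r \<in> {0..T} \<Longrightarrow> U r > 0" "M T = b * T ^ d * U T"
  shows "S = T"
proof -
  have *: False if "0 < S" "S < T" "\<And>r. r \<in> {0..T} \<Longrightarrow> U r > 0" "M S = b * S ^ d * U S" "M T = b * T ^ d * U T" for S T
  proof -
    have "log_slope d U M S < log_slope d U M T"
      using that by (intro profile_log_slope_increasing[OF lane_emden_profile(1)[OF L, of T]]) auto
    moreover have "log_slope d U M S = b" "log_slope d U M T = b"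
      using that(1,2,4,5) that(3)[of S] that(3)[of T] by (auto simp: log_slope_def)
    ultimately show False by simp
  qed
  show ?thesis using *[of S T] *[of T S] S T by (meson linorder_neqE)
qed

lemma log_growth_unbounded:
  fixes f :: "real \<Rightarrow> real"
  assumes "a > 0" "k > 0" and d: "\<And>r. r \<ge> a \<Longrightarrow> \<exists>y. (f has_real_derivative y) (at r) \<and> r * y \<ge> k"
    and bd: "\<And>r. r \<ge> a \<Longrightarrow> f r \<le> B"
  shows False
proof -
  \<comment> \<open>Chosen so that k ln (r / a) = B - f(a) + k, which exceeds the room B - f(a) left
    for the growth of f.\<close>
  define r where "r = a * exp ((B - f a) / k + 1)"
  have "(B - f a) / k + 1 \<ge> 0" using bd[of a] assms by simp
  then have r: "r \<ge> a" using assms by (simp add: r_def)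
  have "f a - k * ln a \<le> f r - k * ln r"
  proof (rule derivative_nonneg_imp_le[where f="\<lambda>r. f r - k * ln r", OF r])
    have "isCont f x" if "x \<in> {a..r}" for x using d[of x] that DERIV_isCont by auto
    then have "continuous_on {a..r} f" by (intro continuous_at_imp_continuous_on) auto
    then show "continuous_on {a..r} (\<lambda>r. f r - k * ln r)" using assms(1) by (intro continuous_intros) auto
    fix x assume x: "a < x" "x < r"
    then obtain y where y: "(f has_real_derivative y) (at x)" "x * y \<ge> k" using d[of x] by auto
    have "((\<lambda>r. f r - k * ln r) has_real_derivative y - k * (1 / x)) (at x)"
      using x assms(1) by (auto intro!: derivative_eq_intros y)
    moreover have "0 \<le> y - k * (1 / x)" using y(2) x assms(1) by (simp add: field_simps)
    ultimately show "\<exists>y. ((\<lambda>r. f r - k * ln r) has_real_derivative y) (at x) \<and> 0 \<le> y" by blast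
  qed
  moreover have "ln r = ln a + ((B - f a) / k + 1)" using assms by (simp add: r_def ln_mult)
  ultimately have "f r \<ge> f a + k * ((B - f a) / k + 1)" by (simp add: algebra_simps)
  also have "k * ((B - f a) / k + 1) = B - f a + k" using assms by (simp add: field_simps)
  finally show False using bd[OF r] assms by simp
qed

text \<open>For a positive U with bounded slope L, the quantity r L' = q + (p-1) / (p+1) y cannot
  stay above a positive constant, as L would grow logarithmically. This forces L \<le> d, since L (L
  - d) > 0 would persist. If d (p-1) \<le> 2, then y is nondecreasing from r = 1 on. Otherwise,
  while L stays below d - e, positivity of q keeps y away from 0; and once L reaches d - e, U decays
  so fast that r^(d+2) U^(p+1) tends to 0, although it dominates a multiple of the increasing
  Pohozaev function.\<close>

lemma lane_emden_log_slope_unbounded: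
  assumes L: "lane_emden d p U M" and pos: "\<And>r. r \<ge> 0 \<Longrightarrow> U r > 0"
    and bd: "\<And>r. r > 0 \<Longrightarrow> log_slope d U M r \<le> B"
  shows False
proof -
  let ?L = "log_slope d U M" and ?P = "pohozaev d p U M"
  have p: "p > 1" using L by (simp add: lane_emden_def)
  have prof: "profile d p S U M" if "S > 0" for S using lane_emden_profile(1)[OF L that] pos by auto
  have der: "(U has_real_derivative - M r / r ^ (d + 1)) (at r)" "(M has_real_derivative r ^ (d + 1) * U r powr p) (at r)" if "r > 0" for r
    using prof[of "r + 1"] that by (auto simp: profile_def)
  define y where "y r = r\<^sup>2 * U r powr (p - 1)" for r
  have yp: "y r > 0" if "r > 0" for r using that pos[of r] by (simp add: y_def)
  have Pp: "?P r > 0" if "r > 0" for r using profile_pohozaev_pos[OF prof[OF that], of r] that by simp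
  define q where "q r = 2 * ?P r / (r ^ d * (U r)\<^sup>2)" for r
  have qp: "q r > 0" if "r > 0" for r using that Pp[OF that] pos[of r] by (simp add: q_def)
  have dL: "(?L has_real_derivative (q r + (p - 1) / (p + 1) * y r) / r) (at r)"
    and q: "q r = (?L r)\<^sup>2 - real d * ?L r + 2 / (p + 1) * y r" if "r > 0" for r
    using log_slope_derivative[OF that pos p der] that by (auto simp: q_def y_def)
  have mono: "?L r \<le> ?L s" if "0 < r" "r \<le> s" for r s
    using profile_log_slope_increasing[OF prof[of s], of r s] that by (cases "r = s") auto
  have Lp: "?L r > 0" if "r > 0" for r
  proof -
    have "M 0 < M r"
    proof (rule DERIV_pos_imp_increasing_open[where f=M, OF that])
      show "continuous_on {0..r} M" using L unfolding lane_emden_def by (auto intro: continuous_on_subset)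
      show "\<exists>y. (M has_real_derivative y) (at x) \<and> 0 < y" if "0 < x" for x
        by (intro exI conjI, rule der(2)[OF that]) (use that pos[of x] in auto)
    qed
    then have "M r > 0" using L by (auto simp: lane_emden_def dest!: spec[of _ 0])
    then show ?thesis using that pos[of r] by (simp add: log_slope_def)
  qed
  have grow: False if "a > 0" "k > 0" "\<And>r. r \<ge> a \<Longrightarrow> q r + (p - 1) / (p + 1) * y r \<ge> k" for a k
  proof (rule log_growth_unbounded[of a k ?L B])
    fix r assume "a \<le> r"
    then show "\<exists>z. (?L has_real_derivative z) (at r) \<and> k \<le> r * z"
      using dL[of r] that by (intro exI[of _ "(q r + (p - 1) / (p + 1) * y r) / r"]) auto
  qed (use that bd in auto)
  have ysum: "q r + (p - 1) / (p + 1) * y r = ?L r * (?L r - real d) + y r" if "r > 0" for r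
  proof -
    have "2 / (p + 1) + (p - 1) / (p + 1) = 1" using p by (simp add: add_divide_distrib[symmetric])
    then have 1: "2 / (p + 1) * y r + (p - 1) / (p + 1) * y r = y r" by (metis distrib_right mult_1)
    have "q r + (p - 1) / (p + 1) * y r = (?L r)\<^sup>2 - real d * ?L r + (2 / (p + 1) * y r + (p - 1) / (p + 1) * y r)"
      using q[OF that] by linarith
    also have "\<dots> = ?L r * (?L r - real d) + y r" unfolding 1 by (simp add: power2_eq_square algebra_simps)
    finally show ?thesis .
  qed
  have Ld: "?L r \<le> real d" if "r > 0" for r
  proof (rule ccontr)
    assume "\<not> ?thesis"
    then have k: "?L r * (?L r - real d) > 0" using Lp[OF that] by simp
    show False
    proof (rule grow[OF that k])
      fix s assume s: "r \<le> s"
      have "?L r * (?L r - real d) \<le> ?L s * (?L s - real d)"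
        using mono[OF that s] Lp[OF that] \<open>\<not> ?L r \<le> real d\<close> by (intro mult_mono) auto
      then show "?L r * (?L r - real d) \<le> q s + (p - 1) / (p + 1) * y s"
        using ysum[of s] yp[of s] that s by simp
    qed
  qed
  have d1: "real d \<ge> 1" using Ld[of 1] Lp[of 1] by (cases d) auto
  define k where "k = (p - 1) / (p + 1)"
  have kp: "k > 0" using p by (simp add: k_def)
  show False
  proof (cases "real d * (p - 1) \<le> 2")
    case True
    have ym: "y 1 \<le> y r" if "r \<ge> 1" for r
    proof (rule derivative_nonneg_imp_le[where f=y and a=1 and b=r, OF that])
      \<comment> \<open>The logarithmic derivative r y' / y equals 2 - (p-1) L, which is nonnegative
        here because L \<le> d and d (p-1) \<le> 2.\<close>
      have dy: "(y has_real_derivative y x / x * (2 - (p - 1) * ?L x)) (at x)" if x: "x > 0" for x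
      proof -
        have Ux: "U x > 0" using pos[of x] x by simp
        have "((\<lambda>r. U r powr (p - 1)) has_real_derivative (p - 1) * U x powr (p - 1 - 1) * (- M x / x ^ (d + 1))) (at x)"
          by (rule powr_compose_has_derivative[OF der(1)[OF x] Ux])
        then have "((\<lambda>r. U r powr (p - 1)) has_real_derivative (p - 1) * (U x powr (p - 1) / U x) * (- M x / x ^ (d + 1))) (at x)"
          using powr_diff[of "U x" "p - 1" 1] Ux by simp
        moreover have "((\<lambda>r. r\<^sup>2) has_real_derivative 2 * x) (at x)" by (auto intro!: derivative_eq_intros)
        ultimately have "(y has_real_derivative 2 * x * U x powr (p - 1) + (p - 1) * (U x powr (p - 1) / U x) * (- M x / x ^ (d + 1)) * x\<^sup>2) (at x)"
          unfolding y_def[abs_def] by (intro DERIV_mult)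
        moreover have "2 * x * U x powr (p - 1) + (p - 1) * (U x powr (p - 1) / U x) * (- M x / x ^ (d + 1)) * x\<^sup>2
          = y x / x * (2 - (p - 1) * ?L x)"
          unfolding y_def log_slope_def using x Ux by (simp add: field_simps power2_eq_square)
        ultimately show ?thesis by simp
      qed
      show "continuous_on {1..r} y"
        by (intro continuous_at_imp_continuous_on ballI DERIV_isCont[OF dy]) auto
      fix x assume x: "1 < x" "x < r"
      have "(p - 1) * ?L x \<le> (p - 1) * real d" using Ld[of x] x p by (intro mult_left_mono) auto
      then have "0 \<le> y x / x * (2 - (p - 1) * ?L x)"
        using True yp[of x] x by (intro mult_nonneg_nonneg) (auto simp: mult.commute)
      then show "\<exists>z. (y has_real_derivative z) (at x) \<and> 0 \<le> z" using dy[of x] x by auto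
    qed
    show False
    proof (rule grow[of 1 "k * y 1"])
      fix r :: real assume "1 \<le> r"
      then show "k * y 1 \<le> q r + (p - 1) / (p + 1) * y r"
        using mult_left_mono[OF ym, of r k] kp qp[of r] by (simp add: k_def)
    qed (use kp yp[of 1] in auto)
  next
    case False
    \<comment> \<open>With this e, (p+1) (d - e) - (d+2) = d (p-1) - 2 + d - 1/2, which is above 1/2
      because d (p-1) > 2 and d \<ge> 1.\<close>
    define e where "e = 1 / (2 * (p + 1))"
    have e: "e > 0" "(p + 1) * e = 1/2" using p by (auto simp: e_def)
    show False
    proof (cases "\<exists>r\<ge>1. ?L r \<ge> real d - e")
      case False
      have c: "?L 1 * e > 0" using Lp[of 1] e by simp
      show False
      proof (rule grow[of 1 "k * ((p + 1) / 2 * (?L 1 * e))"])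
        fix r :: real assume r: "1 \<le> r"
        then have "?L r < real d - e" using False by auto
        then have "?L 1 * e \<le> ?L r * (real d - ?L r)"
          using mono[of 1 r] Lp[of 1] r e by (intro mult_mono) auto
        moreover have "2 / (p + 1) * y r > ?L r * (real d - ?L r)"
          using q[of r] qp[of r] r by (simp add: power2_eq_square algebra_simps)
        ultimately have "?L 1 * e \<le> 2 / (p + 1) * y r" by simp
        then have "(p + 1) / 2 * (?L 1 * e) \<le> (p + 1) / 2 * (2 / (p + 1) * y r)" using p by (intro mult_left_mono) auto
        also have "\<dots> = y r" using p by simp
        finally have "k * ((p + 1) / 2 * (?L 1 * e)) \<le> k * y r" using kp by (intro mult_left_mono) auto
        then show "k * ((p + 1) / 2 * (?L 1 * e)) \<le> q r + (p - 1) / (p + 1) * y r"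
          using qp[of r] r by (simp add: k_def)
      qed (use kp c p in auto)
    next
      case True
      then obtain a where a: "a \<ge> 1" "?L a \<ge> real d - e" by blast
      \<comment> \<open>E is the logarithm of r^(d+2) U^(p+1). Since L \<le> d, the other two terms
        of the Pohozaev function have nonpositive sum, which bounds E below; but L \<ge> d - e makes
        E decrease at least as fast as - (ln r) / 2.\<close>
      define E where "E r = (real d + 2) * ln r + (p + 1) * ln (U r)" for r
      have Plow: "?P 1 \<le> ?P r" if "r \<ge> 1" for r
      proof (rule derivative_nonneg_imp_le[where f="?P" and a=1 and b=r, OF that])
        have kap: "(real d + 2) / (p + 1) - real d / 2 > 0" using L by (simp add: lane_emden_def)
        have dP: "(?P has_real_derivative ((real d + 2) / (p + 1) - real d / 2) * (x ^ (d + 1) * U x powr (p + 1))) (at x)"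
          if "x > 0" for x using that pos[of x] der[OF that] by (intro pohozaev_derivative p) auto
        show "continuous_on {1..r} ?P"
          by (intro continuous_at_imp_continuous_on ballI DERIV_isCont[OF dP]) auto
        show "\<exists>z. (?P has_real_derivative z) (at x) \<and> 0 \<le> z" if "1 < x" for x
          by (intro exI conjI, rule dP[of x]) (use that kap in auto)
      qed
      have Elow: "ln ((p + 1) * ?P 1) \<le> E r" if r: "r \<ge> 1" for r
      proof -
        have Ur: "U r > 0" using pos[of r] r by simp
        have "M r = ?L r * (r ^ d * U r)" using r Ur by (simp add: log_slope_def)
        then have "(M r)\<^sup>2 / (2 * r ^ d) - real d / 2 * U r * M r = (?L r - real d) * (U r * M r) / 2"
          using r Ur by (simp add: power2_eq_square field_simps)
        also have "\<dots> \<le> 0"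
        proof -
          have "M r \<ge> 0" using L r by (auto simp: lane_emden_def)
          then have "(?L r - real d) * (U r * M r) \<le> 0" using Ld[of r] Ur r by (intro mult_nonpos_nonneg) auto
          then show ?thesis by simp
        qed
        finally have "?P r \<le> r\<^sup>2 * r ^ d * U r powr (p + 1) / (p + 1)" by (simp add: pohozaev_def)
        then have "(p + 1) * ?P r \<le> r\<^sup>2 * r ^ d * U r powr (p + 1)"
          using p by (simp add: pos_le_divide_eq mult.commute)
        moreover have "(p + 1) * ?P 1 \<le> (p + 1) * ?P r" using Plow[OF r] p by (intro mult_left_mono) auto
        ultimately have "(p + 1) * ?P 1 \<le> r\<^sup>2 * r ^ d * U r powr (p + 1)" by linarith
        moreover have e: "r ^ (d + 2) = r\<^sup>2 * r ^ d" by (simp add: power_add power2_eq_square)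
        ultimately have "(p + 1) * ?P 1 \<le> r ^ (d + 2) * U r powr (p + 1)" by (simp only: e)
        then have "ln ((p + 1) * ?P 1) \<le> ln (r ^ (d + 2) * U r powr (p + 1))"
          using Pp[of 1] p by (intro ln_mono) auto
        also have "\<dots> = E r" using r Ur by (simp add: E_def ln_mult ln_powr ln_realpow add.commute distrib_right)
        finally show ?thesis .
      qed
      show False
      proof (rule log_growth_unbounded[of a "1/2" "\<lambda>r. - E r" "- ln ((p + 1) * ?P 1)"])
        fix r assume r: "a \<le> r"
        then have r0: "r > 0" "r \<ge> 1" using a by auto
        have Ur: "U r > 0" using pos[of r] r0 by simp
        have "((\<lambda>r. - E r) has_real_derivative - ((real d + 2) * (1 / r) + (p + 1) * (1 / U r * (- M r / r ^ (d + 1))))) (at r)"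
          unfolding E_def using r0 Ur der(1)[OF r0(1)]
          by (auto intro!: derivative_eq_intros simp: DERIV_ln_divide)
        moreover have "- ((real d + 2) * (1 / r) + (p + 1) * (1 / U r * (- M r / r ^ (d + 1)))) = ((p + 1) * ?L r - (real d + 2)) / r"
          unfolding log_slope_def using r0 Ur by (simp add: field_simps)
        moreover have "1 / 2 \<le> r * (((p + 1) * ?L r - (real d + 2)) / r)"
        proof -
          have "?L r \<ge> real d - e" using mono[of a r] a r by linarith
          then have "(p + 1) * ?L r \<ge> (p + 1) * (real d - e)" using p by (intro mult_left_mono) auto
          also have "(p + 1) * (real d - e) = real d * (p - 1) + 2 * real d - 1/2" using e(2) by (simp add: algebra_simps)
          finally show ?thesis using False d1 r0 by simp
        qed
        ultimately show "\<exists>z. ((\<lambda>r. - E r) has_real_derivative z) (at r) \<and> 1 / 2 \<le> r * z" by metis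
      qed (use a Elow in auto)
    qed
  qed
qed

text \<open>h = M - b r^d U takes negative values arbitrarily close to 0, as U is close to 1 there
  and M \<le> r^(d+2). It becomes positive: at the first zero of U because M > 0 there, or, if U has
  no zero, because otherwise b would bound the logarithmic slope. The intermediate value theorem
  gives a root before any zero of U.\<close>

theorem lane_emden_root_exists:
  assumes L: "lane_emden d p U M" and b: "b > 0"
  obtains S where "S > 0" "\<And>r. r \<in> {0..S} \<Longrightarrow> U r > 0" "M S = b * S ^ d * U S"
proof -
  have p: "p > 1" and cU: "continuous_on {0..} U" and cM: "continuous_on {0..} M" and U0: "U 0 = 1"
    and Mb: "\<And>r. r \<ge> 0 \<Longrightarrow> 0 \<le> M r" "\<And>r. r \<ge> 0 \<Longrightarrow> M r \<le> r ^ (d + 2)"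
    using L by (auto simp: lane_emden_def)
  define h where "h r = M r - b * r ^ d * U r" for r
  have ch: "continuous_on {0..} h" unfolding h_def by (intro continuous_intros cU cM)
  have start: "\<exists>r. 0 < r \<and> r < s \<and> h r < 0" if s: "s > 0" for s
  proof -
    have "continuous (at 0 within {0..}) U" using cU by (simp add: continuous_on_eq_continuous_within)
    then have "(U \<longlongrightarrow> 1) (at_right 0)" using U0 by (auto simp: continuous_within intro: tendsto_within_subset)
    then have "\<forall>\<^sub>F r in at_right 0. U r > 1/2" by (rule order_tendstoD) simp
    moreover have "((\<lambda>r::real. r\<^sup>2) \<longlongrightarrow> 0\<^sup>2) (at_right 0)" by (intro tendsto_intros)
    then have "\<forall>\<^sub>F r in at_right 0. r\<^sup>2 < b / 2" by (rule order_tendstoD) (use b in simp)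
    moreover have "\<forall>\<^sub>F r in at_right 0. 0 < r \<and> r < s" using s by (intro eventually_at_rightI[of 0 s]) auto
    ultimately have "\<forall>\<^sub>F r in at_right 0. 0 < r \<and> r < s \<and> h r < 0"
    proof eventually_elim
      case (elim r)
      have "b * (1/2) < b * U r" using elim b by (intro mult_strict_left_mono) auto
      then have "r ^ d * r\<^sup>2 < r ^ d * (b * U r)" using elim by (intro mult_strict_left_mono) auto
      moreover have "M r \<le> r ^ d * r\<^sup>2" using Mb(2)[of r] elim by (simp add: power_add power2_eq_square mult_ac)
      ultimately have "M r < r ^ d * (b * U r)" by linarith
      then show ?case using elim by (simp add: h_def mult_ac)
    qed
    then show ?thesis using eventually_happens[of _ "at_right (0::real)"] by auto
  qed
  have root: "\<exists>S. 0 < S \<and> S < s \<and> h S = 0" if s: "s > 0" "h s > 0" for s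
  proof -
    obtain r where r: "0 < r" "r < s" "h r < 0" using start[OF s(1)] by blast
    have "\<exists>x\<ge>r. x \<le> s \<and> h x = 0"
      using r s by (intro IVT' continuous_on_subset[OF ch]) auto
    then obtain x where "r \<le> x" "x \<le> s" "h x = 0" by blast
    then show ?thesis using r s by (intro exI[of _ x]) (auto simp: less_le)
  qed
  show thesis
  proof (cases "\<exists>r\<ge>0. U r \<le> 0")
    case True
    then obtain r1 where r1: "r1 \<ge> 0" "U r1 \<le> 0" by blast
    have "closed ({0..r1} \<inter> U -` {..0})"
      by (intro continuous_closed_preimage continuous_on_subset[OF cU]) auto
    moreover have "{0..r1} \<inter> U -` {..0} = {r\<in>{0..r1}. U r \<le> 0}" by auto
    ultimately have "closed {r\<in>{0..r1}. U r \<le> 0}" by simp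
    then have "compact {r\<in>{0..r1}. U r \<le> 0}"
      unfolding compact_eq_bounded_closed
      by (intro conjI bounded_subset[OF bounded_closed_interval[of 0 r1]]) auto
    moreover have "{r\<in>{0..r1}. U r \<le> 0} \<noteq> {}" using r1 by auto
    ultimately obtain s where s: "s \<in> {0..r1}" "U s \<le> 0" "\<And>r. r \<in> {0..r1} \<Longrightarrow> U r \<le> 0 \<Longrightarrow> s \<le> r"
      using compact_attains_inf by (metis (mono_tags, lifting) mem_Collect_eq)
    have s0: "s > 0" using s(1,2) U0 by (cases "s = 0") auto
    have below: "U r > 0" if "0 \<le> r" "r < s" for r using s(1) s(3)[of r] that by force
    have "M 0 < M s"
    proof (rule DERIV_pos_imp_increasing_open[where f=M, OF s0])
      show "continuous_on {0..s} M" by (rule continuous_on_subset[OF cM]) auto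
      fix x assume x: "0 < x" "x < s"
      have "trunc_powr p (U x) > 0" using below[of x] x by (simp add: trunc_powr_def)
      then have "x ^ (d + 1) * trunc_powr p (U x) > 0" using x by simp
      moreover have "(M has_real_derivative x ^ (d + 1) * trunc_powr p (U x)) (at x)" using L x by (auto simp: lane_emden_def)
      ultimately show "\<exists>y. (M has_real_derivative y) (at x) \<and> 0 < y" by blast
    qed
    then have "M s > 0" using Mb(1)[of 0] by simp
    moreover have "b * s ^ d * U s \<le> 0" using b s0 s(2) by (intro mult_nonneg_nonpos) auto
    ultimately have "h s > 0" by (simp add: h_def)
    from root[OF s0 this] obtain S where "0 < S" "S < s" "h S = 0" by blast
    then show thesis using below by (intro that[of S]) (auto simp: h_def)
  next
    case False
    then have pos: "U r > 0" if "r \<ge> 0" for r using that by force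
    show thesis
    proof (cases "\<exists>r>0. h r > 0")
      case True
      then obtain s where "s > 0" "h s > 0" by blast
      from root[OF this] obtain S where "0 < S" "h S = 0" by blast
      then show thesis using pos by (intro that[of S]) (auto simp: h_def)
    next
      case False
      have "log_slope d U M r \<le> b" if "r > 0" for r
      proof -
        have "M r \<le> b * (r ^ d * U r)" using False that by (force simp: h_def mult.assoc)
        then show ?thesis using that pos[of r] by (simp add: log_slope_def divide_le_eq)
      qed
      then show thesis using lane_emden_log_slope_unbounded[OF L pos] by blast
    qed
  qed
qed

section \<open>Every profile is a rescaled Lane-Emden function\<close>

lemma flux_nonneg_imp_antimono:
  fixes \<phi> m :: "real \<Rightarrow> real"
  assumes c: "continuous_on {0<..R} \<phi>" and m: "\<And>r. r \<in> {0<..R} \<Longrightarrow> 0 \<le> m r"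
    and d: "\<And>r. r \<in> {0<..<R} \<Longrightarrow> (\<phi> has_real_derivative - m r / r ^ (d + 1)) (at r)" and rs: "0 < r" "r \<le> s" "s \<le> R"
  shows "\<phi> s \<le> \<phi> r"
proof -
  have "- \<phi> r \<le> - \<phi> s"
  proof (rule derivative_nonneg_imp_le[where f="\<lambda>r. - \<phi> r" and a=r and b=s, OF rs(2)])
    show "continuous_on {r..s} (\<lambda>r. - \<phi> r)" by (intro continuous_intros continuous_on_subset[OF c]) (use rs in auto)
    fix x assume "r < x" "x < s"
    then have x: "x \<in> {0<..<R}" "x \<in> {0<..R}" using rs by auto
    have "0 \<le> - (- m x / x ^ (d + 1))" using m[OF x(2)] x by simp
    then show "\<exists>y. ((\<lambda>r. - \<phi> r) has_real_derivative y) (at x) \<and> 0 \<le> y"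
      using DERIV_minus[OF d[OF x(1)]] by blast
  qed
  then show ?thesis by simp
qed

text \<open>\<phi> is nonincreasing because m \<ge> 0, and bounded, so its supremum is the limit at
  0. This limit becomes the amplitude of the rescaling.\<close>

lemma profile_limit_at_0:
  assumes P: "profile d p R \<phi> m"
  obtains a where "a > 0" "(\<phi> \<longlongrightarrow> a) (at_right 0)" "\<forall>r\<in>{0<..R}. \<phi> r \<le> a"
proof -
  obtain K where K: "\<And>r. r \<in> {0<..R} \<Longrightarrow> \<phi> r \<le> K" "\<And>r. r \<in> {0<..R} \<Longrightarrow> \<bar>m r\<bar> \<le> K * r ^ (d + 2)"
    using P unfolding profile_def by metis
  have R: "R > 0" and cphi: "continuous_on {0<..R} \<phi>" and cm: "continuous_on {0<..R} m"
    and pos: "\<And>r. r \<in> {0<..R} \<Longrightarrow> \<phi> r > 0"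
    and der: "\<And>r. r \<in> {0<..<R} \<Longrightarrow> (\<phi> has_real_derivative - m r / r ^ (d + 1)) (at r)"
      "\<And>r. r \<in> {0<..<R} \<Longrightarrow> (m has_real_derivative r ^ (d + 1) * \<phi> r powr p) (at r)"
    using P by (auto simp: profile_def)
  have limm: "(m \<longlongrightarrow> 0) (at_right 0)"
  proof (rule Lim_null_comparison)
    show "\<forall>\<^sub>F r in at_right 0. norm (m r) \<le> K * r ^ (d + 2)"
      using K(2) R by (intro eventually_at_rightI[of 0 R]) auto
    have "((\<lambda>r::real. K * r ^ (d + 2)) \<longlongrightarrow> K * 0 ^ (d + 2)) (at_right 0)" by (intro tendsto_intros)
    then show "((\<lambda>r::real. K * r ^ (d + 2)) \<longlongrightarrow> 0) (at_right 0)" by simp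
  qed
  have mnn: "0 \<le> m r" if "r \<in> {0<..R}" for r
  proof (rule derivative_nonneg_at_0_limit[OF R cm limm _ that])
    show "\<exists>y. (m has_real_derivative y) (at r) \<and> 0 \<le> y" if "r \<in> {0<..<R}" for r
      by (intro exI conjI, rule der(2)[OF that]) (use that in auto)
  qed
  have mono: "\<phi> s \<le> \<phi> r" if "0 < r" "r \<le> s" "s \<le> R" for r s
    by (rule flux_nonneg_imp_antimono[OF cphi mnn der(1) that])
  define a where "a = Sup (\<phi> ` {0<..R})"
  have bdd: "bdd_above (\<phi> ` {0<..R})" using K(1) by (intro bdd_aboveI2)
  have le: "\<phi> r \<le> a" if "r \<in> {0<..R}" for r unfolding a_def using that by (intro cSup_upper bdd) auto
  have "a > 0" using le[of R] pos[of R] R by auto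
  moreover have "(\<phi> \<longlongrightarrow> a) (at_right 0)"
  proof (rule order_tendstoI)
    fix y assume "y < a"
    then obtain r where r: "r \<in> {0<..R}" "y < \<phi> r"
      using less_cSup_iff[OF _ bdd, of y] R unfolding a_def by auto
    show "\<forall>\<^sub>F s in at_right 0. y < \<phi> s"
      using mono r by (intro eventually_at_rightI[of 0 r]) (auto intro: order_less_le_trans)
  next
    fix y assume "a < y"
    then have "\<And>s. s \<in> {0<..<R} \<Longrightarrow> \<phi> s < y"
      using le by (meson greaterThanAtMost_iff greaterThanLessThan_iff less_imp_le order_le_less_trans)
    then show "\<forall>\<^sub>F s in at_right 0. \<phi> s < y" using R by (rule eventually_at_rightI)
  qed
  ultimately show thesis using that le by blast
qed

text \<open>The scaling symmetry: l^2 = a^(p-1) is the same as a l^2 = a^p, which balances the two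
  sides of the equation. The truncation is kept, so the sign of U at l r is left open.\<close>

lemma lane_emden_rescale:
  assumes L: "lane_emden d p U M" and a: "a > 0" and l: "l > 0" and l2: "l\<^sup>2 = a powr (p - 1)" and r: "r > 0"
  shows "((\<lambda>r. a * U (l * r)) has_real_derivative - (a * M (l * r) / l ^ d) / r ^ (d + 1)) (at r)"
    and "((\<lambda>r. a * M (l * r) / l ^ d) has_real_derivative r ^ (d + 1) * (a powr p * trunc_powr p (U (l * r)))) (at r)"
proof -
  have dU: "\<And>r. r > 0 \<Longrightarrow> (U has_real_derivative - M r / r ^ (d + 1)) (at r)"
    and dM: "\<And>r. r > 0 \<Longrightarrow> (M has_real_derivative r ^ (d + 1) * trunc_powr p (U r)) (at r)"
    using L by (auto simp: lane_emden_def)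
  have al: "a * l\<^sup>2 = a powr p" using a by (simp add: l2 powr_diff)
  have "((\<lambda>r. U (l * r)) has_real_derivative (- M (l * r) / (l * r) ^ (d + 1)) * l) (at r)"
    by (rule DERIV_chain2[where f=U and g="\<lambda>r. l * r"]) (use dU l r in \<open>auto intro!: derivative_eq_intros\<close>)
  from DERIV_cmult[OF this, of a]
  show "((\<lambda>r. a * U (l * r)) has_real_derivative - (a * M (l * r) / l ^ d) / r ^ (d + 1)) (at r)"
    using l r by (simp add: power_mult_distrib mult_ac)
  have "((\<lambda>r. M (l * r)) has_real_derivative ((l * r) ^ (d + 1) * trunc_powr p (U (l * r))) * l) (at r)"
    by (rule DERIV_chain2[where f=M and g="\<lambda>r. l * r"]) (use dM l r in \<open>auto intro!: derivative_eq_intros\<close>)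
  from DERIV_cdivide[OF DERIV_cmult[OF this, of a], of "l ^ d"]
  have "((\<lambda>r. a * M (l * r) / l ^ d) has_real_derivative a * (((l * r) ^ (d + 1) * trunc_powr p (U (l * r))) * l) / l ^ d) (at r)"
    by simp
  moreover have "a * (((l * r) ^ (d + 1) * trunc_powr p (U (l * r))) * l) / l ^ d = r ^ (d + 1) * ((a * l\<^sup>2) * trunc_powr p (U (l * r)))"
    using l by (simp add: power_mult_distrib power2_eq_square)
  ultimately show "((\<lambda>r. a * M (l * r) / l ^ d) has_real_derivative r ^ (d + 1) * (a powr p * trunc_powr p (U (l * r)))) (at r)"
    by (simp only: al)
qed

text \<open>Uniqueness for the initial value problem at the singular point r = 0, with \<psi>
  matched to \<phi> by the limit a. For D = \<phi> - \<psi> and q = - D' the only singular term in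
  q' is - (d+1) q / r, which has the damping sign. Hence (D^2 + q^2) e^(-(L+1) r) is nonincreasing
  and nonnegative, and it starts from 0.\<close>

lemma profile_eq_rescaled_lane_emden:
  assumes P: "profile d p R \<phi> m" and L: "lane_emden d p U M"
  obtains a l where "a > 0" "l > 0" "l\<^sup>2 = a powr (p - 1)"
    "\<And>r. r \<in> {0<..R} \<Longrightarrow> \<phi> r = a * U (l * r)" "\<And>r. r \<in> {0<..R} \<Longrightarrow> m r = a * M (l * r) / l ^ d"
proof -
  obtain a where a0: "a > 0" "(\<phi> \<longlongrightarrow> a) (at_right 0)" "\<forall>r\<in>{0<..R}. \<phi> r \<le> a"
    by (rule profile_limit_at_0[OF P])
  note a = a0(1,2) a0(3)[rule_format]
  obtain K where K: "\<And>r. r \<in> {0<..R} \<Longrightarrow> \<phi> r \<le> K" "\<And>r. r \<in> {0<..R} \<Longrightarrow> \<bar>m r\<bar> \<le> K * r ^ (d + 2)"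
    using P unfolding profile_def by metis
  have R: "R > 0" and p: "p > 1" and cphi: "continuous_on {0<..R} \<phi>" and cm: "continuous_on {0<..R} m"
    and pos: "\<And>r. r \<in> {0<..R} \<Longrightarrow> \<phi> r > 0"
    and der: "\<And>r. r \<in> {0<..<R} \<Longrightarrow> (\<phi> has_real_derivative - m r / r ^ (d + 1)) (at r)"
      "\<And>r. r \<in> {0<..<R} \<Longrightarrow> (m has_real_derivative r ^ (d + 1) * \<phi> r powr p) (at r)"
    using P by (auto simp: profile_def)
  have cU: "continuous_on {0..} U" and cM: "continuous_on {0..} M" and U0: "U 0 = 1"
    and Mb: "\<And>r. r \<ge> 0 \<Longrightarrow> 0 \<le> M r" "\<And>r. r \<ge> 0 \<Longrightarrow> M r \<le> r ^ (d + 2)"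
    using L by (auto simp: lane_emden_def)
  define l where "l = a powr ((p - 1) / 2)"
  have l: "l > 0" using a by (simp add: l_def)
  have l2: "l\<^sup>2 = a powr (p - 1)" using a by (simp add: l_def power2_eq_square powr_add[symmetric])
  define \<psi> where "\<psi> r = a * U (l * r)" for r
  define n where "n r = a * M (l * r) / l ^ d" for r
  have d\<psi>: "(\<psi> has_real_derivative - n r / r ^ (d + 1)) (at r)"
    and dn: "(n has_real_derivative r ^ (d + 1) * (a powr p * trunc_powr p (U (l * r)))) (at r)" if "r > 0" for r
    using lane_emden_rescale[OF L a(1) l l2 that] unfolding \<psi>_def[abs_def] n_def[abs_def] by simp_all
  have powphi: "\<phi> r powr p = a powr p * trunc_powr p (\<phi> r / a)" if "r \<in> {0<..R}" for r
    using pos[OF that] a(1) a(3)[OF that] by (subst trunc_powr_eq) (auto simp: powr_divide)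
  \<comment> \<open>The Lipschitz constant of the truncated nonlinearity s -> a^p
    \<open>trunc_powr p (s / a)\<close>, which is s^p for 0 < s \<le> a.\<close>
  define L where "L = a powr p * p / a"
  have Lp: "L > 0" using a p by (simp add: L_def)
  define D where "D r = \<phi> r - \<psi> r" for r
  define q where "q r = (m r - n r) / r ^ (d + 1)" for r
  define E where "E r = - (((D r)\<^sup>2 + (q r)\<^sup>2) * exp (- ((L + 1) * r)))" for r
  have cln: "continuous_on {0<..R} (\<lambda>r. U (l * r))" "continuous_on {0<..R} (\<lambda>r. M (l * r))"
    by (rule continuous_on_compose2[OF cU] continuous_on_compose2[OF cM]; use l in \<open>auto intro!: continuous_intros\<close>)+
  have cD: "continuous_on {0<..R} D" unfolding D_def \<psi>_def by (intro continuous_intros cphi cln)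
  have cq: "continuous_on {0<..R} q" unfolding q_def n_def using l by (intro continuous_intros cm cln) auto
  have cE: "continuous_on {0<..R} E" unfolding E_def by (intro continuous_intros cD cq)
  have limD: "(D \<longlongrightarrow> 0) (at_right 0)"
  proof -
    have "continuous (at 0 within {0..}) U" using cU by (simp add: continuous_on_eq_continuous_within)
    then have "(U \<longlongrightarrow> U 0) (at 0 within {0..})" by (simp add: continuous_within)
    moreover have "filterlim (\<lambda>r. l * r) (at 0 within {0..}) (at_right 0)"
    proof -
      have "((\<lambda>r. l * r) \<longlongrightarrow> l * 0) (at_right 0)" by (intro tendsto_intros)
      then show ?thesis
        unfolding filterlim_at using l by (auto intro!: eventually_at_rightI[of 0 1])
    qed
    ultimately have "((\<lambda>r. U (l * r)) \<longlongrightarrow> 1) (at_right 0)" using U0 by (simp add: filterlim_compose)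
    then have "((\<lambda>r. \<phi> r - a * U (l * r)) \<longlongrightarrow> a - a * 1) (at_right 0)" by (intro tendsto_intros a)
    then show ?thesis by (simp add: D_def[abs_def] \<psi>_def)
  qed
  have limq: "(q \<longlongrightarrow> 0) (at_right 0)"
  proof (rule Lim_null_comparison)
    let ?C = "K + a * l\<^sup>2"
    show "\<forall>\<^sub>F r in at_right 0. norm (q r) \<le> ?C * r"
    proof (rule eventually_at_rightI[of 0 R])
      fix r assume "r \<in> {0<..<R}"
      then have r: "r > 0" "r \<in> {0<..R}" by auto
      have "\<bar>n r\<bar> \<le> a * (l * r) ^ (d + 2) / l ^ d"
        unfolding n_def using Mb[of "l * r"] l r a by (auto intro!: divide_right_mono mult_left_mono simp: abs_mult)
      also have "\<dots> = a * l\<^sup>2 * r ^ (d + 2)" using l by (simp add: power_mult_distrib power2_eq_square)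
      finally have "\<bar>m r - n r\<bar> \<le> ?C * r ^ (d + 2)" using K(2)[OF r(2)] by (simp add: distrib_right)
      then have "\<bar>m r - n r\<bar> / r ^ (d + 1) \<le> ?C * r ^ (d + 2) / r ^ (d + 1)" using r by (intro divide_right_mono) auto
      also have "\<dots> = ?C * r" using r by simp
      finally show "norm (q r) \<le> ?C * r" using r by (simp add: q_def abs_divide)
    qed (rule R)
    have "((\<lambda>r. ?C * r) \<longlongrightarrow> ?C * 0) (at_right 0)" by (intro tendsto_intros)
    then show "((\<lambda>r. ?C * r) \<longlongrightarrow> 0) (at_right 0)" by simp
  qed
  have limE: "(E \<longlongrightarrow> 0) (at_right 0)"
  proof -
    have "(E \<longlongrightarrow> - ((0\<^sup>2 + 0\<^sup>2) * exp (- ((L + 1) * 0)))) (at_right 0)"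
      unfolding E_def[abs_def] by (intro tendsto_intros limD limq)
    then show ?thesis by simp
  qed
  have dE: "\<exists>y. (E has_real_derivative y) (at r) \<and> 0 \<le> y" if r': "r \<in> {0<..<R}" for r
  proof -
    have r: "r > 0" "r \<in> {0<..R}" using r' by auto
    define F where "F = a powr p * (trunc_powr p (\<phi> r / a) - trunc_powr p (\<psi> r / a))"
    have dD: "(D has_real_derivative - q r) (at r)"
      unfolding D_def[abs_def] q_def
      by (rule DERIV_cong[OF DERIV_diff[OF der(1)[OF r'] d\<psi>[OF r(1)]]]) (simp add: diff_divide_distrib)
    have dmn: "((\<lambda>r. m r - n r) has_real_derivative r ^ (d + 1) * F) (at r)"
      by (rule DERIV_cong[OF DERIV_diff[OF der(2)[OF r'] dn[OF r(1)]]])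
        (use a in \<open>simp add: F_def powphi[OF r(2)] \<psi>_def algebra_simps\<close>)
    have dq: "(q has_real_derivative F - (real d + 1) * q r / r) (at r)"
    proof -
      have "r ^ (d + 1) \<noteq> 0" using r by simp
      from DERIV_divide[OF dmn power_has_derivative_pos[OF r(1), of "d + 1"] this]
      have "(q has_real_derivative (r ^ (d + 1) * F * r ^ (d + 1) - (m r - n r) * (real (d + 1) * r ^ (d + 1) / r)) / (r ^ (d + 1) * r ^ (d + 1))) (at r)"
        by (simp add: q_def[abs_def])
      moreover have "(r ^ (d + 1) * F * r ^ (d + 1) - (m r - n r) * (real (d + 1) * r ^ (d + 1) / r)) / (r ^ (d + 1) * r ^ (d + 1)) = F - (real d + 1) * q r / r"
      proof -
        define y where "y = r ^ (d + 1)"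
        have "y > 0" using r by (simp add: y_def)
        then show ?thesis unfolding q_def y_def[symmetric] using r by (simp add: field_simps)
      qed
      ultimately show ?thesis by simp
    qed
    have Fb: "\<bar>F\<bar> \<le> L * \<bar>D r\<bar>"
    proof -
      have "\<bar>trunc_powr p (\<phi> r / a) - trunc_powr p (\<psi> r / a)\<bar> \<le> p * \<bar>\<phi> r / a - \<psi> r / a\<bar>"
        by (rule trunc_powr_lipschitz[OF p])
      also have "\<dots> = p * (\<bar>D r\<bar> / a)" using a by (simp add: D_def diff_divide_distrib[symmetric] abs_divide)
      finally have "a powr p * \<bar>trunc_powr p (\<phi> r / a) - trunc_powr p (\<psi> r / a)\<bar> \<le> a powr p * (p * (\<bar>D r\<bar> / a))"
        by (intro mult_left_mono) auto
      then show ?thesis by (simp add: F_def L_def abs_mult)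
    qed
    define e where "e = exp (- ((L + 1) * r))"
    have "(E has_real_derivative - ((2 * D r * (- q r) + 2 * q r * (F - (real d + 1) * q r / r)) * e + ((D r)\<^sup>2 + (q r)\<^sup>2) * (- (L + 1) * e))) (at r)"
      unfolding E_def[abs_def] e_def by (auto intro!: derivative_eq_intros dD dq)
    moreover have "0 \<le> - ((2 * D r * (- q r) + 2 * q r * (F - (real d + 1) * q r / r)) * e + ((D r)\<^sup>2 + (q r)\<^sup>2) * (- (L + 1) * e))"
    proof -
      have "q r * F \<le> \<bar>q r\<bar> * \<bar>F\<bar>" by (simp add: abs_mult[symmetric])
      also have "\<dots> \<le> \<bar>q r\<bar> * (L * \<bar>D r\<bar>)" using Fb by (intro mult_left_mono) auto
      finally have "q r * F \<le> \<bar>q r\<bar> * (L * \<bar>D r\<bar>)" .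
      moreover have "- (D r * q r) \<le> \<bar>q r\<bar> * \<bar>D r\<bar>"
        using abs_ge_minus_self[of "D r * q r"] by (simp add: abs_mult mult.commute)
      ultimately have "2 * D r * (- q r) + 2 * (q r * F) \<le> (L + 1) * (2 * (\<bar>q r\<bar> * \<bar>D r\<bar>))" by (simp add: algebra_simps)
      also have "\<dots> \<le> (L + 1) * ((D r)\<^sup>2 + (q r)\<^sup>2)"
      proof (rule mult_left_mono)
        show "2 * (\<bar>q r\<bar> * \<bar>D r\<bar>) \<le> (D r)\<^sup>2 + (q r)\<^sup>2"
          using zero_le_power2[of "\<bar>q r\<bar> - \<bar>D r\<bar>"] by (simp add: power2_eq_square algebra_simps)
      qed (use Lp in simp)
      finally have 1: "2 * D r * (- q r) + 2 * (q r * F) \<le> (L + 1) * ((D r)\<^sup>2 + (q r)\<^sup>2)" .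
      have e1: "q r * ((real d + 1) * q r / r) = (real d + 1) * (q r)\<^sup>2 / r" by (simp add: power2_eq_square mult_ac)
      have "0 \<le> (real d + 1) * (q r)\<^sup>2 / r" using r by (intro divide_nonneg_nonneg mult_nonneg_nonneg) auto
      then have "0 \<le> 2 * (q r * ((real d + 1) * q r / r))" unfolding e1 by linarith
      then have "2 * D r * (- q r) + 2 * q r * (F - (real d + 1) * q r / r) \<le> (L + 1) * ((D r)\<^sup>2 + (q r)\<^sup>2)"
        using 1 by (simp add: right_diff_distrib)
      then have "(2 * D r * (- q r) + 2 * q r * (F - (real d + 1) * q r / r)) * e \<le> (L + 1) * ((D r)\<^sup>2 + (q r)\<^sup>2) * e"
        by (intro mult_right_mono) (auto simp: e_def)
      then show ?thesis by (simp add: algebra_simps)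
    qed
    ultimately show ?thesis by blast
  qed
  have "D r = 0 \<and> q r = 0" if r: "r \<in> {0<..R}" for r
  proof -
    have "0 \<le> E r" by (rule derivative_nonneg_at_0_limit[OF R cE limE dE r])
    then have "((D r)\<^sup>2 + (q r)\<^sup>2) * exp (- ((L + 1) * r)) \<le> 0" by (simp add: E_def)
    then have "(D r)\<^sup>2 + (q r)\<^sup>2 \<le> 0" by (simp add: mult_le_0_iff)
    then show ?thesis by (simp add: sum_power2_le_zero_iff)
  qed
  then have "\<phi> r = a * U (l * r)" "m r = a * M (l * r) / l ^ d" if "r \<in> {0<..R}" for r
    using that by (force simp: D_def q_def \<psi>_def n_def)+
  then show thesis using that a(1) l l2 by blast
qed

text \<open>Both functions have the form a U(l r). The Robin condition becomes M(s) = \<beta> R s^d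
  U(s) at s = l R, an equation in s alone with at most one root before the first zero of U; hence l
  agrees, and a is determined by l^2 = a^(p-1).\<close>

theorem profile_unique:
  assumes P: "profile d p R \<phi> m" "m R = \<beta> * R ^ (d + 1) * \<phi> R" and Q: "profile d p R \<psi> n" "n R = \<beta> * R ^ (d + 1) * \<psi> R"
    and r: "r \<in> {0<..R}"
  shows "\<phi> r = \<psi> r"
proof -
  have R: "R > 0" and p: "p > 1" and sub: "(real d + 2) / (p + 1) > real d / 2" using P(1) by (auto simp: profile_def)
  obtain U M where L: "lane_emden d p U M" using lane_emden_exists[OF p sub] .
  have U0: "U 0 = 1" using L by (simp add: lane_emden_def)
  have root: "\<exists>a l. a > 0 \<and> l > 0 \<and> l\<^sup>2 = a powr (p - 1) \<and> (\<forall>r\<in>{0<..R}. \<phi> r = a * U (l * r)) \<and>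
      (\<forall>r\<in>{0..l * R}. U r > 0) \<and> M (l * R) = \<beta> * R * (l * R) ^ d * U (l * R)"
    if P: "profile d p R \<phi> m" "m R = \<beta> * R ^ (d + 1) * \<phi> R" for \<phi> m
  proof -
    obtain a l where al: "a > 0" "l > 0" "l\<^sup>2 = a powr (p - 1)"
      "\<And>r. r \<in> {0<..R} \<Longrightarrow> \<phi> r = a * U (l * r)" "\<And>r. r \<in> {0<..R} \<Longrightarrow> m r = a * M (l * r) / l ^ d"
      using profile_eq_rescaled_lane_emden[OF P(1) L] by blast
    have pos: "U s > 0" if s: "s \<in> {0..l * R}" for s
    proof (cases "s = 0")
      case False
      then have s': "s / l \<in> {0<..R}" using s al(2) by (auto simp: divide_le_eq mult.commute)
      then have "\<phi> (s / l) > 0" using P(1) by (auto simp: profile_def)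
      then show ?thesis using al(1,2) al(4)[OF s'] by (simp add: zero_less_mult_iff)
    qed (use U0 in simp)
    have "a * M (l * R) / l ^ d = \<beta> * R ^ (d + 1) * (a * U (l * R))" using P(2) al(4)[of R] al(5)[of R] R by simp
    then have "M (l * R) = \<beta> * R * (l * R) ^ d * U (l * R)"
      using al(1,2) by (simp add: field_simps power_mult_distrib)
    then show ?thesis using al pos by blast
  qed
  obtain a l where 1: "a > 0" "l > 0" "l\<^sup>2 = a powr (p - 1)" "\<forall>r\<in>{0<..R}. \<phi> r = a * U (l * r)"
    "\<forall>r\<in>{0..l * R}. U r > 0" "M (l * R) = \<beta> * R * (l * R) ^ d * U (l * R)"
    using root[OF P] by blast
  obtain b k where 2: "b > 0" "k > 0" "k\<^sup>2 = b powr (p - 1)" "\<forall>r\<in>{0<..R}. \<psi> r = b * U (k * r)"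
    "\<forall>r\<in>{0..k * R}. U r > 0" "M (k * R) = \<beta> * R * (k * R) ^ d * U (k * R)"
    using root[OF Q] by blast
  have "l * R = k * R"
    by (rule lane_emden_root_unique[OF L _ _ 1(6) _ _ 2(6)]) (use 1 2 R in auto)
  then have lk: "l = k" using R by simp
  then have "a powr (p - 1) = b powr (p - 1)" using 1(3) 2(3) by simp
  then have "(a powr (p - 1)) powr (1 / (p - 1)) = (b powr (p - 1)) powr (1 / (p - 1))" by simp
  then have "a = b" using p 1(1) 2(1) by (simp add: powr_powr)
  then show ?thesis using 1(4) 2(4) lk r by simp
qed

text \<open>Each step improves the decay exponent of \<open>\<phi>\<close> by at least \<open>\<delta> / 2\<close>; subcriticality gives \<open>\<delta> > 0\<close>.\<close>

theorem profile_bootstrap: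
  assumes R: "R > 0" and p: "p > 1" and sub: "(real d + 2) / (p + 1) > real d / 2"
    and cphi: "continuous_on {0<..R} \<phi>" and cm: "continuous_on {0<..R} m"
    and pos: "\<And>r. r \<in> {0<..R} \<Longrightarrow> \<phi> r > 0"
    and d1: "\<And>r. r \<in> {0<..<R} \<Longrightarrow> (\<phi> has_real_derivative - m r / r ^ (d + 1)) (at r)"
    and d2: "\<And>r. r \<in> {0<..<R} \<Longrightarrow> (m has_real_derivative r ^ (d + 1) * \<phi> r powr p) (at r)"
    and m0: "(m \<longlongrightarrow> 0) (at_right 0)"
    and bd: "\<And>r. r \<in> {0<..<R} \<Longrightarrow> m r \<le> C * r powr (real d / 2)"
  shows "profile d p R \<phi> m"
proof -
  have mnn: "0 \<le> m r" if "r \<in> {0<..R}" for r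
  proof (rule derivative_nonneg_at_0_limit[OF R cm m0 _ that])
    show "\<exists>y. (m has_real_derivative y) (at r) \<and> 0 \<le> y" if "r \<in> {0<..<R}" for r
      by (intro exI conjI, rule d2[OF that]) (use that in auto)
  qed
  have rd: "r ^ (d + 1) = r powr (real d + 1)" if "r > 0" for r
    using powr_realpow[OF that, of "d + 1"] by (simp add: add.commute)
  \<comment> \<open>A bound m \<le> B r^(d+e) gives \<phi>' \<ge> - B r^(e-1), which is integrated
    from r to R. The result is a growth rate of \<phi> at 0 for e < 0 and boundedness for e >
    0.\<close>
  have phi_of_m: "\<phi> r + B / e * r powr e \<le> \<phi> R + B / e * R powr e"
    if B: "\<And>r. r \<in> {0<..<R} \<Longrightarrow> m r \<le> B * r powr (real d + e)" and e: "e \<noteq> 0" and r: "r \<in> {0<..R}" for B e r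
  proof (rule derivative_nonneg_imp_le[where f="\<lambda>r. \<phi> r + B / e * r powr e" and a=r and b=R])
    show "continuous_on {r..R} (\<lambda>r. \<phi> r + B / e * r powr e)"
      by (intro continuous_intros continuous_on_subset[OF cphi]) (use r in auto)
    fix x assume x: "r < x" "x < R"
    then have x': "x \<in> {0<..<R}" "x > 0" using r by auto
    have "((\<lambda>r. \<phi> r + B / e * r powr e) has_real_derivative - m x / x ^ (d + 1) + B / e * (e * x powr (e - 1))) (at x)"
      by (intro DERIV_add d1 x' DERIV_cmult has_real_derivative_powr)
    moreover have "0 \<le> - m x / x ^ (d + 1) + B / e * (e * x powr (e - 1))"
    proof -
      have "m x / x ^ (d + 1) \<le> B * x powr (real d + e) / x powr (real d + 1)"
        unfolding rd[OF x'(2)] using B[OF x'(1)] by (intro divide_right_mono) auto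
      also have "\<dots> = B * x powr (e - 1)" using powr_diff[of x "real d + e" "real d + 1"] by (simp add: algebra_simps)
      finally show ?thesis using e by simp
    qed
    ultimately show "\<exists>y. ((\<lambda>r. \<phi> r + B / e * r powr e) has_real_derivative y) (at x) \<and> 0 \<le> y" by blast
  qed (use r in auto)
  \<comment> \<open>Conversely, \<phi> \<le> B r^(-\<alpha>) is inserted into m' = r^(d+1) \<phi>^p
    and integrated from 0, where m has limit 0; the power is integrable because p \<alpha> < d +
    2.\<close>
  have m_of_phi: "m r \<le> B powr p / (real d + 2 - p * \<alpha>) * r powr (real d + 2 - p * \<alpha>)"
    if B: "\<And>r. r \<in> {0<..R} \<Longrightarrow> \<phi> r \<le> B * r powr (- \<alpha>)" and a: "p * \<alpha> < real d + 2" and r: "r \<in> {0<..R}" for B \<alpha> r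
  proof -
    define e where "e = real d + 2 - p * \<alpha>"
    have e: "e > 0" using a by (simp add: e_def)
    have Bp: "B > 0" using B[of R] pos[of R] R by (smt (verit) greaterThanAtMost_iff mult_nonpos_nonneg powr_ge_zero)
    have "0 \<le> B powr p / e * r powr e - m r"
    proof (rule derivative_nonneg_at_0_limit[OF R _ _ _ r, where f="\<lambda>r. B powr p / e * r powr e - m r"])
      show "continuous_on {0<..R} (\<lambda>r. B powr p / e * r powr e - m r)" by (intro continuous_intros cm) auto
      have "((\<lambda>r::real. r powr e) \<longlongrightarrow> 0 powr e) (at_right 0)"
        by (rule tendsto_powr') (use e in \<open>auto intro!: tendsto_intros eventually_at_rightI[of 0 1]\<close>)
      then have "((\<lambda>r::real. r powr e) \<longlongrightarrow> 0) (at_right 0)" by simp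
      then have "((\<lambda>r. B powr p / e * r powr e - m r) \<longlongrightarrow> B powr p / e * 0 - 0) (at_right 0)" by (intro tendsto_intros m0)
      then show "((\<lambda>r. B powr p / e * r powr e - m r) \<longlongrightarrow> 0) (at_right 0)" by simp
      fix x assume x: "x \<in> {0<..<R}"
      then have x': "x > 0" "x \<in> {0<..R}" by auto
      have "((\<lambda>r. B powr p / e * r powr e - m r) has_real_derivative B powr p / e * (e * x powr (e - 1)) - x ^ (d + 1) * \<phi> x powr p) (at x)"
        by (intro DERIV_diff d2 x DERIV_cmult has_real_derivative_powr x')
      moreover have "0 \<le> B powr p / e * (e * x powr (e - 1)) - x ^ (d + 1) * \<phi> x powr p"
      proof -
        have "\<phi> x powr p \<le> (B * x powr (- \<alpha>)) powr p" using B[OF x'(2)] pos[OF x'(2)] p by (intro powr_mono2) auto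
        also have "\<dots> = B powr p * x powr (- (p * \<alpha>))" using Bp by (simp add: powr_mult powr_powr mult.commute)
        finally have "x powr (real d + 1) * \<phi> x powr p \<le> x powr (real d + 1) * (B powr p * x powr (- (p * \<alpha>)))"
          by (intro mult_left_mono) auto
        also have "\<dots> = B powr p * x powr (e - 1)" by (simp add: e_def powr_add[symmetric] mult.left_commute algebra_simps)
        finally show ?thesis using e rd[OF x'(1)] by simp
      qed
      ultimately show "\<exists>y. ((\<lambda>r. B powr p / e * r powr e - m r) has_real_derivative y) (at x) \<and> 0 \<le> y" by blast
    qed
    then show ?thesis by (simp add: e_def)
  qed
  have weaken: "B * r powr b \<le> \<bar>B\<bar> * R powr (b - c) * r powr c" if "c \<le> b" "r \<in> {0<..R}" for B b c r
  proof -
    have "B * r powr b \<le> \<bar>B\<bar> * r powr b" by (intro mult_right_mono) auto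
    also have "\<dots> = \<bar>B\<bar> * (r powr (b - c) * r powr c)" by (simp add: powr_add[symmetric])
    also have "\<bar>B\<bar> * (r powr (b - c) * r powr c) \<le> \<bar>B\<bar> * (R powr (b - c) * r powr c)"
      using that by (intro mult_left_mono mult_right_mono powr_mono2) auto
    finally show ?thesis by (simp add: mult_ac)
  qed
  have phi_decay: "\<exists>B. \<forall>r\<in>{0<..R}. \<phi> r \<le> B * r powr (- \<alpha>)"
    if B: "\<And>r. r \<in> {0<..<R} \<Longrightarrow> m r \<le> B * r powr (real d - \<alpha>)" and a: "\<alpha> > 0" for B \<alpha>
  proof (intro exI ballI)
    fix r assume r: "r \<in> {0<..R}"
    have B0: "B \<ge> 0"
    proof -
      have "0 \<le> B * (R/2) powr (real d - \<alpha>)" using B[of "R/2"] mnn[of "R/2"] R by auto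
      then show ?thesis using R by (simp add: zero_le_mult_iff)
    qed
    have "\<phi> r \<le> \<phi> R - B / \<alpha> * R powr (- \<alpha>) + B / \<alpha> * r powr (- \<alpha>)"
      using phi_of_m[of B "- \<alpha>" r] B a r by simp
    also have "\<dots> \<le> \<phi> R * 1 + B / \<alpha> * r powr (- \<alpha>)" using B0 a by simp
    also have "\<dots> \<le> \<phi> R * (R powr \<alpha> * r powr (- \<alpha>)) + B / \<alpha> * r powr (- \<alpha>)"
    proof -
      have "1 = r powr \<alpha> * r powr (- \<alpha>)" using r by (simp add: powr_add[symmetric])
      also have "\<dots> \<le> R powr \<alpha> * r powr (- \<alpha>)" using r a by (intro mult_right_mono powr_mono2) auto
      finally show ?thesis using pos[of R] R by (intro add_right_mono mult_left_mono) auto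
    qed
    finally show "\<phi> r \<le> (\<phi> R * R powr \<alpha> + B / \<alpha>) * r powr (- \<alpha>)" by (simp add: algebra_simps)
  qed
  \<comment> \<open>For d > 0 the bound m \<le> C r^(d/2) integrates to \<phi> \<le> B r^(-d/2). For
    d = 0 it would give a logarithm, which is replaced by a small power; the exponent 1 / p
    satisfies (p-1) / p < 2 and p (1 / p) < 2.\<close>
  define \<alpha>0 where "\<alpha>0 = (if d = 0 then 1 / p else real d / 2)"
  define \<delta> where "\<delta> = 2 - (p - 1) * \<alpha>0"
  have sub': "real d * (p + 1) < 2 * real d + 4" using sub p by (simp add: field_simps)
  have a0: "\<alpha>0 > 0" using p by (auto simp: \<alpha>0_def)
  have \<delta>: "\<delta> > 0" using sub' p by (auto simp: \<delta>_def \<alpha>0_def field_simps)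
  have pa: "p * \<alpha>0 < real d + 2" using sub' p by (auto simp: \<alpha>0_def field_simps)
  have start: "\<exists>B. \<forall>r\<in>{0<..R}. \<phi> r \<le> B * r powr (- \<alpha>0)"
  proof (rule phi_decay[OF _ a0])
    fix r assume r: "r \<in> {0<..<R}"
    have "m r \<le> C * r powr (real d / 2)" by (rule bd[OF r])
    also have "\<dots> \<le> \<bar>C\<bar> * R powr (real d / 2 - (real d - \<alpha>0)) * r powr (real d - \<alpha>0)"
      using r a0 by (intro weaken) (auto simp: \<alpha>0_def)
    finally show "m r \<le> \<bar>C\<bar> * R powr (real d / 2 - (real d - \<alpha>0)) * r powr (real d - \<alpha>0)" .
  qed
  have bounded: "\<exists>K. \<forall>r\<in>{0<..R}. \<phi> r \<le> K"
    if "0 < \<alpha>" "\<alpha> \<le> \<alpha>0" "\<alpha> \<le> real (Suc k) * (\<delta> / 2)" "\<exists>B. \<forall>r\<in>{0<..R}. \<phi> r \<le> B * r powr (- \<alpha>)" for k \<alpha>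
    using that
  proof (induction k arbitrary: \<alpha>)
    case 0
    obtain B where B: "\<And>r. r \<in> {0<..R} \<Longrightarrow> \<phi> r \<le> B * r powr (- \<alpha>)" using 0(4) by blast
    have le: "(p - 1) * \<alpha> \<le> (p - 1) * \<alpha>0" using 0(2) p by (intro mult_left_mono) auto
    \<comment> \<open>p \<alpha> = (p-1) \<alpha> + \<alpha> \<le> (2 - \<delta>) + \<delta> / 2 <
      2, so the bound on \<phi>' is integrable at 0 and \<phi> is bounded.\<close>
    define e where "e = 2 - p * \<alpha>"
    have e: "e > 0" using le 0(3) \<delta> by (simp add: e_def \<delta>_def algebra_simps)
    have pa': "p * \<alpha> < real d + 2" using e by (simp add: e_def)
    define B' where "B' = B powr p / (real d + 2 - p * \<alpha>)"
    have B'0: "B' \<ge> 0" using pa' by (simp add: B'_def)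
    show ?case
    proof (intro exI ballI)
      fix r assume r: "r \<in> {0<..R}"
      have "\<phi> r + B' / e * r powr e \<le> \<phi> R + B' / e * R powr e"
      proof (rule phi_of_m[OF _ _ r])
        fix s assume "s \<in> {0<..<R}"
        then show "m s \<le> B' * s powr (real d + e)"
          using m_of_phi[OF B pa', of s] by (simp add: B'_def e_def add_diff_eq)
      qed (use e in simp)
      then show "\<phi> r \<le> \<phi> R + B' / e * R powr e" using B'0 e by (smt (verit) divide_nonneg_pos mult_nonneg_nonneg powr_ge_zero)
    qed
  next
    case (Suc k)
    obtain B where B: "\<And>r. r \<in> {0<..R} \<Longrightarrow> \<phi> r \<le> B * r powr (- \<alpha>)" using Suc.prems(4) by blast
    show ?case
    proof (cases "\<alpha> \<le> real (Suc k) * (\<delta> / 2)")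
      case True then show ?thesis using Suc.IH Suc.prems by blast
    next
      case False
      \<comment> \<open>One round turns r^(-\<alpha>) into r^(2 - p \<alpha>), and p \<alpha> - 2
        \<le> \<alpha> - \<delta>. Only half of this gain is taken, so that \<alpha>' remains
        positive.\<close>
      define \<alpha>' where "\<alpha>' = \<alpha> - \<delta> / 2"
      have "1 * (\<delta> / 2) \<le> real (Suc k) * (\<delta> / 2)" using \<delta> by (intro mult_right_mono) auto
      then have a': "0 < \<alpha>'" using False by (simp add: \<alpha>'_def)
      have le: "(p - 1) * \<alpha> \<le> (p - 1) * \<alpha>0" using Suc.prems(2) p by (intro mult_left_mono) auto
      have "p * \<alpha> \<le> p * \<alpha>0" using Suc.prems(2) p by (intro mult_left_mono) auto
      then have pa': "p * \<alpha> < real d + 2" using pa by linarith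
      have "p * \<alpha> - \<alpha> \<le> 2 - \<delta>" using le by (simp add: \<delta>_def algebra_simps)
      then have ex: "real d - \<alpha>' \<le> real d + 2 - p * \<alpha>" using \<delta> unfolding \<alpha>'_def by linarith
      define B' where "B' = B powr p / (real d + 2 - p * \<alpha>)"
      have "\<exists>B. \<forall>r\<in>{0<..R}. \<phi> r \<le> B * r powr (- \<alpha>')"
      proof (rule phi_decay[OF _ a'])
        fix r assume r: "r \<in> {0<..<R}"
        have "m r \<le> B' * r powr (real d + 2 - p * \<alpha>)" unfolding B'_def using r by (intro m_of_phi B pa') auto
        also have "\<dots> \<le> \<bar>B'\<bar> * R powr (real d + 2 - p * \<alpha> - (real d - \<alpha>')) * r powr (real d - \<alpha>')"
          using r ex by (intro weaken) auto
        finally show "m r \<le> \<bar>B'\<bar> * R powr (real d + 2 - p * \<alpha> - (real d - \<alpha>')) * r powr (real d - \<alpha>')" .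
      qed
      moreover have "\<alpha>' \<le> \<alpha>0" using Suc.prems(2) \<delta> by (simp add: \<alpha>'_def)
      moreover have "\<alpha>' \<le> real (Suc k) * (\<delta> / 2)" using Suc.prems(3) by (simp add: \<alpha>'_def algebra_simps)
      ultimately show ?thesis using Suc.IH a' by blast
    qed
  qed
  obtain k where "\<alpha>0 / (\<delta> / 2) \<le> real k" using real_arch_simple by blast
  then have "\<alpha>0 \<le> real (Suc k) * (\<delta> / 2)" using \<delta> by (simp add: divide_le_eq distrib_right)
  then obtain K where K: "\<And>r. r \<in> {0<..R} \<Longrightarrow> \<phi> r \<le> K" using bounded[OF a0 order_refl _ start] by blast
  have "\<exists>K. \<forall>r\<in>{0<..R}. \<phi> r \<le> K \<and> \<bar>m r\<bar> \<le> K * r ^ (d + 2)"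
  proof (intro exI ballI conjI)
    fix r assume r: "r \<in> {0<..R}"
    let ?K = "max K (K powr p / (real d + 2))"
    show "\<phi> r \<le> ?K" using K[OF r] by simp
    have "m r \<le> K powr p / (real d + 2 - p * 0) * r powr (real d + 2 - p * 0)"
      using K r by (intro m_of_phi) auto
    then have "m r \<le> K powr p / (real d + 2) * r ^ (d + 2)"
      using r powr_realpow[of r "d + 2"] by (simp add: add.commute)
    also have "\<dots> \<le> ?K * r ^ (d + 2)" using r by (intro mult_right_mono) auto
    finally show "\<bar>m r\<bar> \<le> ?K * r ^ (d + 2)" using mnn[OF r] by simp
  qed
  then show ?thesis unfolding profile_def using assms by auto
qed

subsection \<open>Weak solutions and profiles\<close>

lemma AE_radial:
  fixes c :: "'a::euclidean_space"
  assumes R: "R > 0" and P: "AE r in lborel. r \<in> {0<..<R} \<longrightarrow> P r" and [measurable]: "Measurable.pred borel P"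
  shows "AE x in lebesgue_on (ball c R). P (norm (x - c))"
proof -
  have [measurable]: "(\<lambda>r::real. if P r then 0 else 1 :: real) \<in> borel_measurable borel" by measurable
  have "AE r in lborel. r \<in> {0<..<R} \<longrightarrow> (if P r then 0 else 1 :: real) = 0" using P by eventually_elim auto
  then have "AE x in lebesgue_on (ball c R). (if P (norm (x - c)) then 0 else 1 :: real) = 0"
    by (subst radial_integral(3)[OF R]) auto
  then show ?thesis by eventually_elim (auto split: if_splits)
qed

lemma AE_radialD:
  fixes c :: "'a::euclidean_space"
  assumes R: "R > 0" and P: "AE x in lebesgue_on (ball c R). P (norm (x - c))" and [measurable]: "Measurable.pred borel P"
  shows "AE r in lborel. r \<in> {0<..<R} \<longrightarrow> P r"
proof -
  have [measurable]: "(\<lambda>r::real. if P r then 0 else 1 :: real) \<in> borel_measurable borel" by measurable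
  have "AE x in lebesgue_on (ball c R). (if P (norm (x - c)) then 0 else 1 :: real) = 0" using P by eventually_elim auto
  then have "AE r in lborel. r \<in> {0<..<R} \<longrightarrow> (if P r then 0 else 1 :: real) = 0"
    by (subst (asm) radial_integral(3)[OF R]) auto
  then show ?thesis by eventually_elim (auto split: if_splits)
qed

lemma AE_ball_norm:
  fixes c :: "'a::euclidean_space"
  assumes R: "R > 0"
  shows "AE x in lebesgue_on (ball c R). norm (x - c) \<in> {0<..<R}"
  by (rule AE_radial[OF R]) auto

lemma AE_eq_continuous_profile:
  fixes c :: "'a::euclidean_space" and g H :: "real \<Rightarrow> real"
  assumes R: "R > 0" and [measurable]: "g \<in> borel_measurable borel" and ug: "AE x in lebesgue_on (ball c R). u x = g (norm (x - c))"
    and gH: "AE r in lborel. r \<in> {0<..<R} \<longrightarrow> g r = H r" and cH: "continuous_on {0<..R} H"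
  shows "AE x in lebesgue_on (ball c R). u x = H (norm (x - c))"
proof -
  define H' where "H' r = indicator {0<..R} r * H r" for r
  have [measurable]: "H' \<in> borel_measurable borel"
    using borel_measurable_continuous_on_indicator[OF _ cH] by (simp add: H'_def[abs_def])
  have "AE r in lborel. r \<in> {0<..<R} \<longrightarrow> g r = H' r" using gH by eventually_elim (auto simp: H'_def)
  then have "AE x in lebesgue_on (ball c R). g (norm (x - c)) = H' (norm (x - c))" by (rule AE_radial[OF R]) measurable
  then show ?thesis using ug AE_ball_norm[OF R, of c] by eventually_elim (simp add: H'_def)
qed

text \<open>F agrees only almost everywhere with a continuous G. The integral does not distinguish
  them, so the fundamental theorem of calculus applies with G.\<close>

lemma flux_has_derivative:
  fixes F G :: "real \<Rightarrow> real"
  assumes [measurable]: "F \<in> borel_measurable borel" and si: "set_integrable lborel {0<..<R} (\<lambda>s. s ^ (d + 1) * F s)"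
    and mu: "\<And>r. r \<in> {0..R} \<Longrightarrow> \<mu> r = (LINT s:{0<..<r}|lborel. s ^ (d + 1) * F s)"
    and FG: "AE r in lborel. r \<in> {0<..<R} \<longrightarrow> F r = G r" and cG: "continuous_on {0<..<R} G" and r: "r \<in> {0<..<R}"
  shows "(\<mu> has_real_derivative r ^ (d + 1) * G r) (at r)"
proof -
  define q where "q s = indicator {0<..<R} s * (s ^ (d + 1) * G s)" for s
  have cq0: "continuous_on {0<..<R} (\<lambda>s. s ^ (d + 1) * G s)" by (intro continuous_intros cG)
  have [measurable]: "q \<in> borel_measurable borel"
    using borel_measurable_continuous_on_indicator[OF _ cq0] by (simp add: q_def[abs_def])
  have qi: "integrable lborel q"
  proof (rule integrable_cong_AE_imp)
    show "integrable lborel (\<lambda>s. indicator {0<..<R} s * (s ^ (d + 1) * F s))" using si by (simp add: set_integrable_def)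
    show "AE s in lborel. indicator {0<..<R} s * (s ^ (d + 1) * F s) = q s"
      using FG by eventually_elim (auto simp: q_def indicator_def)
  qed simp
  have qh: "q integrable_on {0..R}"
    by (rule integrable_on_subinterval[OF integrable_on_lborel[OF qi]]) simp
  have muq: "\<mu> s = integral {0..s} q" if s: "s \<in> {0..R}" for s
  proof -
    have "(LINT t|lborel. indicator {0<..<s} t * (t ^ (d + 1) * F t)) = (LINT t|lborel. indicator {0<..<s} t * q t)"
    proof (rule integral_cong_AE)
      show "AE t in lborel. indicator {0<..<s} t * (t ^ (d + 1) * F t) = indicator {0<..<s} t * q t"
        using FG s by (auto elim!: eventually_mono simp: q_def indicator_def)
    qed measurable
    then have "\<mu> s = (LINT t:{0<..<s}|lborel. q t)" using mu[OF s] by (simp add: set_lebesgue_integral_def)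
    also have "\<dots> = integral {0<..<s} q"
      by (intro set_borel_integral_eq_integral(2)) (simp add: set_integrable_def integrable_mult_indicator[OF _ qi, simplified])
    also have "\<dots> = integral {0..s} q"
      using integral_open_interval_real[of 0 s q] by (simp add: box_real cbox_interval)
    finally show ?thesis .
  qed
  have "continuous_on {0<..<R} q" by (rule continuous_on_eq[OF cq0]) (simp add: q_def)
  then have "isCont q r" using r by (simp add: continuous_on_eq_continuous_at)
  then have "continuous (at r within {0..R} - {}) q" by (rule continuous_at_imp_continuous_at_within)
  from integral_has_vector_derivative_continuous_at[OF qh _ _ this]
  have "((\<lambda>s. integral {0..s} q) has_vector_derivative q r) (at r within {0..R})" using r by simp
  moreover have "at r within {0..R} = at r" using r by (intro at_within_interior) auto
  ultimately have "((\<lambda>s. integral {0..s} q) has_real_derivative q r) (at r)"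
    by (simp add: has_real_derivative_iff_has_vector_derivative)
  then have "(\<mu> has_real_derivative q r) (at r)"
    by (rule has_field_derivative_transform_within_open[where S="{0<..<R}"]) (use r muq in auto)
  then show ?thesis using r by (simp add: q_def)
qed

text \<open>Testing with a tent on \<open>[r\<^sup>2, 4 r\<^sup>2]\<close> bounds \<open>\<mu>\<close> at scale \<open>r\<close>.\<close>

lemma flux_decay:
  fixes \<mu> :: "real \<Rightarrow> real"
  assumes R: "R > 0" and cmu: "continuous_on {0..R} \<mu>" and nn: "\<And>r. r \<in> {0..R} \<Longrightarrow> 0 \<le> \<mu> r"
    and mono: "\<And>r s. 0 \<le> r \<Longrightarrow> r \<le> s \<Longrightarrow> s \<le> R \<Longrightarrow> \<mu> r \<le> \<mu> s"
    and dec: "\<exists>K. \<forall>e. continuous_on UNIV e \<longrightarrow> (LINT t:{0<..<R}|lborel. t * \<mu> t * e (t\<^sup>2))\<^sup>2 \<le> K * (LINT t:{0<..<R}|lborel. t ^ (d + 3) * (e (t\<^sup>2))\<^sup>2)"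
  shows "\<exists>C. \<forall>r\<in>{0<..<R}. \<mu> r \<le> C * r powr (real d / 2)"
proof -
  obtain K where K: "\<And>e. continuous_on UNIV e \<Longrightarrow> (LINT t:{0<..<R}|lborel. t * \<mu> t * e (t\<^sup>2))\<^sup>2 \<le> K * (LINT t:{0<..<R}|lborel. t ^ (d + 3) * (e (t\<^sup>2))\<^sup>2)"
    using dec by blast
  \<comment> \<open>This collects the constants below: 100 from squaring the factor 1/10 of the
    lower bound, 2^(d+3) from t \<le> 2 r in the upper bound.\<close>
  define K' where "K' = \<bar>K\<bar> * 2 ^ (d + 3) * 100"
  have K'0: "K' \<ge> 0" by (simp add: K'_def)
  have small: "\<mu> r \<le> sqrt K' * r powr (real d / 2)" if r: "0 < r" "2 * r \<le> R" for r
  proof -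
    \<comment> \<open>In s = t^2 the tent has centre 5/2 r^2 and half-width 3/2 r^2, so it lives on
      r \<le> t \<le> 2 r. For 1.4 r \<le> t \<le> 1.7 r one has 1.96 r^2 \<le> t^2 \<le> 2.89 r^2,
      within 3/4 r^2 of the centre, hence e \<ge> 1/2 there.\<close>
    define e where "e s = max 0 (1 - \<bar>s - 5 / 2 * r\<^sup>2\<bar> / (3 / 2 * r\<^sup>2))" for s
    have e: "continuous_on UNIV e" unfolding e_def using r by (intro continuous_intros) auto
    have r2: "r\<^sup>2 > 0" using r by simp
    have e01: "0 \<le> e s" "e s \<le> 1" for s unfolding e_def using r2 by auto
    have e_out: "e (t\<^sup>2) = 0" if "t \<ge> 0" "t < r \<or> 2 * r < t" for t
    proof -
      have "t\<^sup>2 \<le> r\<^sup>2 \<or> 4 * r\<^sup>2 \<le> t\<^sup>2"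
        using that r power_mono[of t r 2] power_mono[of "2 * r" t 2] by (auto simp: power_mult_distrib)
      then have "3 / 2 * r\<^sup>2 \<le> \<bar>t\<^sup>2 - 5 / 2 * r\<^sup>2\<bar>" by linarith
      then show ?thesis unfolding e_def using r2 by (simp add: le_divide_eq)
    qed
    have e_in: "1 / 2 \<le> e (t\<^sup>2)" if "14 / 10 * r \<le> t" "t \<le> 17 / 10 * r" for t
    proof -
      have "(14 / 10 * r)\<^sup>2 \<le> t\<^sup>2" "t\<^sup>2 \<le> (17 / 10 * r)\<^sup>2" using that r by (auto intro!: power_mono)
      then have "196 / 100 * r\<^sup>2 \<le> t\<^sup>2" "t\<^sup>2 \<le> 289 / 100 * r\<^sup>2" by (simp_all add: power_mult_distrib power2_eq_square)
      then have "\<bar>t\<^sup>2 - 5 / 2 * r\<^sup>2\<bar> \<le> 1 / 2 * (3 / 2 * r\<^sup>2)" by linarith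
      then have "\<bar>t\<^sup>2 - 5 / 2 * r\<^sup>2\<bar> / (3 / 2 * r\<^sup>2) \<le> 1 / 2" using r2 by (subst pos_divide_le_eq) auto
      then show ?thesis unfolding e_def by linarith
    qed
    have ce: "continuous_on S (\<lambda>t. e (t\<^sup>2))" for S :: "real set"
      by (rule continuous_on_compose2[OF e]) (auto intro!: continuous_intros)
    have int1: "set_integrable lborel {0<..<R} (\<lambda>t. t * \<mu> t * e (t\<^sup>2))"
      by (rule set_integrable_subset[OF borel_integrable_atLeastAtMost'[of 0 R]])
        (auto intro!: continuous_intros cmu ce)
    have int2: "set_integrable lborel {0<..<R} (\<lambda>t. t ^ (d + 3) * (e (t\<^sup>2))\<^sup>2)"
      by (rule set_integrable_subset[OF borel_integrable_atLeastAtMost'[of 0 R]])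
        (auto intro!: continuous_intros ce)
    let ?A = "{14 / 10 * r..17 / 10 * r}" and ?B = "{r..2 * r}"
    \<comment> \<open>The interval \<open>?A\<close> has length 3/10 r, and on it the integrand is
      at least r \<mu>(r) / 2 because \<mu> is nondecreasing.\<close>
    have "r * (r * \<mu> r) / 10 \<le> r * (r * \<mu> r) * (3 / 20)"
      using r nn[of r] by simp
    also have "\<dots> = (LINT t|lborel. indicator ?A t * (r * \<mu> r * (1 / 2)))"
      using r by simp
    also have "\<dots> \<le> (LINT t|lborel. indicator {0<..<R} t * (t * \<mu> t * e (t\<^sup>2)))"
    proof (rule integral_mono)
      show "integrable lborel (\<lambda>t. indicator ?A t * (r * \<mu> r * (1 / 2)))"
        by (intro integrable_mult_left integrable_real_indicator) (auto simp: emeasure_lborel_Icc_eq)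
      show "integrable lborel (\<lambda>t. indicator {0<..<R} t * (t * \<mu> t * e (t\<^sup>2)))" using int1 by (simp add: set_integrable_def)
      fix t :: real
      show "indicator ?A t * (r * \<mu> r * (1 / 2)) \<le> indicator {0<..<R} t * (t * \<mu> t * e (t\<^sup>2))"
      proof (cases "t \<in> ?A")
        case True
        then have t: "t \<in> {0<..<R}" "r \<le> t" using r by auto
        have "r * \<mu> r * (1 / 2) \<le> t * \<mu> t * e (t\<^sup>2)"
          using True t r e_in[of t] mono[of r t] nn[of r] nn[of t] by (intro mult_mono mult_nonneg_nonneg) auto
        then show ?thesis using t True by simp
      next
        case False
        have "0 \<le> indicator {0<..<R} t * (t * \<mu> t * e (t\<^sup>2))" using e01 nn[of t] by (auto simp: indicator_def)
        then show ?thesis using False by simp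
      qed
    qed
    finally have low: "r * (r * \<mu> r) / 10 \<le> (LINT t:{0<..<R}|lborel. t * \<mu> t * e (t\<^sup>2))"
      by (simp add: set_lebesgue_integral_def)
    have "(LINT t|lborel. indicator {0<..<R} t * (t ^ (d + 3) * (e (t\<^sup>2))\<^sup>2)) \<le> (LINT t|lborel. indicator ?B t * (2 * r) ^ (d + 3))"
    proof (rule integral_mono)
      show "integrable lborel (\<lambda>t. indicator ?B t * (2 * r) ^ (d + 3))"
        by (intro integrable_mult_left integrable_real_indicator) (auto simp: emeasure_lborel_Icc_eq)
      show "integrable lborel (\<lambda>t. indicator {0<..<R} t * (t ^ (d + 3) * (e (t\<^sup>2))\<^sup>2))" using int2 by (simp add: set_integrable_def)
      fix t :: real
      show "indicator {0<..<R} t * (t ^ (d + 3) * (e (t\<^sup>2))\<^sup>2) \<le> indicator ?B t * (2 * r) ^ (d + 3)"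
      proof (cases "t \<in> ?B")
        case True
        have "(e (t\<^sup>2))\<^sup>2 \<le> 1" using e01[of "t\<^sup>2"] by (simp add: power_le_one)
        then have "t ^ (d + 3) * (e (t\<^sup>2))\<^sup>2 \<le> (2 * r) ^ (d + 3) * 1"
          using True r by (intro mult_mono power_mono) auto
        moreover have "0 \<le> (2 * r) ^ (d + 3)" using r by simp
        ultimately show ?thesis using True by (auto simp: indicator_def)
      next
        case False
        then show ?thesis using e_out[of t] by (auto simp: indicator_def)
      qed
    qed
    also have "\<dots> = r * (2 * r) ^ (d + 3)" using r by simp
    finally have up: "(LINT t:{0<..<R}|lborel. t ^ (d + 3) * (e (t\<^sup>2))\<^sup>2) \<le> r * (2 * r) ^ (d + 3)"
      by (simp add: set_lebesgue_integral_def)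
    have up0: "0 \<le> (LINT t:{0<..<R}|lborel. t ^ (d + 3) * (e (t\<^sup>2))\<^sup>2)"
      unfolding set_lebesgue_integral_def by (intro Bochner_Integration.integral_nonneg) (auto simp: indicator_def)
    have "(r * (r * \<mu> r) / 10)\<^sup>2 \<le> (LINT t:{0<..<R}|lborel. t * \<mu> t * e (t\<^sup>2))\<^sup>2"
      using low r nn[of r] by (intro power_mono) auto
    also have "\<dots> \<le> K * (LINT t:{0<..<R}|lborel. t ^ (d + 3) * (e (t\<^sup>2))\<^sup>2)" by (rule K[OF e])
    also have "\<dots> \<le> \<bar>K\<bar> * (LINT t:{0<..<R}|lborel. t ^ (d + 3) * (e (t\<^sup>2))\<^sup>2)" by (rule mult_right_mono[OF abs_ge_self up0])
    also have "\<dots> \<le> \<bar>K\<bar> * (r * (2 * r) ^ (d + 3))" by (intro mult_left_mono up) auto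
    finally have "r ^ 4 * (\<mu> r)\<^sup>2 \<le> 100 * (\<bar>K\<bar> * (r * (2 * r) ^ (d + 3)))"
      by (simp add: power2_eq_square power4_eq_xxxx mult_ac)
    also have "\<dots> = r ^ 4 * (K' * r ^ d)"
      unfolding K'_def power_mult_distrib by (simp add: power_add eval_nat_numeral mult_ac)
    finally have "(\<mu> r)\<^sup>2 \<le> K' * r ^ d" using r by simp
    also have "\<dots> = (sqrt K' * r powr (real d / 2))\<^sup>2"
    proof -
      have "(r powr (real d / 2))\<^sup>2 = r ^ d"
        using r powr_realpow[of r d] by (simp add: power2_eq_square powr_add[symmetric])
      then show ?thesis using K'0 by (simp add: power_mult_distrib)
    qed
    finally show ?thesis by (rule power2_le_imp_le) (use K'0 in simp)
  qed
  \<comment> \<open>Radii above R / 2 are covered by \<mu>(r) \<le> \<mu>(R) and (R / 2)^(d/2) \<le>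
    r^(d/2).\<close>
  define C where "C = max (sqrt K') (\<mu> R / (R / 2) powr (real d / 2))"
  have "\<mu> r \<le> C * r powr (real d / 2)" if r: "r \<in> {0<..<R}" for r
  proof (cases "2 * r \<le> R")
    case True
    then have "\<mu> r \<le> sqrt K' * r powr (real d / 2)" using small r by simp
    also have "\<dots> \<le> C * r powr (real d / 2)" by (intro mult_right_mono) (auto simp: C_def)
    finally show ?thesis .
  next
    case False
    have "\<mu> r \<le> \<mu> R" using mono[of r R] r by simp
    also have "\<dots> = \<mu> R / (R / 2) powr (real d / 2) * (R / 2) powr (real d / 2)" using R by simp
    also have "\<dots> \<le> \<mu> R / (R / 2) powr (real d / 2) * r powr (real d / 2)"
      using False R nn[of R] by (intro mult_left_mono powr_mono2) auto
    also have "\<dots> \<le> C * r powr (real d / 2)" by (intro mult_right_mono) (auto simp: C_def)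
    finally show ?thesis .
  qed
  then show ?thesis by blast
qed

lemma continuous_on_Icc_tendsto_at_right:
  fixes f :: "real \<Rightarrow> real"
  assumes "continuous_on {0..R} f" "R > 0"
  shows "(f \<longlongrightarrow> f 0) (at_right 0)"
proof -
  have "continuous (at 0 within {0..R}) f" using assms by (simp add: continuous_on_eq_continuous_within)
  then show ?thesis using assms(2) by (simp add: continuous_within at_within_Icc_at_right)
qed

text \<open>The flux is nonnegative, so H is nonincreasing and H \<ge> H(R); by the Robin condition
  H(R) has the sign of \<mu>(R), which is positive because u is. Positivity up to the boundary makes
  H^p continuous and the equation for \<mu> classical, and \<open>flux_decay\<close> with
  \<open>profile_bootstrap\<close> excludes a singularity at the centre.\<close>

theorem positive_radial_profile:
  fixes c :: "'a::euclidean_space"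
  assumes R: "R > 0" and N: "DIM('a) = d + 2" and p: "p > 1" and sub: "(real d + 2) / (p + 1) > real d / 2" and \<beta>: "\<beta> > 0"
    and sol: "positive_solution c R \<beta> p u" and rad: "radial_on_ball c R u"
  obtains \<phi> m where "profile d p R \<phi> m" "m R = \<beta> * R ^ (d + 1) * \<phi> R"
    "AE x in lebesgue_on (ball c R). u x = \<phi> (norm (x - c))"
proof -
  have W: "weak_Robin_solution c R \<beta> (\<lambda>x. u x powr p) u" and pos: "AE x in lebesgue_on (ball c R). u x > 0"
    using sol by (auto simp: positive_solution_def)
  have u: "u \<in> H1 (ball c R)" using W by (simp add: weak_Robin_solution_def)
  have um: "u \<in> borel_measurable (lebesgue_on (ball c R))" using H1_weak_gradient(1)[OF u] by (simp add: L2_def)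
  obtain g where g[measurable]: "g \<in> borel_measurable borel" and ug: "AE x in lebesgue_on (ball c R). u x = g (norm (x - c))"
    by (rule radial_borel_profile[OF R um rad])
  have F: "(\<lambda>r. g r powr p) \<in> borel_measurable borel" by measurable
  have fF: "AE x in lebesgue_on (ball c R). u x powr p = g (norm (x - c)) powr p" using ug by eventually_elim simp
  show thesis
  proof (rule weak_radial_solution_ode[OF R N W g ug F fF])
    fix H \<mu>
    assume si: "set_integrable lborel {0<..<R} (\<lambda>s. s ^ (d + 1) * g s powr p)"
      and mu: "\<And>r. r \<in> {0..R} \<Longrightarrow> \<mu> r = (LINT s:{0<..<r}|lborel. s ^ (d + 1) * g s powr p)"
      and cmu: "continuous_on {0..R} \<mu>" and mu0: "\<mu> 0 = 0" and cH: "continuous_on {0<..R} H"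
      and dH: "\<And>r. r \<in> {0<..<R} \<Longrightarrow> (H has_real_derivative - \<mu> r / r ^ (d + 1)) (at r)"
      and bR: "\<mu> R = \<beta> * R ^ (d + 1) * H R"
      and gH: "AE r in lborel. r \<in> {0<..<R} \<longrightarrow> g r = H r"
      and dec: "\<exists>K. \<forall>e. continuous_on UNIV e \<longrightarrow> (LINT t:{0<..<R}|lborel. t * \<mu> t * e (t\<^sup>2))\<^sup>2 \<le> K * (LINT t:{0<..<R}|lborel. t ^ (d + 3) * (e (t\<^sup>2))\<^sup>2)"
    have nn: "0 \<le> \<mu> r" if "r \<in> {0..R}" for r
      unfolding mu[OF that] set_lebesgue_integral_def
      by (intro Bochner_Integration.integral_nonneg) (auto simp: indicator_def)
    have Hmono: "H R \<le> H r" if "r \<in> {0<..R}" for r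
      by (rule flux_nonneg_imp_antimono[OF cH _ dH]) (use that nn in auto)
    have gpos: "AE r in lborel. r \<in> {0<..<R} \<longrightarrow> g r > 0"
    proof (rule AE_radialD[OF R])
      show "AE x in lebesgue_on (ball c R). g (norm (x - c)) > 0" using pos ug by eventually_elim simp
    qed measurable
    have "\<mu> R \<noteq> 0"
    proof
      assume "\<mu> R = 0"
      then have "(LINT s|lborel. indicator {0<..<R} s * (s ^ (d + 1) * g s powr p)) = 0"
        using mu[of R] R by (simp add: set_lebesgue_integral_def)
      moreover have "integrable lborel (\<lambda>s. indicator {0<..<R} s * (s ^ (d + 1) * g s powr p))"
        using si by (simp add: set_integrable_def)
      ultimately have "AE s in lborel. indicator {0<..<R} s * (s ^ (d + 1) * g s powr p) = 0"
        by (subst (asm) integral_nonneg_eq_0_iff_AE) (auto simp: indicator_def)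
      then have "AE s in lborel. s \<notin> {0<..<R}" using gpos by eventually_elim (auto simp: indicator_def)
      then have "{s \<in> space lborel. \<not> s \<notin> {0<..<R}} \<in> null_sets lborel" by (subst (asm) AE_iff_null) auto
      then have "{0<..<R} \<in> null_sets lborel" by (simp only: not_not space_lborel space_borel UNIV_I simp_thms Collect_mem_eq)
      then show False using R by (auto simp: null_sets_def)
    qed
    then have "\<mu> R > 0" using nn[of R] R by simp
    then have HR: "H R > 0" unfolding bR by (rule zero_less_mult_pos) (use \<beta> R in simp)
    have Hpos: "H r > 0" if "r \<in> {0<..R}" for r using Hmono[OF that] HR by simp
    have cHp: "continuous_on {0<..<R} (\<lambda>r. H r powr p)"
    proof (intro continuous_on_powr continuous_on_const)
      show "continuous_on {0<..<R} H" by (rule continuous_on_subset[OF cH]) auto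
      show "\<forall>x\<in>{0<..<R}. H x \<noteq> 0"
      proof
        fix x assume "x \<in> {0<..<R}"
        then show "H x \<noteq> 0" using Hpos[of x] by simp
      qed
    qed
    have dmu: "(\<mu> has_real_derivative r ^ (d + 1) * H r powr p) (at r)" if r: "r \<in> {0<..<R}" for r
      by (rule flux_has_derivative[OF F si mu _ cHp r]) (use gH in \<open>auto elim!: eventually_mono\<close>)
    have mono: "\<mu> r \<le> \<mu> s" if "0 \<le> r" "r \<le> s" "s \<le> R" for r s
    proof (rule derivative_nonneg_imp_le[where f=\<mu> and a=r and b=s, OF that(2)])
      show "continuous_on {r..s} \<mu>" by (rule continuous_on_subset[OF cmu]) (use that in auto)
      fix x assume "r < x" "x < s"
      then have x: "x \<in> {0<..<R}" using that by auto
      show "\<exists>y. (\<mu> has_real_derivative y) (at x) \<and> 0 \<le> y"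
        by (intro exI conjI, rule dmu[OF x]) (use x in auto)
    qed
    obtain C where C: "\<forall>r\<in>{0<..<R}. \<mu> r \<le> C * r powr (real d / 2)"
      using flux_decay[OF R cmu nn mono dec] by blast
    have lim: "(\<mu> \<longlongrightarrow> 0) (at_right 0)" using continuous_on_Icc_tendsto_at_right[OF cmu R] mu0 by simp
    have cmu': "continuous_on {0<..R} \<mu>" by (rule continuous_on_subset[OF cmu]) auto
    have "profile d p R H \<mu>"
      by (rule profile_bootstrap[OF R p sub cH cmu' Hpos dH dmu lim C[rule_format]])
    moreover have "AE x in lebesgue_on (ball c R). u x = H (norm (x - c))"
      by (rule AE_eq_continuous_profile[OF R g ug gH cH])
    ultimately show thesis using bR by (intro that)
  qed
qed

theorem positive_radial_unique:
  fixes c :: "'a::euclidean_space"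
  assumes R: "R > 0" and N: "DIM('a) = d + 2" and p: "p > 1" and sub: "(real d + 2) / (p + 1) > real d / 2" and \<beta>: "\<beta> > 0"
    and u: "positive_solution c R \<beta> p u" "radial_on_ball c R u" and w: "positive_solution c R \<beta> p w" "radial_on_ball c R w"
  shows "AE x in lebesgue_on (ball c R). w x = u x"
proof -
  obtain \<phi> m where 1: "profile d p R \<phi> m" "m R = \<beta> * R ^ (d + 1) * \<phi> R" "AE x in lebesgue_on (ball c R). u x = \<phi> (norm (x - c))"
    by (rule positive_radial_profile[OF R N p sub \<beta> u])
  obtain \<psi> n where 2: "profile d p R \<psi> n" "n R = \<beta> * R ^ (d + 1) * \<psi> R" "AE x in lebesgue_on (ball c R). w x = \<psi> (norm (x - c))"
    by (rule positive_radial_profile[OF R N p sub \<beta> w])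
  show ?thesis
    using 1(3) 2(3) AE_ball_norm[OF R, of c]
  proof eventually_elim
    case (elim x)
    then show ?case using profile_unique[OF 1(1,2) 2(1,2), of "norm (x - c)"] by simp
  qed
qed

text \<open>A solution of the linearized equation has no sign, so the regularity argument used for u
  does not carry over. In its place, the limits of \<mu> and r^(d+1) H at 0 are enough for the
  Wronskian in \<open>profile_nondegenerate\<close> to vanish at the centre.\<close>

theorem positive_radial_nondegenerate:
  fixes c :: "'a::euclidean_space"
  assumes R: "R > 0" and N: "DIM('a) = d + 2" and p: "p > 1" and sub: "(real d + 2) / (p + 1) > real d / 2" and \<beta>: "\<beta> > 0"
    and u: "positive_solution c R \<beta> p u" "radial_on_ball c R u"
  shows "radially_nondegenerate c R \<beta> p u"
  unfolding radially_nondegenerate_def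
proof (intro ballI impI)
  fix h assume h: "h \<in> H1_rad c R" and lin: "linearized_solution c R \<beta> p u h"
  obtain \<phi> m where P: "profile d p R \<phi> m" "m R = \<beta> * R ^ (d + 1) * \<phi> R" and u\<phi>: "AE x in lebesgue_on (ball c R). u x = \<phi> (norm (x - c))"
    by (rule positive_radial_profile[OF R N p sub \<beta> u])
  have cphi: "continuous_on {0<..R} \<phi>" and phipos: "\<And>r. r \<in> {0<..R} \<Longrightarrow> \<phi> r > 0" using P(1) by (auto simp: profile_def)
  have hH: "h \<in> H1 (ball c R)" and rad: "radial_on_ball c R h" using h by (auto simp: H1_rad_def)
  have W: "weak_Robin_solution c R \<beta> (\<lambda>x. p * u x powr (p - 1) * h x) h" using lin by (simp add: linearized_solution_def)
  have hm: "h \<in> borel_measurable (lebesgue_on (ball c R))" using H1_weak_gradient(1)[OF hH] by (simp add: L2_def)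
  obtain g where g[measurable]: "g \<in> borel_measurable borel" and hg: "AE x in lebesgue_on (ball c R). h x = g (norm (x - c))"
    by (rule radial_borel_profile[OF R hm rad])
  define \<phi>' where "\<phi>' r = indicator {0<..R} r * \<phi> r" for r
  have [measurable]: "\<phi>' \<in> borel_measurable borel"
    using borel_measurable_continuous_on_indicator[OF _ cphi] by (simp add: \<phi>'_def[abs_def])
  define F where "F r = p * \<phi>' r powr (p - 1) * g r" for r
  have F: "F \<in> borel_measurable borel" unfolding F_def[abs_def] by measurable
  have fF: "AE x in lebesgue_on (ball c R). p * u x powr (p - 1) * h x = F (norm (x - c))"
    using hg u\<phi> AE_ball_norm[OF R, of c] by eventually_elim (simp add: F_def \<phi>'_def)
  show "AE x in lebesgue_on (ball c R). h x = 0"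
  proof (rule weak_radial_solution_ode[OF R N W g hg F fF])
    fix H \<mu>
    assume si: "set_integrable lborel {0<..<R} (\<lambda>s. s ^ (d + 1) * F s)"
      and mu: "\<And>r. r \<in> {0..R} \<Longrightarrow> \<mu> r = (LINT s:{0<..<r}|lborel. s ^ (d + 1) * F s)"
      and cmu: "continuous_on {0..R} \<mu>" and mu0: "\<mu> 0 = 0" and cH: "continuous_on {0<..R} H"
      and dH: "\<And>r. r \<in> {0<..<R} \<Longrightarrow> (H has_real_derivative - \<mu> r / r ^ (d + 1)) (at r)"
      and bR: "\<mu> R = \<beta> * R ^ (d + 1) * H R" and lim: "((\<lambda>r. r ^ (d + 1) * H r) \<longlongrightarrow> 0) (at_right 0)"
      and gH: "AE r in lborel. r \<in> {0<..<R} \<longrightarrow> g r = H r"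
    have FG: "AE r in lborel. r \<in> {0<..<R} \<longrightarrow> F r = p * \<phi> r powr (p - 1) * H r"
      using gH by eventually_elim (auto simp: F_def \<phi>'_def)
    have cG: "continuous_on {0<..<R} (\<lambda>r. p * \<phi> r powr (p - 1) * H r)"
    proof (intro continuous_on_mult continuous_on_powr continuous_on_const)
      show "continuous_on {0<..<R} \<phi>" by (rule continuous_on_subset[OF cphi]) auto
      show "continuous_on {0<..<R} H" by (rule continuous_on_subset[OF cH]) auto
      show "\<forall>x\<in>{0<..<R}. \<phi> x \<noteq> 0"
      proof
        fix x assume "x \<in> {0<..<R}"
        then show "\<phi> x \<noteq> 0" using phipos[of x] by simp
      qed
    qed
    have dmu: "(\<mu> has_real_derivative r ^ (d + 1) * (p * \<phi> r powr (p - 1) * H r)) (at r)" if r: "r \<in> {0<..<R}" for r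
      by (rule flux_has_derivative[OF F si mu FG cG r])
    have mu_lim: "(\<mu> \<longlongrightarrow> 0) (at_right 0)" using continuous_on_Icc_tendsto_at_right[OF cmu R] mu0 by simp
    have cmu': "continuous_on {0<..R} \<mu>" by (rule continuous_on_subset[OF cmu]) auto
    have H0: "H r = 0" if "r \<in> {0<..R}" for r
      by (rule profile_nondegenerate[OF P cH cmu' dH dmu mu_lim lim bR that])
    show ?thesis
      using AE_eq_continuous_profile[OF R g hg gH cH] AE_ball_norm[OF R, of c]
    proof eventually_elim
      case (elim x)
      then show ?case using H0[of "norm (x - c)"] by simp
    qed
  qed
qed

section \<open>Construction of the solution\<close>

lemma lane_emden_constant_extension:
  assumes "lane_emden d p U M"
  shows "lane_emden d p (\<lambda>r. U (max 0 r)) (\<lambda>r. M (max 0 r))"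
    and "continuous_on UNIV (\<lambda>r. U (max 0 r))" "continuous_on UNIV (\<lambda>r. M (max 0 r))"
proof -
  have cU: "continuous_on {0..} U" and cM: "continuous_on {0..} M" and U0: "U 0 = 1"
    and Mb: "\<And>r. r \<ge> 0 \<Longrightarrow> 0 \<le> M r" "\<And>r. r \<ge> 0 \<Longrightarrow> M r \<le> r ^ (d + 2)" and pd: "p > 1" "(real d + 2) / (p + 1) > real d / 2"
    and dU: "\<And>r. r > 0 \<Longrightarrow> (U has_real_derivative - M r / r ^ (d + 1)) (at r)"
    and dM: "\<And>r. r > 0 \<Longrightarrow> (M has_real_derivative r ^ (d + 1) * trunc_powr p (U r)) (at r)"
    using assms by (auto simp: lane_emden_def)
  show c1: "continuous_on UNIV (\<lambda>r. U (max 0 r))"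
    by (rule continuous_on_compose2[OF cU]) (auto intro!: continuous_intros)
  show c2: "continuous_on UNIV (\<lambda>r. M (max 0 r))"
    by (rule continuous_on_compose2[OF cM]) (auto intro!: continuous_intros)
  have d1: "((\<lambda>r. U (max 0 r)) has_real_derivative - M (max 0 r) / r ^ (d + 1)) (at r)"
    and d2: "((\<lambda>r. M (max 0 r)) has_real_derivative r ^ (d + 1) * trunc_powr p (U (max 0 r))) (at r)" if r: "r > 0" for r
  proof -
    have "((\<lambda>r. U (max 0 r)) has_real_derivative - M r / r ^ (d + 1)) (at r)"
      by (rule has_field_derivative_transform_within_open[OF dU[OF r], where S="{0<..}"]) (use r in auto)
    then show "((\<lambda>r. U (max 0 r)) has_real_derivative - M (max 0 r) / r ^ (d + 1)) (at r)" using r by simp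
    have "((\<lambda>r. M (max 0 r)) has_real_derivative r ^ (d + 1) * trunc_powr p (U r)) (at r)"
      by (rule has_field_derivative_transform_within_open[OF dM[OF r], where S="{0<..}"]) (use r in auto)
    then show "((\<lambda>r. M (max 0 r)) has_real_derivative r ^ (d + 1) * trunc_powr p (U (max 0 r))) (at r)" using r by simp
  qed
  show "lane_emden d p (\<lambda>r. U (max 0 r)) (\<lambda>r. M (max 0 r))"
    unfolding lane_emden_def
    using pd U0 Mb d1 d2 continuous_on_subset[OF c1, of "{0..}"] continuous_on_subset[OF c2, of "{0..}"] by simp
qed

text \<open>Writing \<phi>' = r A(r) gives the gradient A(|x - c|) (x - c), which is continuous at c
  as soon as A is bounded. Differentiability at c itself comes from the quadratic bound on \<phi>(r)
  - \<phi>(0).\<close>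

lemma radial_C1:
  fixes c :: "'a::euclidean_space" and \<phi> A :: "real \<Rightarrow> real"
  assumes d: "\<And>r. r > 0 \<Longrightarrow> (\<phi> has_real_derivative A r * r) (at r)" and cA: "continuous_on {0<..} A"
    and bA: "\<And>r. r \<ge> 0 \<Longrightarrow> \<bar>A r\<bar> \<le> B" and b\<phi>: "\<And>r. r \<ge> 0 \<Longrightarrow> \<bar>\<phi> r - \<phi> 0\<bar> \<le> B * r\<^sup>2"
  shows "Ck (Suc 0) (\<lambda>x. \<phi> (norm (x - c)))" "grad (\<lambda>x. \<phi> (norm (x - c))) x = A (norm (x - c)) *\<^sub>R (x - c)"
proof -
  have lim: "((\<lambda>y. B * norm (y - c)) \<longlongrightarrow> 0) (at c)"
  proof -
    have "((\<lambda>y. B * norm (y - c)) \<longlongrightarrow> B * norm (c - c)) (at c)" by (intro tendsto_intros)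
    then show ?thesis by simp
  qed
  have der: "((\<lambda>x. \<phi> (norm (x - c))) has_derivative (\<lambda>h. (A (norm (x - c)) *\<^sub>R (x - c)) \<bullet> h)) (at x)" for x
  proof (cases "x = c")
    case True
    have "((\<lambda>y. norm ((\<phi> (norm (y - c)) - \<phi> (norm (c - c))) - 0) / norm (y - c)) \<longlongrightarrow> 0) (at c)"
    proof (rule Lim_null_comparison[OF _ lim])
      show "\<forall>\<^sub>F y in at c. norm (norm ((\<phi> (norm (y - c)) - \<phi> (norm (c - c))) - 0) / norm (y - c)) \<le> B * norm (y - c)"
        unfolding eventually_at
      proof (intro exI[of _ 1] conjI ballI impI)
        fix y :: 'a assume "y \<noteq> c \<and> dist y c < 1"
        then have y: "norm (y - c) > 0" by simp
        have "\<bar>\<phi> (norm (y - c)) - \<phi> 0\<bar> \<le> B * (norm (y - c))\<^sup>2" by (intro b\<phi>) simp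
        then show "norm (norm ((\<phi> (norm (y - c)) - \<phi> (norm (c - c))) - 0) / norm (y - c)) \<le> B * norm (y - c)"
          using y by (simp add: divide_le_eq power2_eq_square mult.assoc)
      qed simp
    qed
    then have "((\<lambda>x. \<phi> (norm (x - c))) has_derivative (\<lambda>h. 0)) (at c)"
      unfolding has_derivative_iff_norm by simp
    then show ?thesis using True by simp
  next
    case False
    then have n: "norm (x - c) > 0" by simp
    have 0: "((\<lambda>x. x - c) has_derivative (\<lambda>h. h)) (at x)" by (auto intro!: derivative_eq_intros)
    have 1: "((\<lambda>x. norm (x - c)) has_derivative (\<lambda>h. h \<bullet> sgn (x - c))) (at x)"
      using has_derivative_compose[OF 0, of norm "\<lambda>h. h \<bullet> sgn (x - c)"] GDERIV_norm[of "x - c"] False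
      by (simp add: gderiv_def)
    have "((\<lambda>x. \<phi> (norm (x - c))) has_derivative (\<lambda>h. (A (norm (x - c)) * norm (x - c)) * (h \<bullet> sgn (x - c)))) (at x)"
      using has_derivative_compose[OF 1 d[OF n, unfolded has_field_derivative_def]] .
    moreover have "(\<lambda>h. (A (norm (x - c)) * norm (x - c)) * (h \<bullet> sgn (x - c))) = (\<lambda>h. (A (norm (x - c)) *\<^sub>R (x - c)) \<bullet> h)"
      using n by (simp add: sgn_div_norm fun_eq_iff inner_commute[of _ "x - c"])
    ultimately show ?thesis by simp
  qed
  have cont: "continuous_on UNIV (\<lambda>x. A (norm (x - c)) *\<^sub>R (x - c))"
  proof (rule continuous_at_imp_continuous_on, rule ballI)
    fix x
    show "isCont (\<lambda>x. A (norm (x - c)) *\<^sub>R (x - c)) x"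
    proof (cases "x = c")
      case True
      have "((\<lambda>x. A (norm (x - c)) *\<^sub>R (x - c)) \<longlongrightarrow> 0) (at c)"
        by (rule Lim_null_comparison[OF _ lim]) (use bA in \<open>auto intro!: always_eventually mult_right_mono\<close>)
      then show ?thesis using True by (simp add: isCont_def)
    next
      case False
      have "continuous_on (- {c}) (\<lambda>x. A (norm (x - c)) *\<^sub>R (x - c))"
        by (intro continuous_intros continuous_on_compose2[OF cA]) auto
      then show ?thesis using False by (simp add: continuous_on_eq_continuous_at open_Compl)
    qed
  qed
  show "Ck (Suc 0) (\<lambda>x. \<phi> (norm (x - c)))" by (rule Ck_Suc_0I[OF der cont])
  show "grad (\<lambda>x. \<phi> (norm (x - c))) x = A (norm (x - c)) *\<^sub>R (x - c)" by (rule grad_eqI[OF der])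
qed

text \<open>The Lane-Emden function has logarithmic slope \<beta> R at some S, and dilating [0, S]
  to [0, R] yields a C^1 function on the ball. \<open>green_radial\<close> with a(r) = \<phi>'(r) /
  r verifies the weak equation for every v in H1 without second derivatives in x.\<close>

theorem positive_radial_exists:
  fixes c :: "'a::euclidean_space"
  assumes R: "R > 0" and N: "DIM('a) = d + 2" and p: "p > 1" and sub: "(real d + 2) / (p + 1) > real d / 2" and \<beta>: "\<beta> > 0"
  obtains u where "positive_solution c R \<beta> p u" "radial_on_ball c R u"
proof -
  obtain U0 M0 where L0: "lane_emden d p U0 M0" using lane_emden_exists[OF p sub] by blast
  define U M where "U r = U0 (max 0 r)" and "M r = M0 (max 0 r)" for r
  have L: "lane_emden d p U M" and cU: "continuous_on UNIV U" and cM: "continuous_on UNIV M"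
    using lane_emden_constant_extension[OF L0] by (simp_all add: U_def[abs_def] M_def[abs_def])
  have Mb: "\<And>r. r \<ge> 0 \<Longrightarrow> 0 \<le> M r" "\<And>r. r \<ge> 0 \<Longrightarrow> M r \<le> r ^ (d + 2)"
    using L by (auto simp: lane_emden_def)
  have "\<exists>S. S > 0 \<and> (\<forall>r\<in>{0..S}. U r > 0) \<and> M S = (\<beta> * R) * S ^ d * U S"
    by (rule lane_emden_root_exists[OF L, of "\<beta> * R"]) (use \<beta> R in auto)
  then obtain S where S: "S > 0" and Upos: "\<And>r. r \<in> {0..S} \<Longrightarrow> U r > 0" and MS: "M S = (\<beta> * R) * S ^ d * U S"
    by blast
  have Ule: "U r \<le> 1" if "r \<in> {0..S}" for r using lane_emden_profile(2)[OF L S Upos] that by simp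
  define l where "l = S / R"
  \<comment> \<open>The amplitude forced by l^2 = a^(p-1), under which the rescaled function solves
    the same equation.\<close>
  define a where "a = l powr (2 / (p - 1))"
  have l: "l > 0" and lR: "l * R = S" using S R by (auto simp: l_def)
  have a: "a > 0" using l by (simp add: a_def)
  have l2: "l\<^sup>2 = a powr (p - 1)"
  proof -
    have "a powr (p - 1) = l powr (2 / (p - 1) * (p - 1))" by (simp only: a_def powr_powr)
    also have "2 / (p - 1) * (p - 1) = 2" using p by (subst times_divide_eq_left, subst nonzero_mult_div_cancel_right) auto
    also have "l powr 2 = l\<^sup>2" using powr_realpow[OF l, of 2] by simp
    finally show ?thesis by simp
  qed
  define \<phi> where "\<phi> r = a * U (l * r)" for r
  define n where "n r = a * M (l * r) / l ^ d" for r
  define fp where "fp r = a powr p * trunc_powr p (U (l * r))" for r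
  \<comment> \<open>A = \<phi>' / r and b = r A'. Then N A + b = - \<open>fp\<close> is the radial
    form of \<Delta>u = - u^p, and R A(R) = \<phi>'(R) = - \<beta> \<phi>(R) supplies the boundary
    term.\<close>
  define A where "A r = - n r / r ^ (d + 2)" for r
  define b where "b r = - fp r - (real d + 2) * A r" for r
  have d\<phi>: "(\<phi> has_real_derivative - n r / r ^ (d + 1)) (at r)" and dn: "(n has_real_derivative r ^ (d + 1) * fp r) (at r)" if "r > 0" for r
    using lane_emden_rescale[OF L a l l2 that] by (simp_all add: \<phi>_def[abs_def] n_def[abs_def] fp_def)
  have cn: "continuous_on UNIV n" and c\<phi>: "continuous_on UNIV \<phi>" and cfp: "continuous_on UNIV fp"
  proof -
    have 1: "continuous_on UNIV (\<lambda>r. U (l * r))" "continuous_on UNIV (\<lambda>r. M (l * r))"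
      by (rule continuous_on_compose2[OF cU] continuous_on_compose2[OF cM]; auto intro!: continuous_intros)+
    show "continuous_on UNIV n" "continuous_on UNIV \<phi>" unfolding n_def \<phi>_def using l by (intro continuous_intros 1; simp)+
    show "continuous_on UNIV fp" unfolding fp_def by (intro continuous_intros continuous_trunc_powr p 1)
  qed
  have nb: "0 \<le> n r" "n r \<le> (a * l\<^sup>2) * r ^ (d + 2)" if "r \<ge> 0" for r
  proof -
    have lr: "l * r \<ge> 0" using l that by simp
    show "0 \<le> n r" using a l Mb(1)[OF lr] by (simp add: n_def)
    have "n r \<le> a * (l * r) ^ (d + 2) / l ^ d"
      unfolding n_def using a l Mb(2)[OF lr] by (intro divide_right_mono mult_left_mono) auto
    also have "\<dots> = (a * l\<^sup>2) * r ^ (d + 2)" using l by (simp add: power_mult_distrib power2_eq_square)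
    finally show "n r \<le> (a * l\<^sup>2) * r ^ (d + 2)" .
  qed
  have Ab: "\<bar>A r\<bar> \<le> a * l\<^sup>2" if r: "r \<ge> 0" for r
  proof (cases "r = 0")
    case True then show ?thesis using a by (simp add: A_def)
  next
    case False
    then have "\<bar>A r\<bar> = n r / r ^ (d + 2)" using nb(1)[OF r] r by (simp add: A_def abs_divide)
    also have "\<dots> \<le> a * l\<^sup>2" using nb(2)[OF r] False r by (subst pos_divide_le_eq) auto
    finally show ?thesis .
  qed
  have Ar: "A r * r = - n r / r ^ (d + 1)" if "r > 0" for r using that by (simp add: A_def)
  have dA: "(A has_real_derivative b r / r) (at r)" if r: "r > 0" for r
  proof -
    have "r ^ (d + 2) \<noteq> 0" using r by simp
    from DERIV_divide[OF DERIV_minus[OF dn[OF r]] power_has_derivative_pos[OF r, of "d + 2"] this]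
    have "(A has_real_derivative (- (r ^ (d + 1) * fp r) * r ^ (d + 2) - - n r * (real (d + 2) * r ^ (d + 2) / r)) / (r ^ (d + 2) * r ^ (d + 2))) (at r)"
      by (simp add: A_def[abs_def])
    moreover have "(- (r ^ (d + 1) * fp r) * r ^ (d + 2) - - n r * (real (d + 2) * r ^ (d + 2) / r)) / (r ^ (d + 2) * r ^ (d + 2)) = b r / r"
    proof -
      define y where "y = r ^ (d + 1)"
      have y: "y > 0" "r ^ (d + 2) = r * y" using r by (auto simp: y_def)
      show ?thesis unfolding b_def A_def y(2) y_def[symmetric] using r y(1) by (simp add: field_simps)
    qed
    ultimately show ?thesis by simp
  qed
  have \<phi>b: "\<bar>\<phi> r - \<phi> 0\<bar> \<le> (a * l\<^sup>2) * r\<^sup>2" if r: "r \<ge> 0" for r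
  proof -
    have "- \<phi> 0 \<le> - \<phi> r"
    proof (rule derivative_nonneg_imp_le[where f="\<lambda>r. - \<phi> r" and a=0 and b=r, OF r])
      show "continuous_on {0..r} (\<lambda>r. - \<phi> r)" by (intro continuous_intros continuous_on_subset[OF c\<phi>]) auto
      fix x assume x: "0 < x" "x < r"
      have "0 \<le> - (- n x / x ^ (d + 1))" using nb(1)[of x] x by simp
      then show "\<exists>y. ((\<lambda>r. - \<phi> r) has_real_derivative y) (at x) \<and> 0 \<le> y" using DERIV_minus[OF d\<phi>[OF x(1)]] by blast
    qed
    moreover have "\<phi> 0 + (a * l\<^sup>2) * 0\<^sup>2 \<le> \<phi> r + (a * l\<^sup>2) * r\<^sup>2"
    proof (rule derivative_nonneg_imp_le[where f="\<lambda>r. \<phi> r + (a * l\<^sup>2) * r\<^sup>2" and a=0 and b=r, OF r])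
      show "continuous_on {0..r} (\<lambda>r. \<phi> r + (a * l\<^sup>2) * r\<^sup>2)" by (intro continuous_intros continuous_on_subset[OF c\<phi>]) auto
      fix x assume x: "0 < x" "x < r"
      have der: "((\<lambda>r. \<phi> r + (a * l\<^sup>2) * r\<^sup>2) has_real_derivative A x * x + (a * l\<^sup>2) * (2 * x)) (at x)"
        using d\<phi>[OF x(1)] by (auto intro!: derivative_eq_intros simp: Ar[OF x(1)])
      have "- (a * l\<^sup>2) * x \<le> A x * x" using Ab[of x] x by (intro mult_right_mono) auto
      moreover have "0 \<le> (a * l\<^sup>2) * x" using a x by (intro mult_nonneg_nonneg) auto
      ultimately have "0 \<le> (A x * x - (- (a * l\<^sup>2) * x)) + (a * l\<^sup>2) * x" by linarith
      also have "\<dots> = A x * x + (a * l\<^sup>2) * (2 * x)" by (simp add: algebra_simps)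
      finally have "0 \<le> A x * x + (a * l\<^sup>2) * (2 * x)" .
      then show "\<exists>y. ((\<lambda>r. \<phi> r + (a * l\<^sup>2) * r\<^sup>2) has_real_derivative y) (at x) \<and> 0 \<le> y" using der by blast
    qed
    ultimately show ?thesis by simp
  qed
  define u where "u x = \<phi> (norm (x - c))" for x
  have cA: "continuous_on {0<..} A" unfolding A_def by (intro continuous_intros continuous_on_subset[OF cn]) auto
  have d\<phi>': "(\<phi> has_real_derivative A r * r) (at r)" if "r > 0" for r using d\<phi>[OF that] Ar[OF that] by simp
  have C1: "Ck (Suc 0) u" and gr: "grad u x = A (norm (x - c)) *\<^sub>R (x - c)" for x
    using radial_C1[OF d\<phi>' cA Ab \<phi>b, of c] by (simp_all add: u_def[abs_def])
  have uH: "u \<in> H1 (ball c R)" by (rule C1_in_H1(1)[OF C1])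
  have \<phi>pos: "\<phi> r > 0" and fpe: "\<phi> r powr p = fp r" if r: "r \<in> {0..R}" for r
  proof -
    have "l * r \<le> l * R" using r l by (intro mult_left_mono) auto
    then have s: "l * r \<in> {0..S}" using r l lR by simp
    show "\<phi> r > 0" using Upos[OF s] a by (simp add: \<phi>_def)
    show "\<phi> r powr p = fp r" using Upos[OF s] Ule[OF s] a by (simp add: \<phi>_def fp_def trunc_powr_eq powr_mult)
  qed
  have nR: "n R / R ^ (d + 1) = \<beta> * \<phi> R"
  proof -
    have "S ^ d = l ^ d * R ^ d" unfolding lR[symmetric] by (rule power_mult_distrib)
    then have "n R = a * (\<beta> * R * (l ^ d * R ^ d) * U S) / l ^ d" by (simp only: n_def lR MS)
    then show ?thesis using R l by (simp add: \<phi>_def lR)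
  qed
  have fm: "fp \<in> borel_measurable borel" "n \<in> borel_measurable borel"
    using cfp cn by (auto intro: borel_measurable_continuous_onI)
  have Am: "A \<in> borel_measurable borel" unfolding A_def[abs_def] using fm by measurable
  have bm: "b \<in> borel_measurable borel" unfolding b_def[abs_def] using fm Am by measurable
  let ?M = "lebesgue_on (ball c R)" and ?S = "surface_measure c R"
  have fpb: "\<bar>fp r\<bar> \<le> a powr p" for r
    using trunc_powr_bounds[OF p, of "U (l * r)"] by (simp add: fp_def abs_mult mult_left_le)
  have weak: "integrable ?M (\<lambda>x. u x powr p * v x) \<and>
      (LINT x|?M. weak_gradient (ball c R) u x \<bullet> weak_gradient (ball c R) v x)
        + \<beta> * (LINT x|?S. trace_on_sphere c R u x * trace_on_sphere c R v x) = (LINT x|?M. u x powr p * v x)"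
    if v: "v \<in> H1 (ball c R)" for v
  proof -
    note gv = H1_weak_gradient[OF v] and gu = H1_weak_gradient[OF uH]
    note tv = trace_exists[OF R v] and tu = trace_exists[OF R uH]
    have fu: "u x powr p * v x = fp (norm (x - c)) * v x" if "x \<in> space ?M" for x
      using that fpe[of "norm (x - c)"] by (auto simp: u_def dist_norm norm_minus_commute)
    have "L2 ?M (\<lambda>x. fp (norm (x - c)))"
      by (intro L2_continuous_ball continuous_on_compose2[OF cfp] continuous_intros) auto
    from L2_mult_integrable[OF this gv(1)] have int: "integrable ?M (\<lambda>x. fp (norm (x - c)) * v x)" .
    have green: "R * A R * (LINT x|?S. trace_on_sphere c R v x)
      = (LINT x|?M. (real DIM('a) * A (norm (x - c)) + b (norm (x - c))) * v x)
      + (LINT x|?M. A (norm (x - c)) * (weak_gradient (ball c R) v x \<bullet> (x - c)))"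
    proof (rule green_radial[OF R v tv Am bm])
      fix r :: real
      { assume "0 \<le> r" "r \<le> R"
        then have 1: "\<bar>A r\<bar> \<le> a * l\<^sup>2" by (intro Ab)
        have "\<bar>b r\<bar> \<le> \<bar>fp r\<bar> + \<bar>(real d + 2) * A r\<bar>" unfolding b_def by linarith
        also have "\<dots> \<le> a powr p + (real d + 2) * (a * l\<^sup>2)"
          using fpb[of r] 1 by (simp add: abs_mult mult_left_mono add_mono)
        finally have 2: "\<bar>b r\<bar> \<le> a powr p + (real d + 2) * (a * l\<^sup>2)" .
        have al0: "0 \<le> a * l\<^sup>2" using a by simp
        have "0 \<le> (real d + 2) * (a * l\<^sup>2)" by (rule mult_nonneg_nonneg[OF _ al0]) simp
        moreover have "0 \<le> a powr p" by simp
        ultimately show "\<bar>A r\<bar> \<le> a * l\<^sup>2 + (a powr p + (real d + 2) * (a * l\<^sup>2))" "\<bar>b r\<bar> \<le> a * l\<^sup>2 + (a powr p + (real d + 2) * (a * l\<^sup>2))"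
          using 1 2 al0 by linarith+ }
      assume "0 < r" then show "(A has_real_derivative b r / r) (at r)" by (rule dA)
    qed
    have "(LINT x|?M. (real DIM('a) * A (norm (x - c)) + b (norm (x - c))) * v x) = (LINT x|?M. - (fp (norm (x - c)) * v x))"
      by (intro Bochner_Integration.integral_cong) (auto simp: b_def N algebra_simps)
    also have "\<dots> = - (LINT x|?M. fp (norm (x - c)) * v x)" by simp
    finally have g1: "(LINT x|?M. (real DIM('a) * A (norm (x - c)) + b (norm (x - c))) * v x) = - (LINT x|?M. fp (norm (x - c)) * v x)" .
    have RA: "R * A R = - (\<beta> * \<phi> R)" using Ar[OF R] nR by (simp add: mult.commute)
    have e1: "(LINT x|?M. weak_gradient (ball c R) u x \<bullet> weak_gradient (ball c R) v x)
        = (LINT x|?M. A (norm (x - c)) * (weak_gradient (ball c R) v x \<bullet> (x - c)))"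
    proof (rule integral_cong_AE)
      show "AE x in ?M. weak_gradient (ball c R) u x \<bullet> weak_gradient (ball c R) v x = A (norm (x - c)) * (weak_gradient (ball c R) v x \<bullet> (x - c))"
        using weak_gradient_C1[OF R C1, of c] by eventually_elim (simp add: gr inner_commute)
      have [measurable]: "weak_gradient (ball c R) u \<in> borel_measurable ?M" "weak_gradient (ball c R) v \<in> borel_measurable ?M"
        using gu(2) gv(2) by (auto simp: L2_def)
      have [measurable]: "(\<lambda>x. A (norm (x - c))) \<in> borel_measurable ?M" "(\<lambda>x. x - c) \<in> borel_measurable ?M"
        using Am by (intro borel_measurable_lebesgue_on_borel; measurable)+
      show "(\<lambda>x. weak_gradient (ball c R) u x \<bullet> weak_gradient (ball c R) v x) \<in> borel_measurable ?M"
        "(\<lambda>x. A (norm (x - c)) * (weak_gradient (ball c R) v x \<bullet> (x - c))) \<in> borel_measurable ?M" by measurable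
    qed
    have e2: "(LINT x|?S. trace_on_sphere c R u x * trace_on_sphere c R v x) = (LINT x|?S. \<phi> R * trace_on_sphere c R v x)"
    proof (rule integral_cong_AE)
      show "AE x in ?S. trace_on_sphere c R u x * trace_on_sphere c R v x = \<phi> R * trace_on_sphere c R v x"
        using trace_C1[OF R C1 tu] AE_surface_measure_sphere[OF R, of c] by eventually_elim (simp add: u_def)
    qed (use tu tv in \<open>auto simp: has_trace_def L2_def\<close>)
    have "(LINT x|?M. u x powr p * v x) = (LINT x|?M. fp (norm (x - c)) * v x)"
      by (intro Bochner_Integration.integral_cong fu) simp_all
    moreover have "integrable ?M (\<lambda>x. u x powr p * v x)"
      using int by (subst Bochner_Integration.integrable_cong[OF refl fu]) simp_all
    ultimately show ?thesis using green unfolding e1 e2 g1 RA by simp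
  qed
  have "positive_solution c R \<beta> p u"
    unfolding positive_solution_def weak_Robin_solution_def
  proof (intro conjI ballI)
    show "AE x in ?M. u x > 0"
      using AE_ball_norm[OF R, of c] by eventually_elim (auto simp: u_def intro!: \<phi>pos)
  qed (use weak uH in auto)
  moreover have "radial_on_ball c R u"
    unfolding radial_on_ball_def by (intro exI[of _ \<phi>] AE_I2) (simp add: u_def dist_norm norm_minus_commute)
  ultimately show thesis by (rule that)
qed

lemma subcriticalD:
  assumes "subcritical (d + 2) p"
  shows "p > 1" "(real d + 2) / (p + 1) > real d / 2"
proof -
  show p: "p > 1" using assms by (simp add: subcritical_def)
  show "(real d + 2) / (p + 1) > real d / 2"
  proof (cases "d = 0")
    case False
    then have "p < (real d + 4) / real d" using assms False by (simp add: subcritical_def add.commute)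
    then have "p * real d < real d + 4" using False by (simp add: less_divide_eq)
    then show ?thesis using p by (simp add: less_divide_eq divide_less_eq) (simp add: algebra_simps)
  qed (use p in simp)
qed

theorem theorem1p3:
  fixes c :: "'a::euclidean_space" and R \<beta> p :: real
  assumes "DIM('a) \<ge> 2" and "R > 0" and "\<beta> > 0"
    and "subcritical DIM('a) p"
    and "DIM('a) = 2 \<or> (DIM('a) \<ge> 3 \<and> \<beta> \<ge> real DIM('a) - 2)"
  shows "(\<forall>u. positive_solution c R \<beta> p u \<and> radial_on_ball c R u \<longrightarrow>
             radially_nondegenerate c R \<beta> p u) \<and>
         (\<exists>u. positive_solution c R \<beta> p u \<and> radial_on_ball c R u \<and>
             (\<forall>w. positive_solution c R \<beta> p w \<and> radial_on_ball c R w \<longrightarrow>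
                (AE x in lebesgue_on (ball c R). w x = u x)))"
proof -
  obtain d where N: "DIM('a) = d + 2" using assms(1) by (metis add.commute le_Suc_ex)
  have p: "p > 1" and sub: "(real d + 2) / (p + 1) > real d / 2" using subcriticalD assms(4) unfolding N by auto
  obtain u where u: "positive_solution c R \<beta> p u" "radial_on_ball c R u"
    using positive_radial_exists[OF assms(2) N p sub assms(3)] by blast
  show ?thesis
  proof (intro conjI allI impI exI[of _ u] u)
    fix w assume w: "positive_solution c R \<beta> p w \<and> radial_on_ball c R w"
    show "radially_nondegenerate c R \<beta> p w"
      using positive_radial_nondegenerate[OF assms(2) N p sub assms(3)] w by blast
  next
    fix w assume w: "positive_solution c R \<beta> p w \<and> radial_on_ball c R w"
    show "AE x in lebesgue_on (ball c R). w x = u x"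
      using positive_radial_unique[OF assms(2) N p sub assms(3) u] w by blast
  qed
qed

end
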